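(* Let $n\ge 1$ and let $\lambda,\kappa$ be partitions of length at most $n$. For otherwise generic parameters $t_0,t_1,t_2,t_3,u_0,u_1,q,t\in\mathbb C^*$ satisfying $t^{2n-2}t_0t_1t_2t_3u_0u_1=pq$, $$ \tilde R^{(n)}_{\lambda}(\dots t_0 t^{n-i} q^{\kappa_i}\dots;t_0{:}t_1,t_2,t_3;u_0,u_1;q,t;p) = \tilde R^{(n)}_{\kappa}(\dots \hat t_0 t^{n-i} q^{\lambda_i}\dots;\hat t_0{:}\hat t_1,\hat t_2,\hat t_3;\hat u_0,\hat u_1;q,t;p), $$ where $$ \hat t_0=\sqrt{t_0t_1t_2t_3/pq},\quad \hat t_0\hat t_1=t_0t_1,\quad \hat t_0\hat t_2=t_0t_2,\quad \hat t_0\hat t_3=t_0t_3,\quad \frac{\hat u_0}{\hat t_0}=\frac{u_0}{t_0},\quad \frac{\hat u_1}{\hat t_0}=\frac{u_1}{t_0}. $$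
   Context: Fix $p\in\mathbb C$, $0<|p|<1$. $\theta(x;p)=\prod_{k\ge 0}(1-p^kx)(1-p^{k+1}/x)$. Several arguments before the first semicolon of $\theta$ or a $C$ symbol mean the product over the arguments. Partitions are identified with diagrams $\{(i,j):1\le j\le\lambda_i\}$; $\lambda'$ is the conjugate, $\ell(\lambda)$ the length, $\kappa\subset\lambda$ containment of diagrams, $m^n$ the partition with $n$ parts equal to $m$; for $\lambda\subset m^n$, $(m^n-\lambda)_i=m-\lambda_{n+1-i}$; $2\lambda^2$ is the partition with $(2\lambda^2)_i=2\lambda_{\lceil i/2\rceil}$. Symbols: $C^0_\lambda(x;q,t;p)=\prod_{(i,j)\in\lambda}\theta(q^{j-1}t^{1-i}x;p)$, $C^-_\lambda(x;q,t;p)=\prod_{(i,j)\in\lambda}\theta(q^{\lambda_i-j}t^{\lambda'_j-i}x;p)$, $C^+_\lambda(x;q,t;p)=\prod_{(i,j)\in\lambda}\theta(q^{\lambda_i+j-1}t^{2-\lambda'_j-i}x;p)$, $$\Delta^0_\lambda(a|\dots b_i\dots;q,t;p)=\prod_i\frac{C^0_\lambda(b_i;q,t;p)}{C^0_\lambda(pqa/b_i;q,t;p)},$$ $$\Delta_\lambda(a|\dots b_i\dots;q,t;p)=\Delta^0_\lambda(a|\dots b_i\dots;q,t;p)\frac{C^0_{2\lambda^2}(pqa;q,t;p)}{C^-_\lambda(pq,t;q,t;p)\,C^+_\lambda(a,pqa/t;q,t;p)}.$$ Interpolation theta functions: a $BC_n$-symmetric theta function of degree $m$ is a holomorphic $f$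 on $(\mathbb C^* )^n$ invariant under permutations of the $x_i$ and under each $x_i\mapsto1/x_i$, with $f(px_1,x_2,\dots,x_n)=(px_1^2)^{-m}f(x_1,\dots,x_n)$. For $\lambda\subset m^n$ and generic $a,b,q,t$, $P^{*(m,n)}_\lambda(x_1,\dots,x_n;a,b;q,t;p)$ is the unique $BC_n$-symmetric theta function of degree $m$ such that: (i) for every $\mu\subset m^n$, $\mu\ne\lambda$, it vanishes at the point with $x_i=bq^{m-\mu_i}t^{i-1}$ for $1\le i\le l$ and $x_i=aq^{\mu_i}t^{n-i}$ for $l<i\le n$, where $l_0$ is the largest index with $\mu_{l_0}\ne\lambda_{l_0}$, $l_1$ is the largest index with $\mu_{l_1}=m$ ($0$ if none), and $l=l_1$ if $\mu_{l_0}<\lambda_{l_0}$, $l=l_0$ otherwise; (ii) at $x_i=vt^{n-i}$ its value is $C^0_\lambda(t^{n-1}av,a/v;q,t;p)\,C^0_{m^n-\lambda}(t^{n-1}bv,b/v;q,t;p)$, for a generic $v\in\mathbb C^*$ (the function does not depend on $v$). Interpolation abelian functions: for $\ell(\lambda)\le n$, $R^{*(n)}_\lambda(;a,b;q,t;p)=P^{*(m,n)}_\lambda(;a,q^{-m}b;q,t;p)/P^{*(m,n)}_0(;a,q^{-m}b;q,t;p)$ for any $m\ge\lambda_1$ (independent of $m$). Generalized binomial coefficients: for any $n\ge\ell(\lambda),\ell(\mu)$ (the result is independent of $n$ and of the choice of $\sqrt a$), $$\binom{\lambda}{\mu}_{[a,b];q,t;p}=\Delta_\mu(a/b\,|\,t^n,1/b;q,t;p)\,R^{*(n)}_\mu(\dots\sqrt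 a\,q^{\lambda_i}t^{1-i}\dots;t^{1-n}\sqrt a,b/\sqrt a;q,t;p).$$ Biorthogonal functions: for $\ell(\lambda)\le n$ and $t^{2n-2}t_0t_1t_2t_3u_0u_1=pq$, $$\tilde R^{(n)}_\lambda(;t_0{:}t_1,t_2,t_3;u_0,u_1;q,t;p)=\sum_{\mu\subset\lambda}\frac{\binom{\lambda}{\mu}_{[\frac1{u_0u_1},\frac1{t^{n-1}t_0u_1}];q,t;p}\;R^{*(n)}_\mu(;t_0,u_0;q,t;p)}{\Delta^0_\mu(\frac{t^{n-1}t_0}{u_0}|t^{n-1}t_0t_1,t^{n-1}t_0t_2,t^{n-1}t_0t_3,t^{n-1}t_0u_1;q,t;p)}.$$ The notation $f(\dots x_i\dots)$ means $f(x_1,\dots,x_n)$. *)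

theory Defs
  imports "HOL-Analysis.Analysis" "HOL-Combinatorics.Permutations"
begin

definition theta :: "complex \<Rightarrow> complex \<Rightarrow> complex" where
  "theta x p = (\<Prod>k. (1 - p ^ k * x) * (1 - p ^ (k + 1) / x))"

section \<open>Partitions\<close>

text \<open>A partition is a function on indices \<open>1, 2, 3, \<dots>\<close>. The unused value at index 0 is pinned
  to 0, so that equality of functions is equality of partitions.\<close>

definition is_partition :: "(nat \<Rightarrow> nat) \<Rightarrow> bool" where
  "is_partition lam \<longleftrightarrow>
     lam 0 = 0 \<and> (\<forall>i\<ge>1. lam (Suc i) \<le> lam i) \<and> finite {i. lam i \<noteq> 0}"

definition part_length :: "(nat \<Rightarrow> nat) \<Rightarrow> nat" where
  "part_length lam = card {i. 1 \<le> i \<and> lam i \<noteq> 0}"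

definition diagram :: "(nat \<Rightarrow> nat) \<Rightarrow> (nat \<times> nat) set" where
  "diagram lam = {(i, j). 1 \<le> i \<and> 1 \<le> j \<and> j \<le> lam i}"

definition conj_part :: "(nat \<Rightarrow> nat) \<Rightarrow> nat \<Rightarrow> nat" where
  "conj_part lam j = card {i. (i, j) \<in> diagram lam}"

definition subpartitions :: "(nat \<Rightarrow> nat) \<Rightarrow> (nat \<Rightarrow> nat) set" where
  "subpartitions lam = {mu. is_partition mu \<and> diagram mu \<subseteq> diagram lam}"

definition zero_part :: "nat \<Rightarrow> nat" where
  "zero_part i = 0"

definition rect_part :: "nat \<Rightarrow> nat \<Rightarrow> nat \<Rightarrow> nat" where
  "rect_part m n i = (if i \<in> {1..n} then m else 0)"

definition rect_compl :: "nat \<Rightarrow> nat \<Rightarrow> (nat \<Rightarrow> nat) \<Rightarrow> nat \<Rightarrow> nat" where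
  "rect_compl m n lam i = (if i \<in> {1..n} then m - lam (n + 1 - i) else 0)"

text \<open>The partition \<open>2\<lambda>\<^sup>2\<close>; note \<open>\<lceil>i/2\<rceil> = (i + 1) div 2\<close>.\<close>

definition double_part :: "(nat \<Rightarrow> nat) \<Rightarrow> nat \<Rightarrow> nat" where
  "double_part lam i = 2 * lam ((i + 1) div 2)"

section \<open>The C and Delta symbols\<close>

definition C0 :: "(nat \<Rightarrow> nat) \<Rightarrow> complex \<Rightarrow> complex \<Rightarrow> complex \<Rightarrow> complex \<Rightarrow> complex" where
  "C0 lam x q t p =
     (\<Prod>(i, j)\<in>diagram lam. theta (q powi (int j - 1) * t powi (1 - int i) * x) p)"

definition Cminus :: "(nat \<Rightarrow> nat) \<Rightarrow> complex \<Rightarrow> complex \<Rightarrow> complex \<Rightarrow> complex \<Rightarrow> complex" where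
  "Cminus lam x q t p =
     (\<Prod>(i, j)\<in>diagram lam.
        theta (q powi (int (lam i) - int j) * t powi (int (conj_part lam j) - int i) * x) p)"

definition Cplus :: "(nat \<Rightarrow> nat) \<Rightarrow> complex \<Rightarrow> complex \<Rightarrow> complex \<Rightarrow> complex \<Rightarrow> complex" where
  "Cplus lam x q t p =
     (\<Prod>(i, j)\<in>diagram lam.
        theta (q powi (int (lam i) + int j - 1) * t powi (2 - int (conj_part lam j) - int i) * x) p)"

definition Delta0 ::
  "(nat \<Rightarrow> nat) \<Rightarrow> complex \<Rightarrow> complex list \<Rightarrow> complex \<Rightarrow> complex \<Rightarrow> complex \<Rightarrow> complex" where
  "Delta0 lam a bs q t p = (\<Prod>b\<leftarrow>bs. C0 lam b q t p / C0 lam (p * q * a / b) q t p)"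

definition Delta ::
  "(nat \<Rightarrow> nat) \<Rightarrow> complex \<Rightarrow> complex list \<Rightarrow> complex \<Rightarrow> complex \<Rightarrow> complex \<Rightarrow> complex" where
  "Delta lam a bs q t p =
     Delta0 lam a bs q t p *
     (C0 (double_part lam) (p * q * a) q t p /
      (Cminus lam (p * q) q t p * Cminus lam t q t p *
       (Cplus lam a q t p * Cplus lam (p * q * a / t) q t p)))"

section \<open>Theta functions on the complex torus\<close>

text \<open>Points of \<open>(C\<^sup>*)\<^sup>n\<close> are functions on \<open>{1..n}\<close>, extended by \<^const>\<open>undefined\<close>.\<close>

definition ctorus :: "nat \<Rightarrow> (nat \<Rightarrow> complex) set" where
  "ctorus n = {1..n} \<rightarrow>\<^sub>E (- {0})"

text \<open>Holomorphic in several variables: at every point there is a complex-linear total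
  derivative, with coefficients \<open>c\<close>.\<close>

definition torus_holomorphic :: "nat \<Rightarrow> ((nat \<Rightarrow> complex) \<Rightarrow> complex) \<Rightarrow> bool" where
  "torus_holomorphic n f \<longleftrightarrow>
     (\<forall>x\<in>ctorus n. \<exists>c :: nat \<Rightarrow> complex. \<forall>e>0. \<exists>d>0. \<forall>y\<in>ctorus n.
        (\<forall>i\<in>{1..n}. cmod (y i - x i) < d) \<longrightarrow>
        cmod (f y - f x - (\<Sum>i=1..n. c i * (y i - x i))) \<le> e * (\<Sum>i=1..n. cmod (y i - x i)))"

text \<open>Extensionality makes such a function determined by its values on the torus, as is needed
  for the uniqueness in \<open>P_star\<close> below. The notion is used for \<open>n \<ge> 1\<close> only.\<close>

definition BC_theta :: "nat \<Rightarrow> nat \<Rightarrow> complex \<Rightarrow> ((nat \<Rightarrow> complex) \<Rightarrow> complex) \<Rightarrow> bool" where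
  "BC_theta n m p f \<longleftrightarrow>
     f \<in> extensional (ctorus n) \<and> torus_holomorphic n f \<and>
     (\<forall>x\<in>ctorus n.
        (\<forall>\<sigma>. \<sigma> permutes {1..n} \<longrightarrow> f (x \<circ> \<sigma>) = f x) \<and>
        (\<forall>i\<in>{1..n}. f (x(i := 1 / x i)) = f x) \<and>
        f (x(1 := p * x 1)) = (p * (x 1)\<^sup>2) powi (- int m) * f x)"

section \<open>Interpolation functions\<close>

definition split_index :: "nat \<Rightarrow> nat \<Rightarrow> (nat \<Rightarrow> nat) \<Rightarrow> (nat \<Rightarrow> nat) \<Rightarrow> nat" where
  "split_index m n lam mu =
     (let l0 = Max {i \<in> {1..n}. mu i \<noteq> lam i};
          l1 = Max (insert 0 {i \<in> {1..n}. mu i = m})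
      in if mu l0 < lam l0 then l1 else l0)"

definition vanishing_point ::
  "nat \<Rightarrow> nat \<Rightarrow> (nat \<Rightarrow> nat) \<Rightarrow> (nat \<Rightarrow> nat) \<Rightarrow> complex \<Rightarrow> complex \<Rightarrow> complex \<Rightarrow> complex \<Rightarrow> nat \<Rightarrow> complex"
  where
  "vanishing_point m n lam mu a b q t =
     (\<lambda>i\<in>{1..n}. if i \<le> split_index m n lam mu
                  then b * q ^ (m - mu i) * t ^ (i - 1)
                  else a * q ^ mu i * t ^ (n - i))"

text \<open>The normalization is prescribed for a generic \<open>v\<close>, the resulting function not depending on
  \<open>v\<close>. Both sides being holomorphic in \<open>v\<close>, it is imposed here for all nonzero \<open>v\<close>.\<close>

definition P_star ::
  "nat \<Rightarrow> nat \<Rightarrow> (nat \<Rightarrow> nat) \<Rightarrow> complex \<Rightarrow> complex \<Rightarrow> complex \<Rightarrow> complex \<Rightarrow> complex \<Rightarrow>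
   (nat \<Rightarrow> complex) \<Rightarrow> complex" where
  "P_star m n lam a b q t p =
     (THE f. BC_theta n m p f \<and>
        (\<forall>mu\<in>subpartitions (rect_part m n). mu \<noteq> lam \<longrightarrow>
           f (vanishing_point m n lam mu a b q t) = 0) \<and>
        (\<forall>v. v \<noteq> 0 \<longrightarrow>
           f (\<lambda>i\<in>{1..n}. v * t ^ (n - i)) =
             C0 lam (t ^ (n - 1) * a * v) q t p * C0 lam (a / v) q t p *
             (C0 (rect_compl m n lam) (t ^ (n - 1) * b * v) q t p *
              C0 (rect_compl m n lam) (b / v) q t p)))"

text \<open>Any \<open>m \<ge> \<lambda>\<^sub>1\<close> gives the same function; the smallest one is taken.\<close>

definition R_star ::
  "nat \<Rightarrow> (nat \<Rightarrow> nat) \<Rightarrow> complex \<Rightarrow> complex \<Rightarrow> complex \<Rightarrow> complex \<Rightarrow> complex \<Rightarrow>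
   (nat \<Rightarrow> complex) \<Rightarrow> complex" where
  "R_star n lam a b q t p x =
     (let m = lam 1; b' = q powi (- int m) * b
      in P_star m n lam a b' q t p x / P_star m n zero_part a b' q t p x)"

text \<open>The value is the same for every \<open>n\<close> bounding the lengths of both partitions, and for either
  square root of \<open>a\<close>. The rank \<open>n\<close> used to evaluate it is an explicit argument.\<close>

definition ell_binomial ::
  "nat \<Rightarrow> (nat \<Rightarrow> nat) \<Rightarrow> (nat \<Rightarrow> nat) \<Rightarrow> complex \<Rightarrow> complex \<Rightarrow> complex \<Rightarrow> complex \<Rightarrow> complex \<Rightarrow>
   complex" where
  "ell_binomial n lam mu a b q t p =
     Delta mu (a / b) [t ^ n, 1 / b] q t p *
     R_star n mu (t powi (1 - int n) * csqrt a) (b / csqrt a) q t p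
       (\<lambda>i\<in>{1..n}. csqrt a * q ^ lam i * t powi (1 - int i))"

section \<open>Biorthogonal functions\<close>

definition R_tilde ::
  "nat \<Rightarrow> (nat \<Rightarrow> nat) \<Rightarrow> complex \<Rightarrow> complex \<Rightarrow> complex \<Rightarrow> complex \<Rightarrow> complex \<Rightarrow> complex \<Rightarrow>
   complex \<Rightarrow> complex \<Rightarrow> complex \<Rightarrow> (nat \<Rightarrow> complex) \<Rightarrow> complex" where
  "R_tilde n lam t0 t1 t2 t3 u0 u1 q t p x =
     (\<Sum>mu\<in>subpartitions lam.
        ell_binomial n lam mu (1 / (u0 * u1)) (1 / (t ^ (n - 1) * t0 * u1)) q t p *
        R_star n mu t0 u0 q t p x /
        Delta0 mu (t ^ (n - 1) * t0 / u0)
          [t ^ (n - 1) * t0 * t1, t ^ (n - 1) * t0 * t2, t ^ (n - 1) * t0 * t3,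
           t ^ (n - 1) * t0 * u1] q t p)"

section \<open>Generic parameters\<close>

text \<open>A property holds generically on a parameter space \<open>V \<subseteq> (C\<^sup>*)\<^sup>N\<close> if it holds off the zero
  locus of a holomorphic function that does not vanish identically on \<open>V\<close>. This is the right notion
  for irreducible \<open>V\<close>, where that locus is a proper analytic subset, closed and nowhere dense.\<close>

definition holds_generically ::
  "nat \<Rightarrow> (nat \<Rightarrow> complex) set \<Rightarrow> ((nat \<Rightarrow> complex) \<Rightarrow> bool) \<Rightarrow> bool" where
  "holds_generically N V Q \<longleftrightarrow>
     (\<exists>F. torus_holomorphic N F \<and> (\<exists>z\<in>V. F z \<noteq> 0) \<and> (\<forall>z\<in>V. F z \<noteq> 0 \<longrightarrow> Q z))"

text \<open>Parameters are listed as \<open>z = (t0, t1, t2, t3, u0, u1, q, t)\<close>. The balancing condition can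
  be solved for \<open>q\<close>, so this space is the graph of a function on \<open>(C\<^sup>*)\<^sup>7\<close>, hence irreducible.\<close>

definition balanced_params :: "nat \<Rightarrow> complex \<Rightarrow> (nat \<Rightarrow> complex) set" where
  "balanced_params n p =
     {z \<in> ctorus 8. z 8 ^ (2 * n - 2) * z 1 * z 2 * z 3 * z 4 * z 5 * z 6 = p * z 7}"

end

theory Submission
  imports Defs "HOL-Complex_Analysis.Complex_Analysis"
begin

text \<open>The summand of index \<open>\<mu>\<close> contains the value of \<open>R\<^sup>*\<^sub>\<mu>\<close> at the point of \<open>\<lambda>\<close>, through the binomial
  coefficient, and its value at the point of \<open>\<kappa>\<close>. The change of parameters exchanges these two
  values and preserves all other factors. As \<open>R\<^sup>*\<^sub>\<mu>\<close> vanishes at the point of every partition that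
  does not contain \<open>\<mu>\<close>, both sides are the same sum over the \<open>\<mu>\<close> contained in \<open>\<lambda>\<close> and in \<open>\<kappa>\<close>.

  The defining conditions of \<open>P\<^sup>*\<close> demand fewer zeros. The others come from a difference operator with
  one free parameter, which maps a function vanishing as required for \<open>(\<surd>q a, \<surd>q b)\<close> to one for \<open>(a, b)\<close>.
  If the parameter makes the image vanish at the point of \<open>\<lambda>\<close> too, uniqueness shows that the image is
  zero; its value at a minimal point \<open>\<nu>\<close> not containing \<open>\<lambda>\<close> is a nonzero multiple of the original
  function at \<open>\<nu>\<close>, which therefore vanishes. These zeros also determine, up to a factor, the
  restriction to the line \<open>x\<^sub>i = v t\<^bsup>n - i\<^esup>\<close>, so that the normalization of \<open>P\<^sup>*\<close> can be satisfied.\<close>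

section \<open>The theta function\<close>

text \<open>\<open>P_star\<close> is a definite description, so nothing can be said of it before
  existence and uniqueness are proved, normalization included. Uniqueness works one variable at a
  time: a symmetric theta function of degree m in one variable is zero once it vanishes at m + 1
  inequivalent points. Existence is a count: symmetrized products of one-variable Lagrange functions
  are indexed by the partitions in the rectangle, and one condition fewer is imposed. The delicate
  point is that the restriction to the line is not identically zero; the operator serves a second
  time, to climb from the point of \<lambda> to that of the full rectangle, which lies on the line.

  The operator has apparent poles, so functions take multisets and only values at pairwise
  inequivalent coordinates are compared; continuity does the rest. Genericity must become the
  nonvanishing of one function, so each argument uses finitely many monomials in q and t, with
  exponents up to a bound N. Passing from \<beta> to \<open>s * \<beta>\<close> with
  \<open>s\<^sup>2 = q\<close> shifts exponents and costs one unit of N; the number of passages is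
  bounded by the first parts of the partitions.\<close>

locale nome =
  fixes p :: complex
  assumes p_nz [simp]: "p \<noteq> 0" and p_lt1: "cmod p < 1"
begin

abbreviation th :: "complex \<Rightarrow> complex" where "th x \<equiv> theta x p"

definition qpoch :: "complex \<Rightarrow> complex" where
  "qpoch x = (\<Prod>k. 1 - p ^ k * x)"

lemma qpoch_convergent: "convergent_prod (\<lambda>k. 1 - p ^ k * x)"
proof -
  have "summable (\<lambda>k. norm ((1 - p ^ k * x) - 1))"
    using p_lt1 by (simp add: norm_mult norm_power summable_mult2 summable_geometric)
  then show ?thesis
    by (intro abs_convergent_prod_imp_convergent_prod summable_imp_abs_convergent_prod)
qed

lemma qpoch_rec: "qpoch x = (1 - x) * qpoch (p * x)"
proof (cases "x = 1")
  case True
  have "(\<lambda>k. 1 - p ^ k * x) has_prod qpoch x"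
    using qpoch_convergent convergent_prod_has_prod unfolding qpoch_def by blast
  moreover have "1 - p ^ 0 * x = 0" using True by simp
  ultimately have "qpoch x = 0"
    by (metis (no_types, lifting) has_prod_eq_0_iff rangeI)
  then show ?thesis using True by simp
next
  case False
  then have "(\<Prod>k. 1 - p ^ Suc k * x) = qpoch x / (1 - p ^ 0 * x)"
    unfolding qpoch_def by (intro prodinf_split_head[OF qpoch_convergent]) auto
  then show ?thesis
    using False by (simp add: qpoch_def field_simps power_commutes)
qed

lemma qpoch_eq_0_iff: "qpoch x = 0 \<longleftrightarrow> (\<exists>k::nat. p ^ k * x = 1)"
proof -
  have "(\<lambda>k. 1 - p ^ k * x) has_prod qpoch x"
    using qpoch_convergent convergent_prod_has_prod unfolding qpoch_def by blast
  then have "qpoch x = 0 \<longleftrightarrow> 0 \<in> range (\<lambda>k. 1 - p ^ k * x)"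
    by (rule has_prod_eq_0_iff)
  also have "\<dots> \<longleftrightarrow> (\<exists>k::nat. p ^ k * x = 1)"
    by (auto simp: image_iff)
  finally show ?thesis .
qed

lemma qpoch_holomorphic: "qpoch holomorphic_on UNIV"
proof (rule holomorphic_uniform_sequence[where f = "\<lambda>N x. \<Prod>k<N. 1 - p ^ k * x"])
  show "open (UNIV :: complex set)" by simp
  show "(\<lambda>x. \<Prod>k<N. 1 - p ^ k * x) holomorphic_on UNIV" for N
    by (intro holomorphic_intros)
next
  fix x :: complex
  let ?R = "norm x + 1"
  have conv: "uniformly_convergent_on (cball x 1) (\<lambda>N z. \<Prod>k<N. 1 - p ^ k * z)"
  proof (rule uniformly_convergent_on_prod')
    show "uniformly_convergent_on (cball x 1) (\<lambda>N z. \<Sum>n<N. norm (1 - p ^ n * z - 1))"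
    proof (rule Weierstrass_m_test')
      fix n z assume "z \<in> cball x 1"
      then have "norm z \<le> ?R"
        using norm_triangle_ineq2[of z x] by (simp add: dist_norm norm_minus_commute)
      then show "norm (norm (1 - p ^ n * z - 1)) \<le> ?R * norm p ^ n"
        by (simp add: norm_mult norm_power mult.commute mult_right_mono)
    next
      show "summable (\<lambda>n. ?R * norm p ^ n)"
        using p_lt1 by (intro summable_mult summable_geometric) simp
    qed
  qed (auto intro!: continuous_intros)
  then obtain g where g: "uniform_limit (cball x 1) (\<lambda>N z. \<Prod>k<N. 1 - p ^ k * z) g sequentially"
    by (auto simp: uniformly_convergent_on_def)
  have "g z = qpoch z" if "z \<in> cball x 1" for z
  proof -
    have "(\<lambda>N. \<Prod>k<N. 1 - p ^ k * z) \<longlonglongrightarrow> g z"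
      by (rule tendsto_uniform_limitI[OF g that])
    moreover have "(\<lambda>N. \<Prod>k<N. 1 - p ^ k * z) \<longlonglongrightarrow> qpoch z"
      unfolding qpoch_def LIMSEQ_lessThan_iff_atMost
      by (rule convergent_prod_LIMSEQ[OF qpoch_convergent])
    ultimately show ?thesis by (rule LIMSEQ_unique)
  qed
  then have "uniform_limit (cball x 1) (\<lambda>N z. \<Prod>k<N. 1 - p ^ k * z) qpoch sequentially"
    using g by (metis (no_types, lifting) uniform_limit_cong')
  then show "\<exists>d>0. cball x d \<subseteq> UNIV \<and>
      uniform_limit (cball x d) (\<lambda>N z. \<Prod>k<N. 1 - p ^ k * z) qpoch sequentially"
    by (intro exI[of _ 1]) auto
qed

lemma theta_eq: "th x = qpoch x * qpoch (p / x)"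
proof -
  have "qpoch x * qpoch (p / x) = (\<Prod>k. (1 - p ^ k * x) * (1 - p ^ k * (p / x)))"
    unfolding qpoch_def by (rule prodinf_mult[OF qpoch_convergent qpoch_convergent])
  then show ?thesis
    by (simp add: theta_def mult.commute)
qed

lemma theta_p: "x \<noteq> 0 \<Longrightarrow> th (p * x) = - th x / x"
  using qpoch_rec[of x] qpoch_rec[of "1 / x"]
  by (simp add: theta_eq) (simp add: field_simps)

lemma theta_inv: "x \<noteq> 0 \<Longrightarrow> th (1 / x) = - th x / x"
  using theta_p[of x] by (simp add: theta_eq mult.commute)

lemma theta_1 [simp]: "th 1 = 0"
  by (simp add: theta_eq qpoch_rec[of 1])

lemma theta_div_p: "x \<noteq> 0 \<Longrightarrow> th (x / p) = - x * th x / p"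
  using theta_p[of "x / p"] by (simp add: field_simps)

lemma theta_eq_0_iff:
  assumes "x \<noteq> 0"
  shows "th x = 0 \<longleftrightarrow> (\<exists>k::int. x = p powi k)"
proof
  assume "th x = 0"
  then consider k :: nat where "p ^ k * x = 1" | k :: nat where "p ^ k * (p / x) = 1"
    by (auto simp: theta_eq qpoch_eq_0_iff)
  then show "\<exists>k::int. x = p powi k"
  proof cases
    case 1
    then have "x = p powi (- int k)"
      by (simp add: power_int_minus field_simps)
    then show ?thesis by blast
  next
    case 2
    then have "x = p ^ Suc k" using assms by (simp add: field_simps)
    then have "x = p powi (int (Suc k))" by (metis power_int_of_nat)
    then show ?thesis by blast
  qed
next
  assume "\<exists>k::int. x = p powi k"
  then obtain k :: int where k: "x = p powi k" by blast
  show "th x = 0"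
  proof (cases "k \<le> 0")
    case True
    then have "p ^ nat (- k) * x = 1"
      by (simp add: k power_int_def field_simps)
    then show ?thesis by (auto simp: theta_eq qpoch_eq_0_iff)
  next
    case False
    then have *: "nat k = Suc (nat (k - 1))" by simp
    have "x = p * p ^ nat (k - 1)" using False unfolding k power_int_def * by simp
    then have "p ^ nat (k - 1) * (p / x) = 1" by simp
    then show ?thesis by (auto simp: theta_eq qpoch_eq_0_iff)
  qed
qed

lemma theta_inv_0 [simp]: "th (1 / x) = 0 \<longleftrightarrow> th x = 0"
proof (cases "x = 0")
  case False then show ?thesis by (simp add: theta_inv)
qed (simp)

lemma theta_div_commute: "th (x / y) = 0 \<longleftrightarrow> th (y / x) = 0"
  using theta_inv_0[of "x / y"] by simp

lemma theta_p_0 [simp]: "th (p * x) = 0 \<longleftrightarrow> th x = 0"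
  using theta_p[of x] by (cases "x = 0") auto

lemma theta_holomorphic: "th holomorphic_on - {0}"
proof -
  have "(\<lambda>x. qpoch x * qpoch (p / x)) holomorphic_on - {0}"
  proof (intro holomorphic_intros)
    show "qpoch holomorphic_on - {0}"
      using qpoch_holomorphic holomorphic_on_subset by blast
    have "(qpoch \<circ> (\<lambda>x. p / x)) holomorphic_on - {0}"
      by (rule holomorphic_on_compose_gen[OF _ qpoch_holomorphic]) (auto intro!: holomorphic_intros)
    then show "(\<lambda>x. qpoch (p / x)) holomorphic_on - {0}" by (simp add: o_def)
  qed
  then show ?thesis by (simp add: theta_eq[abs_def])
qed

lemma theta_holomorphic_comp [holomorphic_intros]:
  assumes "g holomorphic_on A" "\<And>x. x \<in> A \<Longrightarrow> g x \<noteq> 0"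
  shows "(\<lambda>x. th (g x)) holomorphic_on A"
proof -
  have "(th \<circ> g) holomorphic_on A"
    by (rule holomorphic_on_compose_gen[OF assms(1) theta_holomorphic]) (use assms(2) in auto)
  then show ?thesis by (simp add: o_def)
qed

lemma theta_differentiable: "x \<noteq> 0 \<Longrightarrow> (th has_field_derivative deriv th x) (at x)"
  using holomorphic_derivI[OF theta_holomorphic, of x] by auto

text \<open>At 1 the factor 1 - x splits off and leaves \<open>h\<close> with
  \<open>h 1 \<noteq> 0\<close>; the relation between \<open>th (p * x)\<close> and
  \<open>th x\<close> carries simplicity to all other zeros, the powers of p.\<close>

lemma deriv_theta_nz:
  assumes "x \<noteq> 0" "th x = 0"
  shows "deriv th x \<noteq> 0"
proof -
  have at1: "deriv th 1 \<noteq> 0"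
  proof -
    define h where "h = (\<lambda>x. qpoch (p * x) * qpoch (p / x))"
    have "h holomorphic_on - {0}"
    proof -
      have "(qpoch \<circ> (\<lambda>x. p / x)) holomorphic_on - {0}" "(qpoch \<circ> (\<lambda>x. p * x)) holomorphic_on - {0}"
        by (rule holomorphic_on_compose_gen[OF _ qpoch_holomorphic], auto intro!: holomorphic_intros)+
      then show ?thesis unfolding h_def o_def by (intro holomorphic_intros)
    qed
    then obtain d where "(h has_field_derivative d) (at 1)"
      using holomorphic_derivI[of h "- {0}" 1] by auto
    then have "((\<lambda>x. (1 - x) * h x) has_field_derivative (- h 1)) (at 1)"
      by (auto intro!: derivative_eq_intros)
    moreover have "(\<lambda>x. (1 - x) * h x) = th"
      unfolding h_def theta_eq[abs_def] by (subst (3) qpoch_rec) (simp add: mult.assoc)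
    ultimately have "deriv th 1 = - h 1" by (metis DERIV_imp_deriv)
    moreover have "h 1 \<noteq> 0"
    proof -
      have "p ^ k * p \<noteq> 1" for k
      proof -
        have "norm (p ^ k * p) < 1"
          using p_lt1 by (metis norm_ge_zero norm_power power_Suc2 power_Suc_less_one p_nz zero_less_norm_iff)
        then show ?thesis by (metis norm_one less_irrefl)
      qed
      then show ?thesis by (auto simp: h_def qpoch_eq_0_iff)
    qed
    ultimately show ?thesis by simp
  qed
  have step: "deriv th (p * w) \<noteq> 0 \<longleftrightarrow> deriv th w \<noteq> 0"
    if w: "w \<noteq> 0" "th w = 0" for w
  proof -
    have "((\<lambda>z. th (p * z)) has_field_derivative (deriv th (p * w) * p)) (at w)"
      by (rule DERIV_chain2[OF theta_differentiable]) (use w in \<open>auto intro!: derivative_eq_intros\<close>)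
    moreover have "((\<lambda>z. - th z / z) has_field_derivative (- deriv th w / w)) (at w)"
      using w by (auto intro!: derivative_eq_intros theta_differentiable)
    then have "((\<lambda>z. th (p * z)) has_field_derivative (- deriv th w / w)) (at w)"
    proof (rule has_field_derivative_transform_within_open[of _ _ _ "- {0}"])
      show "- th z / z = th (p * z)" if "z \<in> - {0}" for z using that by (simp add: theta_p)
    qed (use w in auto)
    ultimately have "deriv th (p * w) * p = - deriv th w / w" by (rule DERIV_unique)
    then show ?thesis using w by (auto simp: field_simps)
  qed
  obtain k :: int where k: "x = p powi k" using theta_eq_0_iff assms by blast
  have "deriv th (p powi k) \<noteq> 0"
  proof (induction k rule: int_induct[where k = 0])
    case base then show ?case using at1 by simp
  next
    case (step1 i)
    have "th (p powi i) = 0" using theta_eq_0_iff[of "p powi i"] by auto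
    then show ?case using step[of "p powi i"] step1 by (simp add: power_int_add mult.commute)
  next
    case (step2 i)
    have "th (p powi (i - 1)) = 0" using theta_eq_0_iff[of "p powi (i - 1)"] by auto
    then show ?case using step[of "p powi (i - 1)"] step2 by (simp add: power_int_diff)
  qed
  then show ?thesis by (simp add: k)
qed

lemma theta_zeros_countable: "countable {z. z \<noteq> 0 \<and> th z = 0}"
proof -
  have "{z. z \<noteq> 0 \<and> th z = 0} \<subseteq> range (\<lambda>k::int. p powi k)"
    using theta_eq_0_iff by auto
  then show ?thesis by (rule countable_subset) auto
qed

section \<open>Division of functions holomorphic on the punctured plane\<close>

text \<open>With such a divisor, mere vanishing of the numerator at the zeros already gives a
  holomorphic quotient, so orders of zeros are never counted.\<close>

definition simple_zeros :: "(complex \<Rightarrow> complex) \<Rightarrow> bool" where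
  "simple_zeros R \<longleftrightarrow> R holomorphic_on - {0} \<and> (\<forall>w. w \<noteq> 0 \<longrightarrow> R w = 0 \<longrightarrow> deriv R w \<noteq> 0)"

lemma simple_zerosD: "simple_zeros R \<Longrightarrow> w \<noteq> 0 \<Longrightarrow> R w = 0 \<Longrightarrow> deriv R w \<noteq> 0"
  and simple_zeros_holo: "simple_zeros R \<Longrightarrow> R holomorphic_on - {0}"
  by (auto simp: simple_zeros_def)

lemma simple_zeros_mult:
  assumes R: "simple_zeros R" and S: "simple_zeros S"
    and no: "\<And>w. w \<noteq> 0 \<Longrightarrow> R w = 0 \<Longrightarrow> S w = 0 \<Longrightarrow> False"
  shows "simple_zeros (\<lambda>w. R w * S w)"
  unfolding simple_zeros_def
proof (intro conjI allI impI)
  show "(\<lambda>w. R w * S w) holomorphic_on - {0}"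
    by (intro holomorphic_intros simple_zeros_holo assms)
  fix w :: complex assume w: "w \<noteq> 0" "R w * S w = 0"
  have "(R has_field_derivative deriv R w) (at w)" "(S has_field_derivative deriv S w) (at w)"
    using w holomorphic_derivI[OF simple_zeros_holo[OF R], of w]
      holomorphic_derivI[OF simple_zeros_holo[OF S], of w] by auto
  then have "((\<lambda>w. R w * S w) has_field_derivative (deriv R w * S w + deriv S w * R w)) (at w)"
    by (rule DERIV_mult)
  then have "deriv (\<lambda>w. R w * S w) w = deriv R w * S w + deriv S w * R w"
    by (rule DERIV_imp_deriv)
  then show "deriv (\<lambda>w. R w * S w) w \<noteq> 0"
    using w no[OF w(1)] simple_zerosD[OF R w(1)] simple_zerosD[OF S w(1)] by auto
qed

lemma simple_zeros_const: "c \<noteq> 0 \<Longrightarrow> simple_zeros (\<lambda>_. c)"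
  by (simp add: simple_zeros_def)

lemma simple_zeros_prod:
  assumes "finite I" "\<And>i. i \<in> I \<Longrightarrow> simple_zeros (R i)"
    and "\<And>i j w. i \<in> I \<Longrightarrow> j \<in> I \<Longrightarrow> i \<noteq> j \<Longrightarrow> w \<noteq> 0 \<Longrightarrow> R i w = 0 \<Longrightarrow> R j w = 0 \<Longrightarrow> False"
  shows "simple_zeros (\<lambda>w. \<Prod>i\<in>I. R i w)"
  using assms
proof (induction I rule: finite_induct)
  case empty
  then show ?case by (simp add: simple_zeros_const)
next
  case (insert i I)
  have "simple_zeros (\<lambda>w. R i w * (\<Prod>i\<in>I. R i w))"
  proof (rule simple_zeros_mult)
    fix w assume w: "w \<noteq> 0" "R i w = 0" "(\<Prod>i\<in>I. R i w) = 0"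
    then obtain j where "j \<in> I" "R j w = 0" using insert.hyps(1) by (auto simp: prod_zero_iff)
    then show False using insert.prems(2)[of i j w] w insert.hyps by auto
  qed (use insert in auto)
  then show ?case using insert.hyps by simp
qed

lemma simple_zeros_theta_comp:
  assumes g: "\<And>w. w \<noteq> 0 \<Longrightarrow> (g has_field_derivative g' w) (at w)"
    "\<And>w. w \<noteq> 0 \<Longrightarrow> g w \<noteq> 0" "\<And>w. w \<noteq> 0 \<Longrightarrow> g' w \<noteq> 0"
  shows "simple_zeros (\<lambda>w. th (g w))"
proof -
  have d: "((\<lambda>w. th (g w)) has_field_derivative (deriv th (g w) * g' w)) (at w)" if "w \<noteq> 0" for w
    by (rule DERIV_chain2[OF theta_differentiable]) (use g that in auto)
  then have "(\<lambda>w. th (g w)) holomorphic_on - {0}"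
    unfolding holomorphic_on_def field_differentiable_def
    by (metis ComplD singletonI has_field_derivative_at_within)
  moreover have "deriv (\<lambda>w. th (g w)) w \<noteq> 0" if "w \<noteq> 0" "th (g w) = 0" for w
    using DERIV_imp_deriv[OF d[OF that(1)]] deriv_theta_nz[OF g(2)] g(3) that by auto
  ultimately show ?thesis by (auto simp: simple_zeros_def)
qed

lemma simple_zeros_theta:
  assumes "c \<noteq> 0"
  shows "simple_zeros (\<lambda>w. th (c * w))" "simple_zeros (\<lambda>w. th (c / w))"
    "simple_zeros (\<lambda>w. th (w * c))" "simple_zeros (\<lambda>w. th (w / c))" "simple_zeros (\<lambda>w. th (w\<^sup>2))"
proof -
  have 1: "simple_zeros (\<lambda>w. th (c * w))" if "c \<noteq> 0" for c
    by (rule simple_zeros_theta_comp[of _ "\<lambda>_. c"]) (use that in \<open>auto intro!: derivative_eq_intros\<close>)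
  show "simple_zeros (\<lambda>w. th (c * w))" by (rule 1[OF assms])
  show "simple_zeros (\<lambda>w. th (c / w))"
    by (rule simple_zeros_theta_comp[of _ "\<lambda>w. - c / w\<^sup>2"])
       (use assms in \<open>auto intro!: derivative_eq_intros simp: power2_eq_square\<close>)
  show "simple_zeros (\<lambda>w. th (w * c))" using 1[OF assms] by (simp add: mult.commute)
  show "simple_zeros (\<lambda>w. th (w / c))" using 1[of "1 / c"] assms by (simp add: mult.commute)
  show "simple_zeros (\<lambda>w. th (w\<^sup>2))"
    by (rule simple_zeros_theta_comp[of _ "\<lambda>w. 2 * w"]) (auto intro!: derivative_eq_intros)
qed

text \<open>Where R vanishes, differentiating R h = 0 leaves R' h = 0, and R' is not zero there.
  This replaces the identity theorem whenever an identity is known only after multiplication by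
  R.\<close>

lemma simple_zeros_cancel:
  assumes R: "simple_zeros R" and h: "h holomorphic_on - {0}"
    and eq: "\<And>z. z \<noteq> 0 \<Longrightarrow> R z * h z = 0" and z: "z \<noteq> 0"
  shows "h z = 0"
proof (cases "R z = 0")
  case True
  have "(R has_field_derivative deriv R z) (at z)" "(h has_field_derivative deriv h z) (at z)"
    using z holomorphic_derivI[OF simple_zeros_holo[OF R], of z] holomorphic_derivI[OF h, of z] by auto
  then have "((\<lambda>w. R w * h w) has_field_derivative (deriv R z * h z + deriv h z * R z)) (at z)"
    by (rule DERIV_mult)
  moreover have "((\<lambda>w. R w * h w) has_field_derivative 0) (at z)"
    by (rule has_field_derivative_transform_within_open[of "\<lambda>_. 0" _ _ "- {0}"])
       (use z eq in auto)
  ultimately have "deriv R z * h z + deriv h z * R z = 0" by (rule DERIV_unique)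
  then show ?thesis using True simple_zerosD[OF R z] by simp
qed (use eq z in auto)

lemma simple_zeros_divide:
  assumes R: "simple_zeros R" and f: "f holomorphic_on - {0}"
    and vanishes: "\<And>w. w \<noteq> 0 \<Longrightarrow> R w = 0 \<Longrightarrow> f w = 0"
  obtains g where "g holomorphic_on - {0}" "\<And>z. z \<noteq> 0 \<Longrightarrow> f z = R z * g z"
proof -
  \<comment> \<open>At a zero of R the quotient is given its limit, the ratio of the
    derivatives.\<close>
  define g where "g = (\<lambda>z. if R z = 0 then deriv f z / deriv R z else f z / R z)"
  have Rh: "R holomorphic_on - {0}" by (rule simple_zeros_holo[OF R])
  have "g field_differentiable at w" if w: "w \<noteq> 0" for w
  proof (cases "R w = 0")
    case False
    have "open (- {0} \<inter> R -` (- {0}))"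
      by (intro continuous_open_preimage holomorphic_on_imp_continuous_on[OF Rh]) auto
    moreover have "(\<lambda>z. f z / R z) holomorphic_on (- {0} \<inter> R -` (- {0}))"
      by (intro holomorphic_intros holomorphic_on_subset[OF f] holomorphic_on_subset[OF Rh]) auto
    moreover have "g z = f z / R z" if "z \<in> (- {0} \<inter> R -` (- {0}))" for z
      using that by (simp add: g_def)
    ultimately have "g holomorphic_on (- {0} \<inter> R -` (- {0}))"
      by (metis (no_types, lifting) holomorphic_cong)
    then show ?thesis
      using \<open>open _\<close> False w by (auto simp: holomorphic_on_open field_differentiable_def)
  next
    case True
    have fw: "f w = 0" using vanishes True w by auto
    \<comment> \<open>Divided differences at w: both are holomorphic, \<open>R1 w\<close> is not
      zero, and the common factor z - w cancels in \<open>f z / R z\<close>.\<close>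
    define f1 where "f1 = (\<lambda>z. if z = w then deriv f w else (f z - f w) / (z - w))"
    define R1 where "R1 = (\<lambda>z. if z = w then deriv R w else (R z - R w) / (z - w))"
    have f1: "f1 holomorphic_on - {0}" unfolding f1_def by (rule pole_lemma_open[OF f]) auto
    have R1: "R1 holomorphic_on - {0}" unfolding R1_def by (rule pole_lemma_open[OF Rh]) auto
    have R1w: "R1 w \<noteq> 0" using simple_zerosD[OF R w True] by (simp add: R1_def)
    define U where "U = (- {0} \<inter> R1 -` (- {0}))"
    have U: "open U" unfolding U_def
      by (intro continuous_open_preimage holomorphic_on_imp_continuous_on[OF R1]) auto
    have "(\<lambda>z. f1 z / R1 z) holomorphic_on U"
      unfolding U_def
      by (intro holomorphic_intros holomorphic_on_subset[OF f1] holomorphic_on_subset[OF R1]) auto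
    moreover have "g z = f1 z / R1 z" if "z \<in> U" for z
      using that True fw by (auto simp: g_def U_def f1_def R1_def split: if_splits)
    ultimately have "g holomorphic_on U" by (metis (no_types, lifting) holomorphic_cong)
    then show ?thesis
      using U R1w w by (auto simp: holomorphic_on_open field_differentiable_def U_def)
  qed
  then have "g holomorphic_on - {0}"
    by (auto simp: holomorphic_on_def intro: field_differentiable_at_within)
  moreover have "f z = R z * g z" if "z \<noteq> 0" for z
    using vanishes[OF that] by (simp add: g_def)
  ultimately show ?thesis by (rule that)
qed

text \<open>The closed annulus between |p| and 1 meets every orbit of multiplication by p, so h is
  bounded; composed with \<open>exp\<close> it becomes a bounded entire function, hence
  constant.\<close>

lemma p_invariant_const:
  assumes h: "h holomorphic_on - {0}" and inv: "\<And>z. z \<noteq> 0 \<Longrightarrow> h (p * z) = h z"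
  obtains c where "\<And>z. z \<noteq> 0 \<Longrightarrow> h z = c"
proof -
  have invk: "h (p powi k * z) = h z" if z: "z \<noteq> 0" for k z
  proof (induction k rule: int_induct[where k = 0])
    case (step1 i)
    then show ?case using inv[of "p powi i * z"] z by (simp add: power_int_add mult_ac)
  next
    case (step2 i)
    then show ?case using inv[of "p powi (i - 1) * z"] z by (simp add: power_int_diff mult_ac)
  qed simp
  define A where "A = {z::complex. norm p \<le> norm z \<and> norm z \<le> 1}"
  have "A = cball 0 1 - ball 0 (norm p)"
    by (auto simp: A_def)
  moreover have "compact (cball (0::complex) 1 - ball 0 (norm p))"
    by (intro compact_diff compact_cball open_ball)
  ultimately have "compact A" by metis
  moreover have "continuous_on A h"
    by (rule continuous_on_subset[OF holomorphic_on_imp_continuous_on[OF h]])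
       (auto simp: A_def)
  ultimately have "bounded (h ` A)"
    using compact_continuous_image compact_imp_bounded by blast
  then obtain B where B: "\<And>z. z \<in> A \<Longrightarrow> norm (h z) \<le> B"
    by (auto simp: bounded_iff)
  have bound: "norm (h z) \<le> B" if z: "z \<noteq> 0" for z
  proof -
    define L where "L = ln (norm p)"
    have L: "L < 0" using p_lt1 by (simp add: L_def)
    \<comment> \<open>The logarithm of |z| to base |p| is \<open>ln (norm z) / L\<close>; removing
      its integer part brings |p^k z| into the interval from |p| to 1.\<close>
    define k where "k = - \<lfloor>ln (norm z) / L\<rfloor>"
    have nrm: "norm (p powi k * z) = exp (k * L + ln (norm z))"
      using z by (simp add: norm_mult norm_power_int exp_add L_def powr_real_of_int' [symmetric] powr_def)
    define y where "y = ln (norm z) / L"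
    have yL: "ln (norm z) = y * L" using L by (simp add: y_def)
    have k: "real_of_int k = - of_int \<lfloor>y\<rfloor>" by (simp add: k_def y_def)
    have fr: "0 \<le> y - of_int \<lfloor>y\<rfloor>" "y - of_int \<lfloor>y\<rfloor> \<le> 1" by linarith+
    have e: "k * L + ln (norm z) = (y - of_int \<lfloor>y\<rfloor>) * L"
      by (simp add: k yL algebra_simps)
    have "(y - of_int \<lfloor>y\<rfloor>) * L \<le> 0" using fr L by (simp add: mult_nonneg_nonpos)
    moreover have "1 * L \<le> (y - of_int \<lfloor>y\<rfloor>) * L"
      using fr L by (intro mult_right_mono_neg) auto
    ultimately have "L \<le> k * L + ln (norm z)" "k * L + ln (norm z) \<le> 0"
      unfolding e by auto
    then have "exp L \<le> norm (p powi k * z)" "norm (p powi k * z) \<le> 1"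
      unfolding nrm by auto
    then have "p powi k * z \<in> A" by (simp add: A_def L_def)
    then show ?thesis using B invk[OF z] by metis
  qed
  have "(h \<circ> exp) holomorphic_on UNIV"
    by (rule holomorphic_on_compose_gen[OF _ h]) (auto intro!: holomorphic_intros)
  moreover have "bounded (range (h \<circ> exp))"
    unfolding bounded_iff using bound by (intro exI[of _ B]) auto
  ultimately have "(h \<circ> exp) constant_on UNIV"
    by (rule Liouville_theorem)
  then obtain c where c: "\<forall>z\<in>UNIV. (h \<circ> exp) z = c"
    unfolding constant_on_def by blast
  have "h z = c" if "z \<noteq> 0" for z
    using c[rule_format, of "Ln z"] that by simp
  then show ?thesis by (rule that)
qed

text \<open>The quotient f / R is holomorphic by divisibility; the multipliers agree, so it is
  invariant under p, hence constant. At zeros of R the invariance comes from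
  \<open>simple_zeros_cancel\<close>.\<close>

lemma quasi_periodic_ratio_const:
  assumes R: "simple_zeros R" and f: "f holomorphic_on - {0}"
    and vanishes: "\<And>w. w \<noteq> 0 \<Longrightarrow> R w = 0 \<Longrightarrow> f w = 0"
    and Rp: "\<And>z. z \<noteq> 0 \<Longrightarrow> R (p * z) = M z * R z"
    and fp: "\<And>z. z \<noteq> 0 \<Longrightarrow> f (p * z) = M z * f z"
    and M: "\<And>z. z \<noteq> 0 \<Longrightarrow> M z \<noteq> 0"
  obtains c where "\<And>z. z \<noteq> 0 \<Longrightarrow> f z = c * R z"
proof -
  obtain g where g: "g holomorphic_on - {0}" "\<And>z. z \<noteq> 0 \<Longrightarrow> f z = R z * g z"
    using simple_zeros_divide[OF R f vanishes] by metis
  have "g (p * z) = g z" if z: "z \<noteq> 0" for z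
  proof -
    have "(\<lambda>w. g (p * w) - g w) holomorphic_on - {0}"
    proof -
      have "(g \<circ> (\<lambda>w. p * w)) holomorphic_on - {0}"
        by (rule holomorphic_on_compose_gen[OF _ g(1)]) (auto intro!: holomorphic_intros)
      then show ?thesis using g(1) by (auto simp: o_def intro!: holomorphic_intros)
    qed
    moreover have "R w * (g (p * w) - g w) = 0" if w: "w \<noteq> 0" for w
    proof -
      have "M w * R w * g (p * w) = M w * (R w * g w)"
        using g(2)[of "p * w"] Rp[OF w] fp[OF w] g(2)[OF w] w by (metis mult_eq_0_iff p_nz)
      then show ?thesis using M[OF w] by auto
    qed
    ultimately have "g (p * z) - g z = 0" using simple_zeros_cancel[OF R _ _ z] by blast
    then show ?thesis by simp
  qed
  then obtain c where "\<And>z. z \<noteq> 0 \<Longrightarrow> g z = c" using p_invariant_const[OF g(1)] by metis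
  then have "f z = c * R z" if "z \<noteq> 0" for z using g(2) that by (simp add: mult.commute)
  then show ?thesis by (rule that)
qed

section \<open>Theta functions of one variable\<close>

text \<open>The one-variable form of \<open>BC_theta\<close>. The multiplier stands on the side of
  \<open>f (p * z)\<close>, so that only natural powers occur.\<close>

definition BC1 :: "nat \<Rightarrow> (complex \<Rightarrow> complex) \<Rightarrow> bool" where
  "BC1 m f \<longleftrightarrow> f holomorphic_on - {0} \<and>
     (\<forall>z. z \<noteq> 0 \<longrightarrow> f (1 / z) = f z) \<and>
     (\<forall>z. z \<noteq> 0 \<longrightarrow> (p * z\<^sup>2) ^ m * f (p * z) = f z)"

lemma BC1_holo: "BC1 m f \<Longrightarrow> f holomorphic_on - {0}"
  and BC1_inv: "BC1 m f \<Longrightarrow> z \<noteq> 0 \<Longrightarrow> f (1 / z) = f z"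
  and BC1_p: "BC1 m f \<Longrightarrow> z \<noteq> 0 \<Longrightarrow> (p * z\<^sup>2) ^ m * f (p * z) = f z"
  by (auto simp: BC1_def)

lemma BC1_lincomb:
  assumes "BC1 m f" "BC1 m g"
  shows "BC1 m (\<lambda>z. c * f z + d * g z)"
  unfolding BC1_def
proof (intro conjI allI impI)
  show "(\<lambda>z. c * f z + d * g z) holomorphic_on - {0}"
    by (intro holomorphic_intros BC1_holo[OF assms(1)] BC1_holo[OF assms(2)])
  fix z :: complex assume z: "z \<noteq> 0"
  show "c * f (1 / z) + d * g (1 / z) = c * f z + d * g z"
    using assms z by (simp add: BC1_inv)
  show "(p * z\<^sup>2) ^ m * (c * f (p * z) + d * g (p * z)) = c * f z + d * g z"
    using BC1_p[OF assms(1) z] BC1_p[OF assms(2) z] by (simp add: algebra_simps)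
qed

lemma BC1_theta_prod:
  assumes "finite I" "\<And>i. i \<in> I \<Longrightarrow> \<zeta> i \<noteq> 0"
  shows "BC1 (card I) (\<lambda>z. \<Prod>i\<in>I. th (\<zeta> i * z) * th (\<zeta> i / z))"
  unfolding BC1_def
proof (intro conjI allI impI)
  show "(\<lambda>z. \<Prod>i\<in>I. th (\<zeta> i * z) * th (\<zeta> i / z)) holomorphic_on - {0}"
    by (intro holomorphic_intros) (use assms in auto)
  fix z :: complex assume z: "z \<noteq> 0"
  show "(\<Prod>i\<in>I. th (\<zeta> i * (1 / z)) * th (\<zeta> i / (1 / z))) = (\<Prod>i\<in>I. th (\<zeta> i * z) * th (\<zeta> i / z))"
    by (simp add: mult.commute)
  have *: "(p * z\<^sup>2) * (th (\<zeta> i * (p * z)) * th (\<zeta> i / (p * z))) = th (\<zeta> i * z) * th (\<zeta> i / z)"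
    if "i \<in> I" for i
  proof -
    have e: "th (\<zeta> i * (p * z)) = - th (\<zeta> i * z) / (\<zeta> i * z)"
      "th (\<zeta> i / (p * z)) = - (\<zeta> i / z) * th (\<zeta> i / z) / p"
      using theta_p[of "\<zeta> i * z"] theta_div_p[of "\<zeta> i / z"] z assms(2)[OF that]
      by (simp_all add: mult_ac)
    show ?thesis unfolding e using z assms(2)[OF that] by (simp add: power2_eq_square)
  qed
  have "(p * z\<^sup>2) ^ card I * (\<Prod>i\<in>I. th (\<zeta> i * (p * z)) * th (\<zeta> i / (p * z)))
     = (\<Prod>i\<in>I. (p * z\<^sup>2) * (th (\<zeta> i * (p * z)) * th (\<zeta> i / (p * z))))"
    by (simp add: prod.distrib)
  also have "\<dots> = (\<Prod>i\<in>I. th (\<zeta> i * z) * th (\<zeta> i / z))"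
    by (intro prod.cong refl *)
  finally show "(p * z\<^sup>2) ^ card I * (\<Prod>i\<in>I. th (\<zeta> i * (p * z)) * th (\<zeta> i / (p * z)))
     = (\<Prod>i\<in>I. th (\<zeta> i * z) * th (\<zeta> i / z))" .
qed

text \<open>For nonzero arguments: x and y lie in different orbits of the group generated by x -> p
  x and x -> 1 / x, by \<open>theta_eq_0_iff\<close>.\<close>

definition inequiv :: "complex \<Rightarrow> complex \<Rightarrow> bool" where
  "inequiv x y \<longleftrightarrow> th (x * y) \<noteq> 0 \<and> th (x / y) \<noteq> 0"

lemma inequiv_sym: "inequiv x y \<longleftrightarrow> inequiv y x"
  by (auto simp: inequiv_def mult.commute theta_div_commute[of x y])

text \<open>Transitivity of equivalence: x and y are both equivalent to w, and in each of the four
  cases x y or x / y is a power of p.\<close>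

lemma theta_two_zeros:
  assumes nz: "w \<noteq> 0" "x \<noteq> 0" "y \<noteq> 0"
    and w: "th (x * w) = 0 \<or> th (x / w) = 0" "th (y * w) = 0 \<or> th (y / w) = 0"
  shows "\<not> inequiv x y"
proof -
  have ex: "\<exists>k::int. u = p powi k * w \<or> u = p powi k / w"
    if u: "th (u * w) = 0 \<or> th (u / w) = 0" "u \<noteq> 0" for u
  proof -
    from u obtain k :: int where "u * w = p powi k \<or> u / w = p powi k"
      using theta_eq_0_iff[of "u * w"] theta_eq_0_iff[of "u / w"] nz by auto
    then show ?thesis using nz by (auto simp: field_simps)
  qed
  obtain k l :: int where kl: "x = p powi k * w \<or> x = p powi k / w" "y = p powi l * w \<or> y = p powi l / w"
    using ex w nz by metis
  have "\<exists>j::int. x * y = p powi j \<or> x / y = p powi j"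
  proof -
    consider "x = p powi k * w" "y = p powi l * w" | "x = p powi k * w" "y = p powi l / w"
      | "x = p powi k / w" "y = p powi l * w" | "x = p powi k / w" "y = p powi l / w"
      using kl by blast
    then have "x / y = p powi (k - l) \<or> x * y = p powi (k + l)"
      by cases (use nz in \<open>simp_all add: power_int_add power_int_diff\<close>)
    then show ?thesis by blast
  qed
  then show ?thesis
    using theta_eq_0_iff[of "x * y"] theta_eq_0_iff[of "x / y"] nz by (auto simp: inequiv_def)
qed

text \<open>Any m of the points define a product R of degree m with simple zeros at exactly their
  orbits, so f is a multiple of R; the remaining point, where R is not zero, makes the factor zero.
  The condition on \<open>th (z\<^sup>2)\<close> keeps z and 1 / z inequivalent under multiplication
  by p; otherwise R would have double zeros.\<close>

lemma BC1_eq_0: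
  assumes f: "BC1 m f" and Z: "finite Z" "card Z \<ge> m + 1"
    and Znz: "\<And>z. z \<in> Z \<Longrightarrow> z \<noteq> 0" and Zsq: "\<And>z. z \<in> Z \<Longrightarrow> th (z\<^sup>2) \<noteq> 0"
    and Zin: "\<And>z w. z \<in> Z \<Longrightarrow> w \<in> Z \<Longrightarrow> z \<noteq> w \<Longrightarrow> inequiv z w"
    and f0: "\<And>z. z \<in> Z \<Longrightarrow> f z = 0" and x: "x \<noteq> 0"
  shows "f x = 0"
proof -
  obtain Z' where Z': "Z' \<subseteq> Z" "card Z' = m + 1" "finite Z'"
    using Z obtain_subset_with_card_n by metis
  then obtain z0 where z0: "z0 \<in> Z'" by fastforce
  define I where "I = Z' - {z0}"
  have I: "finite I" "card I = m" "I \<subseteq> Z" "z0 \<in> Z" "z0 \<notin> I" using Z' z0 by (auto simp: I_def)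
  define R where "R = (\<lambda>z. \<Prod>i\<in>I. th (i * z) * th (i / z))"
  have BR: "BC1 m R" using BC1_theta_prod[of I "\<lambda>i. i"] I Znz by (auto simp: R_def)
  have R: "simple_zeros R"
    unfolding R_def
  proof (rule simple_zeros_prod)
    fix i assume i: "i \<in> I"
    show "simple_zeros (\<lambda>z. th (i * z) * th (i / z))"
    proof (rule simple_zeros_mult)
      fix w assume w: "w \<noteq> 0" "th (i * w) = 0" "th (i / w) = 0"
      have inz: "i \<noteq> 0" using Znz i I by auto
      obtain k l :: int where "i * w = p powi k" "i / w = p powi l"
        using w theta_eq_0_iff[of "i * w"] theta_eq_0_iff[of "i / w"] inz by auto
      then have "i\<^sup>2 = p powi (k + l)"
        using w(1) by (simp add: power_int_add power2_eq_square field_simps)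
      then have "th (i\<^sup>2) = 0" using theta_eq_0_iff[of "i\<^sup>2"] inz by auto
      then show False using Zsq i I by auto
    qed (use simple_zeros_theta Znz i I in auto)
  next
    fix i j w assume ij: "i \<in> I" "j \<in> I" "i \<noteq> j" "w \<noteq> 0" "th (i * w) * th (i / w) = 0" "th (j * w) * th (j / w) = 0"
    have "\<not> inequiv i j" by (rule theta_two_zeros[of w]) (use ij Znz I in auto)
    then show False using Zin ij I by blast
  qed (use I in auto)
  have vanishes: "f w = 0" if w: "w \<noteq> 0" "R w = 0" for w
  proof -
    have shift: "f (p powi k * v) = 0 \<longleftrightarrow> f v = 0" if v: "v \<noteq> 0" for k v
    proof (induction k rule: int_induct[where k = 0])
      case (step1 i)
      have "f (p powi (i + 1) * v) = 0 \<longleftrightarrow> f (p powi i * v) = 0"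
        using BC1_p[OF f, of "p powi i * v"] v by (auto simp: power_int_add mult_ac)
      then show ?case using step1 by simp
    next
      case (step2 i)
      have "f (p powi (i - 1) * v) = 0 \<longleftrightarrow> f (p powi i * v) = 0"
        using BC1_p[OF f, of "p powi (i - 1) * v"] v by (auto simp: power_int_diff mult_ac)
      then show ?case using step2 by simp
    qed simp
    obtain i where i: "i \<in> I" "th (i * w) = 0 \<or> th (i / w) = 0"
      using w(2) I(1) by (auto simp: R_def prod_zero_iff)
    have inz: "i \<noteq> 0" using Znz i I by auto
    obtain k :: int where "i * w = p powi k \<or> i / w = p powi k"
      using i(2) theta_eq_0_iff[of "i * w"] theta_eq_0_iff[of "i / w"] inz w by auto
    then have "w = p powi k * (1 / i) \<or> w = p powi (- k) * i"
      using inz w by (auto simp: field_simps power_int_minus)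
    moreover have "f i = 0" "f (1 / i) = 0" using f0 i I BC1_inv[OF f inz] by auto
    ultimately show ?thesis using shift[of i] shift[of "1 / i"] inz by auto
  qed
  have quasi: "g (p * z) = 1 / (p * z\<^sup>2) ^ m * g z" if "BC1 m g" "z \<noteq> 0" for g z
    using BC1_p[OF that] that by (simp add: field_simps)
  obtain c where c: "\<And>z. z \<noteq> 0 \<Longrightarrow> f z = c * R z"
    using quasi_periodic_ratio_const[OF R BC1_holo[OF f] vanishes quasi[OF BR] quasi[OF f]] by auto
  have "R z0 \<noteq> 0"
  proof
    assume "R z0 = 0"
    then obtain i where i: "i \<in> I" "th (i * z0) = 0 \<or> th (i / z0) = 0"
      using I(1) by (auto simp: R_def prod_zero_iff)
    moreover have "inequiv i z0" using Zin[of i z0] i I by auto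
    ultimately show False by (auto simp: inequiv_def)
  qed
  then have "c = 0" using c[of z0] f0 I(4) Znz by auto
  then show ?thesis using c x by simp
qed

section \<open>Symmetric functions of several variables\<close>

text \<open>The denominators of the difference operator are built from
  \<open>th (x\<^sup>2)\<close>, \<open>th (x * y)\<close> and \<open>th (x / y)\<close>; here they
  are nonzero. Removing a single copy of x compares repeated entries with each other, so these are
  excluded.\<close>

definition good :: "complex multiset \<Rightarrow> bool" where
  "good M \<longleftrightarrow> (\<forall>x\<in>#M. x \<noteq> 0 \<and> th (x\<^sup>2) \<noteq> 0 \<and> (\<forall>y\<in>#M - {#x#}. inequiv x y))"

lemma good_empty [simp]: "good {#}"
  by (simp add: good_def)

lemma good_add:
  "good (add_mset x M) \<longleftrightarrow> x \<noteq> 0 \<and> th (x\<^sup>2) \<noteq> 0 \<and> (\<forall>y\<in>#M. inequiv x y) \<and> good M"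
proof -
  have *: "(\<forall>y\<in>#add_mset x M - {#z#}. inequiv z y) \<longleftrightarrow> inequiv z x \<and> (\<forall>y\<in>#M - {#z#}. inequiv z y)"
    if "z \<in># M" for z
    using that by (simp add: add_mset_diff_bothsides)
  show ?thesis
    unfolding good_def using * by (auto simp: inequiv_sym)
qed

lemma good_union_left: "good (M + M') \<Longrightarrow> good M"
  by (induction M') (auto simp: good_add)

lemma good_union_right: "good (M + M') \<Longrightarrow> good M'"
  using good_union_left[of M' M] by (simp add: add.commute)

lemma good_union:
  "good (M + M') \<longleftrightarrow> good M \<and> good M' \<and> (\<forall>x\<in>#M. \<forall>y\<in>#M'. inequiv x y)"
  by (induction M) (auto simp: good_add inequiv_sym)

lemma good_nz: "good M \<Longrightarrow> x \<in># M \<Longrightarrow> x \<noteq> 0"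
  by (auto simp: good_def)

text \<open>Functions whose values matter only at \<open>good\<close> points: the difference operator below has
  denominators that vanish elsewhere.\<close>

definition generic_theta :: "nat \<Rightarrow> nat \<Rightarrow> (complex multiset \<Rightarrow> complex) \<Rightarrow> bool" where
  "generic_theta n m f \<longleftrightarrow> (\<forall>M. size M + 1 = n \<longrightarrow> good M \<longrightarrow>
     (\<exists>\<phi>. BC1 m \<phi> \<and> (\<forall>z. good (add_mset z M) \<longrightarrow> f (add_mset z M) = \<phi> z)))"

text \<open>Honest theta functions, constrained at all points with nonzero entries. Symmetry under
  permutations is carried by the multiset argument, so conditions in one variable suffice.\<close>

definition sym_theta :: "nat \<Rightarrow> nat \<Rightarrow> (complex multiset \<Rightarrow> complex) \<Rightarrow> bool" where
  "sym_theta n m f \<longleftrightarrow> (\<forall>M. size M + 1 = n \<longrightarrow> 0 \<notin># M \<longrightarrow> BC1 m (\<lambda>z. f (add_mset z M)))"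

lemma generic_thetaE:
  assumes "generic_theta n m f" "size M + 1 = n" "good M"
  obtains \<phi> where "BC1 m \<phi>" "\<And>z. good (add_mset z M) \<Longrightarrow> f (add_mset z M) = \<phi> z"
  using assms unfolding generic_theta_def by blast

lemma sym_theta_generic: "sym_theta n m f \<Longrightarrow> generic_theta n m f"
  unfolding sym_theta_def generic_theta_def using good_nz by blast

lemma generic_theta_lincomb:
  assumes "generic_theta n m f" "generic_theta n m g"
  shows "generic_theta n m (\<lambda>M. c * f M + d * g M)"
  unfolding generic_theta_def
proof (intro allI impI)
  fix M :: "complex multiset" assume M: "size M + 1 = n" "good M"
  obtain \<phi> where "BC1 m \<phi>" "\<And>z. good (add_mset z M) \<Longrightarrow> f (add_mset z M) = \<phi> z"
    using generic_thetaE[OF assms(1) M] by blast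
  moreover obtain \<psi> where "BC1 m \<psi>" "\<And>z. good (add_mset z M) \<Longrightarrow> g (add_mset z M) = \<psi> z"
    using generic_thetaE[OF assms(2) M] by blast
  ultimately show "\<exists>\<phi>. BC1 m \<phi> \<and> (\<forall>z. good (add_mset z M) \<longrightarrow> c * f (add_mset z M) + d * g (add_mset z M) = \<phi> z)"
    by (intro exI[of _ "\<lambda>z. c * \<phi> z + d * \<psi> z"]) (auto intro: BC1_lincomb)
qed

section \<open>Vanishing when some of the coordinates are prescribed\<close>

definition ev :: "('a \<Rightarrow> complex) \<Rightarrow> 'a set \<Rightarrow> complex multiset" where
  "ev \<xi> C = image_mset \<xi> (mset_set C)"

lemma ev_insert: "finite C \<Longrightarrow> y \<notin> C \<Longrightarrow> ev \<xi> (insert y C) = add_mset (\<xi> y) (ev \<xi> C)"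
  by (simp add: ev_def)

lemma ev_union: "finite C \<Longrightarrow> finite D \<Longrightarrow> C \<inter> D = {} \<Longrightarrow> ev \<xi> (C \<union> D) = ev \<xi> C + ev \<xi> D"
  by (simp add: ev_def mset_set_Union)

lemma size_ev [simp]: "size (ev \<xi> C) = card C"
  by (simp add: ev_def)

lemma ev_empty [simp]: "ev \<xi> {} = {#}"
  by (simp add: ev_def)

lemma in_ev: "finite C \<Longrightarrow> x \<in># ev \<xi> C \<longleftrightarrow> (\<exists>y\<in>C. x = \<xi> y)"
  by (auto simp: ev_def)

text \<open>The coordinates in \<open>C\<close> are prescribed, the remaining ones are free.\<close>

definition vanishes :: "nat \<Rightarrow> (complex multiset \<Rightarrow> complex) \<Rightarrow> ('a \<Rightarrow> complex) \<Rightarrow> 'a set \<Rightarrow> bool" where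
  "vanishes n f \<xi> C \<longleftrightarrow> (\<forall>F. size F + card C = n \<longrightarrow> good (ev \<xi> C + F) \<longrightarrow> f (ev \<xi> C + F) = 0)"

lemma vanishes_mono:
  assumes "vanishes n f \<xi> C" "C \<subseteq> C'" "finite C'"
  shows "vanishes n f \<xi> C'"
  unfolding vanishes_def
proof (intro allI impI)
  fix F :: "complex multiset" assume F: "size F + card C' = n" "good (ev \<xi> C' + F)"
  have fin: "finite C" using assms finite_subset by blast
  have C': "C' = C \<union> (C' - C)" using assms by auto
  have eq: "ev \<xi> C' = ev \<xi> C + ev \<xi> (C' - C)"
    by (subst C', rule ev_union) (use assms fin in auto)
  have "card C' = card C + card (C' - C)"
    using assms fin by (metis card_Diff_subset card_mono le_add_diff_inverse)
  then have "size (ev \<xi> (C' - C) + F) + card C = n" using F(1) by simp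
  moreover have "good (ev \<xi> C + (ev \<xi> (C' - C) + F))" using F(2) by (simp add: eq add.assoc)
  ultimately have "f (ev \<xi> C + (ev \<xi> (C' - C) + F)) = 0"
    using assms(1) unfolding vanishes_def by blast
  then show "f (ev \<xi> C' + F) = 0" by (simp add: eq add.assoc)
qed

lemma vanishes_full: "card C = n \<Longrightarrow> f (ev \<xi> C) = 0 \<Longrightarrow> vanishes n f \<xi> C"
  by (simp add: vanishes_def)

lemma countable_not_inequiv: "countable {w. w \<noteq> 0 \<and> \<not> inequiv w y}"
proof (cases "y = 0")
  case True
  \<comment> \<open>Division by zero being zero, w * 0 and w / 0 are both 0, and
    \<open>th 0 = 1\<close>.\<close>
  then have "inequiv w y" for w
  proof -
    have "th 0 = 1" by (simp add: theta_def)
    then show ?thesis using True by (simp add: inequiv_def)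
  qed
  then show ?thesis by simp
next
  case False
  let ?Z = "{z. z \<noteq> 0 \<and> th z = 0}"
  have "{w. w \<noteq> 0 \<and> \<not> inequiv w y} \<subseteq> (\<lambda>z. z / y) ` ?Z \<union> (\<lambda>z. z * y) ` ?Z"
  proof
    fix w assume "w \<in> {w. w \<noteq> 0 \<and> \<not> inequiv w y}"
    then have "w * y \<in> ?Z \<or> w / y \<in> ?Z" using False by (auto simp: inequiv_def)
    then show "w \<in> (\<lambda>z. z / y) ` ?Z \<union> (\<lambda>z. z * y) ` ?Z"
      using False by (auto simp: image_iff) (metis nonzero_mult_div_cancel_right mult_eq_0_iff nonzero_eq_divide_eq divide_eq_0_iff)+
  qed
  then show ?thesis
    by (rule countable_subset) (use theta_zeros_countable in auto)
qed

lemma countable_theta_square: "countable {w. w \<noteq> 0 \<and> th (w\<^sup>2) = 0}"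
proof -
  let ?Z = "{z. z \<noteq> 0 \<and> th z = 0}"
  have "{w. w \<noteq> 0 \<and> th (w\<^sup>2) = 0} \<subseteq> csqrt ` ?Z \<union> (\<lambda>z. - csqrt z) ` ?Z"
  proof
    fix w assume "w \<in> {w. w \<noteq> 0 \<and> th (w\<^sup>2) = 0}"
    then have "w\<^sup>2 \<in> ?Z" by auto
    moreover have "w = csqrt (w\<^sup>2) \<or> w = - csqrt (w\<^sup>2)"
      by (metis power2_csqrt power2_eq_iff)
    ultimately show "w \<in> csqrt ` ?Z \<union> (\<lambda>z. - csqrt z) ` ?Z" by blast
  qed
  then show ?thesis
    by (rule countable_subset) (use theta_zeros_countable in auto)
qed

text \<open>The set where f is nonzero is open, and a ball is uncountable. Exceptional sets
  therefore need only be countable, without any description of their accumulation points.\<close>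

lemma holomorphic_eq_0_off_countable:
  assumes f: "f holomorphic_on - {0}" and B: "countable B"
    and f0: "\<And>w. w \<noteq> 0 \<Longrightarrow> w \<notin> B \<Longrightarrow> f w = 0" and z: "z \<noteq> (0::complex)"
  shows "f z = 0"
proof (rule ccontr)
  assume nz: "f z \<noteq> 0"
  let ?U = "- {0} \<inter> f -` (- {0})"
  have "open ?U"
    by (intro continuous_open_preimage holomorphic_on_imp_continuous_on[OF f]) auto
  moreover have "z \<in> ?U" using nz z by auto
  ultimately obtain e where e: "e > 0" "ball z e \<subseteq> ?U" by (meson openE)
  have "?U \<subseteq> B" using f0 by auto
  then have "ball z e \<subseteq> B" using e(2) by blast
  then show False using e(1) B uncountable_ball countable_subset by blast
qed

text \<open>A set \<open>C\<close> of prescribed coordinates forces vanishing as soon as \<open>m + 1\<close> inequivalent ways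
  of prescribing one further coordinate do. Free coordinates equivalent to one of those \<open>m + 1\<close>
  values are reached afterwards by continuity.\<close>

lemma vanishes_step:
  assumes f: "generic_theta n m f" and C: "finite C" "card C < n"
    and Y: "finite Y" "C \<inter> Y = {}" "card Y \<ge> m + 1"
    and good: "good (ev \<xi> (C \<union> Y))"
    and vanishes: "\<And>y. y \<in> Y \<Longrightarrow> vanishes n f \<xi> (insert y C)"
  shows "vanishes n f \<xi> C"
proof -
  define bad where "bad = (\<lambda>x. \<exists>y\<in>Y. \<not> inequiv x (\<xi> y))"
  have gCY: "good (ev \<xi> C + ev \<xi> Y)" using good ev_union[OF C(1) Y(1,2)] by metis
  have gY: "good (ev \<xi> Y)" using good_union_right gCY by blast
  have CY: "inequiv (\<xi> y) x" if "x \<in># ev \<xi> C" "y \<in> Y" for x y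
    using gCY that Y(1) in_ev[of Y "\<xi> y" \<xi>] unfolding good_union by (metis inequiv_sym)
  have Y1: "\<xi> y \<noteq> 0" "th ((\<xi> y)\<^sup>2) \<noteq> 0" if "y \<in> Y" for y
    using gY that in_ev[OF Y(1), of "\<xi> y" \<xi>] unfolding good_def by auto
  have YY: "inequiv (\<xi> y) (\<xi> y')" if "y \<in> Y" "y' \<in> Y" "y \<noteq> y'" for y y'
  proof -
    have "Y = insert y (Y - {y})" using that by auto
    then have "ev \<xi> Y = add_mset (\<xi> y) (ev \<xi> (Y - {y}))"
      using ev_insert[of "Y - {y}" y \<xi>] Y(1) by (metis Diff_iff finite_Diff singletonI)
    then show ?thesis using gY that in_ev[of "Y - {y}" "\<xi> y'" \<xi>] Y(1) by (auto simp: good_add)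
  qed
  have inj: "inj_on \<xi> Y"
  proof (rule inj_onI, rule ccontr)
    fix y y' assume y: "y \<in> Y" "y' \<in> Y" "\<xi> y = \<xi> y'" "y \<noteq> y'"
    then show False using YY[OF y(1,2,4)] Y1[OF y(1)] by (auto simp: inequiv_def)
  qed
  \<comment> \<open>Induction on the number of free coordinates equivalent to a value from Y. While
    one exists it is moved to a generic w, which lowers the count; when none is left, the values of
    Y may be put in place of a free coordinate without leaving the good points.\<close>
  have "f (ev \<xi> C + F) = 0" if "size F + card C = n" "good (ev \<xi> C + F)" for F
    using that
  proof (induction "size (filter_mset bad F)" arbitrary: F rule: less_induct)
    case less
    show ?case
    proof (cases "\<exists>z. z \<in># F \<and> bad z")
      case True
      then obtain z where z: "z \<in># F" "bad z" by blast
      then obtain F' where F: "F = add_mset z F'" by (meson multi_member_split)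
      let ?M = "ev \<xi> C + F'"
      have M: "size ?M + 1 = n" "good ?M" "good (add_mset z ?M)"
        using less.prems F by (auto simp: good_add)
      obtain \<phi> where \<phi>: "BC1 m \<phi>" "\<And>w. good (add_mset w ?M) \<Longrightarrow> f (add_mset w ?M) = \<phi> w"
        using generic_thetaE[OF f M(1,2)] by blast
      let ?B = "{w. w \<noteq> 0 \<and> th (w\<^sup>2) = 0} \<union> (\<Union>y\<in>set_mset ?M. {w. w \<noteq> 0 \<and> \<not> inequiv w y})
         \<union> (\<Union>y\<in>Y. {w. w \<noteq> 0 \<and> \<not> inequiv w (\<xi> y)})"
      have "\<phi> z = 0"
      proof (rule holomorphic_eq_0_off_countable[OF BC1_holo[OF \<phi>(1)]])
        show "countable ?B"
          by (intro countable_Un countable_UN countable_theta_square countable_not_inequiv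
              countable_finite Y(1)) auto
        fix w assume w: "w \<noteq> 0" "w \<notin> ?B"
        then have gw: "good (add_mset w ?M)" and nb: "\<not> bad w"
          using M(2) by (auto simp: good_add bad_def)
        have "f (ev \<xi> C + add_mset w F') = 0"
        proof (rule less.hyps)
          show "size (filter_mset bad (add_mset w F')) < size (filter_mset bad F)"
            using nb z F by simp
        qed (use less.prems F gw in auto)
        then show "\<phi> w = 0" using \<phi>(2)[OF gw] by simp
      qed (use M(3) in \<open>auto simp: good_add\<close>)
      then show ?thesis using \<phi>(2)[OF M(3)] F by simp
    next
      case False
      have "F \<noteq> {#}" using less.prems(1) C(2) by auto
      then obtain z F' where F: "F = add_mset z F'" by (metis multiset_cases)
      let ?M = "ev \<xi> C + F'"
      have M: "size ?M + 1 = n" "good ?M" "good (add_mset z ?M)"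
        using less.prems F by (auto simp: good_add)
      obtain \<phi> where \<phi>: "BC1 m \<phi>" "\<And>w. good (add_mset w ?M) \<Longrightarrow> f (add_mset w ?M) = \<phi> w"
        using generic_thetaE[OF f M(1,2)] by blast
      have "\<phi> z = 0"
      proof (rule BC1_eq_0[OF \<phi>(1), of "\<xi> ` Y"])
        show "finite (\<xi> ` Y)" "m + 1 \<le> card (\<xi> ` Y)" using Y inj by (auto simp: card_image)
        show "z \<noteq> 0" using M(3) by (auto simp: good_add)
        show "x \<noteq> 0" "th (x\<^sup>2) \<noteq> 0" if "x \<in> \<xi> ` Y" for x using that Y1 by auto
        show "inequiv x w" if "x \<in> \<xi> ` Y" "w \<in> \<xi> ` Y" "x \<noteq> w" for x w
          using that YY by blast
        fix x assume "x \<in> \<xi> ` Y"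
        then obtain y where y: "y \<in> Y" "x = \<xi> y" by blast
        have yC: "y \<notin> C" using y Y by auto
        have "inequiv (\<xi> y) w" if "w \<in># F'" for w
          using False that y F by (auto simp: bad_def inequiv_sym)
        then have g: "good (add_mset (\<xi> y) ?M)"
          using M(2) Y1[OF y(1)] CY[OF _ y(1)] by (auto simp: good_add)
        have "f (ev \<xi> (insert y C) + F') = 0"
          using vanishes[OF y(1)] g M(1) C(1) yC by (auto simp: vanishes_def ev_insert)
        then show "\<phi> x = 0" using \<phi>(2)[OF g] y C(1) yC by (simp add: ev_insert)
      qed
      then show ?thesis using \<phi>(2)[OF M(3)] F by simp
    qed
  qed
  then show ?thesis by (simp add: vanishes_def)
qed

end

section \<open>Vanishing on a lattice of points\<close>

type_synonym tag = "bool \<times> nat \<times> nat"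

definition lat :: "(bool \<Rightarrow> complex) \<Rightarrow> complex \<Rightarrow> complex \<Rightarrow> tag \<Rightarrow> complex" where
  "lat \<beta> q t = (\<lambda>(s, c, k). \<beta> s * q ^ c * t ^ k)"

text \<open>Rows \<open>i s\<close> to n are prescribed on each side s, and
  \<open>i s = n + 1\<close> leaves the side empty. All n coordinates are prescribed exactly when
  \<open>i True + i False = n + 2\<close>; a larger sum leaves free coordinates.\<close>

definition config :: "nat \<Rightarrow> (bool \<Rightarrow> nat) \<Rightarrow> (bool \<Rightarrow> nat \<Rightarrow> nat) \<Rightarrow> tag set" where
  "config n i v = (\<lambda>(s, k). (s, v s k, n - k)) ` (SIGMA s:UNIV. {i s..n})"

definition descending :: "nat \<Rightarrow> (bool \<Rightarrow> nat) \<Rightarrow> (bool \<Rightarrow> nat \<Rightarrow> nat) \<Rightarrow> bool" where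
  "descending n i v \<longleftrightarrow> (\<forall>s. 1 \<le> i s \<and> i s \<le> n + 1 \<and> (\<forall>k k'. i s \<le> k \<longrightarrow> k \<le> k' \<longrightarrow> k' \<le> n \<longrightarrow> v s k' \<le> v s k))"

lemma in_cfg: "(s, c, e) \<in> config n i v \<longleftrightarrow> (\<exists>k. i s \<le> k \<and> k \<le> n \<and> c = v s k \<and> e = n - k)"
  by (auto simp: config_def image_iff)

lemma inj_cfg: "inj_on (\<lambda>(s, k). (s, v s k, n - k)) (SIGMA s:(UNIV::bool set). {i s..(n::nat)})"
  by (auto simp: inj_on_def)

lemma finite_cfg [simp]: "finite (config n i v)"
  by (simp add: config_def)

lemma card_cfg: "card (config n i v) = (n + 1 - i True) + (n + 1 - i False)"
proof -
  have "card (config n i v) = card (SIGMA s:(UNIV::bool set). {i s..n})"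
    unfolding config_def by (rule card_image[OF inj_cfg])
  also have "\<dots> = (\<Sum>s\<in>UNIV. card {i s..n})" by (rule card_SigmaI) auto
  finally show ?thesis by (simp add: UNIV_bool)
qed

lemma config_cong:
  assumes "\<And>s. i s \<le> n \<Longrightarrow> i' s = i s" "\<And>s. n < i s \<Longrightarrow> n < i' s"
    "\<And>s k. i s \<le> k \<Longrightarrow> k \<le> n \<Longrightarrow> v s k = v' s k"
  shows "config n i v = config n i' v'"
proof -
  have eq: "(i s \<le> k \<and> k \<le> n) \<longleftrightarrow> (i' s \<le> k \<and> k \<le> n)" for s k
    using assms(1)[of s] assms(2)[of s] by (cases "i s \<le> n") auto
  have "(s, c, e) \<in> config n i v \<longleftrightarrow> (s, c, e) \<in> config n i' v'" for s c e
    unfolding in_cfg using eq[of s] assms(3)[of s] by metis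
  then show ?thesis by auto
qed

text \<open>Inserting a coordinate of value \<open>c\<close> into a decreasing suffix: it takes the place of the last
  row of larger value, which becomes a free coordinate.\<close>

lemma config_insert:
  assumes d: "descending n i v" and i: "2 \<le> i s"
  obtains k where "i s - 1 \<le> k" "k \<le> n" "i s \<le> k \<Longrightarrow> c < v s k"
    "\<And>k'. k < k' \<Longrightarrow> i s \<le> k' \<Longrightarrow> k' \<le> n \<Longrightarrow> v s k' \<le> c"
    "(s, c, n - k) \<notin> config n i v"
    "config n (i(s := min (i s) k)) (v(s := (v s)(k := c))) \<subseteq> insert (s, c, n - k) (config n i v)"
    "descending n (i(s := min (i s) k)) (v(s := (v s)(k := c)))"
proof -
  \<comment> \<open>The index \<open>i s - 1\<close> stands for the case that no row exceeds c; the
    suffix then grows by a new first row instead of having one replaced.\<close>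
  define A where "A = insert (i s - 1) {k \<in> {i s..n}. c < v s k}"
  define k where "k = Max A"
  have A: "finite A" "A \<noteq> {}" by (auto simp: A_def)
  have kA: "k \<in> A" unfolding k_def using A by (rule Max_in)
  have kmax: "k' \<le> k" if "k' \<in> A" for k' unfolding k_def using A that by simp
  have in1: "i s \<le> n + 1" using d by (simp add: descending_def)
  have 1: "i s - 1 \<le> k" using kmax by (simp add: A_def)
  have 2: "k \<le> n" using kA in1 i by (auto simp: A_def)
  have 3: "c < v s k" if "i s \<le> k" using kA that i by (auto simp: A_def)
  have 4: "v s k' \<le> c" if "k < k'" "i s \<le> k'" "k' \<le> n" for k'
    using kmax[of k'] that by (fastforce simp: A_def not_less)
  have 5: "(s, c, n - k) \<notin> config n i v"
  proof
    assume "(s, c, n - k) \<in> config n i v"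
    then obtain k' where k': "i s \<le> k'" "k' \<le> n" "c = v s k'" "n - k = n - k'" by (auto simp: in_cfg)
    then have "k' = k" using 2 by simp
    then show False using 3 k' by auto
  qed
  have min: "min (i s) k \<le> k' \<longleftrightarrow> k' = k \<or> i s \<le> k'" for k'
    using 1 by auto
  have 6: "config n (i(s := min (i s) k)) (v(s := (v s)(k := c))) \<subseteq> insert (s, c, n - k) (config n i v)"
  proof
    fix x assume x: "x \<in> config n (i(s := min (i s) k)) (v(s := (v s)(k := c)))"
    obtain s' c' e where xe: "x = (s', c', e)" by (cases x)
    show "x \<in> insert (s, c, n - k) (config n i v)"
      using x unfolding xe in_cfg insert_iff using min by (cases "s' = s") (auto split: if_splits)
  qed
  have 7: "descending n (i(s := min (i s) k)) (v(s := (v s)(k := c)))"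
    unfolding descending_def
  proof (intro allI conjI impI)
    fix s'
    show "1 \<le> (i(s := min (i s) k)) s'" using d 1 i by (auto simp: descending_def)
    show "(i(s := min (i s) k)) s' \<le> n + 1" using d 2 by (auto simp: descending_def)
    fix k1 k2
    assume k12: "(i(s := min (i s) k)) s' \<le> k1" "k1 \<le> k2" "k2 \<le> n"
    show "(v(s := (v s)(k := c))) s' k2 \<le> (v(s := (v s)(k := c))) s' k1"
    proof (cases "s' = s")
      case False
      then show ?thesis using d k12 by (auto simp: descending_def)
    next
      case True
      have mono: "v s b \<le> v s a" if "i s \<le> a" "a \<le> b" "b \<le> n" for a b using d that
        by (auto simp: descending_def)
      have k12': "min (i s) k \<le> k1" "min (i s) k \<le> k2" using k12 True by auto
      have k1: "k1 = k \<or> i s \<le> k1" "k2 = k \<or> i s \<le> k2" using k12' min by blast+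
      consider "k1 = k" "k2 = k" | "k1 = k" "k2 \<noteq> k" | "k1 \<noteq> k" "k2 = k" | "k1 \<noteq> k" "k2 \<noteq> k"
        by blast
      then show ?thesis
      proof cases
        case 2
        then have "k < k2" "i s \<le> k2" using k12(2) k1(2) by simp_all
        then have "v s k2 \<le> c"
          using \<open>\<And>k'. k < k' \<Longrightarrow> i s \<le> k' \<Longrightarrow> k' \<le> n \<Longrightarrow> v s k' \<le> c\<close> k12
          by blast
        then show ?thesis using True 2 by auto
      next
        case 3
        then have "i s \<le> k1" "k1 < k" using k1(1) k12(2) by simp_all
        moreover from this have "c < v s k" using \<open>i s \<le> k \<Longrightarrow> c < v s k\<close> by simp
        moreover have "v s k \<le> v s k1" using mono[of k1 k] \<open>k \<le> n\<close> calculation by simp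
        ultimately show ?thesis using True 3 by auto
      next
        case 4
        then have "i s \<le> k1" using k1 by simp
        then show ?thesis using True mono[of k1 k2] k12(2,3) 4 by simp
      qed (use True in auto)
    qed
  qed
  show ?thesis by (rule that[of k]) (use 1 2 3 4 5 6 7 in auto)
qed

text \<open>\<open>\<beta> True\<close> and \<open>\<beta> False\<close> are the parameters \<open>a\<close> and \<open>b\<close> of the interpolation functions.\<close>

locale lattice = nome +
  fixes \<beta> :: "bool \<Rightarrow> complex" and q t :: complex and N :: nat
  assumes q_nz [simp]: "q \<noteq> 0" and t_nz [simp]: "t \<noteq> 0" and \<beta>_nz [simp]: "\<beta> s \<noteq> 0"
    and gen_qt: "\<bar>i\<bar> \<le> int N \<Longrightarrow> \<bar>j\<bar> \<le> int N \<Longrightarrow> (i, j) \<noteq> (0, 0) \<Longrightarrow> theta (q powi i * t powi j) p \<noteq> 0"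
    and gen_mult: "\<bar>i\<bar> \<le> int N \<Longrightarrow> \<bar>j\<bar> \<le> int N \<Longrightarrow> theta (\<beta> s * \<beta> s' * q powi i * t powi j) p \<noteq> 0"
    and gen_div: "\<bar>i\<bar> \<le> int N \<Longrightarrow> \<bar>j\<bar> \<le> int N \<Longrightarrow> theta (\<beta> True / \<beta> False * q powi i * t powi j) p \<noteq> 0"
begin

abbreviation lt :: "tag \<Rightarrow> complex" where "lt \<equiv> lat \<beta> q t"

lemma gen_div': "\<bar>i\<bar> \<le> int N \<Longrightarrow> \<bar>j\<bar> \<le> int N \<Longrightarrow> s \<noteq> s' \<Longrightarrow> th (\<beta> s / \<beta> s' * q powi i * t powi j) \<noteq> 0"
proof (cases s)
  case True
  then show "\<bar>i\<bar> \<le> int N \<Longrightarrow> \<bar>j\<bar> \<le> int N \<Longrightarrow> s \<noteq> s' \<Longrightarrow> th (\<beta> s / \<beta> s' * q powi i * t powi j) \<noteq> 0"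
    using gen_div by (cases s') auto
next
  case False
  assume a: "\<bar>i\<bar> \<le> int N" "\<bar>j\<bar> \<le> int N" "s \<noteq> s'"
  have "\<beta> s / \<beta> s' * q powi i * t powi j = 1 / (\<beta> s' / \<beta> s * q powi (- i) * t powi (- j))"
    by (simp add: power_int_minus divide_simps)
  moreover have "th (\<beta> s' / \<beta> s * q powi (- i) * t powi (- j)) \<noteq> 0"
    using gen_div[of "- i" "- j"] a False by (cases s') auto
  ultimately show "th (\<beta> s / \<beta> s' * q powi i * t powi j) \<noteq> 0" by (metis theta_inv_0)
qed

lemma lat_nz [simp]: "lt x \<noteq> 0"
  by (cases x) (simp add: lat_def)

lemma lat_mult: "lt (s, c, k) * lt (s', c', k') = \<beta> s * \<beta> s' * q powi (int c + int c') * t powi (int k + int k')"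
  by (simp add: lat_def power_int_add mult_ac)

lemma lat_div: "lt (s, c, k) / lt (s', c', k') = \<beta> s / \<beta> s' * q powi (int c - int c') * t powi (int k - int k')"
  by (simp add: lat_def power_int_diff field_simps)

text \<open>Half of N, because products and quotients of two coordinates add or subtract
  exponents.\<close>

definition in_range :: "tag \<Rightarrow> bool" where
  "in_range = (\<lambda>(s, c, k). 2 * c \<le> N \<and> 2 * k \<le> N)"

lemma lat_mult_nz: "in_range x \<Longrightarrow> in_range y \<Longrightarrow> th (lt x * lt y) \<noteq> 0"
proof (cases x; cases y)
  fix s c k s' c' k'
  assume a: "in_range x" "in_range y" "x = (s, c, k)" "y = (s', c', k')"
  then have "\<bar>int c + int c'\<bar> \<le> int N" "\<bar>int k + int k'\<bar> \<le> int N"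
    by (auto simp: in_range_def)
  then show "th (lt x * lt y) \<noteq> 0" unfolding a(3,4) lat_mult by (rule gen_mult)
qed

lemma lat_div_nz: "in_range x \<Longrightarrow> in_range y \<Longrightarrow> x \<noteq> y \<Longrightarrow> th (lt x / lt y) \<noteq> 0"
proof (cases x; cases y)
  fix s c k s' c' k'
  assume a: "in_range x" "in_range y" "x \<noteq> y" "x = (s, c, k)" "y = (s', c', k')"
  then have b: "\<bar>int c - int c'\<bar> \<le> int N" "\<bar>int k - int k'\<bar> \<le> int N"
    by (auto simp: in_range_def)
  show "th (lt x / lt y) \<noteq> 0"
  proof (cases "s = s'")
    case True
    then have "(int c - int c', int k - int k') \<noteq> (0, 0)" using a by auto
    then show ?thesis using gen_qt[OF b] unfolding a lat_div True by simp
  next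
    case False
    show ?thesis unfolding a lat_div by (rule gen_div'[OF b False])
  qed
qed

lemma lat_inequiv: "in_range x \<Longrightarrow> in_range y \<Longrightarrow> x \<noteq> y \<Longrightarrow> inequiv (lt x) (lt y)"
  by (simp add: inequiv_def lat_mult_nz lat_div_nz)

lemma good_lat:
  assumes "finite C" "\<And>x. x \<in> C \<Longrightarrow> in_range x"
  shows "good (ev lt C)"
  using assms
proof (induction C rule: finite_induct)
  case (insert x C)
  have "inequiv (lt x) z" if z: "z \<in># ev lt C" for z
  proof -
    obtain y where "y \<in> C" "z = lt y" using in_ev[OF insert.hyps(1), of z lt] z by blast
    then show ?thesis using insert.hyps(2) insert.prems by (metis insertCI lat_inequiv)
  qed
  then show ?case
    using insert lat_mult_nz[of x x] by (auto simp: ev_insert good_add power2_eq_square)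
qed auto

text \<open>The common scheme of the vanishing arguments. Inserting the values c < \<alpha> s on the
  two sides yields at least m + 1 further coordinates, so \<open>vanishes_step\<close> reduces the
  claim to the configurations after insertion; these are smaller members of Q or vanish for another
  reason. The descent ends at full configurations, where f is known.\<close>

lemma vanishes_moves:
  assumes f: "generic_theta n m f" and KN: "2 * K \<le> N" "n \<le> K"
    and Q1: "\<And>i v. Q i v \<Longrightarrow> descending n i v \<and> i True + i False \<ge> n + 2"
    and QK: "\<And>i v s k. Q i v \<Longrightarrow> i s \<le> k \<Longrightarrow> k \<le> n \<Longrightarrow> v s k \<le> K"
    and full: "\<And>i v. Q i v \<Longrightarrow> i True + i False = n + 2 \<Longrightarrow> f (ev lt (config n i v)) = 0"
    and move: "\<And>i v. Q i v \<Longrightarrow> i True + i False > n + 2 \<Longrightarrow>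
      \<exists>\<alpha>. \<alpha> True + \<alpha> False \<ge> m + 1 \<and> (\<forall>s. \<alpha> s \<le> K + 1) \<and>
       (\<forall>s c k i' v'. c < \<alpha> s \<longrightarrow> i s - 1 \<le> k \<longrightarrow> k \<le> n \<longrightarrow> (i s \<le> k \<longrightarrow> c < v s k) \<longrightarrow>
          (\<forall>k'. k < k' \<longrightarrow> i s \<le> k' \<longrightarrow> k' \<le> n \<longrightarrow> v s k' \<le> c) \<longrightarrow>
          i' = i(s := min (i s) k) \<longrightarrow> v' = v(s := (v s)(k := c)) \<longrightarrow> descending n i' v' \<longrightarrow>
          Q i' v' \<or> vanishes n f lt (config n i' v'))"
    and Q: "Q i v"
  shows "vanishes n f lt (config n i v)"
  using Q
proof (induction "(i True + i False) * (K + 1) + (\<Sum>s\<in>UNIV. sum (v s) {i s..n})" arbitrary: i v rule: less_induct)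
  case less
  note Q = less.prems
  have d: "descending n i v" and ge: "i True + i False \<ge> n + 2" using Q1[OF Q] by auto
  have ib: "1 \<le> i s" "i s \<le> n + 1" for s using d by (auto simp: descending_def)
  have cd: "card (config n i v) = 2 * n + 2 - (i True + i False)"
    using ib[of True] ib[of False] by (simp add: card_cfg)
  show ?case
  proof (cases "i True + i False = n + 2")
    case True
    show ?thesis by (rule vanishes_full) (use full[OF Q True] cd True in auto)
  next
    case False
    then have cross_factor: "i True + i False > n + 2" using ge by simp
    obtain \<alpha> where \<alpha>: "\<alpha> True + \<alpha> False \<ge> m + 1" "\<And>s. \<alpha> s \<le> K + 1"
      and mv: "\<And>s c k. c < \<alpha> s \<Longrightarrow> i s - 1 \<le> k \<Longrightarrow> k \<le> n \<Longrightarrow> (i s \<le> k \<longrightarrow> c < v s k) \<Longrightarrow>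
          (\<forall>k'. k < k' \<longrightarrow> i s \<le> k' \<longrightarrow> k' \<le> n \<longrightarrow> v s k' \<le> c) \<Longrightarrow>
          descending n (i(s := min (i s) k)) (v(s := (v s)(k := c))) \<Longrightarrow>
          Q (i(s := min (i s) k)) (v(s := (v s)(k := c))) \<or> vanishes n f lt (config n (i(s := min (i s) k)) (v(s := (v s)(k := c))))"
      using move[OF Q cross_factor] by metis
    have i2: "2 \<le> i s" for s using cross_factor ib[of True] ib[of False] by (cases s) auto
    have "\<exists>k. k \<le> n \<and> (s, c, n - k) \<notin> config n i v \<and> vanishes n f lt (insert (s, c, n - k) (config n i v))"
      if c: "c < \<alpha> s" for s c
    proof -
      obtain k where k: "i s - 1 \<le> k" "k \<le> n" "i s \<le> k \<Longrightarrow> c < v s k"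
        "\<And>k'. k < k' \<Longrightarrow> i s \<le> k' \<Longrightarrow> k' \<le> n \<Longrightarrow> v s k' \<le> c"
        "(s, c, n - k) \<notin> config n i v"
        "config n (i(s := min (i s) k)) (v(s := (v s)(k := c))) \<subseteq> insert (s, c, n - k) (config n i v)"
        "descending n (i(s := min (i s) k)) (v(s := (v s)(k := c)))"
        using config_insert[OF d i2] by blast
      let ?i = "i(s := min (i s) k)" and ?v = "v(s := (v s)(k := c))"
      have "vanishes n f lt (config n ?i ?v)"
      proof (cases "Q ?i ?v")
        case True
        show ?thesis
        proof (rule less.hyps[OF _ True])
          have other: "sum (?v (\<not> s)) {?i (\<not> s)..n} = sum (v (\<not> s)) {i (\<not> s)..n}" by simp
          have UNIVs: "(\<Sum>s\<in>UNIV. g s) = g s + g (\<not> s)" for g :: "bool \<Rightarrow> nat"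
            by (cases s) (auto simp: UNIV_bool)
          have isum: "j True + j False = j s + j (\<not> s)" for j :: "bool \<Rightarrow> nat"
            by (cases s) auto
          \<comment> \<open>An insertion either lowers one row or opens a new one. In the second
            case a start index drops by one, which outweighs the new value because that is at most
            K.\<close>
          show "(?i True + ?i False) * (K + 1) + (\<Sum>s\<in>UNIV. sum (?v s) {?i s..n})
             < (i True + i False) * (K + 1) + (\<Sum>s\<in>UNIV. sum (v s) {i s..n})"
          proof (cases "i s \<le> k")
            case True
            have "sum (?v s) {i s..n} < sum (v s) {i s..n}"
              by (rule sum_strict_mono_ex1) (use k True in auto)
            then show ?thesis using True unfolding UNIVs isum by (simp add: min_def)
          next
            case False
            then have kk: "k = i s - 1" using k(1) by simp
            have "{k..n} = insert k {i s..n}" using kk i2[of s] ib[of s] by auto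
            then have "sum (?v s) {?i s..n} = c + sum (?v s) {i s..n}"
              using False kk by (simp add: min_def)
            also have "sum (?v s) {i s..n} = sum (v s) {i s..n}"
              by (rule sum.cong) (use False in auto)
            finally have "sum (?v s) {?i s..n} = c + sum (v s) {i s..n}" .
            moreover have "c < K + 1" using c \<alpha>(2)[of s] by simp
            moreover have "(i s + i (\<not> s)) * (K + 1) = (?i s + ?i (\<not> s)) * (K + 1) + (K + 1)"
            proof -
              have "i s = Suc k" using kk i2[of s] by simp
              then show ?thesis by (simp add: algebra_simps)
            qed
            ultimately show ?thesis unfolding UNIVs isum by simp
          qed
        qed
      next
        case False
        then show ?thesis using mv[OF c k(1,2) _ _ k(7)] k by blast
      qed
      then have "vanishes n f lt (insert (s, c, n - k) (config n i v))"
        by (rule vanishes_mono) (use k in auto)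
      then show ?thesis using k by blast
    qed
    then have "\<forall>x. \<exists>k. snd x < \<alpha> (fst x) \<longrightarrow> k \<le> n \<and> (fst x, snd x, n - k) \<notin> config n i v \<and>
       vanishes n f lt (insert (fst x, snd x, n - k) (config n i v))" by blast
    from choice[OF this] obtain \<kappa>' where \<kappa>': "\<forall>x. snd x < \<alpha> (fst x) \<longrightarrow> \<kappa>' x \<le> n \<and>
       (fst x, snd x, n - \<kappa>' x) \<notin> config n i v \<and>
       vanishes n f lt (insert (fst x, snd x, n - \<kappa>' x) (config n i v))" by blast
    define \<kappa> where "\<kappa> = curry \<kappa>'"
    have \<kappa>: "\<kappa> s c \<le> n \<and> (s, c, n - \<kappa> s c) \<notin> config n i v \<and>
       vanishes n f lt (insert (s, c, n - \<kappa> s c) (config n i v))" if "c < \<alpha> s" for s c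
      using \<kappa>'[rule_format, of "(s, c)"] that by (simp add: \<kappa>_def)
    \<comment> \<open>One inserted coordinate for each pair of a side s and a value c < \<alpha> s.
      Different pairs give different tags, whatever rows they fall into.\<close>
    define Y where "Y = (\<lambda>(s, c). (s, c, n - \<kappa> s c)) ` (SIGMA s:UNIV. {..<\<alpha> s})"
    have cardY: "card Y = \<alpha> True + \<alpha> False"
    proof -
      have "card Y = card (SIGMA s:(UNIV::bool set). {..<\<alpha> s})"
        unfolding Y_def by (rule card_image) (auto simp: inj_on_def)
      also have "\<dots> = (\<Sum>s\<in>UNIV. card {..<\<alpha> s})" by (rule card_SigmaI) auto
      finally show ?thesis by (simp add: UNIV_bool)
    qed
    show ?thesis
    proof (rule vanishes_step[OF f])
      show "finite (config n i v)" "finite Y" by (auto simp: Y_def)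
      show "card (config n i v) < n" using cd cross_factor ib[of True] ib[of False] by auto
      show "config n i v \<inter> Y = {}" using \<kappa> by (auto simp: Y_def)
      show "m + 1 \<le> card Y" using cardY \<alpha> by simp
      show "vanishes n f lt (insert y (config n i v))" if "y \<in> Y" for y
        using that \<kappa> by (auto simp: Y_def)
      show "good (ev lt (config n i v \<union> Y))"
      proof (rule good_lat)
        fix x assume x: "x \<in> config n i v \<union> Y"
        obtain s c k where xe: "x = (s, c, k)" by (cases x)
        have "c \<le> K \<and> k \<le> n"
        proof (cases "x \<in> Y")
          case True
          then have "c < \<alpha> s" "k \<le> n" by (auto simp: Y_def xe)
          then show ?thesis using \<alpha>(2)[of s] by auto
        next
          case False
          then show ?thesis using x QK[OF Q] by (auto simp: xe in_cfg)
        qed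
        then show "in_range x" using KN by (simp add: in_range_def xe)
      qed (auto simp: Y_def)
    qed
  qed
qed

end

section \<open>Functions vanishing off one partition\<close>

text \<open>Both sides of a configuration are indexed from the last row: the side \<open>True\<close> carries the
  coordinates \<open>a q\<^bsup>\<mu>\<^sub>k\<^esup> t\<^bsup>n - k\<^esup>\<close>, the side \<open>False\<close> the coordinates \<open>b q\<^bsup>m - \<mu>\<^sub>k\<^esup> t\<^bsup>k - 1\<^esup>\<close> with
  \<open>k\<close> replaced by \<open>n + 1 - k\<close>, so that \<open>\<mu>\<close> appears there as its complement in the rectangle.
  A vanishing point of the interpolation function is \<open>lower\<close> or \<open>upper\<close> according to the sign of
  \<open>\<mu>\<^sub>k - \<lambda>\<^sub>k\<close> at the largest \<open>k\<close> where it is not zero.\<close>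

definition lams :: "nat \<Rightarrow> nat \<Rightarrow> (nat \<Rightarrow> nat) \<Rightarrow> bool \<Rightarrow> nat \<Rightarrow> nat" where
  "lams m n lam s = (if s then lam else rect_compl m n lam)"

definition lower :: "nat \<Rightarrow> nat \<Rightarrow> (nat \<Rightarrow> nat) \<Rightarrow> (bool \<Rightarrow> nat) \<Rightarrow> (bool \<Rightarrow> nat \<Rightarrow> nat) \<Rightarrow> bool" where
  "lower m n lam i v \<longleftrightarrow> i True \<le> n \<and> v True (i True) < m \<and> (\<forall>k. i False \<le> k \<longrightarrow> k \<le> n \<longrightarrow> v False k = 0) \<and>
     (\<exists>l. i True \<le> l \<and> l \<le> n \<and> v True l < lam l \<and> (\<forall>k. l < k \<longrightarrow> k \<le> n \<longrightarrow> v True k = lam k))"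

definition upper :: "nat \<Rightarrow> nat \<Rightarrow> (nat \<Rightarrow> nat) \<Rightarrow> (bool \<Rightarrow> nat) \<Rightarrow> (bool \<Rightarrow> nat \<Rightarrow> nat) \<Rightarrow> bool" where
  "upper m n lam i v \<longleftrightarrow> i False \<le> n \<and> (\<forall>k. i True \<le> k \<longrightarrow> k \<le> n \<longrightarrow> v True k = lam k) \<and>
     v False (i False) < m - lam (n + 1 - i False)"

definition suf :: "nat \<Rightarrow> bool \<Rightarrow> nat \<Rightarrow> (nat \<Rightarrow> nat) \<Rightarrow> tag set" where
  "suf n s k \<nu> = config n (\<lambda>s'. if s' = s then k else n + 1) (\<lambda>s'. \<nu>)"

lemma in_suf: "(s', c, e) \<in> suf n s i v \<longleftrightarrow> s' = s \<and> (\<exists>k. i \<le> k \<and> k \<le> n \<and> c = v k \<and> e = n - k)"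
  by (auto simp: suf_def in_cfg split: if_splits)

lemma finite_suf [simp]: "finite (suf n s i v)"
  by (simp add: suf_def)

lemma card_suf: "card (suf n s i v) = n + 1 - i"
  by (cases s) (simp_all add: suf_def card_cfg)

lemma suf_subset_cfg:
  assumes "i s \<le> k" "\<And>j. k \<le> j \<Longrightarrow> j \<le> n \<Longrightarrow> v s j = \<nu> j"
  shows "suf n s k \<nu> \<subseteq> config n i v"
proof
  fix x assume x: "x \<in> suf n s k \<nu>"
  obtain s' c e where xe: "x = (s', c, e)" by (cases x)
  obtain j where "s' = s" "k \<le> j" "j \<le> n" "c = \<nu> j" "e = n - j" using x unfolding xe in_suf by blast
  then show "x \<in> config n i v" using assms unfolding xe in_cfg by (intro exI[of _ j]) auto
qed

context lattice
begin

text \<open>The zeros demanded of \<open>P_star\<close>, stated for full configurations instead of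
  vanishing points; \<open>weak_of_vp\<close> connects the two. In this form the condition also
  makes sense for images of the difference operator.\<close>

definition weak :: "nat \<Rightarrow> nat \<Rightarrow> (nat \<Rightarrow> nat) \<Rightarrow> (complex multiset \<Rightarrow> complex) \<Rightarrow> bool" where
  "weak m n lam f \<longleftrightarrow> (\<forall>i v. descending n i v \<longrightarrow> i True + i False = n + 2 \<longrightarrow>
     lower m n lam i v \<or> upper m n lam i v \<longrightarrow> f (ev lt (config n i v)) = 0)"

text \<open>The class \<open>lower\<close> is closed under inserting any of the m values below m on
  the side True and the value 0 on the side False, which makes m + 1 insertions in all.\<close>

lemma lower_van:
  assumes f: "generic_theta n m f" and N: "2 * m \<le> N" "2 * n \<le> N"
    and weak: "weak m n lam f"
    and Q: "descending n i v" "i True + i False \<ge> n + 2" "lower m n lam i v"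
  shows "vanishes n f lt (config n i v)"
proof -
  define K where "K = max m n"
  define Q where "Q = (\<lambda>i v. descending n i v \<and> i True + i False \<ge> n + 2 \<and> lower m n lam i v)"
  show ?thesis
  proof (rule vanishes_moves[OF f, of K Q])
    show "2 * K \<le> N" "n \<le> K" using N by (auto simp: K_def)
    show "descending n i v \<and> n + 2 \<le> i True + i False" if "Q i v" for i v
      using that by (simp add: Q_def)
    show "v s k \<le> K" if "Q i v" "i s \<le> k" "k \<le> n" for i v s k
    proof (cases s)
      case True
      have "v True k \<le> v True (i True)" using that True by (auto simp: Q_def descending_def)
      then show ?thesis using that True by (auto simp: Q_def lower_def K_def)
    qed (use that in \<open>auto simp: Q_def lower_def\<close>)
    show "f (ev lt (config n i v)) = 0" if "Q i v" "i True + i False = n + 2" for i v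
      using that weak by (auto simp: Q_def weak_def)
    show "Q i v" using Q by (simp add: Q_def)
    fix i v assume q: "Q i v" and cross_factor: "i True + i False > n + 2"
    obtain l where l: "i True \<le> l" "l \<le> n" "v True l < lam l" "\<And>k. l < k \<Longrightarrow> k \<le> n \<Longrightarrow> v True k = lam k"
      using q by (auto simp: Q_def lower_def)
    show "\<exists>\<alpha>. \<alpha> True + \<alpha> False \<ge> m + 1 \<and> (\<forall>s. \<alpha> s \<le> K + 1) \<and>
       (\<forall>s c k i' v'. c < \<alpha> s \<longrightarrow> i s - 1 \<le> k \<longrightarrow> k \<le> n \<longrightarrow> (i s \<le> k \<longrightarrow> c < v s k) \<longrightarrow>
          (\<forall>k'. k < k' \<longrightarrow> i s \<le> k' \<longrightarrow> k' \<le> n \<longrightarrow> v s k' \<le> c) \<longrightarrow>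
          i' = i(s := min (i s) k) \<longrightarrow> v' = v(s := (v s)(k := c)) \<longrightarrow> descending n i' v' \<longrightarrow>
          Q i' v' \<or> vanishes n f lt (config n i' v'))"
    proof (intro exI[of _ "\<lambda>s. if s then m else 1"] conjI allI impI disjI1)
      fix s c k i' v'
      assume c: "c < (if s then m else 1)" and k: "i s - 1 \<le> k" "k \<le> n" "i s \<le> k \<longrightarrow> c < v s k"
        and i': "i' = i(s := min (i s) k)" and v': "v' = v(s := (v s)(k := c))" and d: "descending n i' v'"
      have sum: "n + 2 \<le> i' True + i' False" using cross_factor k(1) by (cases s) (auto simp: i')
      have "lower m n lam i' v'"
      proof (cases s)
        case False
        then have "i False - 1 = k" using q k c by (auto simp: Q_def lower_def not_le) 
        then show ?thesis using q False c by (auto simp: Q_def lower_def i' v')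
      next
        case True
        have 1: "i' True \<le> n" using q True k by (auto simp: Q_def lower_def i')
        have 2: "v' True (i' True) < m" using q True k c by (auto simp: Q_def lower_def i' v' min_def)
        \<comment> \<open>After the insertion the last row differing from \<open>lam\<close> is the
          later of l and k; if that is k, the new value is below the old one, which is at most
          \<open>lam k\<close>.\<close>
        have 3: "v' True (max l k) < lam (max l k)"
        proof (cases "k < l")
          case False
          then have "c < v True k" using k l True by auto
          then show ?thesis using False l True k by (cases "k = l") (auto simp: v' max_def)
        qed (use l True in \<open>auto simp: v' max_def\<close>)
        have 4: "v' True j = lam j" if "max l k < j" "j \<le> n" for j
          using that l True by (auto simp: v')
        have 5: "i' True \<le> max l k" using True by (auto simp: i')
        have 6: "v' False j = 0" if "i' False \<le> j" "j \<le> n" for j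
          using q that True by (auto simp: Q_def lower_def i' v')
        show ?thesis unfolding lower_def
          by (intro conjI exI[of _ "max l k"]) (use 1 2 3 4 5 6 l k in auto)
      qed
      then show "Q i' v'" using d sum by (simp add: Q_def)
    qed (auto simp: K_def)
  qed
qed

lemma lower_van_suf:
  assumes f: "generic_theta n m f" and N: "2 * m \<le> N" "2 * n \<le> N"
    and weak: "weak m n lam f"
    and lam: "\<And>k k'. 1 \<le> k \<Longrightarrow> k \<le> k' \<Longrightarrow> k' \<le> n \<Longrightarrow> lam k' \<le> lam k" "\<And>k. 1 \<le> k \<Longrightarrow> lam k \<le> m"
    and k: "1 \<le> k" "k \<le> n" "c < lam k" "\<And>j. k < j \<Longrightarrow> j \<le> n \<Longrightarrow> lam j \<le> c"
  shows "vanishes n f lt (suf n True k (lam(k := c)))"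
proof -
  have "vanishes n f lt (config n (\<lambda>s. if s = True then k else n + 1) (\<lambda>s. if s then lam(k := c) else (\<lambda>_. 0)))"
  proof (rule lower_van[OF f N weak])
    show "descending n (\<lambda>s. if s = True then k else n + 1) (\<lambda>s. if s then lam(k := c) else (\<lambda>_. 0))"
      using lam k by (auto simp: descending_def)
    have "c < m" using k lam(2)[of k] by simp
    then show "lower m n lam (\<lambda>s. if s = True then k else n + 1) (\<lambda>s. if s then lam(k := c) else (\<lambda>_. 0))"
      using k by (auto simp: lower_def intro!: exI[of _ k])
  qed (use k in auto)
  also have "config n (\<lambda>s. if s = True then k else n + 1) (\<lambda>s. if s then lam(k := c) else (\<lambda>_. 0)) = suf n True k (lam(k := c))"
    unfolding suf_def by (rule config_cong) (auto split: if_splits)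
  finally show ?thesis .
qed

text \<open>Row l is set free. With the rows after l equal to \<open>lam\<close>, the side True
  admits the values 0 to \<open>lam l\<close>: the value \<open>lam l\<close> in row l is the
  hypothesis, and every other insertion drops below \<open>lam\<close> and is covered by
  \<open>lower_van_suf\<close>. The side False admits the values below \<open>m - lam l\<close>, and
  a full configuration of this kind is \<open>upper\<close>.\<close>

lemma vanishes_extend:
  assumes f: "generic_theta n m f" and N: "2 * m \<le> N" "2 * n \<le> N"
    and weak: "weak m n lam f"
    and lam: "\<And>k k'. 1 \<le> k \<Longrightarrow> k \<le> k' \<Longrightarrow> k' \<le> n \<Longrightarrow> lam k' \<le> lam k" "\<And>k. 1 \<le> k \<Longrightarrow> lam k \<le> m"
    and l: "1 \<le> l" "l \<le> n" and vanishes: "vanishes n f lt (suf n True l lam)"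
  shows "vanishes n f lt (suf n True (l + 1) lam)"
proof -
  define K where "K = max m n"
  define Q where "Q = (\<lambda>i v. descending n i v \<and> i True + i False \<ge> n + 2 \<and> i True = l + 1 \<and>
    (\<forall>k. l + 1 \<le> k \<longrightarrow> k \<le> n \<longrightarrow> v True k = lam k) \<and> (i False \<le> n \<longrightarrow> v False (i False) < m - lam l))"
  have card: "card (config n i v) \<le> n" if "descending n i v" "i True + i False \<ge> n + 2" for i v
  proof -
    have "i s \<le> n + 1" for s using that by (auto simp: descending_def)
    from this[of True] this[of False] show ?thesis using that by (simp add: card_cfg)
  qed
  have lamm: "lam l \<le> m" using lam l by simp
  have "vanishes n f lt (config n (\<lambda>s'. if s' = True then l + 1 else n + 1) (\<lambda>s'. lam))"
  proof (rule vanishes_moves[OF f, of K Q])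
    show "2 * K \<le> N" "n \<le> K" using N by (auto simp: K_def)
    show "descending n i v \<and> n + 2 \<le> i True + i False" if "Q i v" for i v
      using that by (simp add: Q_def)
    show "v s k \<le> K" if "Q i v" "i s \<le> k" "k \<le> n" for i v s k
    proof (cases s)
      case True
      then show ?thesis using that lam(2)[of k] by (auto simp: Q_def K_def)
    next
      case False
      have "v False k \<le> v False (i False)" using that False by (auto simp: Q_def descending_def)
      then show ?thesis using that False by (auto simp: Q_def K_def)
    qed
    show "f (ev lt (config n i v)) = 0" if "Q i v" "i True + i False = n + 2" for i v
    proof -
      have "n + 1 - i False = l" "i False \<le> n" using that l by (auto simp: Q_def)
      then have "upper m n lam i v" using that by (auto simp: Q_def upper_def)
      then show ?thesis using that weak by (auto simp: Q_def weak_def)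
    qed
    show "Q (\<lambda>s'. if s' = True then l + 1 else n + 1) (\<lambda>s'. lam)"
      using l lam by (auto simp: Q_def descending_def)
    fix i v assume q: "Q i v" and cross_factor: "i True + i False > n + 2"
    show "\<exists>\<alpha>. \<alpha> True + \<alpha> False \<ge> m + 1 \<and> (\<forall>s. \<alpha> s \<le> K + 1) \<and>
       (\<forall>s c k i' v'. c < \<alpha> s \<longrightarrow> i s - 1 \<le> k \<longrightarrow> k \<le> n \<longrightarrow> (i s \<le> k \<longrightarrow> c < v s k) \<longrightarrow>
          (\<forall>k'. k < k' \<longrightarrow> i s \<le> k' \<longrightarrow> k' \<le> n \<longrightarrow> v s k' \<le> c) \<longrightarrow>
          i' = i(s := min (i s) k) \<longrightarrow> v' = v(s := (v s)(k := c)) \<longrightarrow> descending n i' v' \<longrightarrow>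
          Q i' v' \<or> vanishes n f lt (config n i' v'))"
    proof (intro exI[of _ "\<lambda>s. if s then lam l + 1 else m - lam l"] conjI allI impI)
      \<comment> \<open>The two counts add up to m + 1 because the side False carries the complement
        in the rectangle.\<close>
      show "m + 1 \<le> (if True then lam l + 1 else m - lam l) + (if False then lam l + 1 else m - lam l)"
        using lamm by simp
      show "(if s then lam l + 1 else m - lam l) \<le> K + 1" for s
        using lamm by (auto simp: K_def)
      fix s c k i' v'
      assume c: "c < (if s then lam l + 1 else m - lam l)" and k: "i s - 1 \<le> k" "k \<le> n" "i s \<le> k \<longrightarrow> c < v s k"
        and k': "\<forall>k'. k < k' \<longrightarrow> i s \<le> k' \<longrightarrow> k' \<le> n \<longrightarrow> v s k' \<le> c"
        and i': "i' = i(s := min (i s) k)" and v': "v' = v(s := (v s)(k := c))" and d: "descending n i' v'"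
      have sum: "n + 2 \<le> i' True + i' False" using cross_factor k(1) by (cases s) (auto simp: i')
      show "Q i' v' \<or> vanishes n f lt (config n i' v')"
      proof (cases s)
        case False
        have "i' False \<le> n \<longrightarrow> v' False (i' False) < m - lam l"
          using q False k c by (auto simp: Q_def i' v' min_def)
        then have "Q i' v'" using d sum q False by (auto simp: Q_def i' v')
        then show ?thesis ..
      next
        case True
        have kl: "l \<le> k" using q True k by (auto simp: Q_def)
        have i'k: "i' True \<le> k" "v' True j = (lam(k := c)) j" if "k \<le> j" "j \<le> n" for j
          using that q kl True by (auto simp: Q_def i' v')
        have "vanishes n f lt (config n i' v')"
        proof (cases "k = l \<and> c = lam l")
          case T: True
          have "suf n True l lam \<subseteq> config n i' v'"
            by (rule suf_subset_cfg) (use i'k[of k] i'k(2) T k(2) in auto)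
          then show ?thesis by (rule vanishes_mono[OF vanishes]) simp
        next
          case F: False
          have "vanishes n f lt (suf n True k (lam(k := c)))"
          proof (rule lower_van_suf[OF f N weak lam])
            show "c < lam k" using F q c k kl True by (cases "k = l") (auto simp: Q_def)
            show "lam j \<le> c" if "k < j" "j \<le> n" for j
              using k' that q True kl by (auto simp: Q_def)
          qed (use kl l k in auto)
          moreover have "suf n True k (lam(k := c)) \<subseteq> config n i' v'"
            by (rule suf_subset_cfg) (use i'k[of k] i'k(2) k(2) in auto)
          ultimately show ?thesis by (rule vanishes_mono) simp
        qed
        then show ?thesis ..
      qed
    qed
  qed
  then show ?thesis unfolding suf_def .
qed

text \<open>Uniqueness up to a factor: the value at the point of \<open>lam\<close> is the only
  datum left. Starting from it, rows 1 to n are set free in turn until no coordinate is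
  prescribed.\<close>

lemma weak_eq_0:
  assumes f: "generic_theta n m f" and N: "2 * m \<le> N" "2 * n \<le> N" and n: "1 \<le> n"
    and weak: "weak m n lam f"
    and lam: "\<And>k k'. 1 \<le> k \<Longrightarrow> k \<le> k' \<Longrightarrow> k' \<le> n \<Longrightarrow> lam k' \<le> lam k" "\<And>k. 1 \<le> k \<Longrightarrow> lam k \<le> m"
    and f0: "f (ev lt (suf n True 1 lam)) = 0"
    and M: "size M = n" "good M"
  shows "f M = 0"
proof -
  have "vanishes n f lt (suf n True (l + 1) lam)" if "l \<le> n" for l
    using that
  proof (induction l)
    case 0
    show ?case by (rule vanishes_full) (use f0 n in \<open>auto simp: card_suf\<close>)
  next
    case (Suc l)
    then show ?case using vanishes_extend[OF f N weak lam, of "Suc l"] by simp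
  qed
  from this[of n] have "vanishes n f lt (suf n True (n + 1) lam)" by simp
  moreover have "suf n True (n + 1) lam = {}" by (auto simp: suf_def config_def split: if_splits)
  ultimately show ?thesis using M by (simp add: vanishes_def)
qed

text \<open>With all zeros available, one side suffices: all values 0 to m may be inserted, since
  insertion never raises a row and a deficient row stays deficient. The coordinates before row l are
  arbitrary; this admits points of the line, and partitions whose first rows exceed m.\<close>

lemma vanishes_strong:
  assumes f: "generic_theta n m f" and N: "2 * m \<le> N" "2 * n \<le> N"
    and ext: "\<And>\<nu>. (\<And>k k'. 1 \<le> k \<Longrightarrow> k \<le> k' \<Longrightarrow> k' \<le> n \<Longrightarrow> \<nu> k' \<le> \<nu> k) \<Longrightarrow>
       (\<And>k. 1 \<le> k \<Longrightarrow> k \<le> n \<Longrightarrow> \<nu> k \<le> m) \<Longrightarrow> (\<exists>k. 1 \<le> k \<and> k \<le> n \<and> \<nu> k < \<Lambda> k) \<Longrightarrow> f (ev lt (suf n s 1 \<nu>)) = 0"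
    and l: "1 \<le> l" "l \<le> n" and \<nu>: "\<And>k k'. l \<le> k \<Longrightarrow> k \<le> k' \<Longrightarrow> k' \<le> n \<Longrightarrow> \<nu> k' \<le> \<nu> k"
      "\<nu> l \<le> m" "\<nu> l < \<Lambda> l"
  shows "vanishes n f lt (suf n s l \<nu>)"
proof -
  define K where "K = max m n"
  define Q where "Q = (\<lambda>i v. descending n i v \<and> i (\<not> s) = n + 1 \<and> (\<forall>k. i s \<le> k \<longrightarrow> k \<le> n \<longrightarrow> v s k \<le> m) \<and>
    (\<exists>k. i s \<le> k \<and> k \<le> n \<and> v s k < \<Lambda> k))"
  have isum: "j True + j False = j s + j (\<not> s)" for j :: "bool \<Rightarrow> nat"
    by (cases s) auto
  show ?thesis unfolding suf_def
  proof (rule vanishes_moves[OF f, of K Q])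
    show "2 * K \<le> N" "n \<le> K" using N by (auto simp: K_def)
    show "descending n i v \<and> n + 2 \<le> i True + i False" if "Q i v" for i v
      unfolding isum using that by (auto simp: Q_def descending_def)
    show "v s' k \<le> K" if "Q i v" "i s' \<le> k" "k \<le> n" for i v s' k
      using that by (cases "s' = s") (auto simp: Q_def K_def)
    show "f (ev lt (config n i v)) = 0" if "Q i v" "i True + i False = n + 2" for i v
    proof -
      have is1: "i s = 1" using that unfolding isum by (auto simp: Q_def)
      have "config n i v = suf n s 1 (v s)"
        unfolding suf_def
      proof (rule config_cong)
        have isv: "i s' = (if s' = s then 1 else n + 1)" for s'
          using that(1) is1 by (cases "s' = s") (auto simp: Q_def)
        show "(if s' = s then 1 else n + 1) = i s'" for s'
          using isv by auto
        show "n < (if s' = s then 1 else n + 1)" if "n < i s'" for s'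
          using isv[of s'] that by auto
        show "v s' k = v s k" if "i s' \<le> k" "k \<le> n" for s' k
          using isv[of s'] that by (cases "s' = s") auto
      qed
      moreover have "f (ev lt (suf n s 1 (v s))) = 0"
        using that(1) is1 by (intro ext) (auto simp: Q_def descending_def)
      ultimately show ?thesis by simp
    qed
    show "Q (\<lambda>s'. if s' = s then l else n + 1) (\<lambda>s'. \<nu>)"
      using l \<nu> by (auto simp: Q_def descending_def intro: order_trans)
    fix i v assume q: "Q i v" and cross_factor: "i True + i False > n + 2"
    obtain l where l: "i s \<le> l" "l \<le> n" "v s l < \<Lambda> l" using q by (auto simp: Q_def)
    show "\<exists>\<alpha>. \<alpha> True + \<alpha> False \<ge> m + 1 \<and> (\<forall>s. \<alpha> s \<le> K + 1) \<and>
       (\<forall>s c k i' v'. c < \<alpha> s \<longrightarrow> i s - 1 \<le> k \<longrightarrow> k \<le> n \<longrightarrow> (i s \<le> k \<longrightarrow> c < v s k) \<longrightarrow>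
          (\<forall>k'. k < k' \<longrightarrow> i s \<le> k' \<longrightarrow> k' \<le> n \<longrightarrow> v s k' \<le> c) \<longrightarrow>
          i' = i(s := min (i s) k) \<longrightarrow> v' = v(s := (v s)(k := c)) \<longrightarrow> descending n i' v' \<longrightarrow>
          Q i' v' \<or> vanishes n f lt (config n i' v'))"
    proof (intro exI[of _ "\<lambda>s'. if s' = s then m + 1 else 0"] conjI allI impI disjI1)
      fix s' c k i' v'
      assume c: "c < (if s' = s then m + 1 else 0)" and k: "i s' - 1 \<le> k" "k \<le> n" "i s' \<le> k \<longrightarrow> c < v s' k"
        and i': "i' = i(s' := min (i s') k)" and v': "v' = v(s' := (v s')(k := c))" and d: "descending n i' v'"
      have s': "s' = s" using c by (auto split: if_splits)
      have "\<exists>k. i' s \<le> k \<and> k \<le> n \<and> v' s k < \<Lambda> k"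
        using l k s' by (intro exI[of _ l]) (auto simp: i' v')
      moreover have "v' s j \<le> m" if "i' s \<le> j" "j \<le> n" for j
      proof (cases "j = k")
        case True
        then show ?thesis using c s' by (simp add: v')
      next
        case False
        then have "i s \<le> j" using that(1) k(1) s' by (auto simp: i' min_def split: if_splits)
        then show ?thesis using False that q s' by (auto simp: Q_def v')
      qed
      ultimately show "Q i' v'" using d q s' by (auto simp: Q_def i')
    qed (use isum in \<open>auto simp: K_def\<close>)
  qed
qed

end

section \<open>The difference operator\<close>

context nome
begin

definition single_factor :: "(nat \<Rightarrow> complex) \<Rightarrow> complex \<Rightarrow> complex" where
  "single_factor u y = (\<Prod>r<4. th (u r * y)) / th (y\<^sup>2)"

definition cross_factor :: "complex \<Rightarrow> complex \<Rightarrow> complex" where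
  "cross_factor t x = th (t * x) / th x"

text \<open>The sum over all \<open>y\<^sub>i \<in> {x\<^sub>i, 1/x\<^sub>i}\<close> of
  \<open>\<Prod>\<^sub>i single_factor y\<^sub>i \<Prod>\<^sub>i\<^sub>j cross_factor (y\<^sub>i y\<^sub>j) f (s y)\<close>, with \<open>i\<close> less than \<open>j\<close>; \<open>P\<close> collects the choices already made. The members of
  \<open>Z\<close> are further choices whose interactions with the \<open>x\<^sub>i\<close> have been cleared of denominators,
  so that the sum is holomorphic in them.\<close>

fun diff_sum :: "complex \<Rightarrow> complex \<Rightarrow> (nat \<Rightarrow> complex) \<Rightarrow> (complex multiset \<Rightarrow> complex) \<Rightarrow>
    complex multiset \<Rightarrow> complex multiset \<Rightarrow> complex list \<Rightarrow> complex" where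
  "diff_sum s t u f Z P [] = f (image_mset ((*) s) (Z + P))"
| "diff_sum s t u f Z P (x # xs) =
     single_factor u x * (\<Prod>v\<in>#P. cross_factor t (x * v)) * (\<Prod>z\<in>#Z. th (t * z * x) * th (z / x)) * diff_sum s t u f Z (add_mset x P) xs +
     single_factor u (1 / x) * (\<Prod>v\<in>#P. cross_factor t (1 / x * v)) * (\<Prod>z\<in>#Z. th (t * z * (1 / x)) * th (z / (1 / x))) *
       diff_sum s t u f Z (add_mset (1 / x) P) xs"

lemma diff_sum_swap: "diff_sum s t u f Z P (x # y # xs) = diff_sum s t u f Z P (y # x # xs)"
  by (simp add: algebra_simps add_mset_commute[of x] add_mset_commute[of "1 / x"])

lemma diff_sum_move: "diff_sum s t u f Z P (as @ x # bs) = diff_sum s t u f Z P (x # as @ bs)"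
proof (induction as arbitrary: P)
  case (Cons a as)
  have "diff_sum s t u f Z P ((a # as) @ x # bs) = diff_sum s t u f Z P (a # x # as @ bs)"
    using Cons by simp
  then show ?case using diff_sum_swap by simp
qed simp

lemma diff_sum_mset: "mset xs = mset ys \<Longrightarrow> diff_sum s t u f Z P xs = diff_sum s t u f Z P ys"
proof (induction xs arbitrary: ys P)
  case (Cons x xs)
  then have "x \<in> set ys" by (metis list.set_intros(1) set_mset_mset)
  then obtain as bs where ys: "ys = as @ x # bs" by (meson split_list)
  then have "mset xs = mset (as @ bs)" using Cons.prems by simp
  then have "diff_sum s t u f Z P' xs = diff_sum s t u f Z P' (as @ bs)" for P' by (rule Cons.IH)
  then show ?case by (simp add: ys diff_sum_move)
qed simp

text \<open>The choice x brings the denominator \<open>th (w * x)\<close>, the choice 1 / x brings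
  \<open>th (w / x)\<close>. Multiplying by both leaves, for either choice, the numerator and the
  theta factor that was not cancelled.\<close>

lemma diff_sum_clear:
  assumes "w \<noteq> 0" "\<And>x. x \<in> set xs \<Longrightarrow> x \<noteq> 0 \<and> th (w * x) \<noteq> 0 \<and> th (w / x) \<noteq> 0"
  shows "diff_sum s t u f Z (add_mset w P) xs * (\<Prod>x\<leftarrow>xs. th (w * x) * th (w / x)) = diff_sum s t u f (add_mset w Z) P xs"
  using assms
proof (induction xs arbitrary: P)
  case (Cons x xs)
  have x: "x \<noteq> 0" "th (w * x) \<noteq> 0" "th (w / x) \<noteq> 0" using Cons.prems by auto
  have IH: "diff_sum s t u f (add_mset w Z) P' xs = diff_sum s t u f Z (add_mset w P') xs * (\<Prod>x\<leftarrow>xs. th (w * x) * th (w / x))"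
    for P'
    using Cons by simp
  have 1: "cross_factor t (x * w) * (th (w * x) * th (w / x)) = th (t * w * x) * th (w / x)"
    using x by (simp add: cross_factor_def mult_ac)
  have 2: "cross_factor t (1 / x * w) * (th (w * x) * th (w / x)) = th (t * w * (1 / x)) * th (w / (1 / x))"
    using x by (simp add: cross_factor_def mult_ac)
  define a b c d where abcd: "a = cross_factor t (x * w)" "b = cross_factor t (1 / x * w)" "c = th (w * x) * th (w / x)" "d = (\<Prod>x\<leftarrow>xs. th (w * x) * th (w / x))"
  show ?case
    by (simp only: diff_sum.simps IH image_mset_add_mset prod_mset.add_mset list.map prod_list.Cons 1[symmetric] 2[symmetric]
        add_mset_commute[of w] abcd[symmetric]) (simp only: algebra_simps)
qed simp

text \<open>Moving z to p z contributes t z^2 from the two theta factors of each remaining x, for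
  either choice, and the multiplier of f at s z.\<close>

lemma diff_sum_p:
  assumes f: "sym_theta n m f" and nz: "z \<noteq> 0" "s \<noteq> 0" "t \<noteq> 0" "0 \<notin># P" "0 \<notin> set xs"
    and sz: "size P + length xs + 1 = n"
  shows "(t * z\<^sup>2) ^ length xs * (p * (s * z)\<^sup>2) ^ m * diff_sum s t u f {#p * z#} P xs = diff_sum s t u f {#z#} P xs"
  using nz sz
proof (induction xs arbitrary: P)
  case Nil
  have "BC1 m (\<lambda>z. f (add_mset z (image_mset ((*) s) P)))"
  proof -
    have "0 \<notin># image_mset ((*) s) P" "size (image_mset ((*) s) P) + 1 = n" using Nil by auto
    then show ?thesis using f unfolding sym_theta_def by blast
  qed
  from BC1_p[OF this, of "s * z"] show ?case using Nil by (simp add: mult_ac)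
next
  case (Cons x xs)
  have x: "x \<noteq> 0" using Cons.prems by auto
  have IH: "diff_sum s t u f {#z#} P' xs = (t * z\<^sup>2) ^ length xs * (p * (s * z)\<^sup>2) ^ m * diff_sum s t u f {#p * z#} P' xs"
    if "size P' = Suc (size P)" "0 \<notin># P'" for P'
    using Cons.IH[of P'] Cons.prems that by simp
  have 1: "(t * z\<^sup>2) * (th (t * (p * z) * y) * th (p * z / y)) = th (t * z * y) * th (z / y)"
    if "y \<noteq> 0" for y
  proof -
    have "th (t * (p * z) * y) = - th (t * z * y) / (t * z * y)" "th (p * z / y) = - th (z / y) / (z / y)"
      using theta_p[of "t * z * y"] theta_p[of "z / y"] that Cons.prems by (simp_all add: mult_ac)
    then show ?thesis using that Cons.prems by (simp add: power2_eq_square)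
  qed
  have 2: "diff_sum s t u f {#z#} (add_mset x P) xs = (t * z\<^sup>2) ^ length xs * (p * (s * z)\<^sup>2) ^ m * diff_sum s t u f {#p * z#} (add_mset x P) xs"
    "diff_sum s t u f {#z#} (add_mset (1 / x) P) xs = (t * z\<^sup>2) ^ length xs * (p * (s * z)\<^sup>2) ^ m * diff_sum s t u f {#p * z#} (add_mset (1 / x) P) xs"
    by (rule IH; use Cons.prems x in auto)+
  have x': "1 / x \<noteq> 0" using x by simp
  show ?case
    by (simp only: diff_sum.simps 2 image_mset_add_mset image_mset_empty prod_mset.add_mset prod_mset_empty
         mult_1_right 1[OF x, symmetric] 1[OF x', symmetric] list.size power_add power_one_right add_0_right power_Suc power_0)
       (simp only: algebra_simps power_Suc)
qed

lemma diff_sum_holo: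
  assumes f: "sym_theta n m f" and nz: "s \<noteq> 0" "t \<noteq> 0" "0 \<notin># P" "0 \<notin> set xs"
    and sz: "size P + length xs + 1 = n"
  shows "(\<lambda>z. diff_sum s t u f {#z#} P xs) holomorphic_on - {0}"
  using nz sz
proof (induction xs arbitrary: P)
  case Nil
  have B: "BC1 m (\<lambda>z. f (add_mset z (image_mset ((*) s) P)))"
  proof -
    have "0 \<notin># image_mset ((*) s) P" "size (image_mset ((*) s) P) + 1 = n" using Nil by auto
    then show ?thesis using f unfolding sym_theta_def by blast
  qed
  have "((\<lambda>z. f (add_mset z (image_mset ((*) s) P))) \<circ> (\<lambda>z. s * z)) holomorphic_on - {0}"
    by (rule holomorphic_on_compose_gen[OF _ BC1_holo[OF B]])
      (use Nil in \<open>auto intro!: holomorphic_intros\<close>)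
  then show ?case by (simp add: o_def)
next
  case (Cons x xs)
  have x: "x \<noteq> 0" using Cons.prems by auto
  have "(\<lambda>z. diff_sum s t u f {#z#} (add_mset x P) xs) holomorphic_on - {0}"
    "(\<lambda>z. diff_sum s t u f {#z#} (add_mset (1 / x) P) xs) holomorphic_on - {0}"
    by (rule Cons.IH; use Cons.prems x in auto)+
  then show ?case
    by (simp only: diff_sum.simps image_mset_add_mset image_mset_empty prod_mset.add_mset prod_mset_empty mult_1_right)
       (intro holomorphic_intros; use x nz in auto)
qed

text \<open>The cancellation of the apparent pole at a coordinate already present. With v in the
  cleared place, the choice v for the coordinate v carries th 1 = 0, so only 1 / v survives; with 1
  / v in the cleared place only v survives. Both sums then involve the same pair of choices and
  differ by elementary factors.\<close>

lemma diff_sum_residue: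
  assumes v: "v \<noteq> 0" "th (v\<^sup>2) \<noteq> 0"
    and xs: "\<And>x. x \<in> set xs \<Longrightarrow> x \<noteq> 0 \<and> inequiv v x"
  shows "(\<Prod>r<4. th (u r * v)) * diff_sum s t u f {#v#} {#} (v # xs) =
    v ^ (2 * (length xs + 2)) * ((\<Prod>r<4. th (u r * (1 / v))) * diff_sum s t u f {#1 / v#} {#} (v # xs))"
proof -
  define A where "A = diff_sum s t u f {#v#} {#1 / v#} xs"
  define B where "B = diff_sum s t u f {#1 / v#} {#v#} xs"
  define c where "c = (\<Prod>x\<leftarrow>xs. th (v * x) * th (v / x))"
  have ne: "th (v * x) \<noteq> 0" "th (v / x) \<noteq> 0" "th (1 / v * x) \<noteq> 0" "th (1 / v / x) \<noteq> 0" "x \<noteq> 0"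
    if "x \<in> set xs" for x
  proof -
    show 1: "th (v * x) \<noteq> 0" "th (v / x) \<noteq> 0" "x \<noteq> 0" using xs[OF that]
      by (auto simp: inequiv_def)
    have "1 / v * x = 1 / (v / x)" "1 / v / x = 1 / (v * x)" by simp_all
    then show "th (1 / v * x) \<noteq> 0" "th (1 / v / x) \<noteq> 0" using 1 by (metis theta_inv_0)+
  qed
  have c0: "c \<noteq> 0" using ne by (auto simp: c_def prod_list_zero_iff)
  have A1: "A * (\<Prod>x\<leftarrow>xs. th (1 / v * x) * th (1 / v / x)) = diff_sum s t u f {#1 / v, v#} {#} xs"
    unfolding A_def by (rule diff_sum_clear) (use ne v in auto)
  have B1: "B * c = diff_sum s t u f {#v, 1 / v#} {#} xs"
    unfolding B_def c_def by (rule diff_sum_clear) (use ne v in auto)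
  have c1: "v ^ (2 * length xs) * (\<Prod>x\<leftarrow>xs. th (1 / v * x) * th (1 / v / x)) = c"
    unfolding c_def using ne
  proof (induction xs)
    case (Cons x xs)
    have x: "x \<noteq> 0" using Cons by auto
    have e: "1 / v * x = 1 / (v / x)" "1 / v / x = 1 / (v * x)" by simp_all
    have "v\<^sup>2 * (th (1 / v * x) * th (1 / v / x)) = th (v * x) * th (v / x)"
    proof -
      have i: "th (1 / (v / x)) = - th (v / x) / (v / x)" "th (1 / (v * x)) = - th (v * x) / (v * x)"
        by (rule theta_inv; use v x in simp)+
      show ?thesis unfolding e i using v x by (simp add: power2_eq_square)
    qed
    then show ?case using Cons by (simp add: power2_eq_square algebra_simps)
  qed simp
  have "A * c = v ^ (2 * length xs) * (A * (\<Prod>x\<leftarrow>xs. th (1 / v * x) * th (1 / v / x)))"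
    unfolding c1[symmetric] by (simp only: mult_ac)
  also have "\<dots> = v ^ (2 * length xs) * B * c"
    unfolding A1 mult.assoc B1 by (simp only: add_mset_commute)
  finally have "v ^ (2 * length xs) * B * c = A * c" ..
  then have AB: "A = v ^ (2 * length xs) * B" using c0 by simp
  have inv2: "th ((1 / v)\<^sup>2) = - th (v\<^sup>2) / v\<^sup>2"
    using theta_inv[of "v\<^sup>2"] v by (simp add: power_one_over)
  have W1: "single_factor u (1 / v) = - (\<Prod>r<4. th (u r * (1 / v))) * v\<^sup>2 / th (v\<^sup>2)"
    unfolding single_factor_def inv2 by simp
  have "diff_sum s t u f {#v#} {#} (v # xs) = single_factor u (1 / v) * th t * th (v\<^sup>2) * A"
    using v by (simp add: A_def power2_eq_square)
  then have K1: "diff_sum s t u f {#v#} {#} (v # xs) = - (\<Prod>r<4. th (u r * (1 / v))) * v\<^sup>2 * th t * A"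
    unfolding W1 using v by simp
  have "diff_sum s t u f {#1 / v#} {#} (v # xs) = single_factor u v * th t * th ((1 / v)\<^sup>2) * B"
    using v by (simp add: B_def power2_eq_square)
  then have K2: "diff_sum s t u f {#1 / v#} {#} (v # xs) = - (\<Prod>r<4. th (u r * v)) / v\<^sup>2 * th t * B"
    unfolding inv2 single_factor_def using v by simp
  show ?thesis unfolding K1 K2 AB using v by (simp add: power_add power2_eq_square field_simps power4_eq_xxxx)
qed

text \<open>Modulo powers of p, w is its own inverse and equals x or 1 / x, so x would be its own
  inverse as well.\<close>

lemma theta_sq_div:
  assumes x: "x \<noteq> 0" "th (x\<^sup>2) \<noteq> 0" and w: "w \<noteq> 0" "th (w\<^sup>2) = 0" "th (w * x) * th (w / x) = 0"
  shows False
proof -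
  obtain j :: int where j: "w\<^sup>2 = p powi j" using w theta_eq_0_iff[of "w\<^sup>2"] by auto
  obtain k :: int where k: "w * x = p powi k \<or> w / x = p powi k"
    using w x theta_eq_0_iff[of "w * x"] theta_eq_0_iff[of "w / x"] by auto
  note C = this
  have pk: "(p powi k)\<^sup>2 = p powi (2 * k)"
    using power_int_add[of p k k] by (simp add: power2_eq_square)
  from C have "x\<^sup>2 = p powi (2 * k - j) \<or> x\<^sup>2 = p powi (j - 2 * k)"
  proof
    assume "w * x = p powi k"
    then have a: "x = p powi k / w" using w(1) by (metis nonzero_mult_div_cancel_left)
    have "x\<^sup>2 = (p powi k)\<^sup>2 / w\<^sup>2" unfolding a by (rule power_divide)
    then have "x\<^sup>2 = p powi (2 * k - j)" unfolding j pk by (simp add: power_int_diff)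
    then show ?thesis by blast
  next
    assume "w / x = p powi k"
    then have b: "x = w / p powi k" using x(1)
      by (metis nonzero_divide_eq_eq nonzero_mult_div_cancel_left power_int_eq_0_iff p_nz)
    have "x\<^sup>2 = w\<^sup>2 / (p powi k)\<^sup>2" unfolding b by (rule power_divide)
    then have "x\<^sup>2 = p powi (j - 2 * k)" unfolding j pk by (simp add: power_int_diff)
    then show ?thesis by blast
  qed
  then show False using theta_eq_0_iff[of "x\<^sup>2"] x by auto
qed

lemma simple_zeros_list:
  assumes "good (mset xs)"
  shows "simple_zeros (\<lambda>w. \<Prod>x\<leftarrow>xs. th (w * x) * th (w / x))"
  using assms
proof (induction xs)
  case Nil
  then show ?case by (simp add: simple_zeros_const)
next
  case (Cons x xs)
  have x: "x \<noteq> 0" "th (x\<^sup>2) \<noteq> 0" and xs: "\<And>y. y \<in> set xs \<Longrightarrow> y \<noteq> 0 \<and> inequiv x y" and g: "good (mset xs)"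
    using Cons.prems good_nz[of "mset xs"] by (simp_all add: good_add)
  have "simple_zeros (\<lambda>w. (th (w * x) * th (w / x)) * (\<Prod>x\<leftarrow>xs. th (w * x) * th (w / x)))"
  proof (rule simple_zeros_mult[OF simple_zeros_mult Cons.IH[OF g]])
    show "simple_zeros (\<lambda>w. th (w * x))" "simple_zeros (\<lambda>w. th (w / x))"
      using simple_zeros_theta x by auto
    fix w assume w: "w \<noteq> 0" "th (w * x) = 0" "th (w / x) = 0"
    then obtain k l :: int where "w * x = p powi k" "w / x = p powi l"
      using theta_eq_0_iff[of "w * x"] theta_eq_0_iff[of "w / x"] x by auto
    then have "w\<^sup>2 = p powi (k + l)" using x by (simp add: power_int_add power2_eq_square field_simps)
    then have "th (w\<^sup>2) = 0" using theta_eq_0_iff[of "w\<^sup>2"] w by auto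
    then show False using theta_sq_div[OF x w(1)] w by simp
  next
    fix w assume w: "w \<noteq> 0" "th (w * x) * th (w / x) = 0" "(\<Prod>x\<leftarrow>xs. th (w * x) * th (w / x)) = 0"
    then obtain y where y: "y \<in> set xs" "th (w * y) * th (w / y) = 0"
      by (auto simp: prod_list_zero_iff)
    have "th (x * w) = 0 \<or> th (x / w) = 0" "th (y * w) = 0 \<or> th (y / w) = 0"
      using w(2) y(2) by (auto simp: mult.commute theta_div_commute[of w])
    then have "\<not> inequiv x y" using theta_two_zeros[of w x y] w(1) x xs[OF y(1)] by blast
    then show False using xs[OF y(1)] by simp
  qed
  then show ?case by simp
qed

definition diff_op :: "complex \<Rightarrow> complex \<Rightarrow> (nat \<Rightarrow> complex) \<Rightarrow> (complex multiset \<Rightarrow> complex) \<Rightarrow> complex multiset \<Rightarrow> complex" where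
  "diff_op s t u f M = diff_sum s t u f {#} {#} (SOME xs. mset xs = M)"

lemma diff_op_mset: "diff_op s t u f (mset xs) = diff_sum s t u f {#} {#} xs"
  unfolding diff_op_def by (rule diff_sum_mset) (metis (mono_tags, lifting) someI)

text \<open>In one variable z the operator is K(z) / D(z) + K(1/z) / D(1/z), where D collects the
  denominators. As D(1/z) = - D(z) / z^(2n), this is G / D for the numerator \<open>G\<close> below.
  G vanishes at the zeros of D, so the quotient is holomorphic; the balancing condition gives both
  terms the same multiplier, that of degree m.\<close>

lemma diff_op_generic_theta:
  assumes f: "sym_theta n m f" and nz: "s \<noteq> 0" "t \<noteq> 0" "\<And>r. u r \<noteq> 0"
    and bal: "(\<Prod>r<4. u r) * (s\<^sup>2) ^ m * t ^ (n - 1) = p"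
  shows "generic_theta n m (diff_op s t u f)"
  unfolding generic_theta_def
proof (intro allI impI)
  fix M assume M: "size M + 1 = n" "good M"
  obtain xs where xs: "mset xs = M" using ex_mset by blast
  have len: "length xs + 1 = n" using xs M(1) by (metis size_mset)
  have xnz: "x \<noteq> 0" if "x \<in> set xs" for x using good_nz[OF M(2)] that xs by (metis set_mset_mset)
  have gx: "good (mset xs)" using M xs by simp
  define U where "U = (\<lambda>z. \<Prod>r<4. th (u r * z))"
  define K where "K = (\<lambda>z. U z * diff_sum s t u f {#z#} {#} xs)"
  define D where "D = (\<lambda>z. th (z\<^sup>2) * (\<Prod>x\<leftarrow>xs. th (z * x) * th (z / x)))"
  define G where "G = (\<lambda>z. K z - z ^ (2 * n) * K (1 / z))"
  have Kh: "K holomorphic_on - {0}" unfolding K_def U_def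
    by (intro holomorphic_intros diff_sum_holo[OF f]) (use nz xnz len in auto)
  have "(K \<circ> (\<lambda>z. 1 / z)) holomorphic_on - {0}"
    by (rule holomorphic_on_compose_gen[OF _ Kh]) (auto intro!: holomorphic_intros)
  then have Gh: "G holomorphic_on - {0}" unfolding G_def o_def
    by (intro holomorphic_intros Kh) auto
  have D: "simple_zeros D" unfolding D_def
  proof (rule simple_zeros_mult[OF simple_zeros_theta(5)[of 1] simple_zeros_list[OF gx]])
    fix w assume w: "w \<noteq> 0" "th (w\<^sup>2) = 0" "(\<Prod>x\<leftarrow>xs. th (w * x) * th (w / x)) = 0"
    then obtain x where x: "x \<in> set xs" "th (w * x) * th (w / x) = 0" by (auto simp: prod_list_zero_iff)
    have "th (x\<^sup>2) \<noteq> 0" using M(2) x xs by (auto simp: good_def)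
    then show False using theta_sq_div[OF xnz[OF x(1)]] w x by blast
  qed auto
  have Up: "z ^ 4 * (\<Prod>r<4. u r) * U (p * z) = U z" if z: "z \<noteq> 0" for z
  proof -
    have "z ^ 4 * (\<Prod>r<4. u r) * U (p * z) = (\<Prod>r<4. z * u r * th (u r * (p * z)))"
      by (simp add: U_def prod.distrib mult.assoc)
    also have "\<dots> = (\<Prod>r<4. - th (u r * z))"
    proof (rule prod.cong[OF refl])
      fix r
      show "z * u r * th (u r * (p * z)) = - th (u r * z)"
        using theta_p[of "u r * z"] z nz by (simp add: mult_ac)
    qed
    also have "\<dots> = U z" by (simp add: U_def numeral_eq_Suc)
    finally show ?thesis .
  qed
  \<comment> \<open>Four factors come from the \<open>u r\<close>, n - 1 from the cleared
    denominators, and f gives its multiplier at s z; the constants combine to the left side of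
    \<open>bal\<close>.\<close>
  have Kp: "p * z ^ (2 + 2 * n) * (p * z\<^sup>2) ^ m * K (p * z) = K z" if z: "z \<noteq> 0" for z
  proof -
    have 1: "(t * z\<^sup>2) ^ (n - 1) * (p * (s * z)\<^sup>2) ^ m * diff_sum s t u f {#p * z#} {#} xs = diff_sum s t u f {#z#} {#} xs"
      using diff_sum_p[OF f z nz(1,2), of "{#}" xs u] xnz len by (simp add: len[symmetric]) blast
    have n: "2 + 2 * n = 4 + 2 * (n - 1)" using len by simp
    have "K z = z ^ 4 * (\<Prod>r<4. u r) * U (p * z) * ((t * z\<^sup>2) ^ (n - 1) * (p * (s * z)\<^sup>2) ^ m * diff_sum s t u f {#p * z#} {#} xs)"
      unfolding 1 K_def Up[OF z] ..
    also have "\<dots> = ((\<Prod>r<4. u r) * (s\<^sup>2) ^ m * t ^ (n - 1)) * (z ^ 4 * (z\<^sup>2) ^ (n - 1)) * (p * z\<^sup>2) ^ m * K (p * z)"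
      unfolding K_def by (simp add: power_mult_distrib mult_ac)
    also have "z ^ 4 * (z\<^sup>2) ^ (n - 1) = z ^ (2 + 2 * n)"
      unfolding n by (simp only: power_add power_mult)
    finally show ?thesis using bal by simp
  qed
  have Gp: "p * z ^ (2 + 2 * n) * (p * z\<^sup>2) ^ m * G (p * z) = G z" if z: "z \<noteq> 0" for z
  proof -
    define y where "y = 1 / (p * z)"
    have y: "y \<noteq> 0" "p * y = 1 / z" using z by (auto simp: y_def)
    have yz: "y * (p * z) = 1" using z by (simp add: y_def)
    have K2: "K y = p * y ^ (2 + 2 * n) * (p * y\<^sup>2) ^ m * K (1 / z)" using Kp[OF y(1)] y(2) by simp
    have "(p * z\<^sup>2) * (p * y\<^sup>2) = 1" using yz by (simp add: y_def power2_eq_square field_simps z)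
    then have e1: "(p * z\<^sup>2) ^ m * (p * y\<^sup>2) ^ m = 1" by (metis power_mult_distrib power_one)
    have e3: "(p * z) ^ (2 * n) * y ^ (2 * n) = 1" using yz by (metis mult.commute power_mult_distrib power_one)
    have e4: "p * z ^ 2 * (p * y ^ 2) = 1" by fact
    have e2: "p * z ^ (2 + 2 * n) * ((p * z) ^ (2 * n) * (p * y ^ (2 + 2 * n))) = z ^ (2 * n)"
    proof -
      have "p * z ^ (2 + 2 * n) * ((p * z) ^ (2 * n) * (p * y ^ (2 + 2 * n))) =
        z ^ (2 * n) * (p * z ^ 2 * (p * y ^ 2)) * ((p * z) ^ (2 * n) * y ^ (2 * n))"
        by (simp only: power_add mult_ac)
      then show ?thesis unfolding e3 e4 by simp
    qed
    have "p * z ^ (2 + 2 * n) * (p * z\<^sup>2) ^ m * G (p * z) = p * z ^ (2 + 2 * n) * (p * z\<^sup>2) ^ m * K (p * z) -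
      p * z ^ (2 + 2 * n) * (p * z\<^sup>2) ^ m * ((p * z) ^ (2 * n) * K y)"
      unfolding G_def y_def by (simp add: algebra_simps)
    also have "p * z ^ (2 + 2 * n) * (p * z\<^sup>2) ^ m * ((p * z) ^ (2 * n) * K y) =
       (p * z ^ (2 + 2 * n) * ((p * z) ^ (2 * n) * (p * y ^ (2 + 2 * n)))) * ((p * z\<^sup>2) ^ m * (p * y\<^sup>2) ^ m) * K (1 / z)"
      unfolding K2 by (simp add: mult_ac)
    finally show ?thesis unfolding e1 e2 Kp[OF z] G_def by simp
  qed
  have Gi: "z ^ (2 * n) * G (1 / z) = - G z" if z: "z \<noteq> 0" for z
    using z by (simp add: G_def algebra_simps power_one_over)
  have Gpk: "G (p powi k * z) = 0 \<longleftrightarrow> G z = 0" if z: "z \<noteq> 0" for k z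
  proof (induction k rule: int_induct[where k = 0])
    case (step1 i)
    have "G (p powi (i + 1) * z) = 0 \<longleftrightarrow> G (p powi i * z) = 0"
      using Gp[of "p powi i * z"] z by (auto simp: power_int_add mult_ac)
    then show ?case using step1 by simp
  next
    case (step2 i)
    have "G (p powi (i - 1) * z) = 0 \<longleftrightarrow> G (p powi i * z) = 0"
      using Gp[of "p powi (i - 1) * z"] z by (auto simp: power_int_diff mult_ac)
    then show ?case using step2 by simp
  qed simp
  have Gv: "G v = 0" if v: "v \<in> set xs" for v
  proof -
    obtain as bs where ab: "xs = as @ v # bs" using v by (meson split_list)
    have vv: "v \<noteq> 0" "th (v\<^sup>2) \<noteq> 0" "\<And>x. x \<in> set (as @ bs) \<Longrightarrow> x \<noteq> 0 \<and> inequiv v x"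
      using gx xnz unfolding ab by (auto simp: good_add good_union inequiv_sym)
    have "diff_sum s t u f Z {#} xs = diff_sum s t u f Z {#} (v # as @ bs)" for Z by (simp only: ab diff_sum_move)
    moreover have "n = length (as @ bs) + 2" using len ab by simp
    ultimately show ?thesis
      using diff_sum_residue[OF vv(1,2), of "as @ bs" u s t f] vv(3) by (simp add: G_def K_def U_def)
  qed
  have vanishes: "G w = 0" if w: "w \<noteq> 0" "D w = 0" for w
  proof (cases "th (w\<^sup>2) = 0")
    case True
    then obtain k :: int where k: "w\<^sup>2 = p powi k" using theta_eq_0_iff[of "w\<^sup>2"] w by auto
    \<comment> \<open>A shift by p^(-j) reduces the zeros of \<open>th (w\<^sup>2)\<close> to y^2 =
      1 and y^2 = p. There inversion fixes y or maps it to y / p, and the antisymmetry of G under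
      inversion gives zero.\<close>
    define j where "j = k div 2"
    define y where "y = p powi (- j) * w"
    have y: "y \<noteq> 0" using w by (simp add: y_def)
    have "y\<^sup>2 = p powi (k - 2 * j)"
    proof -
      have "(p powi (- j))\<^sup>2 = p powi (- 2 * j)" by (simp add: power2_eq_square flip: power_int_add)
      then show ?thesis by (simp add: y_def power_mult_distrib k flip: power_int_add)
    qed
    moreover have "k - 2 * j = 0 \<or> k - 2 * j = 1" by (auto simp: j_def)
    ultimately consider "y\<^sup>2 = 1" | "y\<^sup>2 = p" by fastforce
    then have "G y = 0"
    proof cases
      case 1
      then have "1 / y = y" using y by (simp add: field_simps power2_eq_square)
      moreover have "y ^ (2 * n) = 1" using 1 by (simp add: power_mult)
      ultimately show ?thesis by (simp add: G_def)
    next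
      case 2
      define x where "x = 1 / y"
      have x: "x \<noteq> 0" "p * x = y" "p * x\<^sup>2 = 1" using 2 y
        by (auto simp: x_def power_divide power2_eq_square field_simps)
      have g1: "x ^ (2 * n) * G y = - G x" using Gi[of x] x(1) by (simp add: x_def)
      have "p * x ^ (2 + 2 * n) * G y = G x"
        using Gp[OF x(1)] x by simp
      then have "(p * x\<^sup>2) * (x ^ (2 * n) * G y) = G x" by (simp only: power_add mult_ac)
      then have "x ^ (2 * n) * G y = G x" unfolding x(3) by simp
      with g1 have "x ^ (2 * n) * G y = 0"
        by (metis add.inverse_neutral eq_neg_iff_add_eq_0 mult_2 mult_eq_0_iff zero_neq_numeral)
      then show ?thesis using x(1) by simp
    qed
    then show ?thesis using Gpk[OF w(1), of "- j"] by (simp add: y_def)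
  next
    case False
    then obtain v where v: "v \<in> set xs" "th (w * v) = 0 \<or> th (w / v) = 0"
      using w by (auto simp: D_def prod_list_zero_iff)
    then obtain k :: int where "w * v = p powi k \<or> w / v = p powi k"
      using theta_eq_0_iff[of "w * v"] theta_eq_0_iff[of "w / v"] w xnz[OF v(1)] by auto
    then have "w = p powi k * (1 / v) \<or> w = p powi k * v" using xnz[OF v(1)] by (auto simp: field_simps)
    moreover have "G (1 / v) = 0" using Gi[OF xnz[OF v(1)]] Gv[OF v(1)] xnz[OF v(1)] by simp
    ultimately show ?thesis using Gpk[of v] Gpk[of "1 / v"] Gv[OF v(1)] xnz[OF v(1)] by auto
  qed
  obtain \<psi> where \<psi>: "\<psi> holomorphic_on - {0}" "\<And>z. z \<noteq> 0 \<Longrightarrow> G z = D z * \<psi> z"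
    using simple_zeros_divide[OF D Gh vanishes] by metis
  have Di: "z ^ (2 * n) * D (1 / z) = - D z" if z: "z \<noteq> 0" for z
  proof -
    have "z ^ (2 * length xs) * (\<Prod>x\<leftarrow>xs. th (1 / z * x) * th (1 / z / x)) = (\<Prod>x\<leftarrow>xs. th (z * x) * th (z / x))"
      using xnz
    proof (induction xs)
      case (Cons x xs)
      have x: "x \<noteq> 0" using Cons by auto
      have e: "1 / z * x = 1 / (z / x)" "1 / z / x = 1 / (z * x)" by simp_all
      have "z\<^sup>2 * (th (1 / z * x) * th (1 / z / x)) = th (z * x) * th (z / x)"
      proof -
        have i: "th (1 / (z / x)) = - th (z / x) / (z / x)" "th (1 / (z * x)) = - th (z * x) / (z * x)"
          by (rule theta_inv; use z x in simp)+
        show ?thesis unfolding e i using z x by (simp add: power2_eq_square)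
      qed
      then show ?case using Cons by (simp add: power2_eq_square algebra_simps)
    qed simp
    moreover have "z\<^sup>2 * th ((1 / z)\<^sup>2) = - th (z\<^sup>2)"
      using theta_inv[of "z\<^sup>2"] z by (simp add: power_one_over)
    moreover have "z ^ (2 * n) = z\<^sup>2 * z ^ (2 * length xs)" unfolding len[symmetric]
      by (simp add: power2_eq_square)
    moreover have "z ^ (2 * n) * D (1 / z) = (z\<^sup>2 * th ((1 / z)\<^sup>2)) *
        (z ^ (2 * length xs) * (\<Prod>x\<leftarrow>xs. th (1 / z * x) * th (1 / z / x)))"
      unfolding D_def calculation(3) by (simp only: mult_ac)
    ultimately show ?thesis unfolding D_def by simp
  qed
  have Dp: "p * z ^ (2 + 2 * n) * D (p * z) = D z" if z: "z \<noteq> 0" for z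
  proof -
    have "z ^ (2 * length xs) * (\<Prod>x\<leftarrow>xs. th (p * z * x) * th (p * z / x)) = (\<Prod>x\<leftarrow>xs. th (z * x) * th (z / x))"
      using xnz
    proof (induction xs)
      case (Cons x xs)
      have x: "x \<noteq> 0" using Cons by auto
      have "z\<^sup>2 * (th (p * z * x) * th (p * z / x)) = th (z * x) * th (z / x)"
      proof -
        have "th (p * z * x) = - th (z * x) / (z * x)" "th (p * z / x) = - th (z / x) / (z / x)"
          using theta_p[of "z * x"] theta_p[of "z / x"] z x by (simp_all add: mult_ac)
        then show ?thesis using z x by (simp add: power2_eq_square)
      qed
      then show ?case using Cons by (simp add: power2_eq_square algebra_simps)
    qed simp
    moreover have "p * z ^ 4 * th ((p * z)\<^sup>2) = th (z\<^sup>2)"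
    proof -
      have "th ((p * z)\<^sup>2) = - th (p * z\<^sup>2) / (p * z\<^sup>2)"
        using theta_p[of "p * z\<^sup>2"] z by (simp add: power2_eq_square mult_ac)
      also have "th (p * z\<^sup>2) = - th (z\<^sup>2) / z\<^sup>2" using theta_p[of "z\<^sup>2"] z by simp
      finally show ?thesis using z by (simp add: power2_eq_square power4_eq_xxxx)
    qed
    moreover have "z ^ (2 + 2 * n) = z ^ 4 * z ^ (2 * length xs)" unfolding len[symmetric]
      by (simp add: power4_eq_xxxx)
    moreover have "p * z ^ (2 + 2 * n) * D (p * z) = (p * z ^ 4 * th ((p * z)\<^sup>2)) *
        (z ^ (2 * length xs) * (\<Prod>x\<leftarrow>xs. th (p * z * x) * th (p * z / x)))"
      unfolding D_def calculation(3) by (simp only: mult_ac)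
    ultimately show ?thesis unfolding D_def by simp
  qed
  have B\<psi>: "BC1 m \<psi>"
    unfolding BC1_def
  proof (intro conjI allI impI)
    show "\<psi> holomorphic_on - {0}" by fact
    fix z :: complex assume z: "z \<noteq> 0"
    have h1: "(\<lambda>z. \<psi> (1 / z)) holomorphic_on - {0}" "(\<lambda>z. \<psi> (p * z)) holomorphic_on - {0}"
    proof -
      have "(\<psi> \<circ> (\<lambda>z. 1 / z)) holomorphic_on - {0}" "(\<psi> \<circ> (\<lambda>z. p * z)) holomorphic_on - {0}"
        by (rule holomorphic_on_compose_gen[OF _ \<psi>(1)]; auto intro!: holomorphic_intros)+
      then show "(\<lambda>z. \<psi> (1 / z)) holomorphic_on - {0}" "(\<lambda>z. \<psi> (p * z)) holomorphic_on - {0}"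
        by (simp_all add: o_def)
    qed
    have "\<psi> (1 / z) - \<psi> z = 0"
    proof (rule simple_zeros_cancel[OF D _ _ z])
      show "(\<lambda>z. \<psi> (1 / z) - \<psi> z) holomorphic_on - {0}"
        by (intro holomorphic_intros h1 \<psi>(1))
      fix w :: complex assume w: "w \<noteq> 0"
      have "w ^ (2 * n) * (D (1 / w) * \<psi> (1 / w)) = - (D w * \<psi> w)"
        using Gi[OF w] \<psi>(2)[of "1 / w"] \<psi>(2)[of w] w by simp
      moreover have "w ^ (2 * n) * (D (1 / w) * \<psi> (1 / w)) = - D w * \<psi> (1 / w)"
        using Di[OF w] by (simp add: mult.assoc[symmetric])
      ultimately have "D w * \<psi> (1 / w) = D w * \<psi> w" by simp
      then show "D w * (\<psi> (1 / w) - \<psi> w) = 0" by (simp only: right_diff_distrib diff_self)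
    qed
    then show "\<psi> (1 / z) = \<psi> z" by simp
    have "(p * z\<^sup>2) ^ m * \<psi> (p * z) - \<psi> z = 0"
    proof (rule simple_zeros_cancel[OF D _ _ z])
      show "(\<lambda>z. (p * z\<^sup>2) ^ m * \<psi> (p * z) - \<psi> z) holomorphic_on - {0}"
        by (intro holomorphic_intros h1 \<psi>(1))
      fix w :: complex assume w: "w \<noteq> 0"
      have "p * w ^ (2 + 2 * n) * (p * w\<^sup>2) ^ m * (D (p * w) * \<psi> (p * w)) = D w * \<psi> w"
        using Gp[OF w] \<psi>(2)[of "p * w"] \<psi>(2)[of w] w by simp
      moreover have "p * w ^ (2 + 2 * n) * (p * w\<^sup>2) ^ m * (D (p * w) * \<psi> (p * w)) =
         (p * w ^ (2 + 2 * n) * D (p * w)) * ((p * w\<^sup>2) ^ m * \<psi> (p * w))"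
        by (simp add: mult_ac)
      ultimately show "D w * ((p * w\<^sup>2) ^ m * \<psi> (p * w) - \<psi> w) = 0"
        unfolding Dp[OF w] by (simp only: right_diff_distrib diff_self)
    qed
    then show "(p * z\<^sup>2) ^ m * \<psi> (p * z) = \<psi> z" by simp
  qed
  have val: "diff_op s t u f (add_mset z M) = \<psi> z" if g: "good (add_mset z M)" for z
  proof -
    have z: "z \<noteq> 0" "th (z\<^sup>2) \<noteq> 0" "\<And>x. x \<in> set xs \<Longrightarrow> inequiv z x"
      using g xs by (auto simp: good_add)
    define d where "d = (\<lambda>w. \<Prod>x\<leftarrow>xs. th (w * x) * th (w / x))"
    have d: "d w \<noteq> 0" "diff_sum s t u f {#} {#w#} xs = diff_sum s t u f {#w#} {#} xs / d w"
      if "w \<noteq> 0" "\<And>x. x \<in> set xs \<Longrightarrow> th (w * x) \<noteq> 0 \<and> th (w / x) \<noteq> 0"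
        for w
    proof -
      show "d w \<noteq> 0" using that by (auto simp: d_def prod_list_zero_iff)
      then show "diff_sum s t u f {#} {#w#} xs = diff_sum s t u f {#w#} {#} xs / d w"
        using diff_sum_clear[of w xs s t u f "{#}" "{#}"] that xnz by (simp add: d_def field_simps)
    qed
    have z1: "th (z * x) \<noteq> 0 \<and> th (z / x) \<noteq> 0" if "x \<in> set xs" for x
      using z(3)[OF that] by (simp add: inequiv_def)
    have z2: "th (1 / z * x) \<noteq> 0 \<and> th (1 / z / x) \<noteq> 0" if "x \<in> set xs" for x
    proof -
      have "1 / z * x = 1 / (z / x)" "1 / z / x = 1 / (z * x)" by simp_all
      then show ?thesis using z1[OF that] by (metis theta_inv_0)
    qed
    have z': "1 / z \<noteq> 0" using z by simp
    have Dz: "D w = th (w\<^sup>2) * d w" for w by (simp add: D_def d_def)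
    have dz: "d z \<noteq> 0" "diff_sum s t u f {#} {#z#} xs = diff_sum s t u f {#z#} {#} xs / d z"
      using d[of z] z(1) z1 by blast+
    have dz': "diff_sum s t u f {#} {#1 / z#} xs = diff_sum s t u f {#1 / z#} {#} xs / d (1 / z)"
      using d(2)[of "1 / z"] z' z2 by blast
    have D0: "D z \<noteq> 0" unfolding Dz using z(2) dz(1) by simp
    have "diff_op s t u f (add_mset z M) = diff_sum s t u f {#} {#} (z # xs)"
      using diff_op_mset[of s t u f "z # xs"] xs by simp
    also have "\<dots> = single_factor u z * diff_sum s t u f {#} {#z#} xs + single_factor u (1 / z) * diff_sum s t u f {#} {#1 / z#} xs"
      by simp
    also have "\<dots> = K z / D z + K (1 / z) / D (1 / z)"
      unfolding dz(2) dz' single_factor_def K_def U_def Dz by simp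
    also have "D (1 / z) = - D z / z ^ (2 * n)" using Di[OF z(1)] z(1) by (simp add: field_simps)
    also have "K z / D z + K (1 / z) / (- D z / z ^ (2 * n)) = G z / D z"
      using z(1) D0 by (simp add: G_def field_simps)
    also have "\<dots> = \<psi> z" using \<psi>(2)[OF z(1)] D0 by simp
    finally show ?thesis .
  qed
  show "\<exists>\<phi>. BC1 m \<phi> \<and> (\<forall>z. good (add_mset z M) \<longrightarrow> diff_op s t u f (add_mset z M) = \<phi> z)"
    using B\<psi> val by blast
qed

section \<open>Expansion of the operator as a sum over sets of inverted coordinates\<close>

fun choice_weight :: "complex \<Rightarrow> (nat \<Rightarrow> complex) \<Rightarrow> complex multiset \<Rightarrow> complex list \<Rightarrow> complex" where
  "choice_weight t u P [] = 1"
| "choice_weight t u P (y # ys) = single_factor u y * (\<Prod>v\<in>#P. cross_factor t (y * v)) * choice_weight t u (add_mset y P) ys"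

lemma choice_weight_nz_iff:
  "choice_weight t u P ys \<noteq> 0 \<longleftrightarrow> (\<forall>y\<in>set ys. single_factor u y \<noteq> 0 \<and> (\<forall>v\<in>#P. cross_factor t (y * v) \<noteq> 0)) \<and>
     sorted_wrt (\<lambda>a b. cross_factor t (a * b) \<noteq> 0) ys"
  by (induction ys arbitrary: P) (auto simp: prod_mset_zero_iff image_iff mult.commute)

text \<open>E is the set of indices at which 1 / X is chosen; summing over indices instead of values
  keeps the choices apart even where values coincide.\<close>

lemma diff_sum_expand:
  assumes "distinct rs"
  shows "diff_sum s t u f {#} P (map X rs) = (\<Sum>E\<in>Pow (set rs).
     choice_weight t u P (map (\<lambda>r. if r \<in> E then 1 / X r else X r) rs) *
     f (image_mset ((*) s) (P + mset (map (\<lambda>r. if r \<in> E then 1 / X r else X r) rs))))"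
  using assms
proof (induction rs arbitrary: P)
  case (Cons r rs)
  let ?y = "\<lambda>E r. if r \<in> E then 1 / X r else X r"
  let ?h = "\<lambda>P rs E. choice_weight t u P (map (?y E) rs) * f (image_mset ((*) s) (P + mset (map (?y E) rs)))"
  have r: "r \<notin> set rs" "distinct rs" using Cons.prems by auto
  have "(\<Sum>E\<in>Pow (set (r # rs)). ?h P (r # rs) E) =
     (\<Sum>E\<in>Pow (set rs). ?h P (r # rs) E) + (\<Sum>E\<in>insert r ` Pow (set rs). ?h P (r # rs) E)"
    unfolding list.set Pow_insert by (rule sum.union_disjoint) (use r in auto)
  also have "(\<Sum>E\<in>insert r ` Pow (set rs). ?h P (r # rs) E) = (\<Sum>E\<in>Pow (set rs). ?h P (r # rs) (insert r E))"
    by (subst sum.reindex) (use r in \<open>auto simp: inj_on_def insert_ident\<close>)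
  also have "(\<Sum>E\<in>Pow (set rs). ?h P (r # rs) E) =
     single_factor u (X r) * (\<Prod>v\<in>#P. cross_factor t (X r * v)) * diff_sum s t u f {#} (add_mset (X r) P) (map X rs)"
    unfolding Cons.IH[OF r(2)] sum_distrib_left
  proof (rule sum.cong[OF refl])
    fix E assume "E \<in> Pow (set rs)"
    then have "r \<notin> E" using r by auto
    then show "?h P (r # rs) E = single_factor u (X r) * (\<Prod>v\<in>#P. cross_factor t (X r * v)) * ?h (add_mset (X r) P) rs E"
      by (simp add: mult_ac)
  qed
  also have "(\<Sum>E\<in>Pow (set rs). ?h P (r # rs) (insert r E)) =
     single_factor u (1 / X r) * (\<Prod>v\<in>#P. cross_factor t (1 / X r * v)) * diff_sum s t u f {#} (add_mset (1 / X r) P) (map X rs)"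
    unfolding Cons.IH[OF r(2)] sum_distrib_left
  proof (rule sum.cong[OF refl])
    fix E assume "E \<in> Pow (set rs)"
    have m: "map (?y (insert r E)) (r # rs) = 1 / X r # map (?y E) rs" using r by auto
    show "?h P (r # rs) (insert r E) = single_factor u (1 / X r) * (\<Prod>v\<in>#P. cross_factor t (1 / X r * v)) * ?h (add_mset (1 / X r) P) rs E"
      unfolding m by (simp add: mult_ac)
  qed
  finally show ?case by simp
qed simp

lemma sym_theta_inv:
  assumes f: "sym_theta n m f" and "0 \<notin># M" "0 \<notin># M'" "size M + size M' = n"
  shows "f (image_mset (\<lambda>x. 1 / x) M + M') = f (M + M')"
  using assms(2-)
proof (induction M arbitrary: M')
  case (add x M)
  have "BC1 m (\<lambda>z. f (add_mset z (M + M')))"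
    using f add.prems by (auto simp: sym_theta_def)
  then have 1: "f (add_mset (1 / x) (M + M')) = f (add_mset x (M + M'))"
    using BC1_inv add.prems by fastforce
  have "f (image_mset (\<lambda>x. 1 / x) M + add_mset (1 / x) M') = f (M + add_mset (1 / x) M')"
    by (rule add.IH) (use add.prems in auto)
  then show ?case using 1 by simp
qed simp

end

section \<open>The difference operator on the lattice\<close>

type_synonym row = "bool \<times> nat"

definition config_rows :: "nat \<Rightarrow> (bool \<Rightarrow> nat) \<Rightarrow> row list" where
  "config_rows n i = map (Pair True) [i True..<n + 1] @ map (Pair False) [i False..<n + 1]"

text \<open>Effect of choosing inverses in the rows E. As \<open>s\<^sup>2 = q\<close>, the number s
  / (\<beta> q^v t^e) is the inverse of s \<beta> q^(v - 1) t^e, so on the lattice of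
  \<open>s * \<beta>\<close> the value of such a row has dropped by one.\<close>

definition dv :: "(bool \<Rightarrow> nat \<Rightarrow> nat) \<Rightarrow> row set \<Rightarrow> bool \<Rightarrow> nat \<Rightarrow> nat" where
  "dv v E = (\<lambda>c k. v c k - (if (c, k) \<in> E then 1 else 0))"

lemma in_cfg_rows: "(c, k) \<in> set (config_rows n i) \<longleftrightarrow> i c \<le> k \<and> k \<le> n"
  by (cases c) (auto simp: config_rows_def)

lemma distinct_cfg_rows: "distinct (config_rows n i)"
  by (auto simp: config_rows_def distinct_map inj_on_def)

lemma dv_empty [simp]: "dv v {} = v"
  by (simp add: dv_def)

lemma dv_le: "dv v E c k \<le> v c k"
  by (simp add: dv_def)

text \<open>The choices that lead to a descending configuration again. The condition
  \<open>1 \<le> v c k\<close> keeps the truncated subtraction in \<open>dv\<close> exact.\<close>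

definition rvalid :: "nat \<Rightarrow> (bool \<Rightarrow> nat) \<Rightarrow> (bool \<Rightarrow> nat \<Rightarrow> nat) \<Rightarrow> row set \<Rightarrow> bool" where
  "rvalid n i v E \<longleftrightarrow> E \<subseteq> set (config_rows n i) \<and> (\<forall>(c, k)\<in>E. 1 \<le> v c k) \<and> descending n i (dv v E)"

context nome
begin

lemma ev_cfg: "ev \<xi> (config n i v) = mset (map (\<lambda>(c, k). \<xi> (c, v c k, n - k)) (config_rows n i))"
proof -
  have S: "set (config_rows n i) = (SIGMA c:UNIV. {i c..n})"
    by (auto simp: in_cfg_rows)
  have "ev \<xi> (config n i v) = image_mset \<xi> (image_mset (\<lambda>(c, k). (c, v c k, n - k)) (mset_set (set (config_rows n i))))"
    unfolding ev_def config_def S by (subst image_mset_mset_set[OF inj_cfg, symmetric]) simp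
  also have "mset_set (set (config_rows n i)) = mset (config_rows n i)"
    by (rule mset_set_set[OF distinct_cfg_rows])
  finally show ?thesis by (simp add: multiset.map_comp o_def case_prod_unfold)
qed

lemma choice_weight_nz_iff_distinct:
  assumes "distinct rs"
  shows "choice_weight t u {#} (map y rs) \<noteq> 0 \<longleftrightarrow> (\<forall>r\<in>set rs. single_factor u (y r) \<noteq> 0) \<and>
     (\<forall>r\<in>set rs. \<forall>r'\<in>set rs. r \<noteq> r' \<longrightarrow> cross_factor t (y r * y r') \<noteq> 0)"
proof -
  have "sorted_wrt (\<lambda>a b. cross_factor t (a * b) \<noteq> 0) (map y rs) \<longleftrightarrow>
     (\<forall>r\<in>set rs. \<forall>r'\<in>set rs. r \<noteq> r' \<longrightarrow> cross_factor t (y r * y r') \<noteq> 0)"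
    using assms by (induction rs) (auto simp: mult.commute)
  then show ?thesis unfolding choice_weight_nz_iff by auto
qed

end

text \<open>The operator reads f on the lattice of \<open>s * \<beta>\<close>, prefix S, and its
  image is evaluated on the lattice of \<beta>.\<close>

locale lattice_shift = lattice p \<beta> q t N + S: lattice p "\<lambda>c. s * \<beta> c" q t N
  for p \<beta> q t N s +
  assumes s2: "s\<^sup>2 = q"
begin

lemma s_nz [simp]: "s \<noteq> 0"
  using s2 q_nz by auto

definition yE :: "nat \<Rightarrow> (bool \<Rightarrow> nat \<Rightarrow> nat) \<Rightarrow> row set \<Rightarrow> row \<Rightarrow> complex" where
  "yE n v E = (\<lambda>(c, k). if (c, k) \<in> E then 1 / lt (c, v c k, n - k) else lt (c, v c k, n - k))"

definition wtE :: "(nat \<Rightarrow> complex) \<Rightarrow> nat \<Rightarrow> (bool \<Rightarrow> nat) \<Rightarrow> (bool \<Rightarrow> nat \<Rightarrow> nat) \<Rightarrow> row set \<Rightarrow> complex" where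
  "wtE u n i v E = choice_weight t u {#} (map (yE n v E) (config_rows n i))"

lemma wtE_nz_iff:
  "wtE u n i v E \<noteq> 0 \<longleftrightarrow> (\<forall>r\<in>set (config_rows n i). single_factor u (yE n v E r) \<noteq> 0) \<and>
     (\<forall>r\<in>set (config_rows n i). \<forall>r'\<in>set (config_rows n i). r \<noteq> r' \<longrightarrow> cross_factor t (yE n v E r * yE n v E r') \<noteq> 0)"
  unfolding wtE_def by (rule choice_weight_nz_iff_distinct[OF distinct_cfg_rows])

lemma diff_op_expand:
  "diff_op s t u f (ev lt (config n i v)) = (\<Sum>E\<in>Pow (set (config_rows n i)).
     wtE u n i v E * f (image_mset ((*) s) (mset (map (yE n v E) (config_rows n i)))))"
proof -
  have e: "(\<lambda>r. if r \<in> E then 1 / (case r of (c, k) \<Rightarrow> lt (c, v c k, n - k)) else (case r of (c, k) \<Rightarrow> lt (c, v c k, n - k))) = yE n v E"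
    for E
    by (auto simp: yE_def)
  show ?thesis
    unfolding ev_cfg diff_op_mset diff_sum_expand[OF distinct_cfg_rows] e wtE_def by simp
qed

text \<open>A choice breaking the monotonicity of \<open>v\<close> has weight zero: two equal consecutive rows
  give the factor \<open>\<theta>(1)\<close>, and so does a row of value zero through \<open>u\<^sub>0 = a\<close> or \<open>u\<^sub>1 = b\<close>.\<close>

lemma wtE_rvalid:
  assumes d: "descending n i v" and u: "u 0 = \<beta> True" "u 1 = \<beta> False"
    and E: "E \<subseteq> set (config_rows n i)" and nz: "wtE u n i v E \<noteq> 0"
  shows "rvalid n i v E"
proof -
  note nz' = nz[unfolded wtE_nz_iff]
  have step_E: "(c, Suc k) \<in> E" if "(c, k) \<in> E" "k < n" "v c (Suc k) = v c k" for c k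
  proof (rule ccontr)
    assume n: "(c, Suc k) \<notin> E"
    have r: "(c, k) \<in> set (config_rows n i)" using E that by blast
    then have r': "(c, Suc k) \<in> set (config_rows n i)" using that by (simp add: in_cfg_rows)
    have "t * (yE n v E (c, k) * yE n v E (c, Suc k)) = 1"
    proof -
      have "n - k = Suc (n - Suc k)" using that by simp
      then show ?thesis using that n by (simp add: yE_def lat_def)
    qed
    then have "cross_factor t (yE n v E (c, k) * yE n v E (c, Suc k)) = 0" by (simp add: cross_factor_def)
    moreover have "(c, k) \<noteq> (c, Suc k)" by simp
    ultimately show False using nz' r r' by blast
  qed
  have last: "0 < v c n" if "(c, n) \<in> E" for c
  proof (rule ccontr)
    assume "\<not> 0 < v c n"
    then have v: "v c n = 0" by simp
    have "yE n v E (c, n) = 1 / \<beta> c" using v that by (simp add: yE_def lat_def)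
    then have "th (u (if c then 0 else 1) * yE n v E (c, n)) = 0" using u by simp
    moreover have "(if c then 0 else 1) \<in> {..<4::nat}" by simp
    ultimately have "(\<Prod>r<4. th (u r * yE n v E (c, n))) = 0"
      by (intro prod_zero) auto
    then have "single_factor u (yE n v E (c, n)) = 0" by (simp add: single_factor_def)
    then show False using nz' E that by blast
  qed
  \<comment> \<open>A row of value zero forces the later rows to be zero, and by
    \<open>step_E\<close> they are all inverted, down to row n, where \<open>u 0\<close> or
    \<open>u 1\<close> kills the weight.\<close>
  have pos: "v c k \<noteq> 0" if cE: "(c, k) \<in> E" for c k
  proof
    assume v: "v c k = 0"
    have k: "i c \<le> k" "k \<le> n" using E that by (auto simp: in_cfg_rows)
    have v0: "v c j = 0" if "k \<le> j" "j \<le> n" for j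
      using d v k that unfolding descending_def by (metis le_zero_eq)
    have "(c, j) \<in> E" if "k \<le> j" "j \<le> n" for j
      using that
    proof (induction j rule: dec_induct)
      case (step j)
      then show ?case using v0 by (intro step_E) auto
    qed (use cE in simp_all)
    then have "(c, n) \<in> E" using k by simp
    then show False using last[of c] v0[of n] k by simp
  qed
  have "descending n i (dv v E)"
    unfolding descending_def
  proof (intro allI conjI impI)
    fix c
    show "1 \<le> i c" "i c \<le> n + 1" using d by (auto simp: descending_def)
    fix k k' assume k: "i c \<le> k" "k \<le> k'" "k' \<le> n"
    show "dv v E c k' \<le> dv v E c k"
      using k(2,3)
    proof (induction k' rule: dec_induct)
      case (step j)
      have "v c (Suc j) \<le> v c j" using d step k by (auto simp: descending_def)
      then have "dv v E c (Suc j) \<le> dv v E c j"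
        using step_E[of c j] step pos[of c "Suc j"]
        by (cases "v c (Suc j) = v c j") (auto simp: dv_def)
      then show ?case using step by simp
    qed simp
  qed
  then show ?thesis using E pos by (fastforce simp: rvalid_def Suc_le_eq)
qed

lemma f_yE:
  assumes f: "sym_theta n m f" and i: "descending n i v" "i True + i False = n + 2" and E: "rvalid n i v E"
  shows "f (image_mset ((*) s) (mset (map (yE n v E) (config_rows n i)))) = f (ev S.lt (config n i (dv v E)))"
proof -
  let ?X = "\<lambda>(c, k). S.lt (c, dv v E c k, n - k)"
  let ?R = "mset (config_rows n i)"
  have y: "s * yE n v E r = (if r \<in> E then 1 / ?X r else ?X r)" if "r \<in> set (config_rows n i)" for r
  proof -
    obtain c k where r: "r = (c, k)" by (cases r)
    show ?thesis
    proof (cases "r \<in> E")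
      case True
      then have "1 \<le> v c k" using E r by (auto simp: rvalid_def)
      then obtain w where w: "v c k = Suc w" by (metis Suc_le_D One_nat_def)
      have "s / q = 1 / s" using s2[symmetric] by (simp add: power2_eq_square)
      then have "s * (1 / (\<beta> c * q ^ Suc w * t ^ (n - k))) = 1 / (s * \<beta> c * q ^ w * t ^ (n - k))"
        by (simp add: field_simps)
      then show ?thesis using True w r by (simp add: yE_def dv_def lat_def)
    next
      case False
      then show ?thesis using r by (simp add: yE_def dv_def lat_def mult_ac)
    qed
  qed
  have split: "?R = filter_mset (\<lambda>r. r \<in> E) ?R + filter_mset (\<lambda>r. r \<notin> E) ?R"
    by (rule multiset_partition)
  have "image_mset ((*) s) (mset (map (yE n v E) (config_rows n i))) = image_mset (\<lambda>r. if r \<in> E then 1 / ?X r else ?X r) ?R"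
    using y by (auto simp: multiset.map_comp o_def intro!: image_mset_cong)
  also have "\<dots> = image_mset (\<lambda>r. if r \<in> E then 1 / ?X r else ?X r) (filter_mset (\<lambda>r. r \<in> E) ?R)
      + image_mset (\<lambda>r. if r \<in> E then 1 / ?X r else ?X r) (filter_mset (\<lambda>r. r \<notin> E) ?R)"
    by (simp only: image_mset_union[symmetric] split[symmetric])
  also have "image_mset (\<lambda>r. if r \<in> E then 1 / ?X r else ?X r) (filter_mset (\<lambda>r. r \<in> E) ?R)
     = image_mset (\<lambda>x. 1 / x) (image_mset ?X (filter_mset (\<lambda>r. r \<in> E) ?R))"
    by (auto simp: multiset.map_comp o_def intro!: image_mset_cong)
  also have "image_mset (\<lambda>r. if r \<in> E then 1 / ?X r else ?X r) (filter_mset (\<lambda>r. r \<notin> E) ?R)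
     = image_mset ?X (filter_mset (\<lambda>r. r \<notin> E) ?R)"
    by (auto intro!: image_mset_cong)
  finally have 1: "image_mset ((*) s) (mset (map (yE n v E) (config_rows n i))) =
     image_mset (\<lambda>x. 1 / x) (image_mset ?X (filter_mset (\<lambda>r. r \<in> E) ?R)) + image_mset ?X (filter_mset (\<lambda>r. r \<notin> E) ?R)" .
  have sum_sub: "(n + 1 - a) + (n + 1 - b) = n" if "a \<le> n + 1" "b \<le> n + 1" "a + b = n + 2" for a b
    using that by arith
  have len: "length (config_rows n i) = n"
  proof -
    have "i c \<le> n + 1" for c using i by (auto simp: descending_def)
    moreover have "length (config_rows n i) = (n + 1 - i True) + (n + 1 - i False)"
      unfolding config_rows_def by (simp only: length_append length_map length_upt)
    ultimately show ?thesis using i(2) by (metis sum_sub)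
  qed
  have "f (image_mset (\<lambda>x. 1 / x) (image_mset ?X (filter_mset (\<lambda>r. r \<in> E) ?R)) + image_mset ?X (filter_mset (\<lambda>r. r \<notin> E) ?R))
    = f (image_mset ?X (filter_mset (\<lambda>r. r \<in> E) ?R) + image_mset ?X (filter_mset (\<lambda>r. r \<notin> E) ?R))"
  proof (rule sym_theta_inv[OF f])
    have "size (filter_mset (\<lambda>r. r \<in> E) ?R) + size (filter_mset (\<lambda>r. r \<notin> E) ?R) = size ?R"
      by (metis split size_union)
    then show "size (image_mset ?X (filter_mset (\<lambda>r. r \<in> E) ?R)) + size (image_mset ?X (filter_mset (\<lambda>r. r \<notin> E) ?R)) = n"
      using len by simp
  qed auto
  also have "image_mset ?X (filter_mset (\<lambda>r. r \<in> E) ?R) + image_mset ?X (filter_mset (\<lambda>r. r \<notin> E) ?R) = image_mset ?X ?R"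
    by (metis split image_mset_union)
  also have "\<dots> = ev S.lt (config n i (dv v E))"
    unfolding ev_cfg by simp
  finally show ?thesis using 1 by simp
qed

text \<open>Choices outside \<open>rvalid\<close> have weight zero, so only lowered configurations
  have to be examined; in the applications at most one contributes.\<close>

lemma diff_op_cfg:
  assumes f: "sym_theta n m f" and i: "descending n i v" "i True + i False = n + 2"
    and u: "u 0 = \<beta> True" "u 1 = \<beta> False" and E0: "rvalid n i v E0"
    and z: "\<And>E. rvalid n i v E \<Longrightarrow> E \<noteq> E0 \<Longrightarrow> wtE u n i v E \<noteq> 0 \<Longrightarrow> f (ev S.lt (config n i (dv v E))) = 0"
  shows "diff_op s t u f (ev lt (config n i v)) = wtE u n i v E0 * f (ev S.lt (config n i (dv v E0)))"
proof -
  let ?h = "\<lambda>E. wtE u n i v E * f (image_mset ((*) s) (mset (map (yE n v E) (config_rows n i))))"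
  have E0P: "E0 \<in> Pow (set (config_rows n i))" using E0 by (simp add: rvalid_def)
  have "?h E = 0" if "E \<in> Pow (set (config_rows n i)) - {E0}" for E
    using wtE_rvalid[OF i(1) u, of E] f_yE[OF f i, of E] z[of E] that by fastforce
  then have "(\<Sum>E\<in>Pow (set (config_rows n i)) - {E0}. ?h E) = 0" by (rule sum.neutral[rule_format])
  then have "(\<Sum>E\<in>Pow (set (config_rows n i)). ?h E) = ?h E0"
    using E0P by (subst sum.remove[of "Pow (set (config_rows n i))" E0]) simp_all
  then show ?thesis unfolding diff_op_expand f_yE[OF f i E0] .
qed

lemma rvalid_empty: "descending n i v \<Longrightarrow> rvalid n i v {}"
  by (simp add: rvalid_def)

text \<open>The last row below \<open>lam\<close>, together with the rows after it, is a suffix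
  treated by \<open>lower_van_suf\<close>; the side False only has to stay in range.\<close>

lemma below_lam_0:
  assumes f: "sym_theta n m f" and N: "2 * m \<le> N" "2 * n \<le> N"
    and weak: "S.weak m n lam f"
    and lam: "\<And>k k'. 1 \<le> k \<Longrightarrow> k \<le> k' \<Longrightarrow> k' \<le> n \<Longrightarrow> lam k' \<le> lam k" "\<And>k. 1 \<le> k \<Longrightarrow> lam k \<le> m"
    and w: "descending n i w" "i True + i False = n + 2"
    and le: "\<And>k. i True \<le> k \<Longrightarrow> k \<le> n \<Longrightarrow> w True k \<le> lam k" "\<And>k. i False \<le> k \<Longrightarrow> k \<le> n \<Longrightarrow> w False k \<le> m"
    and ex: "\<exists>k. i True \<le> k \<and> k \<le> n \<and> w True k < lam k"
  shows "f (ev S.lt (config n i w)) = 0"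
proof -
  define A where "A = {k. i True \<le> k \<and> k \<le> n \<and> w True k < lam k}"
  define k where "k = Max A"
  have A: "finite A" "A \<noteq> {}" using ex by (auto simp: A_def)
  have kA: "k \<in> A" unfolding k_def by (rule Max_in[OF A])
  have kmax: "w True j = lam j" if "k < j" "j \<le> n" for j
  proof -
    have "j \<notin> A" using Max_ge[OF A(1), of j] that by (auto simp: k_def)
    moreover have "i True \<le> j" using kA that by (auto simp: A_def)
    ultimately show ?thesis using that le(1)[of j] by (auto simp: A_def)
  qed
  have k: "i True \<le> k" "1 \<le> k" "k \<le> n" "w True k < lam k" using kA w(1) unfolding A_def descending_def
    by (auto intro: order_trans)
  have "vanishes n f S.lt (suf n True k (lam(k := w True k)))"
  proof (rule S.lower_van_suf[OF sym_theta_generic[OF f] N weak lam])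
    show "lam j \<le> w True k" if "k < j" "j \<le> n" for j
    proof -
      have "w True j \<le> w True k" using w(1) k that by (auto simp: descending_def)
      then show ?thesis using kmax that by simp
    qed
  qed (use k in auto)
  then have "vanishes n f S.lt (config n i w)"
    by (rule vanishes_mono[OF _ suf_subset_cfg]) (use k kmax in auto)
  moreover have "card (config n i w) = n"
  proof -
    have "i c \<le> n + 1" for c using w by (auto simp: descending_def)
    from this[of True] this[of False] show ?thesis using w(2) by (simp add: card_cfg)
  qed
  moreover have "good (ev S.lt (config n i w))"
  proof (rule S.good_lat)
    fix x assume x: "x \<in> config n i w"
    obtain c e k where xe: "x = (c, e, k)" by (cases x)
    obtain j where j: "i c \<le> j" "j \<le> n" "e = w c j" "k = n - j" using x xe by (auto simp: in_cfg)
    have "1 \<le> i c" using w(1) by (simp add: descending_def)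
    then have "e \<le> m" using j le(1)[of j] le(2)[of j] lam(2)[of j] by (cases c) auto
    then show "S.in_range x" using j N by (auto simp: S.in_range_def xe)
  qed simp
  ultimately show ?thesis unfolding vanishes_def by (metis add.right_neutral add_0 size_empty)
qed

text \<open>Choices only lower values. A \<open>lower\<close> configuration stays
  \<open>lower\<close>; an \<open>upper\<close> one stays \<open>upper\<close> unless some row of
  the side True drops below \<open>lam\<close>, and then \<open>below_lam_0\<close> applies. So
  every term vanishes.\<close>

lemma weak_Top:
  assumes f: "sym_theta n m f" and N: "2 * m \<le> N" "2 * n \<le> N"
    and weak: "S.weak m n lam f"
    and lam: "\<And>k k'. 1 \<le> k \<Longrightarrow> k \<le> k' \<Longrightarrow> k' \<le> n \<Longrightarrow> lam k' \<le> lam k" "\<And>k. 1 \<le> k \<Longrightarrow> lam k \<le> m"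
    and u: "u 0 = \<beta> True" "u 1 = \<beta> False"
  shows "weak m n lam (diff_op s t u f)"
  unfolding weak_def
proof (intro allI impI)
  fix i v assume d: "descending n i v" and i: "i True + i False = n + 2" and lu: "lower m n lam i v \<or> upper m n lam i v"
  have z: "f (ev S.lt (config n i (dv v E))) = 0" if E: "rvalid n i v E" for E
    using lu
  proof
    assume low: "lower m n lam i v"
    then obtain l where l: "i True \<le> l" "l \<le> n" "v True l < lam l" "\<And>k. l < k \<Longrightarrow> k \<le> n \<Longrightarrow> v True k = lam k"
      by (auto simp: lower_def)
    define A where "A = {k. l \<le> k \<and> k \<le> n \<and> dv v E True k < lam k}"
    have "l \<in> A" using l dv_le[of v E True l] by (simp add: A_def)
    moreover have "finite A" by (simp add: A_def)
    ultimately have kA: "Max A \<in> A" and kge: "\<And>j. j \<in> A \<Longrightarrow> j \<le> Max A" using Max_in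
      by auto
    have "dv v E True j = lam j" if "Max A < j" "j \<le> n" for j
    proof -
      have "l \<le> Max A" using kA by (auto simp: A_def)
      moreover have "j \<notin> A" using kge[of j] that by auto
      ultimately show ?thesis using that l(4)[of j] dv_le[of v E True j] by (auto simp: A_def)
    qed
    moreover have "dv v E True (i True) < m" using low dv_le[of v E True "i True"] by (auto simp: lower_def)
    moreover have "dv v E False k = 0" if "i False \<le> k" "k \<le> n" for k
      using low dv_le[of v E False k] that by (auto simp: lower_def)
    moreover note lo = calculation
    ultimately have "lower m n lam i (dv v E)"
    proof -
      have "l \<le> Max A" "Max A \<le> n" "dv v E True (Max A) < lam (Max A)" using kA by (auto simp: A_def)
      moreover have "i True \<le> n" using low by (simp add: lower_def)
      ultimately show ?thesis using l(1) lo unfolding lower_def by (blast intro: order_trans)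
    qed
    then show ?thesis using weak E i unfolding S.weak_def rvalid_def by blast
  next
    assume up: "upper m n lam i v"
    show ?thesis
    proof (cases "\<exists>k. i True \<le> k \<and> k \<le> n \<and> dv v E True k < lam k")
      case True
      show ?thesis
      proof (rule below_lam_0[OF f N weak lam])
        show "descending n i (dv v E)" using E by (simp add: rvalid_def)
        show "dv v E True k \<le> lam k" if "i True \<le> k" "k \<le> n" for k
          using up that dv_le[of v E True k] by (auto simp: upper_def)
        show "dv v E False k \<le> m" if "i False \<le> k" "k \<le> n" for k
        proof -
          have "v False k \<le> v False (i False)" using d that by (auto simp: descending_def)
          then show ?thesis using up dv_le[of v E False k] by (auto simp: upper_def)
        qed
      qed (use i True in auto)
    next
      case False
      have "dv v E True k = lam k" if "i True \<le> k" "k \<le> n" for k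
        using False up that dv_le[of v E True k] by (fastforce simp: upper_def)
      then have "upper m n lam i (dv v E)"
        using up dv_le[of v E False "i False"] by (auto simp: upper_def)
      then show ?thesis using weak E i unfolding S.weak_def rvalid_def by blast
    qed
  qed
  have "diff_op s t u f (ev lt (config n i v)) = wtE u n i v {} * f (ev S.lt (config n i (dv v {})))"
    by (rule diff_op_cfg[OF f d i u rvalid_empty[OF d]]) (use z in auto)
  then show "diff_op s t u f (ev lt (config n i v)) = 0" using z[OF rvalid_empty[OF d]] by simp
qed

end

section \<open>Extra vanishing\<close>

lemma ev_suf_cfg: "ev \<xi> (suf n c 1 \<nu>) = ev \<xi> (config n (\<lambda>c'. if c' = c then 1 else n + 1) (\<lambda>_. \<nu>))"
  by (simp only: suf_def)

context lattice_shift
begin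

lemma single_factor_nzI:
  assumes "th (y\<^sup>2) \<noteq> 0" "th (u 0 * y) \<noteq> 0" "th (u 1 * y) \<noteq> 0" "th (u 2 * y) \<noteq> 0" "th (u 3 * y) \<noteq> 0"
  shows "single_factor u y \<noteq> 0"
  using assms by (simp add: single_factor_def numeral_eq_Suc lessThan_Suc)

lemma single_factor_0I: "r < 4 \<Longrightarrow> th (u r * y) = 0 \<Longrightarrow> single_factor u y = 0"
  by (auto simp: single_factor_def prod_zero_iff)

text \<open>\<open>w\<close> is the free parameter, and the last entry is solved from the balancing condition under
  which the difference operator preserves theta functions of degree \<open>m\<close>.\<close>

definition upar :: "nat \<Rightarrow> nat \<Rightarrow> complex \<Rightarrow> nat \<Rightarrow> complex" where
  "upar m n w = (\<lambda>r. if r = 0 then \<beta> True else if r = 1 then \<beta> False else if r = 2 then 1 / w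
      else p * w / (\<beta> True * \<beta> False * q ^ m * t ^ (n - 1)))"

lemma upar_simps: "upar m n w 0 = \<beta> True" "upar m n w (Suc 0) = \<beta> False" "upar m n w 1 = \<beta> False" "upar m n w 2 = 1 / w"
  "upar m n w 3 = p * w / (\<beta> True * \<beta> False * q ^ m * t ^ (n - 1))"
  by (simp_all add: upar_def)

lemma upar_nz: "w \<noteq> 0 \<Longrightarrow> upar m n w r \<noteq> 0"
  by (simp add: upar_def)

lemma upar_bal: "w \<noteq> 0 \<Longrightarrow> (\<Prod>r<4. upar m n w r) * (s\<^sup>2) ^ m * t ^ (n - 1) = p"
proof -
  assume "w \<noteq> 0"
  moreover have "{..<4::nat} = {0, 1, 2, 3}" by auto
  ultimately show ?thesis by (simp add: upar_def s2)
qed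

lemma cross_factor_lat_nz:
  assumes "in_range x" "in_range y" "2 * fst (snd x) + 1 \<le> N" "2 * snd (snd x) + 1 \<le> N"
    "2 * fst (snd y) + 1 \<le> N" "2 * snd (snd y) + 1 \<le> N"
  shows "cross_factor t (lt x * lt y) \<noteq> 0" "cross_factor t (1 / lt x * (1 / lt y)) \<noteq> 0"
proof -
  obtain c e k c' e' k' where xy: "x = (c, e, k)" "y = (c', e', k')" by (cases x, cases y)
  have 1: "th (lt x * lt y) \<noteq> 0" by (rule lat_mult_nz[OF assms(1,2)])
  have e1: "t * (lt x * lt y) = \<beta> c * \<beta> c' * q powi (int e + int e') * t powi (int k + int k' + 1)"
    unfolding xy lat_mult by (simp add: power_int_add)
  have "th (t * (lt x * lt y)) \<noteq> 0"
    unfolding e1 by (rule gen_mult) (use assms xy in auto)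
  then show "cross_factor t (lt x * lt y) \<noteq> 0" using 1 by (simp add: cross_factor_def)
  have e2: "t * (1 / (lt x * lt y)) = 1 / (\<beta> c * \<beta> c' * q powi (int e + int e') * t powi (int k + int k' - 1))"
    unfolding xy lat_mult by (simp add: power_int_add power_int_diff)
  have "th (t * (1 / (lt x * lt y))) \<noteq> 0"
    unfolding e2 theta_inv_0 by (rule gen_mult) (use assms xy in auto)
  then show "cross_factor t (1 / lt x * (1 / lt y)) \<noteq> 0" using 1 by (simp add: cross_factor_def)
qed

context
  fixes m n :: nat and lam :: "nat \<Rightarrow> nat" and f :: "complex multiset \<Rightarrow> complex"
  assumes f: "sym_theta n m f" and N: "2 * m + 2 \<le> N" "2 * n + 2 \<le> N" and n: "1 \<le> n"
    and weak: "S.weak m n lam f"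
    and lam: "\<And>k k'. 1 \<le> k \<Longrightarrow> k \<le> k' \<Longrightarrow> k' \<le> n \<Longrightarrow> lam k' \<le> lam k" "\<And>k. 1 \<le> k \<Longrightarrow> lam k \<le> m"
begin

lemma diff_op_upar_generic: "w \<noteq> 0 \<Longrightarrow> generic_theta n m (diff_op s t (upar m n w) f)"
  by (rule diff_op_generic_theta[OF f s_nz t_nz upar_nz upar_bal])

lemma diff_op_upar_weak: "weak m n lam (diff_op s t (upar m n w) f)"
  by (rule weak_Top[OF f _ _ weak lam]) (use N in \<open>auto simp: upar_simps\<close>)

text \<open>With w the coordinate of row i0 of \<open>lam\<close>, \<open>u 2 * w = 1\<close> kills
  the choice that leaves all rows of \<open>lam\<close> unchanged; any other choice falls below
  \<open>lam\<close>. So the image is zero at the point of \<open>lam\<close>, hence at all good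
  points.\<close>

lemma diff_op_0:
  assumes i0: "1 \<le> i0" "i0 \<le> n" and M: "size M = n" "good M"
  shows "diff_op s t (upar m n (lt (True, lam i0, n - i0))) f M = 0"
proof -
  define w where "w = lt (True, lam i0, n - i0)"
  define u where "u = upar m n w"
  have w: "w \<noteq> 0" by (simp add: w_def)
  show ?thesis
    unfolding w_def[symmetric]
  proof (rule weak_eq_0[OF diff_op_upar_generic[OF w] _ _ n diff_op_upar_weak])
    define i where "i = (\<lambda>c. if c = True then 1 else n + 1)"
    have d: "descending n i (\<lambda>_. lam)" using lam n by (auto simp: i_def descending_def)
    have isum: "i True + i False = n + 2" by (simp add: i_def)
    have "diff_op s t u f (ev lt (config n i (\<lambda>_. lam))) = wtE u n i (\<lambda>_. lam) {} * f (ev S.lt (config n i (dv (\<lambda>_. lam) {})))"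
    proof (rule diff_op_cfg[OF f d isum _ _ rvalid_empty[OF d]])
      show "u 0 = \<beta> True" "u 1 = \<beta> False" by (simp_all add: u_def upar_simps)
      fix E assume E: "rvalid n i (\<lambda>_. lam) E" "E \<noteq> {}"
      then obtain c k where ck: "(c, k) \<in> E" by auto
      then have "(c, k) \<in> set (config_rows n i)" "1 \<le> lam k" using E(1) by (auto simp: rvalid_def)
      then have "i c \<le> k" "k \<le> n" "1 \<le> lam k" by (simp_all add: in_cfg_rows)
      then have k: "c = True" "1 \<le> k" "k \<le> n" "1 \<le> lam k"
        by (auto simp: i_def split: if_splits)
      show "f (ev S.lt (config n i (dv (\<lambda>_. lam) E))) = 0"
      proof (rule below_lam_0[OF f _ _ weak lam _ isum])
        show "descending n i (dv (\<lambda>_. lam) E)" using E by (simp add: rvalid_def)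
        show "\<exists>k\<ge>i True. k \<le> n \<and> dv (\<lambda>_. lam) E True k < lam k"
          using k ck by (intro exI[of _ k]) (auto simp: i_def dv_def)
      qed (use N dv_le[of "\<lambda>_. lam" E] in \<open>auto simp: i_def\<close>)
    qed
    moreover have "wtE u n i (\<lambda>_. lam) {} = 0"
    proof -
      have "(True, i0) \<in> set (config_rows n i)" using i0 by (simp add: in_cfg_rows i_def)
      moreover have "single_factor u (yE n (\<lambda>_. lam) {} (True, i0)) = 0"
        by (rule single_factor_0I[of 2]) (simp_all add: u_def upar_simps yE_def w_def)
      ultimately show ?thesis using wtE_nz_iff by blast
    qed
    ultimately show "diff_op s t (upar m n w) f (ev lt (suf n True 1 lam)) = 0"
      unfolding ev_suf_cfg i_def u_def by simp
  qed (use N lam M in auto)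
qed

text \<open>Induction on the size of \<nu>: a nonempty choice leads to a smaller partition that is
  still deficient, where f vanishes. Only the empty choice remains; the sum is zero by
  \<open>diff_op_0\<close>, and for a suitable i0 the weight is not.\<close>

lemma extra_vanishing:
  assumes \<nu>: "\<And>k k'. 1 \<le> k \<Longrightarrow> k \<le> k' \<Longrightarrow> k' \<le> n \<Longrightarrow> \<nu> k' \<le> \<nu> k" "\<And>k. 1 \<le> k \<Longrightarrow> k \<le> n \<Longrightarrow> \<nu> k \<le> m"
    and bad: "\<exists>k. 1 \<le> k \<and> k \<le> n \<and> \<nu> k < lams m n lam c k"
  shows "f (ev S.lt (suf n c 1 \<nu>)) = 0"
  using assms
proof (induction "sum \<nu> {1..n}" arbitrary: \<nu> rule: less_induct)
  case less
  obtain k0 where k0: "1 \<le> k0" "k0 \<le> n" "\<nu> k0 < lams m n lam c k0" using less.prems by auto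
  \<comment> \<open>On the side True, row k0 of \<nu> differs from that of \<open>lam\<close>, so
    \<open>u 2\<close> cancels no row of \<nu>. On the side False the danger is \<open>u 3\<close>:
    its product with row k is p times a power of q times a power of t. The t-exponent is zero only
    for k = k0, where the q-exponent is \<open>lam i0 + \<nu> k0 - m < 0\<close>.\<close>
  define i0 where "i0 = (if c then k0 else n + 1 - k0)"
  have i0: "1 \<le> i0" "i0 \<le> n" using k0 by (auto simp: i0_def)
  define w where "w = lt (True, lam i0, n - i0)"
  have w: "w \<noteq> 0" by (simp add: w_def)
  define u where "u = upar m n w"
  define i where "i = (\<lambda>c'. if c' = c then 1 else n + 1)"
  let ?v = "\<lambda>_. \<nu>"
  have d: "descending n i ?v" using less.prems n by (auto simp: i_def descending_def)
  have isum: "i True + i False = n + 2" by (cases c) (simp_all add: i_def)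
  have lami: "lam i0 \<le> m" using lam i0 by simp
  have "diff_op s t u f (ev lt (config n i ?v)) = wtE u n i ?v {} * f (ev S.lt (config n i (dv ?v {})))"
  proof (rule diff_op_cfg[OF f d isum _ _ rvalid_empty[OF d]])
    show "u 0 = \<beta> True" "u 1 = \<beta> False" by (simp_all add: u_def upar_simps)
    fix E assume E: "rvalid n i ?v E" "E \<noteq> {}"
    then obtain c' k where ck: "(c', k) \<in> E" by auto
    then have "(c', k) \<in> set (config_rows n i)" "1 \<le> \<nu> k" using E(1) by (auto simp: rvalid_def)
    then have k: "c' = c" "1 \<le> k" "k \<le> n" "1 \<le> \<nu> k"
    proof -
      assume a: "(c', k) \<in> set (config_rows n i)" "1 \<le> \<nu> k"
      then have "i c' \<le> k" "k \<le> n" by (simp_all add: in_cfg_rows)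
      then show "c' = c" "1 \<le> k" "k \<le> n" "1 \<le> \<nu> k" using a(2)
        by (auto simp: i_def split: if_splits)
    qed
    let ?\<nu> = "dv ?v E c"
    have le: "?\<nu> j \<le> \<nu> j" for j by (rule dv_le)
    have "f (ev S.lt (suf n c 1 ?\<nu>)) = 0"
    proof (rule less.hyps)
      show "sum ?\<nu> {1..n} < sum \<nu> {1..n}"
      proof (rule sum_strict_mono_ex1)
        have "?\<nu> k < \<nu> k" using k ck by (simp add: dv_def)
        then show "\<exists>j\<in>{1..n}. ?\<nu> j < \<nu> j" using k by auto
      qed (use le in auto)
      show "?\<nu> k' \<le> ?\<nu> k" if "1 \<le> k" "k \<le> k'" "k' \<le> n" for k k'
        using E that by (auto simp: rvalid_def descending_def i_def)
      show "?\<nu> k \<le> m" if "1 \<le> k" "k \<le> n" for k using less.prems(2)[OF that] le[of k] by simp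
      show "\<exists>k. 1 \<le> k \<and> k \<le> n \<and> ?\<nu> k < lams m n lam c k" using k0 le[of k0]
        by (intro exI[of _ k0]) auto
    qed
    moreover have "suf n c 1 ?\<nu> = config n i (dv ?v E)"
      unfolding suf_def by (rule config_cong) (auto simp: i_def split: if_splits)
    ultimately show "f (ev S.lt (config n i (dv ?v E))) = 0" by simp
  qed
  moreover have "diff_op s t u f (ev lt (config n i ?v)) = 0"
    unfolding u_def w_def
  proof (rule diff_op_0[OF i0])
    show "size (ev lt (config n i ?v)) = n" by (cases c) (simp_all add: card_cfg i_def)
    show "good (ev lt (config n i ?v))"
    proof (rule good_lat)
      fix x assume x: "x \<in> config n i ?v"
      then obtain k where "x = (c, \<nu> k, n - k)" "1 \<le> k" "k \<le> n"
        by (cases x) (auto simp: in_cfg i_def split: if_splits)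
      then show "in_range x" using less.prems(2)[of k] N by (simp add: in_range_def)
    qed simp
  qed
  moreover have "wtE u n i ?v {} \<noteq> 0"
    unfolding wtE_nz_iff
  proof (intro conjI ballI impI)
    define X where "X = (\<lambda>k. lt (c, \<nu> k, n - k))"
    have rw: "\<exists>k. r = (c, k) \<and> 1 \<le> k \<and> k \<le> n \<and> yE n ?v {} r = X k"
      if "r \<in> set (config_rows n i)" for r
      by (cases r; use that in \<open>auto simp: in_cfg_rows i_def yE_def X_def split: if_splits\<close>)
    have ok: "in_range (c, \<nu> k, n - k)" if "1 \<le> k" "k \<le> n" for k
      using less.prems(2)[OF that] N by (simp add: in_range_def)
    have okw: "in_range (True, lam i0, n - i0)" using lami N by (simp add: in_range_def)
    have ok0: "in_range (c', 0, 0)" for c' by (simp add: in_range_def)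
    fix r assume "r \<in> set (config_rows n i)"
    then obtain k where r: "r = (c, k)" and k: "1 \<le> k" "k \<le> n" and y: "yE n ?v {} r = X k" using rw
      by blast
    have \<nu>m: "\<nu> k \<le> m" using less.prems(2) k by simp
    show "single_factor u (yE n ?v {} r) \<noteq> 0"
      unfolding y
    proof (rule single_factor_nzI)
      show "th ((X k)\<^sup>2) \<noteq> 0" using lat_mult_nz[OF ok[OF k] ok[OF k]]
        by (simp add: X_def power2_eq_square)
      show "th (u 0 * X k) \<noteq> 0" "th (u 1 * X k) \<noteq> 0"
        using lat_mult_nz[OF ok0[of True] ok[OF k]] lat_mult_nz[OF ok0[of False] ok[OF k]]
        by (simp_all add: u_def upar_simps X_def lat_def)
      have "(c, \<nu> k, n - k) \<noteq> (True, lam i0, n - i0)"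
      proof -
        have "n - k = n - k0 \<Longrightarrow> k = k0" using k k0 by arith
        then show ?thesis using k0 k by (auto simp: i0_def lams_def)
      qed
      then show "th (u 2 * X k) \<noteq> 0"
        using lat_div_nz[OF ok[OF k] okw] by (simp add: u_def upar_simps X_def w_def)
      have e: "u 3 * X k = p * (w * X k / (\<beta> True * \<beta> False * q powi (int m) * t powi (int n - 1)))"
        using n by (simp add: u_def upar_simps power_int_def nat_diff_distrib)
      show "th (u 3 * X k) \<noteq> 0"
      proof (cases c)
        case True
        have "w * X k / (\<beta> True * \<beta> False * q powi (int m) * t powi (int n - 1)) =
           \<beta> True / \<beta> False * q powi (int (lam i0) + int (\<nu> k) - int m) * t powi (int (n - i0) + int (n - k) - (int n - 1))"
          unfolding w_def X_def lat_mult using True by (simp add: power_int_diff mult_ac)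
        moreover have "th (\<beta> True / \<beta> False * q powi (int (lam i0) + int (\<nu> k) - int m) * t powi (int (n - i0) + int (n - k) - (int n - 1))) \<noteq> 0"
          by (rule gen_div) (use lami \<nu>m N k i0 in auto)
        ultimately show ?thesis unfolding e theta_p_0 by metis
      next
        case False
        have "w * X k / (\<beta> True * \<beta> False * q powi (int m) * t powi (int n - 1)) =
           q powi (int (lam i0) + int (\<nu> k) - int m) * t powi (int (n - i0) + int (n - k) - (int n - 1))"
          unfolding w_def X_def lat_mult using False by (simp add: power_int_diff mult_ac)
        moreover have "th (q powi (int (lam i0) + int (\<nu> k) - int m) * t powi (int (n - i0) + int (n - k) - (int n - 1))) \<noteq> 0"
        proof (rule gen_qt)
          have "int (lam i0) + int (\<nu> k) - int m \<noteq> 0" if "k = k0"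
            using k0 that False lami by (auto simp: lams_def rect_compl_def i0_def)
          moreover have "int (n - i0) + int (n - k) - (int n - 1) \<noteq> 0" if "k \<noteq> k0"
            using k0 k that False by (auto simp: i0_def)
          ultimately show "(int (lam i0) + int (\<nu> k) - int m, int (n - i0) + int (n - k) - (int n - 1)) \<noteq> (0, 0)"
            by blast
        qed (use lami \<nu>m N k i0 in auto)
        ultimately show ?thesis unfolding e theta_p_0 by metis
      qed
    qed
    fix r' assume "r' \<in> set (config_rows n i)" "r \<noteq> r'"
    then obtain k' where k': "1 \<le> k'" "k' \<le> n" and y': "yE n ?v {} r' = X k'" using rw by blast
    show "cross_factor t (yE n ?v {} r * yE n ?v {} r') \<noteq> 0"
      unfolding y y' X_def
      by (rule cross_factor_lat_nz[OF ok[OF k] ok[OF k']]) (use less.prems(2)[OF k] less.prems(2)[OF k'] N in auto)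
  qed
  ultimately have "f (ev S.lt (config n i ?v)) = 0" by simp
  then show ?case unfolding ev_suf_cfg i_def .
qed

text \<open>Let i0 be the first row of \<open>lam\<close> below c, and w its coordinate after
  raising it to c. Leaving row i0 unchanged is killed by \<open>u 2\<close>; inverting it forces all
  later rows, which have the same value c, to be inverted too; inverting an earlier row falls below
  \<open>lam\<close> and is excluded by \<open>extra_vanishing\<close>. Only \<open>E0\<close>
  survives, and it leads back to c - 1.\<close>

lemma diff_op_step_nz:
  assumes c: "lam n < c" "c \<le> m"
    and nz: "f (ev S.lt (suf n True 1 (\<lambda>k. max (lam k) (c - 1)))) \<noteq> 0"
  shows "\<exists>w. w \<noteq> 0 \<and> diff_op s t (upar m n w) f (ev lt (suf n True 1 (\<lambda>k. max (lam k) c))) \<noteq> 0"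
proof -
  define \<nu> where "\<nu> = (\<lambda>k. max (lam k) c)"
  define i0 where "i0 = (LEAST k. 1 \<le> k \<and> lam k < c)"
  have ex: "1 \<le> n \<and> lam n < c" using n c by simp
  have i0: "1 \<le> i0" "lam i0 < c" "i0 \<le> n"
    using LeastI[of "\<lambda>k. 1 \<le> k \<and> lam k < c", OF ex] Least_le[of "\<lambda>k. 1 \<le> k \<and> lam k < c", OF ex]
    by (auto simp: i0_def)
  have below: "c \<le> lam k" if "1 \<le> k" "k < i0" for k
    using not_less_Least[of k "\<lambda>k. 1 \<le> k \<and> lam k < c"] that by (auto simp: i0_def)
  have above: "lam k < c" if "i0 \<le> k" "k \<le> n" for k
    using lam(1)[of i0 k] i0 that by simp
  have \<nu>c: "\<nu> k = c" if "i0 \<le> k" "k \<le> n" for k using above[OF that] by (simp add: \<nu>_def)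
  have \<nu>lam: "\<nu> k = lam k" if "1 \<le> k" "k < i0" for k using below[OF that] by (simp add: \<nu>_def)
  have \<nu>m: "\<nu> k \<le> m" if "1 \<le> k" for k using lam(2)[OF that] c by (simp add: \<nu>_def)
  define w where "w = lt (True, c, n - i0)"
  have w: "w \<noteq> 0" by (simp add: w_def)
  define u where "u = upar m n w"
  define i where "i = (\<lambda>c'. if c' = True then 1 else n + 1)"
  let ?v = "\<lambda>_. \<nu>"
  define E0 where "E0 = {(True, k) |k. i0 \<le> k \<and> k \<le> n}"
  have d: "descending n i ?v" using lam n
    by (auto simp: i_def descending_def \<nu>_def) (meson max.coboundedI1 max.coboundedI2 order_refl)
  have isum: "i True + i False = n + 2" by (simp add: i_def)
  have dv0: "dv ?v E0 True k = max (lam k) (c - 1)" if "1 \<le> k" "k \<le> n" for k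
  proof (cases "i0 \<le> k")
    case True
    then show ?thesis using \<nu>c[OF True that(2)] above[OF True that(2)] that by (auto simp: dv_def E0_def)
  next
    case False
    then show ?thesis using \<nu>lam[of k] below[of k] that by (auto simp: dv_def E0_def)
  qed
  have E0: "rvalid n i ?v E0"
    unfolding rvalid_def
  proof (intro conjI)
    show "E0 \<subseteq> set (config_rows n i)" using i0 by (auto simp: E0_def in_cfg_rows i_def)
    show "\<forall>(c', k)\<in>E0. 1 \<le> \<nu> k" using c by (auto simp: E0_def \<nu>_def)
    show "descending n i (dv ?v E0)"
      unfolding descending_def
    proof (intro allI conjI impI)
      fix c' k k' assume k: "i c' \<le> k" "k \<le> k'" "k' \<le> n"
      then have "c' = True" "1 \<le> k" by (auto simp: i_def split: if_splits)
      then show "dv ?v E0 c' k' \<le> dv ?v E0 c' k" using k dv0[of k] dv0[of k'] lam(1)[of k k'] by auto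
    qed (use d in \<open>auto simp: descending_def\<close>)
  qed
  have rw: "\<exists>k. r = (True, k) \<and> 1 \<le> k \<and> k \<le> n" if "r \<in> set (config_rows n i)" for r
    by (cases r; use that in \<open>auto simp: in_cfg_rows i_def split: if_splits\<close>)
  have ok: "in_range (True, \<nu> k, n - k)" if "1 \<le> k" "k \<le> n" for k
    using \<nu>m[OF that(1)] N by (simp add: in_range_def)
  have okw: "in_range (True, c, n - i0)" using c N by (simp add: in_range_def)
  have ok0: "in_range (c', 0, 0)" for c' by (simp add: in_range_def)
  define X where "X = (\<lambda>k. lt (True, \<nu> k, n - k))"
  have wX: "w = X i0" using \<nu>c[of i0] i0 by (simp add: w_def X_def)
  have y: "yE n ?v E (True, k) = (if (True, k) \<in> E then 1 / X k else X k)" for k E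
    by (simp add: yE_def X_def)
  have "diff_op s t u f (ev lt (config n i ?v)) = wtE u n i ?v E0 * f (ev S.lt (config n i (dv ?v E0)))"
  proof (rule diff_op_cfg[OF f d isum _ _ E0])
    show "u 0 = \<beta> True" "u 1 = \<beta> False" by (simp_all add: u_def upar_simps)
    fix E assume E: "rvalid n i ?v E" "E \<noteq> E0" and wE: "wtE u n i ?v E \<noteq> 0"
    have dE: "descending n i (dv ?v E)" and Er: "E \<subseteq> set (config_rows n i)" using E
      by (auto simp: rvalid_def)
    have i0E: "(True, i0) \<in> E"
    proof (rule ccontr)
      assume "(True, i0) \<notin> E"
      then have "single_factor u (yE n ?v E (True, i0)) = 0"
        by (intro single_factor_0I[of 2]) (use w in \<open>simp_all add: y u_def upar_simps wX\<close>)
      moreover have "(True, i0) \<in> set (config_rows n i)" using i0 by (simp add: in_cfg_rows i_def)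
      ultimately show False using wE wtE_nz_iff by blast
    qed
    have up: "(True, k) \<in> E" if "i0 \<le> k" "k \<le> n" for k
    proof (rule ccontr)
      assume k: "(True, k) \<notin> E"
      have "dv ?v E True k \<le> dv ?v E True i0" using dE that i0 by (auto simp: descending_def i_def)
      then show False using k i0E \<nu>c that i0 c by (simp add: dv_def)
    qed
    obtain k where k: "1 \<le> k" "k < i0" "(True, k) \<in> E"
    proof -
      have "E0 \<subseteq> E" using up by (auto simp: E0_def)
      then obtain r where "r \<in> E" "r \<notin> E0" using E by blast
      moreover from this obtain k where "r = (True, k)" "1 \<le> k" "k \<le> n" using rw Er by blast
      ultimately show ?thesis by (intro that[of k]) (auto simp: E0_def)
    qed
    have "f (ev S.lt (suf n True 1 (dv ?v E True))) = 0"
    proof (rule extra_vanishing)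
      show "dv ?v E True k' \<le> dv ?v E True k" if "1 \<le> k" "k \<le> k'" "k' \<le> n" for k k'
        using dE that by (auto simp: descending_def i_def)
      show "dv ?v E True k \<le> m" if "1 \<le> k" "k \<le> n" for k
        using \<nu>m[OF that(1)] dv_le[of ?v E True k] by simp
      have "dv ?v E True k < lam k" using k \<nu>lam[of k] below[of k] c by (simp add: dv_def)
      then show "\<exists>k. 1 \<le> k \<and> k \<le> n \<and> dv ?v E True k < lams m n lam True k"
        using k i0 by (intro exI[of _ k]) (auto simp: lams_def)
    qed
    moreover have "suf n True 1 (dv ?v E True) = config n i (dv ?v E)"
      unfolding suf_def by (rule config_cong) (auto simp: i_def split: if_splits)
    ultimately show "f (ev S.lt (config n i (dv ?v E))) = 0" by simp
  qed
  moreover have "config n i (dv ?v E0) = suf n True 1 (\<lambda>k. max (lam k) (c - 1))"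
    unfolding suf_def by (rule config_cong) (auto simp: i_def dv0 split: if_splits)
  moreover have "wtE u n i ?v E0 \<noteq> 0"
    unfolding wtE_nz_iff
  proof (intro conjI ballI impI)
    have mem: "(True, k) \<in> E0 \<longleftrightarrow> i0 \<le> k" if "k \<le> n" for k using that
      by (auto simp: E0_def)
    fix r assume "r \<in> set (config_rows n i)"
    then obtain k where r: "r = (True, k)" and k: "1 \<le> k" "k \<le> n" using rw by blast
    show "single_factor u (yE n ?v E0 r) \<noteq> 0"
    proof (cases "i0 \<le> k")
      case True
      have yk: "yE n ?v E0 r = 1 / X k" using True k by (simp add: r y mem)
      show ?thesis unfolding yk
      proof (rule single_factor_nzI)
        have "th (1 / (X k)\<^sup>2) \<noteq> 0"
          unfolding theta_inv_0 using lat_mult_nz[OF ok[OF k] ok[OF k]] by (simp add: X_def power2_eq_square)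
        then show "th ((1 / X k)\<^sup>2) \<noteq> 0" by (simp add: power_one_over)
        have "(c', 0, 0) \<noteq> (True, \<nu> k, n - k)" for c' using \<nu>c[OF True k(2)] c by auto
        then show "th (u 0 * (1 / X k)) \<noteq> 0" "th (u 1 * (1 / X k)) \<noteq> 0"
          using lat_div_nz[OF ok0[of True] ok[OF k]] lat_div_nz[OF ok0[of False] ok[OF k]]
          by (simp_all add: u_def upar_simps X_def lat_def)
        have "th (1 / (w * X k)) \<noteq> 0"
          unfolding theta_inv_0 using lat_mult_nz[OF okw ok[OF k]] by (simp add: X_def w_def)
        then show "th (u 2 * (1 / X k)) \<noteq> 0" by (simp add: u_def upar_simps)
        have "u 3 * (1 / X k) = p * (w / X k / (\<beta> True * \<beta> False * q powi (int m) * t powi (int n - 1)))"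
          using n by (simp add: u_def upar_simps power_int_def nat_diff_distrib)
        also have "w / X k = q powi (int c - int (\<nu> k)) * t powi (int (n - i0) - int (n - k))"
          unfolding w_def X_def lat_div by simp
        also have "q powi (int c - int (\<nu> k)) * t powi (int (n - i0) - int (n - k)) / (\<beta> True * \<beta> False * q powi (int m) * t powi (int n - 1))
           = 1 / (\<beta> True * \<beta> False * q powi (int m - (int c - int (\<nu> k))) * t powi (int n - 1 - (int (n - i0) - int (n - k))))"
        proof -
          have qe: "q powi (int m - (int c - int (\<nu> k))) = q powi (int m) / q powi (int c - int (\<nu> k))"
            by (rule power_int_diff) simp
          have te: "t powi (int n - 1 - (int (n - i0) - int (n - k))) = t powi (int n - 1) / t powi (int (n - i0) - int (n - k))"
            by (rule power_int_diff) simp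
          show ?thesis unfolding qe te by simp
        qed
        finally have e: "u 3 * (1 / X k) = p * (1 / (\<beta> True * \<beta> False * q powi (int m - (int c - int (\<nu> k))) * t powi (int n - 1 - (int (n - i0) - int (n - k)))))" .
        show "th (u 3 * (1 / X k)) \<noteq> 0"
          unfolding e theta_p_0 theta_inv_0
          by (rule gen_mult) (use \<nu>m[OF k(1)] N k i0 c in auto)
      qed
    next
      case False
      have yk: "yE n ?v E0 r = X k" using False k by (simp add: r y mem)
      show ?thesis unfolding yk
      proof (rule single_factor_nzI)
        show "th ((X k)\<^sup>2) \<noteq> 0" using lat_mult_nz[OF ok[OF k] ok[OF k]]
          by (simp add: X_def power2_eq_square)
        show "th (u 0 * X k) \<noteq> 0" "th (u 1 * X k) \<noteq> 0"
          using lat_mult_nz[OF ok0[of True] ok[OF k]] lat_mult_nz[OF ok0[of False] ok[OF k]]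
          by (simp_all add: u_def upar_simps X_def lat_def)
        have "(True, \<nu> k, n - k) \<noteq> (True, c, n - i0)" using False k i0 by auto
        then show "th (u 2 * X k) \<noteq> 0"
          using lat_div_nz[OF ok[OF k] okw] by (simp add: u_def upar_simps X_def w_def)
        have e: "u 3 * X k = p * (w * X k / (\<beta> True * \<beta> False * q powi (int m) * t powi (int n - 1)))"
          using n by (simp add: u_def upar_simps power_int_def nat_diff_distrib)
        have "w * X k / (\<beta> True * \<beta> False * q powi (int m) * t powi (int n - 1)) =
           \<beta> True / \<beta> False * q powi (int c + int (\<nu> k) - int m) * t powi (int (n - i0) + int (n - k) - (int n - 1))"
          unfolding w_def X_def lat_mult by (simp add: power_int_diff mult_ac)
        moreover have "th (\<beta> True / \<beta> False * q powi (int c + int (\<nu> k) - int m) * t powi (int (n - i0) + int (n - k) - (int n - 1))) \<noteq> 0"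
          by (rule gen_div) (use \<nu>m[OF k(1)] N k i0 c in auto)
        ultimately show "th (u 3 * X k) \<noteq> 0" unfolding e theta_p_0 by metis
      qed
    qed
    fix r' assume r': "r' \<in> set (config_rows n i)" "r \<noteq> r'"
    then obtain k' where r'e: "r' = (True, k')" and k': "1 \<le> k'" "k' \<le> n" using rw by blast
    have bnd: "2 * fst (snd (True, \<nu> k, n - k)) + 1 \<le> N" "2 * snd (snd (True, \<nu> k, n - k)) + 1 \<le> N"
      "2 * fst (snd (True, \<nu> k', n - k')) + 1 \<le> N" "2 * snd (snd (True, \<nu> k', n - k')) + 1 \<le> N"
      using \<nu>m[OF k(1)] \<nu>m[OF k'(1)] N by auto
    have mixed: "cross_factor t (X a * (1 / X b)) \<noteq> 0" if ab: "1 \<le> a" "a < i0" "i0 \<le> b" "b \<le> n"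
      for a b
    proof -
      have a: "a \<le> n" "1 \<le> b" using ab i0 by auto
      have "(True, \<nu> a, n - a) \<noteq> (True, \<nu> b, n - b)" using ab by auto
      then have "th (X a / X b) \<noteq> 0" unfolding X_def using lat_div_nz ok a ab by blast
      moreover have e: "t * (X a / X b) = q powi (int (\<nu> a) - int (\<nu> b)) * t powi (int (n - a) - int (n - b) + 1)"
        unfolding X_def lat_div by (simp add: power_int_add)
      have "th (t * (X a / X b)) \<noteq> 0"
        unfolding e by (rule gen_qt) (use \<nu>m[of a] \<nu>m[of b] N a ab in auto)
      ultimately show ?thesis by (simp add: cross_factor_def)
    qed
    consider "i0 \<le> k" "i0 \<le> k'" | "k < i0" "k' < i0" | "k < i0" "i0 \<le> k'" | "i0 \<le> k" "k' < i0"
      by linarith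
    then show "cross_factor t (yE n ?v E0 r * yE n ?v E0 r') \<noteq> 0"
    proof cases
      case 1
      then show ?thesis using cross_factor_lat_nz(2)[OF ok[OF k] ok[OF k'] bnd] k k'
        by (simp add: r r'e y mem X_def)
    next
      case 2
      then show ?thesis using cross_factor_lat_nz(1)[OF ok[OF k] ok[OF k'] bnd] k k'
        by (simp add: r r'e y mem X_def)
    next
      case 3
      then show ?thesis using mixed[of k k'] k k' by (simp add: r r'e y mem)
    next
      case 4
      then show ?thesis using mixed[of k' k] k k' by (simp add: r r'e y mem mult.commute)
    qed
  qed
  ultimately have "diff_op s t u f (ev lt (config n i ?v)) \<noteq> 0" using nz by simp
  then show ?thesis unfolding ev_suf_cfg using w by (intro exI[of _ w]) (simp add: i_def u_def \<nu>_def)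
qed

end

end

section \<open>Holomorphic functions on the torus\<close>

lemma torus_holo_const: "torus_holomorphic n (\<lambda>x. c)"
  unfolding torus_holomorphic_def
proof (intro ballI exI[of _ "\<lambda>_. 0"] allI impI)
  fix e :: real assume "e > 0"
  then show "\<exists>d>0. \<forall>y\<in>ctorus n. (\<forall>i\<in>{1..n}. cmod (y i - x i) < d) \<longrightarrow>
     cmod (c - c - (\<Sum>i = 1..n. 0 * (y i - x i))) \<le> e * (\<Sum>i = 1..n. cmod (y i - x i))" for x
    by (intro exI[of _ 1]) (simp add: sum_nonneg)
qed

lemma torus_holo_coord:
  assumes "i \<in> {1..n}"
  shows "torus_holomorphic n (\<lambda>x. x i)"
  unfolding torus_holomorphic_def
proof (intro ballI exI[of _ "\<lambda>j. if j = i then 1 else 0"] allI impI)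
  fix x and e :: real assume "e > 0"
  moreover have "(\<Sum>j = 1..n. (if j = i then 1 else 0) * (y j - x j)) = y i - x i"
    for y :: "nat \<Rightarrow> complex"
    using assms by (simp add: if_distrib[of "\<lambda>a. a * _"] sum.delta' cong: if_cong)
  ultimately show "\<exists>d>0. \<forall>y\<in>ctorus n. (\<forall>i\<in>{1..n}. cmod (y i - x i) < d) \<longrightarrow>
     cmod (y i - x i - (\<Sum>j = 1..n. (if j = i then 1 else 0) * (y j - x j))) \<le> e * (\<Sum>i = 1..n. cmod (y i - x i))"
    by (intro exI[of _ 1]) (simp add: sum_nonneg)
qed

lemma torus_holo_add:
  assumes "torus_holomorphic n f" "torus_holomorphic n g"
  shows "torus_holomorphic n (\<lambda>x. f x + g x)"
  unfolding torus_holomorphic_def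
proof (intro ballI)
  fix x assume x: "x \<in> ctorus n"
  obtain c where c: "\<And>e. e > 0 \<Longrightarrow> \<exists>d>0. \<forall>y\<in>ctorus n. (\<forall>i\<in>{1..n}. cmod (y i - x i) < d) \<longrightarrow>
     cmod (f y - f x - (\<Sum>i = 1..n. c i * (y i - x i))) \<le> e * (\<Sum>i = 1..n. cmod (y i - x i))"
    using assms(1) x unfolding torus_holomorphic_def by blast
  obtain c' where c': "\<And>e. e > 0 \<Longrightarrow> \<exists>d>0. \<forall>y\<in>ctorus n. (\<forall>i\<in>{1..n}. cmod (y i - x i) < d) \<longrightarrow>
     cmod (g y - g x - (\<Sum>i = 1..n. c' i * (y i - x i))) \<le> e * (\<Sum>i = 1..n. cmod (y i - x i))"
    using assms(2) x unfolding torus_holomorphic_def by blast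
  show "\<exists>c. \<forall>e>0. \<exists>d>0. \<forall>y\<in>ctorus n. (\<forall>i\<in>{1..n}. cmod (y i - x i) < d) \<longrightarrow>
     cmod (f y + g y - (f x + g x) - (\<Sum>i = 1..n. c i * (y i - x i))) \<le> e * (\<Sum>i = 1..n. cmod (y i - x i))"
  proof (intro exI[of _ "\<lambda>i. c i + c' i"] allI impI)
    fix e :: real assume e: "e > 0"
    obtain d where d: "d > 0" "\<And>y. y \<in> ctorus n \<Longrightarrow> (\<forall>i\<in>{1..n}. cmod (y i - x i) < d) \<Longrightarrow>
     cmod (f y - f x - (\<Sum>i = 1..n. c i * (y i - x i))) \<le> e / 2 * (\<Sum>i = 1..n. cmod (y i - x i))"
      using c[of "e / 2"] e by auto
    obtain d' where d': "d' > 0" "\<And>y. y \<in> ctorus n \<Longrightarrow> (\<forall>i\<in>{1..n}. cmod (y i - x i) < d') \<Longrightarrow>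
     cmod (g y - g x - (\<Sum>i = 1..n. c' i * (y i - x i))) \<le> e / 2 * (\<Sum>i = 1..n. cmod (y i - x i))"
      using c'[of "e / 2"] e by auto
    show "\<exists>d>0. \<forall>y\<in>ctorus n. (\<forall>i\<in>{1..n}. cmod (y i - x i) < d) \<longrightarrow>
     cmod (f y + g y - (f x + g x) - (\<Sum>i = 1..n. (c i + c' i) * (y i - x i))) \<le> e * (\<Sum>i = 1..n. cmod (y i - x i))"
    proof (intro exI[of _ "min d d'"] conjI ballI impI)
      fix y assume y: "y \<in> ctorus n" "\<forall>i\<in>{1..n}. cmod (y i - x i) < min d d'"
      have "f y + g y - (f x + g x) - (\<Sum>i = 1..n. (c i + c' i) * (y i - x i)) =
        (f y - f x - (\<Sum>i = 1..n. c i * (y i - x i))) + (g y - g x - (\<Sum>i = 1..n. c' i * (y i - x i)))"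
        by (simp add: distrib_right sum.distrib)
      also have "cmod \<dots> \<le> e / 2 * (\<Sum>i = 1..n. cmod (y i - x i)) + e / 2 * (\<Sum>i = 1..n. cmod (y i - x i))"
        by (rule order_trans[OF norm_triangle_ineq add_mono[OF d(2) d'(2)]]) (use y in auto)
      finally show "cmod (f y + g y - (f x + g x) - (\<Sum>i = 1..n. (c i + c' i) * (y i - x i))) \<le> e * (\<Sum>i = 1..n. cmod (y i - x i))"
        by simp
    qed (use d d' in auto)
  qed
qed

lemma torus_holo_comp:
  assumes g: "torus_holomorphic n g" and h: "h holomorphic_on U" "open U"
    and U: "\<And>x. x \<in> ctorus n \<Longrightarrow> g x \<in> U"
  shows "torus_holomorphic n (\<lambda>x. h (g x))"
  unfolding torus_holomorphic_def
proof (intro ballI)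
  fix x assume x: "x \<in> ctorus n"
  let ?S = "\<lambda>y. \<Sum>i = 1..n. cmod (y i - x i)"
  obtain c where c: "\<And>e. e > 0 \<Longrightarrow> \<exists>d>0. \<forall>y\<in>ctorus n. (\<forall>i\<in>{1..n}. cmod (y i - x i) < d) \<longrightarrow>
     cmod (g y - g x - (\<Sum>i = 1..n. c i * (y i - x i))) \<le> e * ?S y"
    using g x unfolding torus_holomorphic_def by blast
  have "(h has_field_derivative deriv h (g x)) (at (g x))"
    using holomorphic_derivI[OF h U[OF x]] .
  then have hd: "\<And>e. e > 0 \<Longrightarrow> \<exists>d>0. \<forall>w. cmod (w - g x) < d \<longrightarrow>
     cmod (h w - h (g x) - deriv h (g x) * (w - g x)) \<le> e * cmod (w - g x)"
    unfolding has_field_derivative_def has_derivative_at_alt by blast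
  define h' where "h' = deriv h (g x)"
  \<comment> \<open>A bounds the growth of g at x: the linear part contributes A - 1, and the error
    at most 1 because \<open>e2 \<le> 1\<close>.\<close>
  define A where "A = (\<Sum>i = 1..n. cmod (c i)) + 1"
  have A: "A \<ge> 1" by (simp add: A_def sum_nonneg)
  show "\<exists>c. \<forall>e>0. \<exists>d>0. \<forall>y\<in>ctorus n. (\<forall>i\<in>{1..n}. cmod (y i - x i) < d) \<longrightarrow>
     cmod (h (g y) - h (g x) - (\<Sum>i = 1..n. c i * (y i - x i))) \<le> e * ?S y"
  proof (intro exI[of _ "\<lambda>i. h' * c i"] allI impI)
    fix e :: real assume e: "e > 0"
    obtain d1 where d1: "d1 > 0" "\<And>w. cmod (w - g x) < d1 \<Longrightarrow>
       cmod (h w - h (g x) - h' * (w - g x)) \<le> e / (2 * A) * cmod (w - g x)"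
    proof -
      have "e / (2 * A) > 0" using e A by simp
      from hd[OF this] show ?thesis using that unfolding h'_def by blast
    qed
    define e2 where "e2 = min 1 (e / (2 * (cmod h' + 1)))"
    have h'1: "cmod h' + 1 > 0" using norm_ge_zero[of h'] by linarith
    have e2: "e2 > 0" "e2 \<le> 1" "cmod h' * e2 \<le> e / 2"
    proof -
      show "e2 > 0" "e2 \<le> 1" using e h'1 by (auto simp: e2_def)
      have "cmod h' * e2 \<le> (cmod h' + 1) * (e / (2 * (cmod h' + 1)))"
        by (intro mult_mono) (use e h'1 in \<open>auto simp: e2_def\<close>)
      also have "\<dots> = e / 2" using h'1 by (simp add: field_simps)
      finally show "cmod h' * e2 \<le> e / 2" .
    qed
    obtain d2 where d2: "d2 > 0" "\<And>y. y \<in> ctorus n \<Longrightarrow> (\<forall>i\<in>{1..n}. cmod (y i - x i) < d2) \<Longrightarrow>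
     cmod (g y - g x - (\<Sum>i = 1..n. c i * (y i - x i))) \<le> e2 * ?S y"
      using c[OF e2(1)] by blast
    \<comment> \<open>Ensures \<open>A * ?S y < d1\<close>; n + 1 instead of n keeps the denominator
      positive and the estimate strict also for n = 0.\<close>
    define d3 where "d3 = d1 / (A * (real n + 1))"
    have d3: "d3 > 0" using d1 A by (simp add: d3_def)
    show "\<exists>d>0. \<forall>y\<in>ctorus n. (\<forall>i\<in>{1..n}. cmod (y i - x i) < d) \<longrightarrow>
     cmod (h (g y) - h (g x) - (\<Sum>i = 1..n. h' * c i * (y i - x i))) \<le> e * ?S y"
    proof (intro exI[of _ "min d2 d3"] conjI ballI impI)
      fix y assume y: "y \<in> ctorus n" "\<forall>i\<in>{1..n}. cmod (y i - x i) < min d2 d3"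
      let ?L = "\<Sum>i = 1..n. c i * (y i - x i)"
      have S0: "0 \<le> ?S y" by (simp add: sum_nonneg)
      have r: "cmod (g y - g x - ?L) \<le> e2 * ?S y" using d2(2) y by simp
      have "cmod ?L \<le> (\<Sum>i = 1..n. cmod (c i) * cmod (y i - x i))"
        by (rule order_trans[OF norm_sum]) (simp add: norm_mult)
      also have "\<dots> \<le> (\<Sum>i = 1..n. cmod (c i) * ?S y)"
        by (intro sum_mono mult_left_mono member_le_sum) auto
      also have "\<dots> = (A - 1) * ?S y" by (simp add: A_def sum_distrib_right)
      finally have L: "cmod ?L \<le> (A - 1) * ?S y" .
      have "cmod (g y - g x) \<le> cmod (g y - g x - ?L) + cmod ?L"
        using norm_triangle_ineq[of "g y - g x - ?L" ?L] by simp
      also have "\<dots> \<le> 1 * ?S y + (A - 1) * ?S y"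
        using r L e2(2) S0 by (meson add_mono mult_right_mono order_trans)
      finally have gA: "cmod (g y - g x) \<le> A * ?S y" by (simp add: algebra_simps)
      have "?S y \<le> (\<Sum>i = 1..n. d3)" by (intro sum_mono) (use y in \<open>auto intro: less_imp_le\<close>)
      also have "\<dots> < (real n + 1) * d3" using d3 by simp
      finally have "A * ?S y < A * ((real n + 1) * d3)" using A by simp
      also have "\<dots> = d1" using A by (simp add: d3_def)
      finally have "cmod (g y - g x) < d1" using gA by simp
      then have "cmod (h (g y) - h (g x) - h' * (g y - g x)) \<le> e / (2 * A) * cmod (g y - g x)"
        by (rule d1(2))
      also have "\<dots> \<le> e / (2 * A) * (A * ?S y)"
        by (intro mult_left_mono gA) (use e A in auto)
      also have "\<dots> = e / 2 * ?S y" using A by simp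
      finally have 1: "cmod (h (g y) - h (g x) - h' * (g y - g x)) \<le> e / 2 * ?S y" .
      have "cmod (h' * (g y - g x - ?L)) \<le> cmod h' * (e2 * ?S y)"
        unfolding norm_mult by (intro mult_left_mono r) simp
      also have "\<dots> \<le> e / 2 * ?S y" using e2(3) S0 by (metis mult.assoc mult_right_mono)
      finally have 2: "cmod (h' * (g y - g x - ?L)) \<le> e / 2 * ?S y" .
      have "h (g y) - h (g x) - (\<Sum>i = 1..n. h' * c i * (y i - x i)) =
         (h (g y) - h (g x) - h' * (g y - g x)) + h' * (g y - g x - ?L)"
        by (simp add: algebra_simps sum_distrib_left)
      also have "cmod \<dots> \<le> e / 2 * ?S y + e / 2 * ?S y"
        by (rule order_trans[OF norm_triangle_ineq add_mono[OF 1 2]])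
      finally show "cmod (h (g y) - h (g x) - (\<Sum>i = 1..n. h' * c i * (y i - x i))) \<le> e * ?S y"
        by simp
    qed (use d2 d3 in auto)
  qed
qed

lemma torus_holo_cmul: "torus_holomorphic n f \<Longrightarrow> torus_holomorphic n (\<lambda>x. c * f x)"
  by (rule torus_holo_comp[where h = "\<lambda>w. c * w" and U = UNIV]) (auto intro!: holomorphic_intros)

text \<open>Polarization, 4 f g = (f + g)^2 - (f - g)^2, reduces products to squares, which are
  compositions with an entire function of one variable.\<close>

lemma torus_holo_mult:
  assumes f: "torus_holomorphic n f" and g: "torus_holomorphic n g"
  shows "torus_holomorphic n (\<lambda>x. f x * g x)"
proof -
  have sq: "torus_holomorphic n (\<lambda>x. (h x)\<^sup>2)" if "torus_holomorphic n h" for h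
    by (rule torus_holo_comp[OF that, where h = "\<lambda>w. w\<^sup>2" and U = UNIV]) (auto intro!: holomorphic_intros)
  have "torus_holomorphic n (\<lambda>x. 1 / 4 * (f x + g x)\<^sup>2 + - (1 / 4) * (f x + (- 1) * g x)\<^sup>2)"
    by (intro torus_holo_add torus_holo_cmul sq f g)
  moreover have "1 / 4 * (a + b)\<^sup>2 + - (1 / 4) * (a + (- 1) * b)\<^sup>2 = a * b" for a b :: complex
    by (simp add: power2_eq_square algebra_simps)
  ultimately show ?thesis by simp
qed

lemma torus_holo_sum: "finite I \<Longrightarrow> (\<And>i. i \<in> I \<Longrightarrow> torus_holomorphic n (f i)) \<Longrightarrow> torus_holomorphic n (\<lambda>x. \<Sum>i\<in>I. f i x)"
  by (induction I rule: finite_induct) (simp_all add: torus_holo_const torus_holo_add)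

lemma torus_holo_prod: "finite I \<Longrightarrow> (\<And>i. i \<in> I \<Longrightarrow> torus_holomorphic n (f i)) \<Longrightarrow> torus_holomorphic n (\<lambda>x. \<Prod>i\<in>I. f i x)"
  by (induction I rule: finite_induct) (simp_all add: torus_holo_const torus_holo_mult)

lemma torus_holo_cong:
  assumes "torus_holomorphic n f" "\<And>x. x \<in> ctorus n \<Longrightarrow> f x = g x"
  shows "torus_holomorphic n g"
  using assms(1) unfolding torus_holomorphic_def by (simp add: assms(2))

text \<open>Holomorphy along a curve \<open>v \<mapsto> (v c\<^sub>1 + d\<^sub>1, \<dots>)\<close>; it covers both single coordinates and
  lines through the origin.\<close>

lemma torus_holo_line:
  assumes f: "torus_holomorphic n f" and x: "\<And>v. v \<noteq> 0 \<Longrightarrow> x v \<in> ctorus n"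
    and lin: "\<And>v i. i \<in> {1..n} \<Longrightarrow> x v i = c i * v + d i"
  shows "(\<lambda>v. f (x v)) holomorphic_on - {0}"
  unfolding holomorphic_on_def
proof
  fix v0 :: complex assume "v0 \<in> - {0}"
  then have v0: "v0 \<noteq> 0" by simp
  obtain a where a: "\<And>e. e > 0 \<Longrightarrow> \<exists>\<delta>>0. \<forall>y\<in>ctorus n. (\<forall>i\<in>{1..n}. cmod (y i - x v0 i) < \<delta>) \<longrightarrow>
     cmod (f y - f (x v0) - (\<Sum>i = 1..n. a i * (y i - x v0 i))) \<le> e * (\<Sum>i = 1..n. cmod (y i - x v0 i))"
    using f x[OF v0] unfolding torus_holomorphic_def by blast
  define C where "C = (\<Sum>i = 1..n. cmod (c i)) + 1"
  have C: "C \<ge> 1" by (simp add: C_def sum_nonneg)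
  have diff: "x v i - x v0 i = c i * (v - v0)" if "i \<in> {1..n}" for v i
    using lin[OF that] by (simp add: algebra_simps)
  have "((\<lambda>v. f (x v)) has_field_derivative (\<Sum>i = 1..n. a i * c i)) (at v0)"
    unfolding has_field_derivative_def has_derivative_at_alt
  proof (intro conjI allI impI)
    show "bounded_linear ((*) (\<Sum>i = 1..n. a i * c i))" by (rule bounded_linear_mult_right)
    fix e :: real assume e: "e > 0"
    obtain \<delta> where \<delta>: "\<delta> > 0" "\<And>y. y \<in> ctorus n \<Longrightarrow> (\<forall>i\<in>{1..n}. cmod (y i - x v0 i) < \<delta>) \<Longrightarrow>
     cmod (f y - f (x v0) - (\<Sum>i = 1..n. a i * (y i - x v0 i))) \<le> e / C * (\<Sum>i = 1..n. cmod (y i - x v0 i))"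
      using a[of "e / C"] e C by auto
    show "\<exists>d>0. \<forall>v. cmod (v - v0) < d \<longrightarrow>
       cmod (f (x v) - f (x v0) - (\<Sum>i = 1..n. a i * c i) * (v - v0)) \<le> e * cmod (v - v0)"
    proof (intro exI[of _ "min (\<delta> / C) (cmod v0)"] conjI allI impI)
      show "0 < min (\<delta> / C) (cmod v0)" using \<delta> C v0 by auto
      fix v assume v: "cmod (v - v0) < min (\<delta> / C) (cmod v0)"
      then have vnz: "v \<noteq> 0" by auto
      have ci: "cmod (c i) \<le> C" if "i \<in> {1..n}" for i
      proof -
        have "cmod (c i) \<le> (\<Sum>i = 1..n. cmod (c i))" by (rule member_le_sum) (use that in auto)
        then show ?thesis by (simp add: C_def)
      qed
      have close: "cmod (x v i - x v0 i) < \<delta>" if "i \<in> {1..n}" for i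
      proof -
        have "cmod (x v i - x v0 i) \<le> C * cmod (v - v0)"
          unfolding diff[OF that] norm_mult by (intro mult_right_mono ci[OF that]) simp
        also have "\<dots> < \<delta>" using v C by (simp add: field_simps)
        finally show ?thesis .
      qed
      have eq: "(\<Sum>i = 1..n. a i * (x v i - x v0 i)) = (\<Sum>i = 1..n. a i * c i) * (v - v0)"
        unfolding sum_distrib_right by (intro sum.cong refl) (simp add: diff)
      have "(\<Sum>i = 1..n. cmod (x v i - x v0 i)) = (\<Sum>i = 1..n. cmod (c i)) * cmod (v - v0)"
        unfolding sum_distrib_right by (intro sum.cong refl) (simp add: diff norm_mult)
      also have "\<dots> \<le> C * cmod (v - v0)" by (intro mult_right_mono) (auto simp: C_def)
      finally have S: "(\<Sum>i = 1..n. cmod (x v i - x v0 i)) \<le> C * cmod (v - v0)" .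
      have "cmod (f (x v) - f (x v0) - (\<Sum>i = 1..n. a i * (x v i - x v0 i))) \<le> e / C * (\<Sum>i = 1..n. cmod (x v i - x v0 i))"
        using \<delta>(2) x[OF vnz] close by blast
      also have "\<dots> \<le> e / C * (C * cmod (v - v0))"
        by (intro mult_left_mono S) (use e C in auto)
      also have "e / C * (C * cmod (v - v0)) = e * cmod (v - v0)" using C by simp
      finally show "cmod (f (x v) - f (x v0) - (\<Sum>i = 1..n. a i * c i) * (v - v0)) \<le> e * cmod (v - v0)"
        unfolding eq .
    qed
  qed
  then show "(\<lambda>v. f (x v)) field_differentiable at v0 within - {0}"
    using field_differentiable_at_within field_differentiable_def by blast
qed

section \<open>Symmetric theta functions on the torus and on multisets\<close>

definition pt :: "nat \<Rightarrow> complex list \<Rightarrow> nat \<Rightarrow> complex" where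
  "pt n xs = (\<lambda>i\<in>{1..n}. xs ! (i - 1))"

text \<open>For multisets of size n without zero the ordering chosen is immaterial, by
  \<open>mset_fun_eq\<close>.\<close>

definition mset_fun :: "nat \<Rightarrow> ((nat \<Rightarrow> complex) \<Rightarrow> complex) \<Rightarrow> complex multiset \<Rightarrow> complex" where
  "mset_fun n f M = f (pt n (SOME xs. mset xs = M))"

lemma pt_ctorus: "length xs = n \<Longrightarrow> 0 \<notin> set xs \<Longrightarrow> pt n xs \<in> ctorus n"
proof -
  assume xs: "length xs = n" "0 \<notin> set xs"
  have "xs ! (i - 1) \<noteq> 0" if "i \<in> {1..n}" for i
  proof -
    have "i - 1 < length xs" using that xs(1) by auto
    then show ?thesis using xs(2) nth_mem by metis
  qed
  then show ?thesis by (auto simp: ctorus_def pt_def PiE_iff)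
qed

lemma BC_theta_perm:
  assumes f: "BC_theta n m p f" and xs: "length xs = n" "0 \<notin> set xs" "mset xs = mset ys"
  shows "f (pt n xs) = f (pt n ys)"
proof -
  obtain \<pi> where \<pi>: "\<pi> permutes {..<length ys}" "permute_list \<pi> ys = xs"
    using mset_eq_permutation[OF xs(3)] by blast
  have len: "length ys = n" using xs by (metis size_mset)
  have ys0: "0 \<notin> set ys" using xs by (metis set_mset_mset)
  \<comment> \<open>Conjugate of \<pi> by the shift between list positions 0 to n - 1 and
    coordinates 1 to n.\<close>
  define \<sigma> where "\<sigma> = (\<lambda>i. if i \<in> {1..n} then Suc (\<pi> (i - 1)) else i)"
  have \<pi>lt: "\<pi> i < n" if "i < n" for i using \<pi>(1) that len permutes_in_image[of \<pi> "{..<n}" i]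
    by simp
  have "bij_betw \<sigma> {1..n} {1..n}"
  proof (rule bij_betw_imageI)
    show inj: "inj_on \<sigma> {1..n}"
    proof (rule inj_onI)
      fix i j assume ij: "i \<in> {1..n}" "j \<in> {1..n}" "\<sigma> i = \<sigma> j"
      then have "\<pi> (i - 1) = \<pi> (j - 1)" by (simp add: \<sigma>_def)
      then have "i - 1 = j - 1" using permutes_inj[OF \<pi>(1)] by (simp add: inj_eq)
      then show "i = j" using ij by auto
    qed
    have "\<sigma> ` {1..n} \<subseteq> {1..n}"
    proof
      fix j assume "j \<in> \<sigma> ` {1..n}"
      then obtain i where i: "i \<in> {1..n}" "j = Suc (\<pi> (i - 1))" by (auto simp: \<sigma>_def)
      then have "\<pi> (i - 1) < n" by (intro \<pi>lt) auto
      then show "j \<in> {1..n}" using i by simp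
    qed
    then show "\<sigma> ` {1..n} = {1..n}" using inj by (intro endo_inj_surj) auto
  qed
  then have "\<sigma> permutes {1..n}" by (rule bij_imp_permutes) (simp add: \<sigma>_def del: atLeastAtMost_iff)
  then have "f (pt n ys \<circ> \<sigma>) = f (pt n ys)"
    using f pt_ctorus[OF len ys0] by (auto simp: BC_theta_def)
  moreover have "pt n ys \<circ> \<sigma> = pt n xs"
  proof
    fix i
    show "(pt n ys \<circ> \<sigma>) i = pt n xs i"
    proof (cases "i \<in> {1..n}")
      case True
      then have "i - 1 < n" by auto
      then have "\<pi> (i - 1) < n" by (rule \<pi>lt)
      then show ?thesis using True \<open>i - 1 < n\<close> \<pi> len
        by (auto simp: pt_def \<sigma>_def permute_list_nth[symmetric])
    qed (auto simp: pt_def \<sigma>_def)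
  qed
  ultimately show ?thesis by simp
qed

lemma mset_fun_eq:
  assumes "BC_theta n m p f" "length xs = n" "0 \<notin> set xs"
  shows "mset_fun n f (mset xs) = f (pt n xs)"
proof -
  have "mset (SOME ys. mset ys = mset xs) = mset xs" by (rule someI[of "\<lambda>ys. mset ys = mset xs"]) simp
  then show ?thesis unfolding mset_fun_def using BC_theta_perm[OF assms] by metis
qed

lemma pt_image: "pt n (map x [1..<n + 1]) = restrict x {1..n}"
  by (auto simp: pt_def restrict_def fun_eq_iff nth_map nth_upt simp del: upt_Suc)

lemma mset_fun_points:
  assumes "BC_theta n m p f" "x \<in> ctorus n"
  shows "mset_fun n f (mset (map x [1..<n + 1])) = f x"
proof -
  have nz: "x i \<noteq> 0" if "i \<in> {1..n}" for i using assms(2) that by (auto simp: ctorus_def PiE_iff)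
  have "mset_fun n f (mset (map x [1..<n + 1])) = f (pt n (map x [1..<n + 1]))"
    by (rule mset_fun_eq[OF assms(1)]) (use nz in fastforce)+
  also have "pt n (map x [1..<n + 1]) = x"
    unfolding pt_image using assms(2) by (auto simp: ctorus_def PiE_restrict)
  finally show ?thesis .
qed

context nome
begin

lemma mset_fun_sym_theta:
  assumes f: "BC_theta n m p f"
  shows "sym_theta n m (mset_fun n f)"
  unfolding sym_theta_def
proof (intro allI impI)
  fix M :: "complex multiset" assume M: "size M + 1 = n" "0 \<notin># M"
  obtain xs where xs: "mset xs = M" using ex_mset by blast
  have len: "length xs + 1 = n" using xs M by (metis size_mset)
  have xnz: "0 \<notin> set xs" using M xs by auto
  define X where "X = (\<lambda>z. pt n (z # xs))"
  have X: "X z \<in> ctorus n" if "z \<noteq> 0" for z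
    unfolding X_def by (rule pt_ctorus) (use that len xnz in auto)
  have mfX: "mset_fun n f (add_mset z M) = f (X z)" if "z \<noteq> 0" for z
    using mset_fun_eq[OF f, of "z # xs"] that len xnz by (simp add: X_def xs)
  have n1: "1 \<in> {1..n}" using len by simp
  have upd: "(X z)(1 := w) = X w" for z w
    using n1 by (auto simp: X_def pt_def fun_eq_iff nth_Cons')
  have X1: "X z 1 = z" for z using n1 by (simp add: X_def pt_def)
  \<comment> \<open>Coordinate i > 1 of \<open>z # xs\<close> is entry \<open>i - 2\<close> of xs:
    one off for the head, one for counting from 0.\<close>
  have H: "(\<lambda>z. f (X z)) holomorphic_on - {0}"
  proof (rule torus_holo_line[where n = n and f = f and x = X and c = "\<lambda>i. if i = 1 then 1 else 0" and d = "\<lambda>i. if i = 1 then 0 else xs ! (i - 2)"])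
    show "torus_holomorphic n f" using f by (simp add: BC_theta_def)
    show "X v i = (if i = 1 then 1 else 0) * v + (if i = 1 then 0 else xs ! (i - 2))" if "i \<in> {1..n}" for v i
      using that by (auto simp: X_def pt_def nth_Cons' numeral_2_eq_2)
  qed (use X in auto)
  show "BC1 m (\<lambda>z. mset_fun n f (add_mset z M))"
    unfolding BC1_def
  proof (intro conjI allI impI)
    show "(\<lambda>z. mset_fun n f (add_mset z M)) holomorphic_on - {0}"
      by (rule holomorphic_transform[OF H]) (use mfX in auto)
    fix z :: complex assume z: "z \<noteq> 0"
    have "f ((X z)(1 := 1 / X z 1)) = f (X z)" using f X[OF z] n1 by (auto simp: BC_theta_def)
    then have "f (X (1 / z)) = f (X z)" unfolding upd X1 .
    then show "mset_fun n f (add_mset (1 / z) M) = mset_fun n f (add_mset z M)" using z by (simp add: mfX)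
    have "f ((X z)(1 := p * X z 1)) = (p * (X z 1)\<^sup>2) powi (- int m) * f (X z)"
      using f X[OF z] unfolding BC_theta_def by blast
    then have "f (X (p * z)) = inverse ((p * z\<^sup>2) ^ m) * f (X z)"
      unfolding upd X1 by (simp only: power_int_minus power_int_of_nat)
    then show "(p * z\<^sup>2) ^ m * mset_fun n f (add_mset (p * z) M) = mset_fun n f (add_mset z M)"
      using z by (simp add: mfX)
  qed
qed

text \<open>Coordinates are replaced one at a time by generic ones, until the point is good;
  holomorphy in the replaced coordinate carries the vanishing back.\<close>

lemma sym_theta_eq_0:
  assumes f: "sym_theta n m f" and z: "\<And>M. size M = n \<Longrightarrow> good M \<Longrightarrow> f M = 0"
    and M: "size M = n" "0 \<notin># M"
  shows "f M = 0"
proof -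
  have "f (A + B) = 0" if "size A + size B = n" "good A" "0 \<notin># B" for A B
    using that
  proof (induction B arbitrary: A)
    case (add x B)
    let ?\<phi> = "\<lambda>w. f (add_mset w (A + B))"
    have A0: "0 \<notin># A" using add.prems good_nz by blast
    have \<phi>: "BC1 m ?\<phi>" using f add.prems A0 by (auto simp: sym_theta_def)
    let ?B = "{w. w \<noteq> 0 \<and> th (w\<^sup>2) = 0} \<union> (\<Union>y\<in>set_mset A. {w. w \<noteq> 0 \<and> \<not> inequiv w y})"
    have "?\<phi> x = 0"
    proof (rule holomorphic_eq_0_off_countable[OF BC1_holo[OF \<phi>]])
      show "countable ?B"
        by (intro countable_Un countable_UN countable_theta_square countable_not_inequiv countable_finite) auto
      fix w assume "w \<noteq> 0" "w \<notin> ?B"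
      then have "good (add_mset w A)" using add.prems by (auto simp: good_add)
      then have "f (add_mset w A + B) = 0" using add by (intro add.IH) auto
      then show "?\<phi> w = 0" by simp
    qed (use add.prems in auto)
    then show ?case by simp
  qed (use z in auto)
  from this[of "{#}" M] show ?thesis using M by simp
qed

end

section \<open>A homogeneous linear system with more unknowns than equations\<close>

lemma nontrivial_kernel:
  fixes c :: "'j \<Rightarrow> 'i \<Rightarrow> 'a :: field"
  assumes "finite J" "finite I" "card J < card I"
  shows "\<exists>x. (\<exists>i\<in>I. x i \<noteq> 0) \<and> (\<forall>j\<in>J. (\<Sum>i\<in>I. c j i * x i) = 0)"
  using assms
proof (induction J arbitrary: I c rule: finite_induct)
  case empty
  then have "I \<noteq> {}" by auto
  then show ?case by (intro exI[of _ "\<lambda>_. 1"]) auto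
next
  case (insert j J)
  show ?case
  proof (cases "\<exists>k\<in>I. c j k \<noteq> 0")
    case False
    have "card J < card I" using insert.prems insert.hyps by simp
    then obtain x where "\<exists>i\<in>I. x i \<noteq> 0" "\<forall>j\<in>J. (\<Sum>i\<in>I. c j i * x i) = 0"
      using insert.IH[OF insert.prems(1), of c] by blast
    then show ?thesis using False by (intro exI[of _ x]) auto
  next
    case True
    then obtain k where k: "k \<in> I" "c j k \<noteq> 0" by blast
    define I' where "I' = I - {k}"
    have I: "I = insert k I'" "k \<notin> I'" "finite I'" using k insert.prems by (auto simp: I'_def)
    \<comment> \<open>Gaussian elimination: equation j is solved for the unknown k and substituted
      into the others.\<close>
    define c' where "c' = (\<lambda>l i. c l i - c l k * c j i / c j k)"
    have "card J < card I'" using insert I by simp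
    then obtain x where x: "\<exists>i\<in>I'. x i \<noteq> 0" "\<forall>l\<in>J. (\<Sum>i\<in>I'. c' l i * x i) = 0"
      using insert.IH[OF I(3), of c'] by blast
    define y where "y = x(k := - (\<Sum>i\<in>I'. c j i * x i) / c j k)"
    have sum: "(\<Sum>i\<in>I. c l i * y i) = c l k * (- (\<Sum>i\<in>I'. c j i * x i) / c j k) + (\<Sum>i\<in>I'. c l i * x i)"
      for l
    proof -
      have "(\<Sum>i\<in>I'. c l i * y i) = (\<Sum>i\<in>I'. c l i * x i)"
        by (rule sum.cong) (use I in \<open>auto simp: y_def\<close>)
      then show ?thesis using I by (simp add: y_def)
    qed
    have "(\<Sum>i\<in>I. c l i * y i) = 0" if l: "l \<in> J" for l
    proof -
      have "(\<Sum>i\<in>I'. c' l i * x i) = (\<Sum>i\<in>I'. c l i * x i) - (\<Sum>i\<in>I'. c l k * c j i / c j k * x i)"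
        by (simp add: c'_def left_diff_distrib sum_subtractf)
      also have "(\<Sum>i\<in>I'. c l k * c j i / c j k * x i) = c l k * ((\<Sum>i\<in>I'. c j i * x i) / c j k)"
        by (simp add: sum_distrib_left sum_divide_distrib algebra_simps)
      finally show ?thesis using x(2) l unfolding sum by (simp add: algebra_simps)
    qed
    moreover have "(\<Sum>i\<in>I. c j i * y i) = 0" unfolding sum using k by simp
    moreover have "\<exists>i\<in>I. y i \<noteq> 0" using x(1) I by (auto simp: y_def)
    ultimately show ?thesis by (intro exI[of _ y]) auto
  qed
qed

section \<open>Existence of functions vanishing off one partition\<close>

lemma is_partition_mono:
  assumes "is_partition \<mu>" "1 \<le> k" "k \<le> k'"
  shows "\<mu> k' \<le> \<mu> k"
  using assms(3,2)
proof (induction k' rule: dec_induct)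
  case (step j)
  then show ?case using assms(1) unfolding is_partition_def by (metis le_trans)
qed simp

lemma mem_subpartitions_rect:
  "\<mu> \<in> subpartitions (rect_part m n) \<longleftrightarrow> is_partition \<mu> \<and> (\<forall>k. 1 \<le> k \<longrightarrow> k \<le> n \<longrightarrow> \<mu> k \<le> m) \<and> (\<forall>k>n. \<mu> k = 0)"
proof -
  have "diagram \<mu> \<subseteq> diagram (rect_part m n) \<longleftrightarrow> (\<forall>k. 1 \<le> k \<longrightarrow> \<mu> k \<le> rect_part m n k)"
  proof
    assume a: "diagram \<mu> \<subseteq> diagram (rect_part m n)"
    show "\<forall>k. 1 \<le> k \<longrightarrow> \<mu> k \<le> rect_part m n k"
    proof (intro allI impI)
      fix k :: nat assume k: "1 \<le> k"
      show "\<mu> k \<le> rect_part m n k"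
      proof (cases "\<mu> k = 0")
        case False
        then have "(k, \<mu> k) \<in> diagram \<mu>" using k by (simp add: diagram_def)
        then have "(k, \<mu> k) \<in> diagram (rect_part m n)" using a by blast
        then show ?thesis by (simp add: diagram_def)
      qed simp
    qed
  next
    assume a: "\<forall>k. 1 \<le> k \<longrightarrow> \<mu> k \<le> rect_part m n k"
    have "j \<le> rect_part m n i" if "1 \<le> i" "j \<le> \<mu> i" for i j
      using a[rule_format, OF that(1)] that(2) by (rule order_trans[rotated])
    then show "diagram \<mu> \<subseteq> diagram (rect_part m n)" by (auto simp: diagram_def)
  qed
  also have "\<dots> \<longleftrightarrow> (\<forall>k. 1 \<le> k \<longrightarrow> k \<le> n \<longrightarrow> \<mu> k \<le> m) \<and> (\<forall>k>n. \<mu> k = 0)"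
  proof
    assume a: "\<forall>k. 1 \<le> k \<longrightarrow> \<mu> k \<le> rect_part m n k"
    show "(\<forall>k. 1 \<le> k \<longrightarrow> k \<le> n \<longrightarrow> \<mu> k \<le> m) \<and> (\<forall>k>n. \<mu> k = 0)"
    proof (intro conjI allI impI)
      fix k
      show "\<mu> k \<le> m" if "1 \<le> k" "k \<le> n" using a[rule_format, of k] that
        by (simp add: rect_part_def)
      show "\<mu> k = 0" if "n < k" using a[rule_format, of k] that by (simp add: rect_part_def)
    qed
  next
    assume a: "(\<forall>k. 1 \<le> k \<longrightarrow> k \<le> n \<longrightarrow> \<mu> k \<le> m) \<and> (\<forall>k>n. \<mu> k = 0)"
    show "\<forall>k. 1 \<le> k \<longrightarrow> \<mu> k \<le> rect_part m n k"
    proof (intro allI impI)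
      fix k :: nat assume "1 \<le> k"
      then show "\<mu> k \<le> rect_part m n k" using a by (cases "k \<le> n") (simp_all add: rect_part_def)
    qed
  qed
  finally show ?thesis by (simp only: subpartitions_def mem_Collect_eq)
qed

lemma finite_subpartitions_rect: "finite (subpartitions (rect_part m n))"
proof (rule finite_subset)
  show "subpartitions (rect_part m n) \<subseteq> {f. \<forall>x. (x \<in> {1..n} \<longrightarrow> f x \<in> {..m}) \<and> (x \<notin> {1..n} \<longrightarrow> f x = 0)}"
    unfolding mem_subpartitions_rect subset_iff by (auto simp: is_partition_def not_le)
  show "finite {f. \<forall>x. (x \<in> {1..n} \<longrightarrow> f x \<in> {..m}) \<and> (x \<notin> {1..n} \<longrightarrow> f x = (0::nat))}"
    by (rule finite_set_of_finite_funs) auto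
qed

lemma partition_perm_eq:
  assumes \<mu>: "\<mu> \<in> subpartitions (rect_part m n)" and \<nu>: "\<nu> \<in> subpartitions (rect_part m n)"
    and \<pi>: "\<pi> permutes {1..n}" and eq: "\<And>i. i \<in> {1..n} \<Longrightarrow> \<mu> (\<pi> i) = \<nu> i"
  shows "\<mu> = \<nu>"
proof -
  have srt: "sorted (rev (map \<nu> [1..<n + 1]))" if "\<nu> \<in> subpartitions (rect_part m n)" for \<nu>
    unfolding sorted_wrt_rev sorted_wrt_map
  proof (rule sorted_wrt_mono_rel[OF _ sorted_wrt_upt])
    fix x y assume "x \<in> set [1..<n + 1]" "y \<in> set [1..<n + 1]" "x < y"
    then show "\<nu> y \<le> \<nu> x"
      using that by (intro is_partition_mono[of \<nu>]) (auto simp: mem_subpartitions_rect)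
  qed
  have "mset (map \<nu> [1..<n + 1]) = image_mset \<nu> (mset_set {1..n})"
    by (simp add: mset_map mset_upt atLeastLessThanSuc_atLeastAtMost del: upt_Suc)
  also have "\<dots> = image_mset \<mu> (image_mset \<pi> (mset_set {1..n}))"
    unfolding multiset.map_comp using eq by (intro image_mset_cong) auto
  also have "image_mset \<pi> (mset_set {1..n}) = mset_set {1..n}"
    using \<pi> by (simp add: image_mset_mset_set permutes_inj_on permutes_image)
  also have "image_mset \<mu> (mset_set {1..n}) = mset (map \<mu> [1..<n + 1])"
    by (simp add: mset_map mset_upt atLeastLessThanSuc_atLeastAtMost del: upt_Suc)
  finally have "mset (rev (map \<nu> [1..<n + 1])) = mset (rev (map \<mu> [1..<n + 1]))" by (simp only: mset_rev)
  then have "rev (map \<nu> [1..<n + 1]) = rev (map \<mu> [1..<n + 1])"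
    using properties_for_sort srt[OF \<mu>] srt[OF \<nu>] by metis
  then have "map \<nu> [1..<n + 1] = map \<mu> [1..<n + 1]" by (simp only: rev_is_rev_conv)
  then have "\<nu> i = \<mu> i" if "1 \<le> i" "i \<le> n" for i using that by (simp add: map_eq_conv del: upt_Suc)
  moreover have "\<nu> i = \<mu> i" if "i = 0 \<or> n < i" for i using that \<mu> \<nu>
    by (auto simp: mem_subpartitions_rect is_partition_def)
  ultimately show ?thesis by (metis ext not_less One_nat_def Suc_leI neq0_conv)
qed

context lattice
begin

abbreviation vp :: "nat \<Rightarrow> nat \<Rightarrow> (nat \<Rightarrow> nat) \<Rightarrow> (nat \<Rightarrow> nat) \<Rightarrow> nat \<Rightarrow> complex" where
  "vp m n lam \<mu> \<equiv> vanishing_point m n lam \<mu> (\<beta> True) (\<beta> False) q t"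

lemma vp_ctorus: "vp m n lam \<mu> \<in> ctorus n"
  by (auto simp: vanishing_point_def ctorus_def PiE_iff)

text \<open>Rows 1 to r of \<mu> come from the side False as complements in the rectangle, the later
  rows from the side True. The cut r is the split index: for \<open>lower\<close>, rows up to r
  equal m and row r + 1 is below m; for \<open>upper\<close>, row r is the last one that differs
  from \<open>lam\<close>.\<close>

lemma config_vp:
  assumes lam: "lam \<in> subpartitions (rect_part m n)"
    and d: "descending n i v" and isum: "i True + i False = n + 2"
    and lu: "lower m n lam i v \<or> upper m n lam i v"
  shows "\<exists>\<mu>\<in>subpartitions (rect_part m n). \<mu> \<noteq> lam \<and> mset (map (vp m n lam \<mu>) [1..<n + 1]) = ev lt (config n i v)"
proof -
  note lamr = lam[unfolded mem_subpartitions_rect]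
  have ib: "1 \<le> i c" "i c \<le> n + 1" for c using d by (auto simp: descending_def)
  define r where "r = i True - 1"
  have iT: "i True = r + 1" "r \<le> n" using ib[of True] by (auto simp: r_def)
  have iF: "i False = n + 1 - r" using isum iT by simp
  define \<mu> where "\<mu> = (\<lambda>k. if k = 0 \<or> n < k then 0 else if k \<le> r then m - v False (n + 1 - k) else v True k)"
  have vF: "v False k \<le> v False (i False)" if "i False \<le> k" "k \<le> n" for k using d that
    by (auto simp: descending_def)
  have vT: "v True k' \<le> v True k" if "i True \<le> k" "k \<le> k'" "k' \<le> n" for k k' using d that
    by (auto simp: descending_def)
  have vFm: "v False k \<le> m" if "i False \<le> k" "k \<le> n" for k
    using lu vF[OF that] that by (auto simp: lower_def upper_def)
  have vTm: "v True k \<le> m" if "i True \<le> k" "k \<le> n" for k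
    using lu vT[of "i True" k] that lamr ib[of True] by (auto simp: lower_def upper_def)
  have top: "v True (r + 1) \<le> \<mu> r" if "1 \<le> r" "r < n"
  proof (rule disjE[OF lu])
    assume "lower m n lam i v"
    then show ?thesis using that iF iT by (auto simp: lower_def \<mu>_def)
  next
    assume u: "upper m n lam i v"
    then have "v False (n + 1 - r) < m - lam r" "v True (r + 1) = lam (r + 1)" using that iF iT
      by (auto simp: upper_def)
    moreover have "lam (r + 1) \<le> lam r" using is_partition_mono[of lam r "r + 1"] lamr that by simp
    ultimately show ?thesis using that by (simp add: \<mu>_def)
  qed
  have "\<mu> (Suc k) \<le> \<mu> k" if "1 \<le> k" for k
  proof -
    consider "n \<le> k" | "k < n" "k < r" | "k < n" "k = r" | "k < n" "r < k" by linarith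
    then show ?thesis
    proof cases
      case 2
      then have "v False (n + 1 - k) \<le> v False (n + 1 - Suc k)"
        using d iF that iT(2) unfolding descending_def
        by (metis diff_le_mono2 diff_le_self le_SucI le_diff_conv2 Suc_eq_plus1 Suc_leI add_le_mono1 diff_Suc_1 diff_Suc_eq_diff_pred not_less_eq_eq)
      then show ?thesis using 2 that by (simp add: \<mu>_def)
    next
      case 3 then show ?thesis using top that by (simp add: \<mu>_def)
    next
      case 4 then show ?thesis using vT[of k "Suc k"] iT that by (simp add: \<mu>_def)
    qed (simp add: \<mu>_def)
  qed
  moreover have "finite {k. \<mu> k \<noteq> 0}"
    by (rule finite_subset[of _ "{..n}"]) (auto simp: \<mu>_def split: if_splits)
  ultimately have "is_partition \<mu>" by (simp add: is_partition_def \<mu>_def)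
  moreover have "\<mu> k \<le> m" if "1 \<le> k" "k \<le> n" for k using that vTm[of k] iT
    by (auto simp: \<mu>_def)
  ultimately have \<mu>: "\<mu> \<in> subpartitions (rect_part m n)"
    by (auto simp: mem_subpartitions_rect \<mu>_def)
  have split: "\<mu> \<noteq> lam \<and> split_index m n lam \<mu> = r"
  proof (rule disjE[OF lu])
    assume low: "lower m n lam i v"
    then obtain l where l: "i True \<le> l" "l \<le> n" "v True l < lam l" "\<And>k. l < k \<Longrightarrow> k \<le> n \<Longrightarrow> v True k = lam k"
      by (auto simp: lower_def)
    have \<mu>l: "\<mu> l < lam l" using l iT by (auto simp: \<mu>_def)
    have "Max {k \<in> {1..n}. \<mu> k \<noteq> lam k} = l"
    proof (rule Max_eqI)
      fix k assume "k \<in> {k \<in> {1..n}. \<mu> k \<noteq> lam k}"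
      then show "k \<le> l" using l(4)[of k] iT l(1) by (cases "k \<le> l") (auto simp: \<mu>_def)
    qed (use \<mu>l l iT in auto)
    moreover have "Max (insert 0 {k \<in> {1..n}. \<mu> k = m}) = r"
    proof (rule Max_eqI)
      fix k assume k: "k \<in> insert 0 {k \<in> {1..n}. \<mu> k = m}"
      show "k \<le> r"
      proof (rule ccontr)
        assume "\<not> k \<le> r"
        then have "\<mu> k = v True k" "v True k \<le> v True (i True)" "\<mu> k = m" using k vT[of "i True" k] iT
          by (auto simp: \<mu>_def)
        then show False using low by (simp add: lower_def)
      qed
    next
      have "\<mu> r = m" if "1 \<le> r" using low that iF iT by (simp add: \<mu>_def lower_def)
      then show "r \<in> insert 0 {k \<in> {1..n}. \<mu> k = m}" using iT by (cases "r = 0") auto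
    qed simp
    ultimately show ?thesis using \<mu>l by (auto simp: split_index_def Let_def)
  next
    assume up: "upper m n lam i v"
    have "i False \<le> n" using up by (simp add: upper_def)
    then have r1: "1 \<le> r" using iF iT(2) by linarith
    have \<mu>r: "lam r < \<mu> r" using up iF iT r1 by (auto simp: upper_def \<mu>_def)
    have "Max {k \<in> {1..n}. \<mu> k \<noteq> lam k} = r"
    proof (rule Max_eqI)
      fix k assume k: "k \<in> {k \<in> {1..n}. \<mu> k \<noteq> lam k}"
      show "k \<le> r"
      proof (rule ccontr)
        assume "\<not> k \<le> r"
        then have "\<mu> k = lam k" using up iT k by (auto simp: upper_def \<mu>_def)
        then show False using k by simp
      qed
    qed (use \<mu>r r1 iT in auto)
    then show ?thesis using \<mu>r by (auto simp: split_index_def Let_def)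
  qed
  have "mset (map (vp m n lam \<mu>) [1..<n + 1]) = mset (map (vp m n lam \<mu>) [1..<r + 1]) + mset (map (vp m n lam \<mu>) [r + 1..<n + 1])"
    using iT upt_add_eq_append[of 1 "r + 1" "n - r"] by (simp del: upt_Suc)
  also have "map (vp m n lam \<mu>) [r + 1..<n + 1] = map (\<lambda>k. lt (True, v True k, n - k)) [i True..<n + 1]"
    unfolding iT using split by (intro map_cong refl) (auto simp: vanishing_point_def lat_def \<mu>_def)
  also have "mset (map (vp m n lam \<mu>) [1..<r + 1]) = image_mset (vp m n lam \<mu>) (mset_set {1..<r + 1})"
    by (simp only: mset_map mset_upt)
  also have "\<dots> = image_mset (\<lambda>k. lt (False, v False (n + 1 - k), n - (n + 1 - k))) (mset_set {1..<r + 1})"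
  proof (rule image_mset_cong)
    fix k assume "k \<in># mset_set {1..<r + 1}"
    then have k: "1 \<le> k" "k \<le> r" by auto
    have "v False (n + 1 - k) \<le> m" using k iF iT by (intro vFm) auto
    then have "m - \<mu> k = v False (n + 1 - k)" using k iT by (simp add: \<mu>_def)
    moreover have "k - 1 = n - (n + 1 - k)" using k iT by simp
    ultimately show "vp m n lam \<mu> k = lt (False, v False (n + 1 - k), n - (n + 1 - k))"
      using k iT split by (simp add: vanishing_point_def lat_def)
  qed
  also have "\<dots> = image_mset (\<lambda>k. lt (False, v False k, n - k)) (image_mset (\<lambda>k. n + 1 - k) (mset_set {1..<r + 1}))"
    by (simp add: multiset.map_comp o_def)
  also have "image_mset (\<lambda>k. n + 1 - k) (mset_set {1..<r + 1}) = mset_set ((\<lambda>k. n + 1 - k) ` {1..<r + 1})"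
    by (rule image_mset_mset_set) (use iT in \<open>auto simp: inj_on_def\<close>)
  also have "(\<lambda>k. n + 1 - k) ` {1..<r + 1} = {i False..<n + 1}"
  proof
    show "{i False..<n + 1} \<subseteq> (\<lambda>k. n + 1 - k) ` {1..<r + 1}"
    proof
      fix k assume "k \<in> {i False..<n + 1}"
      then have "k = n + 1 - (n + 1 - k)" "n + 1 - k \<in> {1..<r + 1}" using iF iT by auto
      then show "k \<in> (\<lambda>k. n + 1 - k) ` {1..<r + 1}" by blast
    qed
  qed (use iF iT in auto)
  also have "image_mset (\<lambda>k. lt (False, v False k, n - k)) (mset_set {i False..<n + 1}) = mset (map (\<lambda>k. lt (False, v False k, n - k)) [i False..<n + 1])"
    by (simp only: mset_map mset_upt)
  finally have "mset (map (vp m n lam \<mu>) [1..<n + 1]) = ev lt (config n i v)"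
    unfolding ev_cfg config_rows_def by (simp add: add.commute o_def del: upt_Suc)
  then show ?thesis using \<mu> split by blast
qed

lemma weak_of_vp:
  assumes f: "BC_theta n m p f" and lam: "lam \<in> subpartitions (rect_part m n)"
    and vanishes: "\<And>\<mu>. \<mu> \<in> subpartitions (rect_part m n) \<Longrightarrow> \<mu> \<noteq> lam \<Longrightarrow> f (vp m n lam \<mu>) = 0"
  shows "weak m n lam (mset_fun n f)"
  unfolding weak_def
proof (intro allI impI)
  fix i v assume a: "descending n i v" "i True + i False = n + 2" "lower m n lam i v \<or> upper m n lam i v"
  obtain \<mu> where \<mu>: "\<mu> \<in> subpartitions (rect_part m n)" "\<mu> \<noteq> lam"
    "mset (map (vp m n lam \<mu>) [1..<n + 1]) = ev lt (config n i v)"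
    using config_vp[OF lam a] by blast
  have "mset_fun n f (mset (map (vp m n lam \<mu>) [1..<n + 1])) = f (vp m n lam \<mu>)"
    by (rule mset_fun_points[OF f vp_ctorus])
  then show "mset_fun n f (ev lt (config n i v)) = 0" using \<mu> vanishes by metis
qed

text \<open>Lagrange functions of degree m in one variable, at the m + 1 nodes a q^k with k from 0
  to m, where a is \<open>\<beta> True\<close>.\<close>

definition lagr :: "nat \<Rightarrow> nat \<Rightarrow> complex \<Rightarrow> complex" where
  "lagr m j z = 1 / (\<Prod>k\<in>{..m} - {j}. th (lt (True, k, 0) * lt (True, j, 0)) * th (lt (True, k, 0) / lt (True, j, 0))) *
     (\<Prod>k\<in>{..m} - {j}. th (lt (True, k, 0) * z) * th (lt (True, k, 0) / z))"

lemma lagr_BC1: "j \<le> m \<Longrightarrow> BC1 m (lagr m j)"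
proof -
  assume j: "j \<le> m"
  have "BC1 (card ({..m} - {j})) (\<lambda>z. \<Prod>k\<in>{..m} - {j}. th (lt (True, k, 0) * z) * th (lt (True, k, 0) / z))"
    by (rule BC1_theta_prod) auto
  moreover have "card ({..m} - {j}) = m" using j by simp
  ultimately have "BC1 m (\<lambda>z. \<Prod>k\<in>{..m} - {j}. th (lt (True, k, 0) * z) * th (lt (True, k, 0) / z))"
    by simp
  from BC1_lincomb[OF this this, where c = "1 / (\<Prod>k\<in>{..m} - {j}. th (lt (True, k, 0) * lt (True, j, 0)) * th (lt (True, k, 0) / lt (True, j, 0)))" and d = 0]
  show ?thesis by (simp add: lagr_def[abs_def])
qed

lemma lagr_node:
  assumes N: "2 * m \<le> N" and j: "j \<le> m" "k \<le> m"
  shows "lagr m j (lt (True, k, 0)) = (if j = k then 1 else 0)"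
proof (cases "j = k")
  case True
  have "th (lt (True, k', 0) * lt (True, k, 0)) * th (lt (True, k', 0) / lt (True, k, 0)) \<noteq> 0"
    if "k' \<in> {..m} - {k}" for k'
    using lat_mult_nz[of "(True, k', 0)" "(True, k, 0)"] lat_div_nz[of "(True, k', 0)" "(True, k, 0)"] that N j
    by (auto simp: in_range_def)
  then have "(\<Prod>k'\<in>{..m} - {k}. th (lt (True, k', 0) * lt (True, k, 0)) * th (lt (True, k', 0) / lt (True, k, 0))) \<noteq> 0"
    by (simp add: prod_zero_iff)
  then show ?thesis using True by (simp add: lagr_def)
next
  case False
  then have "k \<in> {..m} - {j}" using j by simp
  then have "(\<Prod>k'\<in>{..m} - {j}. th (lt (True, k', 0) * lt (True, k, 0)) * th (lt (True, k', 0) / lt (True, k, 0))) = 0"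
    by (intro prod_zero bexI[of _ k]) auto
  then show ?thesis using False by (simp add: lagr_def)
qed

text \<open>Symmetrized products of Lagrange functions. Up to positive integers they are dual to the
  nodes indexed by the partitions in the rectangle, see \<open>msym_node\<close>, so there are as
  many independent functions as partitions.\<close>

definition msym :: "nat \<Rightarrow> nat \<Rightarrow> (nat \<Rightarrow> nat) \<Rightarrow> (nat \<Rightarrow> complex) \<Rightarrow> complex" where
  "msym m n \<mu> x = (\<Sum>\<pi>\<in>{\<pi>. \<pi> permutes {1..n}}. \<Prod>i=1..n. lagr m (\<mu> (\<pi> i)) (x i))"

lemma msym_BC_theta:
  assumes I: "finite I" "\<And>\<mu>. \<mu> \<in> I \<Longrightarrow> \<mu> \<in> subpartitions (rect_part m n)" and n: "1 \<le> n"
  shows "BC_theta n m p (\<lambda>x\<in>ctorus n. \<Sum>\<mu>\<in>I. X \<mu> * msym m n \<mu> x)"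
proof -
  have fin: "finite {\<pi>. \<pi> permutes {1..n}}" by (rule finite_permutations) simp
  have le: "\<mu> (\<pi> i) \<le> m" if "\<mu> \<in> I" "\<pi> permutes {1..n}" "i \<in> {1..n}" for \<mu> \<pi> i
    using I(2)[OF that(1)] permutes_in_image[OF that(2), of i] that(3) by (auto simp: mem_subpartitions_rect)
  have nz: "x i \<noteq> 0" if "x \<in> ctorus n" "i \<in> {1..n}" for x i using that
    by (auto simp: ctorus_def PiE_iff)
  let ?g = "\<lambda>x. \<Sum>\<mu>\<in>I. X \<mu> * msym m n \<mu> x"
  have hol: "torus_holomorphic n ?g"
    unfolding msym_def
  proof (intro torus_holo_sum torus_holo_cmul torus_holo_prod I(1) fin)
    fix \<mu> \<pi> i assume a: "\<mu> \<in> I" "\<pi> \<in> {\<pi>. \<pi> permutes {1..n}}" "i \<in> {1..n}"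
    show "torus_holomorphic n (\<lambda>x. lagr m (\<mu> (\<pi> i)) (x i))"
    proof (rule torus_holo_comp[OF torus_holo_coord[OF a(3)] BC1_holo[OF lagr_BC1]])
      show "\<mu> (\<pi> i) \<le> m" using le a by simp
    qed (use nz a in auto)
  qed simp
  have ms: "msym m n \<mu> (x \<circ> \<sigma>) = msym m n \<mu> x" if \<sigma>: "\<sigma> permutes {1..n}"
    for \<mu> x \<sigma>
  proof -
    have "(\<Prod>i=1..n. lagr m (\<mu> (\<pi> i)) (x (\<sigma> i))) = (\<Prod>i=1..n. lagr m (\<mu> ((\<pi> \<circ> inv \<sigma>) i)) (x i))"
      for \<pi>
      by (subst prod.permute[OF \<sigma>, of "\<lambda>i. lagr m (\<mu> ((\<pi> \<circ> inv \<sigma>) i)) (x i)"])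
        (simp add: o_def permutes_inverses[OF \<sigma>])
    then have "msym m n \<mu> (x \<circ> \<sigma>) = (\<Sum>\<pi>\<in>{\<pi>. \<pi> permutes {1..n}}. \<Prod>i=1..n. lagr m (\<mu> ((\<pi> \<circ> inv \<sigma>) i)) (x i))"
      by (simp add: msym_def)
    also have "\<dots> = msym m n \<mu> x"
      unfolding msym_def by (rule sum_permutations_compose_right[OF permutes_inv[OF \<sigma>], symmetric])
    finally show ?thesis .
  qed
  have upd: "msym m n \<mu> (x(i := w)) = \<kappa> * msym m n \<mu> x" if i: "i \<in> {1..n}"
    and eq: "\<And>j. j \<le> m \<Longrightarrow> lagr m j w = \<kappa> * lagr m j (x i)" and \<mu>: "\<mu> \<in> I"
      for \<mu> x i w \<kappa>
  proof -
    have "(\<Prod>k=1..n. lagr m (\<mu> (\<pi> k)) ((x(i := w)) k)) = \<kappa> * (\<Prod>k=1..n. lagr m (\<mu> (\<pi> k)) (x k))"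
      if \<pi>: "\<pi> permutes {1..n}" for \<pi>
    proof -
      have "(\<Prod>k\<in>{1..n} - {i}. lagr m (\<mu> (\<pi> k)) ((x(i := w)) k)) = (\<Prod>k\<in>{1..n} - {i}. lagr m (\<mu> (\<pi> k)) (x k))"
        by (rule prod.cong) auto
      moreover have "prod g {1..n} = g i * prod g ({1..n} - {i})" for g :: "nat \<Rightarrow> complex"
        by (rule prod.remove) (use i in auto)
      ultimately show ?thesis
        using eq[OF le[OF \<mu> \<pi> i]] by (simp only: fun_upd_same mult.assoc)
    qed
    then show ?thesis by (simp add: msym_def sum_distrib_left)
  qed
  show ?thesis
    unfolding BC_theta_def
  proof (intro conjI ballI allI impI)
    show "restrict ?g (ctorus n) \<in> extensional (ctorus n)" by simp
    show "torus_holomorphic n (restrict ?g (ctorus n))" by (rule torus_holo_cong[OF hol]) simp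
    fix x assume x: "x \<in> ctorus n"
    show "restrict ?g (ctorus n) (x \<circ> \<sigma>) = restrict ?g (ctorus n) x"
      if \<sigma>: "\<sigma> permutes {1..n}" for \<sigma>
    proof -
      have "x \<circ> \<sigma> \<in> ctorus n"
        unfolding ctorus_def
      proof (rule PiE_I)
        fix i assume "i \<in> {1..n}"
        then show "(x \<circ> \<sigma>) i \<in> - {0}"
          using nz[OF x, of "\<sigma> i"] permutes_in_image[OF \<sigma>] by simp
      next
        fix i assume i: "i \<notin> {1..n}"
        then have "\<sigma> i = i" using permutes_not_in[OF \<sigma>] by simp
        then show "(x \<circ> \<sigma>) i = undefined" using x i by (auto simp: ctorus_def PiE_iff extensional_def)
      qed
      then show ?thesis using x ms[OF \<sigma>] by simp
    qed
    have updc: "x(i := w) \<in> ctorus n" if "i \<in> {1..n}" "w \<noteq> 0" for i w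
      using x that by (auto simp: ctorus_def PiE_iff extensional_def)
    show "restrict ?g (ctorus n) (x(i := 1 / x i)) = restrict ?g (ctorus n) x" if i: "i \<in> {1..n}" for i
    proof -
      have "msym m n \<mu> (x(i := 1 / x i)) = 1 * msym m n \<mu> x" if "\<mu> \<in> I" for \<mu>
        by (rule upd[OF i _ that]) (use nz[OF x i] BC1_inv[OF lagr_BC1] in auto)
      then show ?thesis using x updc[OF i, of "1 / x i"] nz[OF x i] by (simp cong: sum.cong)
    qed
    have 1: "1 \<in> {1..n}" using n by simp
    have x1: "x 1 \<noteq> 0" by (rule nz[OF x 1])
    let ?\<kappa> = "(p * (x 1)\<^sup>2) powi (- int m)"
    have "msym m n \<mu> (x(1 := p * x 1)) = ?\<kappa> * msym m n \<mu> x" if "\<mu> \<in> I" for \<mu>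
    proof (rule upd[OF 1 _ that])
      fix j assume "j \<le> m"
      from BC1_p[OF lagr_BC1[OF this] x1] have "lagr m j (p * x 1) = inverse ((p * (x 1)\<^sup>2) ^ m) * lagr m j (x 1)"
        using x1 by (simp add: field_simps)
      then show "lagr m j (p * x 1) = ?\<kappa> * lagr m j (x 1)"
        by (simp only: power_int_minus power_int_of_nat)
    qed
    then have "?g (x(1 := p * x 1)) = ?\<kappa> * ?g x"
      by (simp add: sum_distrib_left mult.left_commute cong: sum.cong)
    then show "restrict ?g (ctorus n) (x(1 := p * x 1)) = ?\<kappa> * restrict ?g (ctorus n) x"
      using x updc[OF 1, of "p * x 1"] x1 by simp
  qed
qed

text \<open>The value counts the permutations carrying \<mu> to \<nu>; rows of partitions are
  sorted, so there is one only if the partitions agree.\<close>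

lemma msym_node:
  assumes N: "2 * m \<le> N" and \<mu>: "\<mu> \<in> subpartitions (rect_part m n)" and \<nu>: "\<nu> \<in> subpartitions (rect_part m n)"
  shows "msym m n \<mu> (\<lambda>i\<in>{1..n}. lt (True, \<nu> i, 0)) \<noteq> 0 \<longleftrightarrow> \<mu> = \<nu>"
proof -
  have fin: "finite {\<pi>. \<pi> permutes {1..n}}" by (rule finite_permutations) simp
  let ?x = "\<lambda>i\<in>{1..n}. lt (True, \<nu> i, 0)"
  have prd: "(\<Prod>i=1..n. lagr m (\<mu> (\<pi> i)) (?x i)) = (if \<forall>i\<in>{1..n}. \<mu> (\<pi> i) = \<nu> i then 1 else 0)"
    if \<pi>: "\<pi> permutes {1..n}" for \<pi>
  proof -
    have "lagr m (\<mu> (\<pi> i)) (?x i) = (if \<mu> (\<pi> i) = \<nu> i then 1 else 0)" if i: "i \<in> {1..n}"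
      for i
    proof -
      have "\<mu> (\<pi> i) \<le> m" "\<nu> i \<le> m"
        using \<mu> \<nu> permutes_in_image[OF \<pi>, of i] i by (auto simp: mem_subpartitions_rect)
      then show ?thesis using lagr_node[OF N] i by simp
    qed
    then have "(\<Prod>i=1..n. lagr m (\<mu> (\<pi> i)) (?x i)) = (\<Prod>i=1..n. if \<mu> (\<pi> i) = \<nu> i then 1 else 0)"
      by (intro prod.cong refl)
    then show ?thesis by (auto intro: prod.neutral simp: prod_zero_iff)
  qed
  have sum: "msym m n \<mu> ?x = of_nat (card {\<pi>. \<pi> permutes {1..n} \<and> (\<forall>i\<in>{1..n}. \<mu> (\<pi> i) = \<nu> i)})"
  proof -
    have "msym m n \<mu> ?x = (\<Sum>\<pi>\<in>{\<pi>. \<pi> permutes {1..n}}. if \<forall>i\<in>{1..n}. \<mu> (\<pi> i) = \<nu> i then 1 else 0)"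
      unfolding msym_def by (intro sum.cong refl prd) simp
    also have "\<dots> = (\<Sum>\<pi>\<in>{\<pi> \<in> {\<pi>. \<pi> permutes {1..n}}. \<forall>i\<in>{1..n}. \<mu> (\<pi> i) = \<nu> i}. 1)"
      by (rule sum.inter_filter[symmetric, OF fin])
    finally show ?thesis by simp
  qed
  have fin2: "finite {\<pi>. \<pi> permutes {1..n} \<and> (\<forall>i\<in>{1..n}. \<mu> (\<pi> i) = \<nu> i)}"
    by (rule finite_subset[OF _ fin]) auto
  show ?thesis
  proof
    assume "msym m n \<mu> ?x \<noteq> 0"
    then obtain \<pi> where "\<pi> permutes {1..n}" "\<forall>i\<in>{1..n}. \<mu> (\<pi> i) = \<nu> i"
      unfolding sum by (auto simp: card_eq_0_iff fin2)
    then show "\<mu> = \<nu>" using partition_perm_eq[OF \<mu> \<nu>] by blast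
  next
    assume "\<mu> = \<nu>"
    then have "id \<in> {\<pi>. \<pi> permutes {1..n} \<and> (\<forall>i\<in>{1..n}. \<mu> (\<pi> i) = \<nu> i)}"
      by (simp add: permutes_id del: atLeastAtMost_iff)
    then have "card {\<pi>. \<pi> permutes {1..n} \<and> (\<forall>i\<in>{1..n}. \<mu> (\<pi> i) = \<nu> i)} \<noteq> 0"
      unfolding card_0_eq[OF fin2] by blast
    then show "msym m n \<mu> ?x \<noteq> 0" unfolding sum of_nat_eq_0_iff .
  qed
qed

text \<open>There is one unknown for each partition in the rectangle and one equation for each but
  \<open>lam\<close>, so a nontrivial combination exists. It is not the zero function, as a node
  with nonzero coefficient shows; by uniqueness its value at the point of \<open>lam\<close> cannot
  vanish.\<close>

lemma weak_exists:
  assumes N: "2 * m \<le> N" "2 * n \<le> N" and n: "1 \<le> n" and lam: "lam \<in> subpartitions (rect_part m n)"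
  obtains f where "BC_theta n m p f"
    "\<And>\<mu>. \<mu> \<in> subpartitions (rect_part m n) \<Longrightarrow> \<mu> \<noteq> lam \<Longrightarrow> f (vp m n lam \<mu>) = 0"
    "mset_fun n f (ev lt (suf n True 1 lam)) \<noteq> 0"
proof -
  let ?I = "subpartitions (rect_part m n)"
  have fin: "finite ?I" by (rule finite_subpartitions_rect)
  have "card (?I - {lam}) < card ?I" by (rule card_Diff1_less[OF fin lam])
  then obtain X where X: "\<exists>\<mu>\<in>?I. X \<mu> \<noteq> 0"
    "\<forall>\<nu>\<in>?I - {lam}. (\<Sum>\<mu>\<in>?I. msym m n \<mu> (vp m n lam \<nu>) * X \<mu>) = 0"
    using nontrivial_kernel[of "?I - {lam}" ?I "\<lambda>\<nu> \<mu>. msym m n \<mu> (vp m n lam \<nu>)"] fin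
    by blast
  define f where "f = (\<lambda>x\<in>ctorus n. \<Sum>\<mu>\<in>?I. X \<mu> * msym m n \<mu> x)"
  have f: "BC_theta n m p f" unfolding f_def by (rule msym_BC_theta[OF fin _ n])
  have vanishes: "f (vp m n lam \<mu>) = 0" if "\<mu> \<in> ?I" "\<mu> \<noteq> lam" for \<mu>
    using X(2) that vp_ctorus[of m n lam \<mu>] by (simp add: f_def mult.commute)
  obtain \<nu> where \<nu>: "\<nu> \<in> ?I" "X \<nu> \<noteq> 0" using X(1) by blast
  let ?x = "\<lambda>i\<in>{1..n}. lt (True, \<nu> i, 0)"
  have x: "?x \<in> ctorus n" by (auto simp: ctorus_def PiE_iff)
  have "f ?x = (\<Sum>\<mu>\<in>?I. X \<mu> * msym m n \<mu> ?x)" using x by (simp add: f_def)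
  also have "\<dots> = X \<nu> * msym m n \<nu> ?x + (\<Sum>\<mu>\<in>?I - {\<nu>}. X \<mu> * msym m n \<mu> ?x)"
    by (rule sum.remove[OF fin \<nu>(1)])
  also have "(\<Sum>\<mu>\<in>?I - {\<nu>}. X \<mu> * msym m n \<mu> ?x) = 0"
    using msym_node[OF N(1) _ \<nu>(1)] by (intro sum.neutral) auto
  finally have "f ?x = X \<nu> * msym m n \<nu> ?x" by (simp only: add_0_right)
  then have fx: "f ?x \<noteq> 0" using \<nu>(2) msym_node[OF N(1) \<nu>(1) \<nu>(1)] by (metis mult_eq_0_iff)
  have fs: "sym_theta n m (mset_fun n f)" by (rule mset_fun_sym_theta[OF f])
  have w: "weak m n lam (mset_fun n f)" by (rule weak_of_vp[OF f lam vanishes])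
  note lamr = lam[unfolded mem_subpartitions_rect]
  have "mset_fun n f (ev lt (suf n True 1 lam)) \<noteq> 0"
  proof
    assume z: "mset_fun n f (ev lt (suf n True 1 lam)) = 0"
    have "mset_fun n f M = 0" if "size M = n" "good M" for M
    proof (rule weak_eq_0[OF sym_theta_generic[OF fs] N n w _ _ z that])
      show "lam k \<le> m" if "1 \<le> k" for k using lamr that by (cases "k \<le> n") auto
    qed (use lamr is_partition_mono[of lam] in auto)
    then have "mset_fun n f (mset (map ?x [1..<n + 1])) = 0"
      by (rule sym_theta_eq_0[OF fs]) auto
    then show False using fx mset_fun_points[OF f x] by simp
  qed
  then show ?thesis using that f vanishes by blast
qed

end

section \<open>The interpolation functions\<close>

context nome
begin

lemma lattice_mono: "lattice p \<beta> q t N \<Longrightarrow> N' \<le> N \<Longrightarrow> lattice p \<beta> q t N'"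
  unfolding lattice_def lattice_axioms_def by (meson of_nat_mono order_trans)

text \<open>A product of two coordinates gains or loses \<open>s\<^sup>2 = q\<close>, hence one unit
  of the q-exponent; quotients are unchanged.\<close>

lemma lattice_scale:
  assumes L: "lattice p \<beta> q t (Suc N)" and s: "s\<^sup>2 = q"
  shows "lattice p (\<lambda>c. s * \<beta> c) q t N" "lattice p (\<lambda>c. \<beta> c / s) q t N"
proof -
  interpret lattice p \<beta> q t "Suc N" by fact
  have snz: "s \<noteq> 0" using s q_nz by auto
  have 1: "s * \<beta> c * (s * \<beta> c') * q powi i * t powi j = \<beta> c * \<beta> c' * q powi (i + 1) * t powi j"
    for c c' i j
  proof -
    have "s * \<beta> c * (s * \<beta> c') * q powi i * t powi j = \<beta> c * \<beta> c' * (q powi i * s\<^sup>2) * t powi j"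
      by (simp only: power2_eq_square mult_ac)
    then show ?thesis unfolding s by (simp add: power_int_add)
  qed
  have 2: "\<beta> c / s * (\<beta> c' / s) * q powi i * t powi j = \<beta> c * \<beta> c' * q powi (i - 1) * t powi j"
    for c c' i j
  proof -
    have "\<beta> c / s * (\<beta> c' / s) * q powi i * t powi j = \<beta> c * \<beta> c' * (q powi i / s\<^sup>2) * t powi j"
      by (simp add: power2_eq_square)
    then show ?thesis unfolding s by (simp add: power_int_diff)
  qed
  show "lattice p (\<lambda>c. s * \<beta> c) q t N"
  proof (unfold_locales)
    fix i j :: int and c c' assume ij: "\<bar>i\<bar> \<le> int N" "\<bar>j\<bar> \<le> int N"
    show "th (s * \<beta> c * (s * \<beta> c') * q powi i * t powi j) \<noteq> 0" unfolding 1
      by (rule gen_mult) (use ij in auto)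
    show "th (s * \<beta> True / (s * \<beta> False) * q powi i * t powi j) \<noteq> 0"
      using gen_div[of i j] ij snz by simp
    show "th (q powi i * t powi j) \<noteq> 0" if "(i, j) \<noteq> (0, 0)" by (rule gen_qt) (use ij that in auto)
  qed (use snz in auto)
  show "lattice p (\<lambda>c. \<beta> c / s) q t N"
  proof (unfold_locales)
    fix i j :: int and c c' assume ij: "\<bar>i\<bar> \<le> int N" "\<bar>j\<bar> \<le> int N"
    show "th (\<beta> c / s * (\<beta> c' / s) * q powi i * t powi j) \<noteq> 0" unfolding 2
      by (rule gen_mult) (use ij in auto)
    show "th (\<beta> True / s / (\<beta> False / s) * q powi i * t powi j) \<noteq> 0"
      using gen_div[of i j] ij snz by simp
    show "th (q powi i * t powi j) \<noteq> 0" if "(i, j) \<noteq> (0, 0)" by (rule gen_qt) (use ij that in auto)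
  qed (use snz in auto)
qed

text \<open>The operator reads functions on the lattice of s times its base. To make that the
  lattice of \<beta>, the base is taken to be \<beta> / s.\<close>

lemma lattice_extra_vanishing:
  assumes L: "lattice p \<beta> q t (Suc N)" and N: "2 * m + 2 \<le> N" "2 * n + 2 \<le> N" and n: "1 \<le> n"
    and f: "sym_theta n m f" and weak: "lattice.weak \<beta> q t m n lam f"
    and lam: "lam \<in> subpartitions (rect_part m n)"
    and \<nu>: "\<And>k k'. 1 \<le> k \<Longrightarrow> k \<le> k' \<Longrightarrow> k' \<le> n \<Longrightarrow> \<nu> k' \<le> \<nu> k" "\<And>k. 1 \<le> k \<Longrightarrow> k \<le> n \<Longrightarrow> \<nu> k \<le> m"
    and bad: "\<exists>k. 1 \<le> k \<and> k \<le> n \<and> \<nu> k < lams m n lam c k"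
  shows "f (ev (lat \<beta> q t) (suf n c 1 \<nu>)) = 0"
proof -
  define s where "s = csqrt q"
  have s: "s\<^sup>2 = q" by (simp add: s_def)
  interpret L: lattice p \<beta> q t "Suc N" by fact
  have snz: "s \<noteq> 0" using s L.q_nz by auto
  have e: "(\<lambda>c. s * (\<beta> c / s)) = \<beta>" using snz by auto
  interpret lattice_shift p "\<lambda>c. \<beta> c / s" q t N s
    unfolding lattice_shift_def lattice_shift_axioms_def e
    using lattice_scale(2)[OF L s] lattice_mono[OF L] s by auto
  note lamr = lam[unfolded mem_subpartitions_rect]
  have "f (ev (lat (\<lambda>c. s * (\<beta> c / s)) q t) (suf n c 1 \<nu>)) = 0"
  proof (rule extra_vanishing[OF f N n _ _ _ \<nu> bad])
    show "lattice.weak (\<lambda>c. s * (\<beta> c / s)) q t m n lam f" unfolding e by (rule weak)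
    show "lam k' \<le> lam k" if "1 \<le> k" "k \<le> k'" "k' \<le> n" for k k'
      using is_partition_mono[of lam] lamr that by blast
    show "lam k \<le> m" if "1 \<le> k" for k using lamr that by (cases "k \<le> n") auto
  qed
  then show ?thesis unfolding e .
qed

lemma suf_cong: "(\<And>k. i \<le> k \<Longrightarrow> k \<le> n \<Longrightarrow> \<nu> k = \<nu>' k) \<Longrightarrow> suf n c i \<nu> = suf n c i \<nu>'"
  unfolding suf_def by (rule config_cong) (auto split: if_splits)

text \<open>Induction on k. On the lattice of \<open>s * \<beta>\<close> there is a function g,
  nonzero at level k; the operator carries it to h, nonzero at level k + 1 on the lattice of
  \<beta>. By uniqueness h is a multiple of f, so f is nonzero there too. Each step uses one unit of
  the exponent bound.\<close>

lemma lattice_column_nz: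
  assumes "lattice p \<beta> q t (N + k)" and N: "2 * m + 2 \<le> N" "2 * n + 2 \<le> N" and n: "1 \<le> n"
    and lam: "lam \<in> subpartitions (rect_part m n)" and "lam n + k \<le> m"
    and "sym_theta n m f" "lattice.weak \<beta> q t m n lam f" "f (ev (lat \<beta> q t) (suf n True 1 lam)) \<noteq> 0"
  shows "f (ev (lat \<beta> q t) (suf n True 1 (\<lambda>j. max (lam j) (lam n + k)))) \<noteq> 0"
  using assms(1,6-)
proof (induction k arbitrary: \<beta> f)
  case 0
  have "suf n True 1 (\<lambda>j. max (lam j) (lam n + 0)) = suf n True 1 lam"
  proof (rule suf_cong)
    fix k assume "1 \<le> k" "k \<le> n"
    moreover have "is_partition lam" using lam by (simp add: mem_subpartitions_rect)
    ultimately have "lam n \<le> lam k" using is_partition_mono by blast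
    then show "max (lam k) (lam n + 0) = lam k" by simp
  qed
  then show ?case using 0 by simp
next
  case (Suc k)
  define s where "s = csqrt q"
  have s: "s\<^sup>2 = q" by (simp add: s_def)
  have L': "lattice p (\<lambda>c. s * \<beta> c) q t (N + k)" using lattice_scale(1)[OF _ s] Suc.prems(1) by simp
  interpret lattice_shift p \<beta> q t "N + k" s
    unfolding lattice_shift_def lattice_shift_axioms_def
    using L' lattice_mono[OF Suc.prems(1)] s by auto
  note lamr = lam[unfolded mem_subpartitions_rect]
  have lam1: "lam k' \<le> lam k" if "1 \<le> k" "k \<le> k'" "k' \<le> n" for k k'
    using is_partition_mono[of lam] lamr that by blast
  have lam2: "lam k \<le> m" if "1 \<le> k" for k using lamr that by (cases "k \<le> n") auto
  obtain f' where f': "BC_theta n m p f'"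
    "\<And>\<mu>. \<mu> \<in> subpartitions (rect_part m n) \<Longrightarrow> \<mu> \<noteq> lam \<Longrightarrow> f' (S.vp m n lam \<mu>) = 0"
    "mset_fun n f' (ev S.lt (suf n True 1 lam)) \<noteq> 0"
    by (rule S.weak_exists[OF _ _ n lam]) (use N in auto)
  define g where "g = mset_fun n f'"
  have g: "sym_theta n m g" unfolding g_def by (rule mset_fun_sym_theta[OF f'(1)])
  have gw: "S.weak m n lam g" unfolding g_def by (rule S.weak_of_vp[OF f'(1) lam f'(2)])
  have IH: "g (ev S.lt (suf n True 1 (\<lambda>j. max (lam j) (lam n + k)))) \<noteq> 0"
    by (rule Suc.IH[OF L' _ g gw]) (use Suc.prems f'(3) in \<open>auto simp: g_def\<close>)
  obtain w where w: "w \<noteq> 0" "diff_op s t (upar m n w) g (ev lt (suf n True 1 (\<lambda>j. max (lam j) (lam n + Suc k)))) \<noteq> 0"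
    using diff_op_step_nz[OF g _ _ n gw lam1 lam2, of "lam n + Suc k"] N Suc.prems IH by auto
  define h where "h = diff_op s t (upar m n w) g"
  have hg: "generic_theta n m h" unfolding h_def
    by (rule diff_op_upar_generic[OF g _ _ n gw lam1 lam2 w(1)]) (use N in auto)
  have hw: "weak m n lam h" unfolding h_def
    by (rule diff_op_upar_weak[OF g _ _ n gw lam1 lam2]) (use N in auto)
  define \<kappa> where "\<kappa> = h (ev lt (suf n True 1 lam)) / f (ev lt (suf n True 1 lam))"
  let ?M = "ev lt (suf n True 1 (\<lambda>j. max (lam j) (lam n + Suc k)))"
  have "1 * h ?M + (- \<kappa>) * f ?M = 0"
  proof (rule weak_eq_0[OF generic_theta_lincomb[OF hg sym_theta_generic[OF Suc.prems(3)], where c = 1 and d = "- \<kappa>"]])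
    show "weak m n lam (\<lambda>M. 1 * h M + (- \<kappa>) * f M)"
      using hw Suc.prems(4) by (auto simp: weak_def)
    show "1 * h (ev lt (suf n True 1 lam)) + (- \<kappa>) * f (ev lt (suf n True 1 lam)) = 0"
      using Suc.prems(5) by (simp add: \<kappa>_def)
    show "size ?M = n" by (simp add: card_suf)
    show "good ?M"
    proof (rule good_lat)
      fix x assume x: "x \<in> suf n True 1 (\<lambda>j. max (lam j) (lam n + Suc k))"
      obtain c e l where xe: "x = (c, e, l)" by (cases x)
      obtain j where "1 \<le> j" "j \<le> n" "e = max (lam j) (lam n + Suc k)" "l = n - j" using x
        unfolding xe in_suf by auto
      then have "e \<le> m" "l \<le> n" using lam2[of j] Suc.prems(2) by simp_all
      then show "in_range x" using N by (simp add: in_range_def xe)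
    qed simp
  qed (use N n lam1 lam2 in auto)
  then show ?case using w(2) by (auto simp: h_def)
qed

section \<open>Restriction to the line x_i = v t^(n - i) and its normalizing product\<close>

lemma sym_theta_p:
  assumes f: "sym_theta n m f" and "0 \<notin># A" "0 \<notin># B" "size A + size B = n"
  shows "(\<Prod>x\<in>#A. (p * x\<^sup>2) ^ m) * f (image_mset ((*) p) A + B) = f (A + B)"
  using assms(2-)
proof (induction A arbitrary: B)
  case (add x A)
  have "BC1 m (\<lambda>z. f (add_mset z (A + B)))"
    using f add.prems by (auto simp: sym_theta_def)
  then have 1: "(p * x\<^sup>2) ^ m * f (add_mset (p * x) (A + B)) = f (add_mset x (A + B))"
    using BC1_p[of m "\<lambda>z. f (add_mset z (A + B))" x] add.prems by auto
  have 2: "(\<Prod>x\<in>#A. (p * x\<^sup>2) ^ m) * f (image_mset ((*) p) A + add_mset (p * x) B) = f (A + add_mset (p * x) B)"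
    by (rule add.IH) (use add.prems in auto)
  then show ?case using 1 by (simp add: mult.assoc)
qed simp

lemma theta_mult_div_0:
  assumes "x \<noteq> 0" "y \<noteq> 0" "th x = 0" "th y = 0"
  shows "th (x * y) = 0" "th (x / y) = 0"
proof -
  obtain k l :: int where "x = p powi k" "y = p powi l" using assms theta_eq_0_iff by blast
  then have "x * y = p powi (k + l)" "x / y = p powi (k - l)" by (simp_all add: power_int_add power_int_diff)
  then show "th (x * y) = 0" "th (x / y) = 0"
    using theta_eq_0_iff[of "x * y"] theta_eq_0_iff[of "x / y"] assms by auto
qed

lemma good_image:
  assumes "finite I" "\<And>i. i \<in> I \<Longrightarrow> h i \<noteq> 0 \<and> th ((h i)\<^sup>2) \<noteq> 0"
    and "\<And>i j. i \<in> I \<Longrightarrow> j \<in> I \<Longrightarrow> i \<noteq> j \<Longrightarrow> inequiv (h i) (h j)"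
  shows "good (image_mset h (mset_set I))"
  using assms
proof (induction I rule: finite_induct)
  case (insert i I)
  then show ?case by (auto simp: good_add)
qed simp

definition line :: "nat \<Rightarrow> complex \<Rightarrow> complex \<Rightarrow> complex multiset" where
  "line n t v = image_mset (\<lambda>e. v * t ^ e) (mset_set {..<n})"

lemma line_eq: "mset (map (\<lambda>i. v * t ^ (n - i)) [1..<n + 1]) = line n t v"
proof -
  have "mset (map (\<lambda>i. v * t ^ (n - i)) [1..<n + 1]) = image_mset (\<lambda>e. v * t ^ e) (image_mset (\<lambda>i. n - i) (mset_set {1..<n + 1}))"
    by (simp only: mset_map mset_upt multiset.map_comp o_def)
  also have "image_mset (\<lambda>i. n - i) (mset_set {1..<n + 1}) = mset_set ((\<lambda>i. n - i) ` {1..<n + 1})"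
    by (rule image_mset_mset_set) (auto simp: inj_on_def)
  also have "(\<lambda>i. n - i) ` {1..<n + 1} = {..<n}"
  proof
    show "{..<n} \<subseteq> (\<lambda>i. n - i) ` {1..<n + 1}"
    proof
      fix e assume "e \<in> {..<n}"
      then have "e = n - (n - e)" "n - e \<in> {1..<n + 1}" by auto
      then show "e \<in> (\<lambda>i. n - i) ` {1..<n + 1}" by blast
    qed
  qed auto
  finally show ?thesis by (simp add: line_def)
qed

lemma size_line [simp]: "size (line n t v) = n"
  by (simp add: line_def)

text \<open>The exponents e and n - 1 - e are exchanged, so inverting all coordinates maps the line
  to itself.\<close>

lemma line_inv:
  assumes "t \<noteq> 0" "v \<noteq> 0"
  shows "line n t (1 / (t ^ (n - 1) * v)) = image_mset (\<lambda>x. 1 / x) (line n t v)"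
proof -
  have "mset_set {..<n} = image_mset (\<lambda>e. n - 1 - e) (mset_set {..<n})"
  proof -
    have "(\<lambda>e. n - 1 - e) ` {..<n} = {..<n}"
    proof
      show "{..<n} \<subseteq> (\<lambda>e. n - 1 - e) ` {..<n}"
      proof
        fix e assume "e \<in> {..<n}"
        then have "e = n - 1 - (n - 1 - e)" "n - 1 - e \<in> {..<n}" by auto
        then show "e \<in> (\<lambda>e. n - 1 - e) ` {..<n}" by blast
      qed
    qed auto
    moreover have "inj_on (\<lambda>e. n - 1 - e) {..<n}" by (auto simp: inj_on_def)
    ultimately show ?thesis using image_mset_mset_set by metis
  qed
  then have "line n t (1 / (t ^ (n - 1) * v)) = image_mset (\<lambda>e. 1 / (t ^ (n - 1) * v) * t ^ e) (image_mset (\<lambda>e. n - 1 - e) (mset_set {..<n}))"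
    by (simp add: line_def)
  also have "\<dots> = image_mset (\<lambda>x. 1 / x) (line n t v)"
    unfolding line_def multiset.map_comp
  proof (rule image_mset_cong)
    fix e assume "e \<in># mset_set {..<n}"
    then have "e \<le> n - 1" by auto
    then have "t ^ (n - 1) = t ^ (n - 1 - e) * t ^ e" by (metis le_add_diff_inverse2 power_add)
    then show "((\<lambda>e. 1 / (t ^ (n - 1) * v) * t ^ e) \<circ> (\<lambda>e. n - 1 - e)) e = ((\<lambda>x. 1 / x) \<circ> (\<lambda>e. v * t ^ e)) e"
      using assms by (simp add: field_simps)
  qed
  finally show ?thesis .
qed

end

context lattice
begin

text \<open>As functions of \<open>v\<close>, the normalizing factors of a box \<open>(i, j)\<close> vanish at this point and at its
  image under \<open>v \<mapsto> 1 / (t\<^bsup>n - 1\<^esup> v)\<close>.\<close>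

definition box_root :: "bool \<times> nat \<times> nat \<Rightarrow> complex" where
  "box_root = (\<lambda>(c, i, j). \<beta> c * q powi (int j - 1) * t powi (1 - int i))"

lemma box_root_nz [simp]: "box_root b \<noteq> 0"
  by (cases b) (simp add: box_root_def)

lemma ev_suf_const: "ev lt (suf n c i (\<lambda>_. e)) = image_mset (\<lambda>l. lt (c, e, l)) (mset_set {..<n + 1 - i})"
  if "1 \<le> i"
proof -
  have "suf n c i (\<lambda>_. e) = (\<lambda>l. (c, e, l)) ` {..<n + 1 - i}"
  proof (rule set_eqI)
    fix x :: tag obtain c' e' l where x: "x = (c', e', l)" by (cases x)
    have "(\<exists>k. i \<le> k \<and> k \<le> n \<and> l = n - k) \<longleftrightarrow> l < n + 1 - i"
    proof
      assume "l < n + 1 - i"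
      then have "i \<le> n - l \<and> n - l \<le> n \<and> l = n - (n - l)" using that by auto
      then show "\<exists>k. i \<le> k \<and> k \<le> n \<and> l = n - k" by blast
    qed (use that in auto)
    then show "x \<in> suf n c i (\<lambda>_. e) \<longleftrightarrow> x \<in> (\<lambda>l. (c, e, l)) ` {..<n + 1 - i}"
      unfolding x in_suf by auto
  qed
  moreover have "inj_on (\<lambda>l. (c, e, l)) {..<n + 1 - i}" by (simp add: inj_on_def)
  ultimately have "mset_set (suf n c i (\<lambda>_. e)) = image_mset (\<lambda>l. (c, e, l)) (mset_set {..<n + 1 - i})"
    using image_mset_mset_set by metis
  then show ?thesis by (simp add: ev_def multiset.map_comp o_def)
qed

text \<open>At this v the coordinates with exponent e \<ge> i - 1 are \<beta> c q^(j - 1) t^l with l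
  = e - (i - 1): rows i to n with constant value j - 1, which is below \<Lambda> i. The other i - 1
  coordinates are free.\<close>

lemma line_brt_0:
  assumes f: "sym_theta n m f" and N: "2 * m \<le> N" "2 * n \<le> N"
    and ext: "\<And>\<nu>. (\<And>k k'. 1 \<le> k \<Longrightarrow> k \<le> k' \<Longrightarrow> k' \<le> n \<Longrightarrow> \<nu> k' \<le> \<nu> k) \<Longrightarrow>
       (\<And>k. 1 \<le> k \<Longrightarrow> k \<le> n \<Longrightarrow> \<nu> k \<le> m) \<Longrightarrow> (\<exists>k. 1 \<le> k \<and> k \<le> n \<and> \<nu> k < \<Lambda> k) \<Longrightarrow> f (ev lt (suf n c 1 \<nu>)) = 0"
    and ij: "1 \<le> i" "i \<le> n" "1 \<le> j" "j \<le> \<Lambda> i" "j \<le> m"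
  shows "f (line n t (box_root (c, i, j))) = 0"
proof -
  let ?h = "\<lambda>e. box_root (c, i, j) * t ^ e"
  have h: "?h e = \<beta> c * q powi (int j - 1) * t powi (1 - int i + int e)" for e
    by (simp add: box_root_def power_int_add mult_ac)
  have hh: "?h e * ?h e' = \<beta> c * \<beta> c * q powi (2 * (int j - 1)) * t powi (2 * (1 - int i) + int e + int e')"
    for e e'
  proof -
    have "2 * (int j - 1) = (int j - 1) + (int j - 1)" "2 * (1 - int i) + int e + int e' = (1 - int i + int e) + (1 - int i + int e')"
      by simp_all
    then show ?thesis unfolding h by (simp only: power_int_add q_nz t_nz simp_thms mult_ac)
  qed
  have h0: "th (?h e * ?h e') \<noteq> 0" if "e < n" "e' < n" for e e'
    unfolding hh by (rule gen_mult) (use that ij N in auto)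
  have good: "good (line n t (box_root (c, i, j)))"
    unfolding line_def
  proof (rule good_image)
    fix e assume e: "e \<in> {..<n}"
    show "?h e \<noteq> 0 \<and> th ((?h e)\<^sup>2) \<noteq> 0" using h0[of e e] e by (simp add: power2_eq_square)
    fix e' assume e': "e' \<in> {..<n}" "e \<noteq> e'"
    have r: "?h e / ?h e' = q powi 0 * t powi (int e - int e')"
      by (simp add: power_int_diff)
    have "th (?h e / ?h e') \<noteq> 0" unfolding r by (rule gen_qt) (use e e' N in auto)
    then show "inequiv (?h e) (?h e')" unfolding inequiv_def using h0[of e e'] e e' by simp
  qed simp
  define F where "F = image_mset ?h (mset_set {..<i - 1})"
  have split: "line n t (box_root (c, i, j)) = ev lt (suf n c i (\<lambda>_. j - 1)) + F"
  proof -
    have U: "{..<n} = {..<i - 1} \<union> {i - 1..<n}" using ij by auto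
    have "mset_set ({..<i - 1} \<union> {i - 1..<n}) = mset_set {..<i - 1} + mset_set {i - 1..<n}"
      by (rule mset_set_Union) auto
    then have "mset_set {..<n} = mset_set {..<i - 1} + mset_set {i - 1..<n}" by (simp only: U)
    moreover have "mset_set {i - 1..<n} = image_mset (\<lambda>l. l + (i - 1)) (mset_set {..<n + 1 - i})"
    proof -
      have "(\<lambda>l. l + (i - 1)) ` {0..<n + 1 - i} = {0 + (i - 1)..<n + 1 - i + (i - 1)}"
        by (rule image_add_atLeastLessThan')
      moreover have "n + 1 - i + (i - 1) = n" using ij(1,2) by arith
      ultimately have "(\<lambda>l. l + (i - 1)) ` {..<n + 1 - i} = {i - 1..<n}"
        by (simp only: lessThan_atLeast0 add_0)
      moreover have "inj_on (\<lambda>l. l + (i - 1)) {..<n + 1 - i}" by simp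
      ultimately show ?thesis using image_mset_mset_set by metis
    qed
    ultimately have "line n t (box_root (c, i, j)) = F + image_mset (\<lambda>l. ?h (l + (i - 1))) (mset_set {..<n + 1 - i})"
      by (simp add: line_def F_def multiset.map_comp o_def)
    also have "image_mset (\<lambda>l. ?h (l + (i - 1))) (mset_set {..<n + 1 - i}) = ev lt (suf n c i (\<lambda>_. j - 1))"
      unfolding ev_suf_const[OF ij(1)]
    proof (rule image_mset_cong)
      fix l
      have eqs: "1 - int i + int (l + (i - 1)) = int l" "int j - 1 = int (j - 1)" using ij by simp_all
      show "?h (l + (i - 1)) = lt (c, j - 1, l)"
        unfolding h eqs lat_def by (simp only: power_int_of_nat prod.case)
    qed
    finally show ?thesis by (simp add: add.commute)
  qed
  have "vanishes n f lt (suf n c i (\<lambda>_. j - 1))"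
    by (rule vanishes_strong[OF sym_theta_generic[OF f] N ext]) (use ij in auto)
  moreover have "size F + card (suf n c i (\<lambda>_. j - 1)) = n"
    using arg_cong[OF split, of size] by simp
  ultimately show ?thesis using good unfolding split vanishes_def by blast
qed

lemma box_root_div_nz:
  assumes "2 * m \<le> N" "2 * n \<le> N" "1 \<le> i" "i \<le> n" "1 \<le> j" "j \<le> m" "1 \<le> i'" "i' \<le> n" "1 \<le> j'" "j' \<le> m"
    "(c, i, j) \<noteq> (c', i', j')"
  shows "th (box_root (c, i, j) / box_root (c', i', j')) \<noteq> 0"
proof -
  have e: "box_root (c, i, j) / box_root (c', i', j') = \<beta> c / \<beta> c' * q powi (int j - int j') * t powi (int i' - int i)"
  proof -
    have "int j - int j' = (int j - 1) - (int j' - 1)" "int i' - int i = (1 - int i) - (1 - int i')" by simp_all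
    then have "q powi (int j - int j') = q powi (int j - 1) / q powi (int j' - 1)"
      "t powi (int i' - int i) = t powi (1 - int i) / t powi (1 - int i')"
      by (metis power_int_diff q_nz t_nz)+
    then show ?thesis by (simp add: box_root_def)
  qed
  show ?thesis
  proof (cases "c = c'")
    case True
    have "th (q powi (int j - int j') * t powi (int i' - int i)) \<noteq> 0"
      by (rule gen_qt) (use assms True in auto)
    then show ?thesis unfolding e using True by simp
  next
    case False
    show ?thesis unfolding e by (rule gen_div'[OF _ _ False]) (use assms in auto)
  qed
qed

lemma box_root_mult_nz:
  assumes "2 * m + 2 \<le> N" "2 * n + 2 \<le> N" "1 \<le> n" "1 \<le> i" "i \<le> n" "1 \<le> j" "j \<le> m" "1 \<le> i'" "i' \<le> n" "1 \<le> j'" "j' \<le> m"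
  shows "th (t ^ (n - 1) * box_root (c, i, j) * box_root (c', i', j')) \<noteq> 0"
proof -
  have e: "t ^ (n - 1) * box_root (c, i, j) * box_root (c', i', j') =
     \<beta> c * \<beta> c' * q powi ((int j - 1) + (int j' - 1)) * t powi (int (n - 1) + (1 - int i) + (1 - int i'))"
    unfolding box_root_def by (simp only: power_int_add q_nz t_nz simp_thms prod.case power_int_of_nat mult_ac)
  show ?thesis unfolding e by (rule gen_mult) (use assms in auto)
qed

definition boxes :: "nat \<Rightarrow> nat \<Rightarrow> (nat \<Rightarrow> nat) \<Rightarrow> (bool \<times> nat \<times> nat) set" where
  "boxes m n lam = (SIGMA c:UNIV. diagram (lams m n lam c))"

definition normf :: "nat \<Rightarrow> nat \<Rightarrow> (nat \<Rightarrow> nat) \<Rightarrow> complex \<Rightarrow> complex" where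
  "normf m n lam v = (\<Prod>b\<in>boxes m n lam. th (t ^ (n - 1) * box_root b * v) * th (box_root b / v))"

lemma diagram_Sigma:
  assumes "\<And>k. 1 \<le> k \<Longrightarrow> k \<le> n \<Longrightarrow> \<mu> k \<le> m" "\<And>k. n < k \<Longrightarrow> \<mu> k = 0"
  shows "diagram \<mu> = (SIGMA k:{1..n}. {1..\<mu> k})"
proof -
  have "1 \<le> j \<Longrightarrow> j \<le> \<mu> k \<Longrightarrow> k \<le> n" for j k using assms(2)[of k]
    by (cases "k \<le> n") auto
  then show ?thesis by (auto simp: diagram_def)
qed

lemma lams_bounds:
  assumes "lam \<in> subpartitions (rect_part m n)"
  shows "\<And>k. 1 \<le> k \<Longrightarrow> k \<le> n \<Longrightarrow> lams m n lam c k \<le> m" "\<And>k. n < k \<Longrightarrow> lams m n lam c k = 0"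
  using assms by (cases c; auto simp: lams_def rect_compl_def mem_subpartitions_rect)+

lemma diagram_lams:
  assumes "lam \<in> subpartitions (rect_part m n)"
  shows "diagram (lams m n lam c) = (SIGMA k:{1..n}. {1..lams m n lam c k})"
  by (rule diagram_Sigma[where m = m]) (use lams_bounds[OF assms] in auto)

lemma finite_diagram_lams:
  assumes "lam \<in> subpartitions (rect_part m n)"
  shows "finite (diagram (lams m n lam c))"
  unfolding diagram_lams[OF assms] by simp

lemma finite_boxes: "lam \<in> subpartitions (rect_part m n) \<Longrightarrow> finite (boxes m n lam)"
  unfolding boxes_def by (intro finite_SigmaI finite_diagram_lams) auto

text \<open>The degree n m of the restriction to the line, whatever \<open>lam\<close> is; it makes
  the multipliers in \<open>line_p\<close> and \<open>normf_p\<close> agree.\<close>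

lemma card_boxes:
  assumes "lam \<in> subpartitions (rect_part m n)"
  shows "card (boxes m n lam) = n * m"
proof -
  have cd: "card (diagram (lams m n lam c)) = (\<Sum>k=1..n. lams m n lam c k)" for c
    unfolding diagram_lams[OF assms] by simp
  have "card (boxes m n lam) = card (diagram (lams m n lam True)) + card (diagram (lams m n lam False))"
    unfolding boxes_def using finite_diagram_lams[OF assms] by (simp add: card_SigmaI UNIV_bool add.commute)
  also have "\<dots> = (\<Sum>k=1..n. lam k) + (\<Sum>k=1..n. m - lam (n + 1 - k))"
    unfolding cd by (simp add: lams_def rect_compl_def)
  also have "(\<Sum>k=1..n. m - lam (n + 1 - k)) = (\<Sum>k=1..n. m - lam k)"
    by (subst sum.atLeastAtMost_rev) (simp add: add.commute)
  also have "(\<Sum>k=1..n. lam k) + (\<Sum>k=1..n. m - lam k) = (\<Sum>k=1..n. m)"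
    unfolding sum.distrib[symmetric] using assms by (intro sum.cong) (auto simp: mem_subpartitions_rect)
  finally show ?thesis by simp
qed

lemma in_boxes:
  assumes "lam \<in> subpartitions (rect_part m n)" "(c, i, j) \<in> boxes m n lam"
  shows "1 \<le> i" "i \<le> n" "1 \<le> j" "j \<le> lams m n lam c i" "j \<le> m"
proof -
  have "(i, j) \<in> diagram (lams m n lam c)" using assms(2) by (simp add: boxes_def)
  then show "1 \<le> i" "i \<le> n" "1 \<le> j" "j \<le> lams m n lam c i" "j \<le> m"
    using lams_bounds(1)[OF assms(1), of i c] unfolding diagram_lams[OF assms(1)] by auto
qed

lemma normf_C0:
  assumes "lam \<in> subpartitions (rect_part m n)"
  shows "normf m n lam v = C0 lam (t ^ (n - 1) * \<beta> True * v) q t p * C0 lam (\<beta> True / v) q t p *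
     (C0 (rect_compl m n lam) (t ^ (n - 1) * \<beta> False * v) q t p * C0 (rect_compl m n lam) (\<beta> False / v) q t p)"
proof -
  have "normf m n lam v = (\<Prod>c\<in>UNIV. \<Prod>b\<in>diagram (lams m n lam c). th (t ^ (n - 1) * box_root (c, b) * v) * th (box_root (c, b) / v))"
    unfolding normf_def boxes_def using finite_diagram_lams[OF assms]
    by (subst prod.Sigma) (auto simp: case_prod_unfold)
  also have "\<dots> = (\<Prod>c\<in>UNIV. C0 (lams m n lam c) (t ^ (n - 1) * \<beta> c * v) q t p * C0 (lams m n lam c) (\<beta> c / v) q t p)"
    unfolding C0_def prod.distrib[symmetric]
    by (intro prod.cong refl) (auto simp: box_root_def mult_ac)
  finally show ?thesis by (simp add: UNIV_bool lams_def mult_ac)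
qed

text \<open>Roots of distinct boxes are inequivalent under v -> p v and v -> 1 / (t^(n - 1) v), and
  no root is equivalent under powers of p to its own image under the second map.\<close>

lemma normf_simple_zeros:
  assumes lam: "lam \<in> subpartitions (rect_part m n)" and N: "2 * m + 2 \<le> N" "2 * n + 2 \<le> N" and n: "1 \<le> n"
  shows "simple_zeros (normf m n lam)"
  unfolding normf_def[abs_def]
proof (rule simple_zeros_prod[OF finite_boxes[OF lam]])
  have mult: "th (t ^ (n - 1) * box_root b * box_root b') \<noteq> 0"
    if "b \<in> boxes m n lam" "b' \<in> boxes m n lam" for b b'
  proof -
    obtain c i j c' i' j' where b: "b = (c, i, j)" "b' = (c', i', j')" by (cases b, cases b')
    show ?thesis unfolding b
      by (rule box_root_mult_nz[OF N n]) (use that[unfolded b] in_boxes[OF lam] in blast)+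
  qed
  have dvd: "th (box_root b / box_root b') \<noteq> 0"
    if "b \<in> boxes m n lam" "b' \<in> boxes m n lam" "b \<noteq> b'" for b b'
  proof -
    obtain c i j c' i' j' where b: "b = (c, i, j)" "b' = (c', i', j')" by (cases b, cases b')
    have N': "2 * m \<le> N" "2 * n \<le> N" using N by auto
    show ?thesis unfolding b
      by (rule box_root_div_nz[OF N']) (use that[unfolded b] in_boxes[OF lam] in blast)+
  qed
  have both: False if "w \<noteq> 0" "th (t ^ (n - 1) * box_root b * w) = 0" "th (box_root b' / w) = 0" "b \<in> boxes m n lam" "b' \<in> boxes m n lam"
    for b b' w
  proof -
    have "th (t ^ (n - 1) * box_root b * w * (box_root b' / w)) = 0"
      by (rule theta_mult_div_0) (use that in auto)
    moreover have "t ^ (n - 1) * box_root b * w * (box_root b' / w) = t ^ (n - 1) * box_root b * box_root b'"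
      using that(1) by simp
    ultimately show False using mult[OF that(4,5)] by metis
  qed
  fix b assume b: "b \<in> boxes m n lam"
  show "simple_zeros (\<lambda>w. th (t ^ (n - 1) * box_root b * w) * th (box_root b / w))"
  proof (rule simple_zeros_mult)
    show "simple_zeros (\<lambda>w. th (t ^ (n - 1) * box_root b * w))" "simple_zeros (\<lambda>w. th (box_root b / w))"
      using simple_zeros_theta by auto
  qed (use both b in blast)
  fix b' w assume b': "b' \<in> boxes m n lam" "b \<noteq> b'" and w: "w \<noteq> 0"
    "th (t ^ (n - 1) * box_root b * w) * th (box_root b / w) = 0" "th (t ^ (n - 1) * box_root b' * w) * th (box_root b' / w) = 0"
  have "th (box_root b / box_root b') = 0"
    if "th (t ^ (n - 1) * box_root b * w) = 0" "th (t ^ (n - 1) * box_root b' * w) = 0"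
    using theta_mult_div_0(2)[OF _ _ that] w by simp
  moreover have "th (box_root b / box_root b') = 0" if "th (box_root b / w) = 0" "th (box_root b' / w) = 0"
    using theta_mult_div_0(2)[OF _ _ that] w by simp
  ultimately show False using w both[of w b b'] both[of w b' b] dvd[OF b b'] b b' by auto
qed

end

section \<open>Existence, uniqueness and zeros of the interpolation theta functions\<close>

definition star_cond :: "nat \<Rightarrow> nat \<Rightarrow> (nat \<Rightarrow> nat) \<Rightarrow> complex \<Rightarrow> complex \<Rightarrow> complex \<Rightarrow> complex \<Rightarrow> complex \<Rightarrow>
    ((nat \<Rightarrow> complex) \<Rightarrow> complex) \<Rightarrow> bool" where
  "star_cond m n lam a b q t p f \<longleftrightarrow> BC_theta n m p f \<and>
        (\<forall>mu\<in>subpartitions (rect_part m n). mu \<noteq> lam \<longrightarrow>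
           f (vanishing_point m n lam mu a b q t) = 0) \<and>
        (\<forall>v. v \<noteq> 0 \<longrightarrow>
           f (\<lambda>i\<in>{1..n}. v * t ^ (n - i)) =
             C0 lam (t ^ (n - 1) * a * v) q t p * C0 lam (a / v) q t p *
             (C0 (rect_compl m n lam) (t ^ (n - 1) * b * v) q t p *
              C0 (rect_compl m n lam) (b / v) q t p))"

lemma P_star_eq: "P_star m n lam a b q t p = (THE f. star_cond m n lam a b q t p f)"
  unfolding P_star_def star_cond_def ..

text \<open>For |s| = 1 the increments keep their modulus, so the same \<open>d\<close>
  works.\<close>

lemma torus_holo_scale:
  assumes f: "torus_holomorphic n f" and s: "cmod s = 1"
  shows "torus_holomorphic n (\<lambda>x. f (\<lambda>i\<in>{1..n}. s * x i))"
  unfolding torus_holomorphic_def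
proof (intro ballI)
  fix x assume x: "x \<in> ctorus n"
  let ?s = "\<lambda>x. \<lambda>i\<in>{1..n}. s * x i"
  have sx: "?s y \<in> ctorus n" if "y \<in> ctorus n" for y
    using that s by (auto simp: ctorus_def PiE_iff)
  from f[unfolded torus_holomorphic_def, rule_format, OF sx[OF x]]
  obtain c where c: "\<forall>e>0. \<exists>d>0. \<forall>y\<in>ctorus n. (\<forall>i\<in>{1..n}. cmod (y i - ?s x i) < d) \<longrightarrow>
      cmod (f y - f (?s x) - (\<Sum>i=1..n. c i * (y i - ?s x i))) \<le> e * (\<Sum>i=1..n. cmod (y i - ?s x i))" ..
  have d: "s * a - s * b = s * (a - b)" for a b by (simp add: right_diff_distrib)
  show "\<exists>c. \<forall>e>0. \<exists>d>0. \<forall>y\<in>ctorus n. (\<forall>i\<in>{1..n}. cmod (y i - x i) < d) \<longrightarrow>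
      cmod (f (?s y) - f (?s x) - (\<Sum>i=1..n. c i * (y i - x i))) \<le> e * (\<Sum>i=1..n. cmod (y i - x i))"
  proof (intro exI[of _ "\<lambda>i. c i * s"] allI impI)
    fix e :: real assume e0: "0 < e"
    from c[rule_format, OF e0] obtain d where d01: "0 < d \<and> (\<forall>y\<in>ctorus n. (\<forall>i\<in>{1..n}. cmod (y i - ?s x i) < d) \<longrightarrow>
      cmod (f y - f (?s x) - (\<Sum>i=1..n. c i * (y i - ?s x i))) \<le> e * (\<Sum>i=1..n. cmod (y i - ?s x i)))" ..
    then have d0: "0 < d" and d1: "\<And>y. y \<in> ctorus n \<Longrightarrow> (\<forall>i\<in>{1..n}. cmod (y i - ?s x i) < d) \<Longrightarrow>
      cmod (f y - f (?s x) - (\<Sum>i=1..n. c i * (y i - ?s x i))) \<le> e * (\<Sum>i=1..n. cmod (y i - ?s x i))"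
      by simp_all
    show "\<exists>d>0. \<forall>y\<in>ctorus n. (\<forall>i\<in>{1..n}. cmod (y i - x i) < d) \<longrightarrow>
      cmod (f (?s y) - f (?s x) - (\<Sum>i=1..n. c i * s * (y i - x i))) \<le> e * (\<Sum>i=1..n. cmod (y i - x i))"
    proof (intro exI[of _ d] conjI ballI impI d0)
      fix y assume y: "y \<in> ctorus n" "\<forall>i\<in>{1..n}. cmod (y i - x i) < d"
      have 1: "(\<Sum>i=1..n. c i * (?s y i - ?s x i)) = (\<Sum>i=1..n. c i * s * (y i - x i))"
        by (rule sum.cong) (auto simp: d mult.assoc)
      have 2: "(\<Sum>i=1..n. cmod (?s y i - ?s x i)) = (\<Sum>i=1..n. cmod (y i - x i))"
        by (rule sum.cong) (auto simp: d norm_mult s)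
      have 3: "\<forall>i\<in>{1..n}. cmod (?s y i - ?s x i) < d" using y(2) by (simp add: d norm_mult s)
      show "cmod (f (?s y) - f (?s x) - (\<Sum>i=1..n. c i * s * (y i - x i))) \<le> e * (\<Sum>i=1..n. cmod (y i - x i))"
        using d1[OF sx[OF y(1)] 3] unfolding 1 2 .
    qed
  qed
qed

text \<open>The case s = 1 gives scalar multiples; s = -1 prepares the change of sign of a square
  root. Both satisfy s = 1 / s, which makes the scaling commute with inversion.\<close>

lemma BC_theta_scale:
  assumes f: "BC_theta n m p f" and n: "1 \<le> n" and p: "p \<noteq> 0" and s: "s = 1 \<or> s = -1"
  shows "BC_theta n m p (\<lambda>x\<in>ctorus n. c * f (\<lambda>i\<in>{1..n}. s * x i))"
proof -
  let ?s = "\<lambda>x. \<lambda>i\<in>{1..n}. s * x i"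
  let ?g = "\<lambda>x\<in>ctorus n. c * f (?s x)"
  have ss: "s * s = 1" "cmod s = 1" "1 / s = s" using s by auto
  have mem: "x \<circ> \<sigma> \<in> ctorus n" if x: "x \<in> ctorus n" and \<sigma>: "\<sigma> permutes {1..n}"
    for x \<sigma>
    unfolding ctorus_def
  proof (rule PiE_I)
    fix i assume "i \<in> {1..n}"
    then have "\<sigma> i \<in> {1..n}" using permutes_in_image[OF \<sigma>] by blast
    then show "(x \<circ> \<sigma>) i \<in> - {0}" using x unfolding ctorus_def PiE_iff o_def by blast
  next
    fix i assume "i \<notin> {1..n}"
    moreover from this have "\<sigma> i = i" using permutes_not_in[OF \<sigma>] by simp
    ultimately show "(x \<circ> \<sigma>) i = undefined" using x by (simp add: ctorus_def PiE_iff extensional_def)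
  qed
  have upd: "x(i := w) \<in> ctorus n" if "x \<in> ctorus n" "i \<in> {1..n}" "w \<noteq> 0" for x i w
    using that by (auto simp: ctorus_def PiE_iff extensional_def)
  have nz: "x i \<noteq> 0" if "x \<in> ctorus n" "i \<in> {1..n}" for x i using that
    by (auto simp: ctorus_def PiE_iff)
  have sx: "?s x \<in> ctorus n" if "x \<in> ctorus n" for x
    using that s by (auto simp: ctorus_def PiE_iff)
  have one: "1 \<in> {1..n}" using n by simp
  have fperm: "f (x \<circ> \<sigma>) = f x" if "x \<in> ctorus n" "\<sigma> permutes {1..n}" for x \<sigma>
    using f that unfolding BC_theta_def by blast
  have finv: "f (x(i := 1 / x i)) = f x" if "x \<in> ctorus n" "i \<in> {1..n}" for x i using f that
    unfolding BC_theta_def by blast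
  have fp: "f (x(1 := p * x 1)) = (p * (x 1)\<^sup>2) powi (- int m) * f x" if "x \<in> ctorus n" for x
    using f that unfolding BC_theta_def by blast
  show ?thesis
    unfolding BC_theta_def
  proof (intro conjI ballI allI impI)
    have fh: "torus_holomorphic n f" using f by (simp add: BC_theta_def)
    show "torus_holomorphic n ?g"
      by (rule torus_holo_cong[OF torus_holo_cmul[OF torus_holo_scale[OF fh ss(2)], where c = c]]) simp
    fix x assume x: "x \<in> ctorus n"
    show "?g (x \<circ> \<sigma>) = ?g x" if \<sigma>: "\<sigma> permutes {1..n}" for \<sigma>
    proof -
      have "?s (x \<circ> \<sigma>) = ?s x \<circ> \<sigma>"
      proof
        fix i show "?s (x \<circ> \<sigma>) i = (?s x \<circ> \<sigma>) i"
          using permutes_in_image[OF \<sigma>, of i] permutes_not_in[OF \<sigma>, of i]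
          by (cases "i \<in> {1..n}") auto
      qed
      then show ?thesis using fperm[OF sx[OF x] \<sigma>] x mem[OF x \<sigma>] by simp
    qed
    show "?g (x(i := 1 / x i)) = ?g x" if i: "i \<in> {1..n}" for i
    proof -
      have "?s (x(i := 1 / x i)) = (?s x)(i := 1 / ?s x i)"
        using i s by (auto simp: fun_eq_iff)
      then show ?thesis using finv[OF sx[OF x] i] x upd[OF x i, of "1 / x i"] nz[OF x i] by simp
    qed
    show "?g (x(1 := p * x 1)) = (p * (x 1)\<^sup>2) powi - int m * ?g x"
    proof -
      have "?s (x(1 := p * x 1)) = (?s x)(1 := p * ?s x 1)"
        using one by (auto simp: fun_eq_iff)
      moreover have "(?s x 1)\<^sup>2 = (x 1)\<^sup>2" using one s by auto
      ultimately show ?thesis using fp[OF sx[OF x]] x upd[OF x one, of "p * x 1"] nz[OF x one] p by simp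
    qed
  qed simp
qed

lemma BC_theta_cmul:
  assumes f: "BC_theta n m p f" and n: "1 \<le> n" and p: "p \<noteq> 0"
  shows "BC_theta n m p (\<lambda>x\<in>ctorus n. c * f x)"
proof -
  have "(\<lambda>i\<in>{1..n}. 1 * x i) = x" if "x \<in> ctorus n" for x
    using that by (auto simp: ctorus_def PiE_iff extensional_def fun_eq_iff)
  then have "(\<lambda>x\<in>ctorus n. c * f x) = (\<lambda>x\<in>ctorus n. c * f (\<lambda>i\<in>{1..n}. 1 * x i))"
    by (intro restrict_ext) simp
  then show ?thesis using BC_theta_scale[OF f n p, of 1 c] by simp
qed

context lattice
begin

lemma line_pt:
  assumes "BC_theta n m p f" "v \<noteq> 0"
  shows "f (\<lambda>i\<in>{1..n}. v * t ^ (n - i)) = mset_fun n f (line n t v)"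
proof -
  have "(\<lambda>i\<in>{1..n}. v * t ^ (n - i)) \<in> ctorus n" using assms by (auto simp: ctorus_def PiE_iff)
  from mset_fun_points[OF assms(1) this]
  have "f (\<lambda>i\<in>{1..n}. v * t ^ (n - i)) = mset_fun n f (mset (map (\<lambda>i\<in>{1..n}. v * t ^ (n - i)) [1..<n + 1]))"
    by simp
  also have "map (\<lambda>i\<in>{1..n}. v * t ^ (n - i)) [1..<n + 1] = map (\<lambda>i. v * t ^ (n - i)) [1..<n + 1]"
    by (rule map_cong) auto
  finally show ?thesis unfolding line_eq .
qed

lemma line_nz: "v \<noteq> 0 \<Longrightarrow> 0 \<notin># line n t v"
  by (auto simp: line_def)

lemma line_holo:
  assumes f: "BC_theta n m p f"
  shows "(\<lambda>v. mset_fun n f (line n t v)) holomorphic_on - {0}"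
proof -
  have "(\<lambda>v. f (\<lambda>i\<in>{1..n}. v * t ^ (n - i))) holomorphic_on - {0}"
  proof (rule torus_holo_line[where n = n and f = f and x = "\<lambda>v. \<lambda>i\<in>{1..n}. v * t ^ (n - i)" and c = "\<lambda>i. t ^ (n - i)" and d = "\<lambda>_. 0"])
    show "torus_holomorphic n f" using f by (simp add: BC_theta_def)
  qed (auto simp: ctorus_def PiE_iff)
  then show ?thesis by (rule holomorphic_transform) (use line_pt[OF f] in auto)
qed

lemma prod_line: "(\<Prod>e<n. (p * (v * t ^ e)\<^sup>2) ^ m) = (t ^ (n - 1) * p * v\<^sup>2) ^ (n * m)"
proof -
  have "(\<Prod>e<n. (t ^ e)\<^sup>2) = (\<Prod>e<n. t ^ e) * (\<Prod>e<n. t ^ e)"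
    by (simp add: power2_eq_square prod.distrib)
  also have "(\<Prod>e<n. t ^ e) * (\<Prod>e<n. t ^ e) = (\<Prod>e<n. t ^ (n - Suc e)) * (\<Prod>e<n. t ^ e)"
    by (subst prod.nat_diff_reindex) simp
  also have "\<dots> = (\<Prod>e<n. t ^ (n - 1))"
    unfolding prod.distrib[symmetric]
  proof (rule prod.cong[OF refl])
    fix e assume "e \<in> {..<n}"
    then have "n - Suc e + e = n - 1" by auto
    then show "t ^ (n - Suc e) * t ^ e = t ^ (n - 1)" by (simp only: power_add[symmetric])
  qed
  finally have 1: "(\<Prod>e<n. (t ^ e)\<^sup>2) = (t ^ (n - 1)) ^ n" by simp
  have "(\<Prod>e<n. p * (v * t ^ e)\<^sup>2) = (p * v\<^sup>2) ^ n * (\<Prod>e<n. (t ^ e)\<^sup>2)"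
    by (simp add: power_mult_distrib prod.distrib mult.assoc[symmetric])
  also have "\<dots> = (t ^ (n - 1) * p * v\<^sup>2) ^ n"
    unfolding 1 by (simp add: power_mult_distrib mult_ac)
  finally show ?thesis by (simp add: prod_power_distrib[symmetric] power_mult)
qed

lemma line_p:
  assumes f: "sym_theta n m f" and v: "v \<noteq> 0"
  shows "(t ^ (n - 1) * p * v\<^sup>2) ^ (n * m) * f (line n t (p * v)) = f (line n t v)"
proof -
  have "(\<Prod>x\<in>#line n t v. (p * x\<^sup>2) ^ m) * f (image_mset ((*) p) (line n t v) + {#}) = f (line n t v + {#})"
    by (rule sym_theta_p[OF f]) (use line_nz[OF v] in auto)
  moreover have "image_mset ((*) p) (line n t v) = line n t (p * v)"
    by (simp add: line_def multiset.map_comp o_def mult.assoc)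
  moreover have "(\<Prod>x\<in>#line n t v. (p * x\<^sup>2) ^ m) = (\<Prod>e<n. (p * (v * t ^ e)\<^sup>2) ^ m)"
    by (simp add: line_def multiset.map_comp o_def prod_unfold_prod_mset)
  ultimately show ?thesis by (simp add: prod_line)
qed

lemma normf_p:
  assumes lam: "lam \<in> subpartitions (rect_part m n)" and v: "v \<noteq> 0"
  shows "(t ^ (n - 1) * p * v\<^sup>2) ^ (n * m) * normf m n lam (p * v) = normf m n lam v"
proof -
  have pc: "(\<Prod>b\<in>B. c * g b) = c ^ card B * prod g B"
    for c and g :: "bool \<times> nat \<times> nat \<Rightarrow> complex" and B
    by (simp add: prod.distrib)
  have "(t ^ (n - 1) * p * v\<^sup>2) ^ (n * m) * normf m n lam (p * v) =
    (\<Prod>b\<in>boxes m n lam. (t ^ (n - 1) * p * v\<^sup>2) * (th (t ^ (n - 1) * box_root b * (p * v)) * th (box_root b / (p * v))))"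
    using pc[of _ "\<lambda>b. th (t ^ (n - 1) * box_root b * (p * v)) * th (box_root b / (p * v))" "boxes m n lam"]
    unfolding normf_def card_boxes[OF lam, symmetric] by simp
  also have "\<dots> = normf m n lam v"
    unfolding normf_def
  proof (rule prod.cong[OF refl])
    fix b
    have e: "th (t ^ (n - 1) * box_root b * (p * v)) = - th (t ^ (n - 1) * box_root b * v) / (t ^ (n - 1) * box_root b * v)"
      "th (box_root b / (p * v)) = - (box_root b / v) * th (box_root b / v) / p"
      using theta_p[of "t ^ (n - 1) * box_root b * v"] theta_div_p[of "box_root b / v"] v
      by (simp_all add: mult_ac)
    show "(t ^ (n - 1) * p * v\<^sup>2) * (th (t ^ (n - 1) * box_root b * (p * v)) * th (box_root b / (p * v))) = th (t ^ (n - 1) * box_root b * v) * th (box_root b / v)"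
      unfolding e using v by (simp add: power2_eq_square)
  qed
  finally show ?thesis .
qed

text \<open>On the line, the function from \<open>weak_exists\<close> vanishes at every root of the
  normalizing product and has its multiplier, so it equals c times that product. Dividing by c gives
  the normalization, provided c \<noteq> 0.\<close>

lemma star_exists_data:
  assumes N: "3 * m + 3 \<le> N" "2 * n + m + 3 \<le> N" and n: "1 \<le> n"
    and lam: "lam \<in> subpartitions (rect_part m n)"
  obtains f where "BC_theta n m p f"
    "\<And>\<mu>. \<mu> \<in> subpartitions (rect_part m n) \<Longrightarrow> \<mu> \<noteq> lam \<Longrightarrow> f (vp m n lam \<mu>) = 0"
    "\<And>v. v \<noteq> 0 \<Longrightarrow> mset_fun n f (line n t v) = normf m n lam v"
    "mset_fun n f (ev lt (suf n True 1 lam)) \<noteq> 0"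
    "normf m n lam (\<beta> True * q ^ m) \<noteq> 0"
    "\<And>\<nu>. (\<And>k k'. 1 \<le> k \<Longrightarrow> k \<le> k' \<Longrightarrow> k' \<le> n \<Longrightarrow> \<nu> k' \<le> \<nu> k) \<Longrightarrow>
       (\<And>k. 1 \<le> k \<Longrightarrow> k \<le> n \<Longrightarrow> \<nu> k \<le> m) \<Longrightarrow> (\<exists>k. 1 \<le> k \<and> k \<le> n \<and> \<nu> k < lam k) \<Longrightarrow>
       mset_fun n f (ev lt (suf n True 1 \<nu>)) = 0"
proof -
  have L: "lattice p \<beta> q t N" by (rule lattice_axioms)
  have N2: "2 * m \<le> N" "2 * n \<le> N" "2 * m + 2 \<le> N" "2 * n + 2 \<le> N" using N by auto
  obtain f where f: "BC_theta n m p f"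
    "\<And>\<mu>. \<mu> \<in> subpartitions (rect_part m n) \<Longrightarrow> \<mu> \<noteq> lam \<Longrightarrow> f (vp m n lam \<mu>) = 0"
    "mset_fun n f (ev lt (suf n True 1 lam)) \<noteq> 0"
    using weak_exists[OF N2(1,2) n lam] by blast
  have fs: "sym_theta n m (mset_fun n f)" by (rule mset_fun_sym_theta[OF f(1)])
  have w: "weak m n lam (mset_fun n f)" by (rule weak_of_vp[OF f(1) lam f(2)])
  note lamr = lam[unfolded mem_subpartitions_rect]
  have ext: "mset_fun n f (ev lt (suf n c 1 \<nu>)) = 0"
    if "\<And>k k'. 1 \<le> k \<Longrightarrow> k \<le> k' \<Longrightarrow> k' \<le> n \<Longrightarrow> \<nu> k' \<le> \<nu> k" "\<And>k. 1 \<le> k \<Longrightarrow> k \<le> n \<Longrightarrow> \<nu> k \<le> m"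
      "\<exists>k. 1 \<le> k \<and> k \<le> n \<and> \<nu> k < lams m n lam c k" for c \<nu>
  proof (rule lattice_extra_vanishing[of \<beta> q t "N - 1" m n])
    show "lattice p \<beta> q t (Suc (N - 1))" using L N by simp
  qed (use N n fs w lam that in auto)
  have "lam n \<le> m" using lamr n by simp
  \<comment> \<open>For v = a q^m the line passes through the point of the constant partition m.
    \<open>lattice_column_nz\<close> reaches it from \<open>lam\<close> in \<open>m - lam n\<close>
    steps; this gives c \<noteq> 0.\<close>
  have top: "mset_fun n f (line n t (\<beta> True * q ^ m)) \<noteq> 0"
  proof -
    have "mset_fun n f (ev (lat \<beta> q t) (suf n True 1 (\<lambda>j. max (lam j) (lam n + (m - lam n))))) \<noteq> 0"
    proof (rule lattice_column_nz[of \<beta> q t "N - m"])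
      show "lattice p \<beta> q t (N - m + (m - lam n))"
        by (rule lattice_mono[OF L]) (use N \<open>lam n \<le> m\<close> in auto)
    qed (use N n lam fs w f(3) \<open>lam n \<le> m\<close> in auto)
    moreover have "suf n True 1 (\<lambda>j. max (lam j) (lam n + (m - lam n))) = suf n True 1 (\<lambda>_. m)"
      by (rule suf_cong) (use lamr \<open>lam n \<le> m\<close> in \<open>auto simp: max_def\<close>)
    moreover have "ev lt (suf n True 1 (\<lambda>_. m)) = line n t (\<beta> True * q ^ m)"
      by (subst ev_suf_const[OF order_refl]) (simp add: line_def lat_def)
    ultimately show ?thesis by simp
  qed
  define \<phi> where "\<phi> = (\<lambda>v. mset_fun n f (line n t v))"
  define M where "M = (\<lambda>v. 1 / (t ^ (n - 1) * p * v\<^sup>2) ^ (n * m))"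
  have \<phi>p: "\<phi> (p * v) = M v * \<phi> v" if "v \<noteq> 0" for v
    using line_p[OF fs that] that by (simp add: \<phi>_def M_def field_simps)
  have \<phi>pk: "\<phi> (p powi k * v) = 0 \<longleftrightarrow> \<phi> v = 0" if v: "v \<noteq> 0" for k v
  proof (induction k rule: int_induct[where k = 0])
    case (step1 i)
    have "\<phi> (p powi (i + 1) * v) = 0 \<longleftrightarrow> \<phi> (p powi i * v) = 0"
      using \<phi>p[of "p powi i * v"] v by (simp add: power_int_add mult_ac M_def)
    then show ?case using step1 by simp
  next
    case (step2 i)
    have "\<phi> (p powi (i - 1) * v) = 0 \<longleftrightarrow> \<phi> (p powi i * v) = 0"
      using \<phi>p[of "p powi (i - 1) * v"] v by (simp add: power_int_diff mult_ac M_def)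
    then show ?case using step2 by simp
  qed simp
  have root0: "\<phi> (box_root b) = 0" if b: "b \<in> boxes m n lam" for b
  proof -
    obtain c i j where be: "b = (c, i, j)" by (cases b)
    show ?thesis unfolding \<phi>_def be
      by (rule line_brt_0[OF fs N2(1,2) ext]) (use in_boxes[OF lam b[unfolded be]] in auto)
  qed
  have inv0: "\<phi> (1 / (t ^ (n - 1) * v)) = \<phi> v" if v: "v \<noteq> 0" for v
    unfolding \<phi>_def line_inv[OF t_nz v]
    using sym_theta_inv[OF fs line_nz[OF v], of "{#}"] by simp
  obtain c where c: "\<And>v. v \<noteq> 0 \<Longrightarrow> \<phi> v = c * normf m n lam v"
  proof (rule quasi_periodic_ratio_const[OF normf_simple_zeros[OF lam N2(3,4) n], of \<phi> M])
    show "\<phi> holomorphic_on - {0}" unfolding \<phi>_def by (rule line_holo[OF f(1)])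
    show "normf m n lam (p * z) = M z * normf m n lam z" if "z \<noteq> 0" for z
      using normf_p[OF lam that] that by (simp add: M_def field_simps)
    show "M z \<noteq> 0" if "z \<noteq> 0" for z using that by (simp add: M_def)
    show "\<phi> w = 0" if w: "w \<noteq> 0" "normf m n lam w = 0" for w
    proof -
      obtain b where b: "b \<in> boxes m n lam" "th (t ^ (n - 1) * box_root b * w) = 0 \<or> th (box_root b / w) = 0"
        using w(2) finite_boxes[OF lam] by (auto simp: normf_def prod_zero_iff)
      from b(2) show ?thesis
      proof
        assume "th (t ^ (n - 1) * box_root b * w) = 0"
        then obtain k :: int where "t ^ (n - 1) * box_root b * w = p powi k" using theta_eq_0_iff w(1) by force
        then have "w = p powi k * (1 / (t ^ (n - 1) * box_root b))" by (simp add: field_simps)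
        then show ?thesis using \<phi>pk[of "1 / (t ^ (n - 1) * box_root b)" k] inv0[of "box_root b"] root0[OF b(1)]
          by simp
      next
        assume "th (box_root b / w) = 0"
        then obtain k :: int where "box_root b / w = p powi k" using theta_eq_0_iff w(1) by force
        then have "w = p powi (- k) * box_root b" using w(1) by (simp add: power_int_minus field_simps)
        then show ?thesis using \<phi>pk[of "box_root b" "- k"] root0[OF b(1)] by simp
      qed
    qed
  qed (use \<phi>p in auto)
  have cR: "c * normf m n lam (\<beta> True * q ^ m) \<noteq> 0"
    using top c[of "\<beta> True * q ^ m"] by (simp add: \<phi>_def)
  then have c0: "c \<noteq> 0" by auto
  define g where "g = (\<lambda>x\<in>ctorus n. (1 / c) * f x)"
  have g: "BC_theta n m p g" unfolding g_def by (rule BC_theta_cmul[OF f(1) n p_nz])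
  have mg: "mset_fun n g M = (1 / c) * mset_fun n f M" if "size M = n" "0 \<notin># M" for M
  proof -
    obtain xs where xs: "mset xs = M" using ex_mset by blast
    have "length xs = n" "0 \<notin> set xs" using xs that by auto
    then show ?thesis using mset_fun_eq[OF g, of xs] mset_fun_eq[OF f(1), of xs] pt_ctorus[of xs n] xs
      by (simp add: g_def)
  qed
  have mgl: "mset_fun n g (ev lt (suf n True 1 \<nu>)) = (1 / c) * mset_fun n f (ev lt (suf n True 1 \<nu>))"
    for \<nu>
    by (rule mg) (auto simp: card_suf in_ev)
  show ?thesis
  proof (rule that[OF g])
    show "g (vp m n lam \<mu>) = 0" if "\<mu> \<in> subpartitions (rect_part m n)" "\<mu> \<noteq> lam" for \<mu>
      using f(2)[OF that] vp_ctorus[of m n lam \<mu>] by (simp add: g_def)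
    show "mset_fun n g (line n t v) = normf m n lam v" if "v \<noteq> 0" for v
      using mg[of "line n t v"] line_nz[OF that] c[OF that] c0 by (simp add: \<phi>_def)
    show "mset_fun n g (ev lt (suf n True 1 lam)) \<noteq> 0" unfolding mgl using f(3) c0 by simp
    show "normf m n lam (\<beta> True * q ^ m) \<noteq> 0" using cR by auto
    show "mset_fun n g (ev lt (suf n True 1 \<nu>)) = 0"
      if "\<And>k k'. 1 \<le> k \<Longrightarrow> k \<le> k' \<Longrightarrow> k' \<le> n \<Longrightarrow> \<nu> k' \<le> \<nu> k"
      "\<And>k. 1 \<le> k \<Longrightarrow> k \<le> n \<Longrightarrow> \<nu> k \<le> m" "\<exists>k. 1 \<le> k \<and> k \<le> n \<and> \<nu> k < lam k"
        for \<nu>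
      unfolding mgl using ext[of \<nu> True] that by (simp add: lams_def)
  qed
qed

lemma weak_lincomb:
  assumes "weak m n lam f" "weak m n lam g"
  shows "weak m n lam (\<lambda>M. c * f M + d * g M)"
  unfolding weak_def
proof (intro allI impI)
  fix i v assume a: "descending n i v" "i True + i False = n + 2" "lower m n lam i v \<or> upper m n lam i v"
  have "f (ev lt (config n i v)) = 0" "g (ev lt (config n i v)) = 0"
    using assms[unfolded weak_def, rule_format, OF a] .
  then show "c * f (ev lt (config n i v)) + d * g (ev lt (config n i v)) = 0"
    by (simp only: mult_zero_right add_0_right)
qed

text \<open>Uniqueness up to a factor gives f = \<kappa> g on the torus; comparing at one point of
  the line where the normalization is nonzero gives \<kappa> = 1. Off the torus both are
  \<open>undefined\<close>.\<close>

lemma star_unique: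
  assumes N: "3 * m + 3 \<le> N" "2 * n + m + 3 \<le> N" and n: "1 \<le> n"
    and lam: "lam \<in> subpartitions (rect_part m n)"
    and f: "BC_theta n m p f"
      "\<And>\<mu>. \<mu> \<in> subpartitions (rect_part m n) \<Longrightarrow> \<mu> \<noteq> lam \<Longrightarrow> f (vp m n lam \<mu>) = 0"
      "\<And>v. v \<noteq> 0 \<Longrightarrow> mset_fun n f (line n t v) = normf m n lam v"
    and g: "BC_theta n m p g"
      "\<And>\<mu>. \<mu> \<in> subpartitions (rect_part m n) \<Longrightarrow> \<mu> \<noteq> lam \<Longrightarrow> g (vp m n lam \<mu>) = 0"
      "\<And>v. v \<noteq> 0 \<Longrightarrow> mset_fun n g (line n t v) = normf m n lam v"
      "mset_fun n g (ev lt (suf n True 1 lam)) \<noteq> 0" "normf m n lam (\<beta> True * q ^ m) \<noteq> 0"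
  shows "f = g"
proof -
  have N2: "2 * m \<le> N" "2 * n \<le> N" using N by auto
  note lamr = lam[unfolded mem_subpartitions_rect]
  have fs: "sym_theta n m (mset_fun n f)" "sym_theta n m (mset_fun n g)" using f(1) g(1) mset_fun_sym_theta by auto
  have w: "weak m n lam (mset_fun n f)" "weak m n lam (mset_fun n g)"
    by (rule weak_of_vp[OF f(1) lam f(2)], assumption+, rule weak_of_vp[OF g(1) lam g(2)])
  define \<kappa> where "\<kappa> = mset_fun n f (ev lt (suf n True 1 lam)) / mset_fun n g (ev lt (suf n True 1 lam))"
  let ?h = "\<lambda>M. 1 * mset_fun n f M + (- \<kappa>) * mset_fun n g M"
  have hs: "sym_theta n m ?h"
    unfolding sym_theta_def
    by (intro allI impI, rule BC1_lincomb; rule fs[unfolded sym_theta_def, rule_format]; assumption)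
  have h0: "?h M = 0" if M: "size M = n" "0 \<notin># M" for M
  proof (rule sym_theta_eq_0[OF hs _ M])
    fix M :: "complex multiset" assume M: "size M = n" "good M"
    show "?h M = 0"
    proof (rule weak_eq_0[OF sym_theta_generic[OF hs] N2 n _ _ _ _ M])
      show "weak m n lam ?h" by (rule weak_lincomb[OF w])
      show "?h (ev lt (suf n True 1 lam)) = 0" using g(4) by (simp add: \<kappa>_def)
      show "lam k \<le> m" if "1 \<le> k" for k using lamr that by (cases "k \<le> n") auto
      show "lam k' \<le> lam k" if "1 \<le> k" "k \<le> k'" "k' \<le> n" for k k'
        using is_partition_mono[of lam] lamr that by blast
    qed
  qed
  have v: "\<beta> True * q ^ m \<noteq> 0" by simp
  have "\<kappa> = 1"
    using h0[of "line n t (\<beta> True * q ^ m)"] line_nz[OF v] f(3)[OF v] g(3)[OF v] g(5) by simp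
  have "f x = g x" for x
  proof (cases "x \<in> ctorus n")
    case True
    have "size (mset (map x [1..<n + 1])) = n" by (simp del: upt_Suc)
    moreover have "0 \<notin># mset (map x [1..<n + 1])" using True
      by (auto simp: ctorus_def PiE_iff simp del: upt_Suc)
    ultimately have "mset_fun n f (mset (map x [1..<n + 1])) = mset_fun n g (mset (map x [1..<n + 1]))"
      using h0 \<open>\<kappa> = 1\<close> by fastforce
    then show ?thesis using mset_fun_points[OF f(1) True] mset_fun_points[OF g(1) True] by simp
  next
    case False
    have "f \<in> extensional (ctorus n)" "g \<in> extensional (ctorus n)" using f(1) g(1)
      by (auto simp: BC_theta_def)
    then show ?thesis using False by (simp add: extensional_def)
  qed
  then show ?thesis by (rule ext)
qed

lemma star_cond_iff:
  assumes "lam \<in> subpartitions (rect_part m n)"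
  shows "star_cond m n lam (\<beta> True) (\<beta> False) q t p f \<longleftrightarrow> BC_theta n m p f \<and>
    (\<forall>\<mu>\<in>subpartitions (rect_part m n). \<mu> \<noteq> lam \<longrightarrow> f (vp m n lam \<mu>) = 0) \<and>
    (\<forall>v. v \<noteq> 0 \<longrightarrow> mset_fun n f (line n t v) = normf m n lam v)"
  unfolding star_cond_def normf_C0[OF assms, symmetric] using line_pt[of n m f] by auto

lemma P_star_props:
  assumes N: "3 * m + 3 \<le> N" "2 * n + m + 3 \<le> N" and n: "1 \<le> n"
    and lam: "lam \<in> subpartitions (rect_part m n)"
  shows "\<exists>!f. star_cond m n lam (\<beta> True) (\<beta> False) q t p f"
    and "star_cond m n lam (\<beta> True) (\<beta> False) q t p (P_star m n lam (\<beta> True) (\<beta> False) q t p)"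
    and "is_partition \<kappa> \<Longrightarrow> \<exists>k. 1 \<le> k \<and> k \<le> n \<and> \<kappa> k < lam k \<Longrightarrow> 2 * \<kappa> 1 \<le> N \<Longrightarrow>
      P_star m n lam (\<beta> True) (\<beta> False) q t p (\<lambda>i\<in>{1..n}. \<beta> True * t ^ (n - i) * q ^ \<kappa> i) = 0"
proof -
  obtain g where g: "BC_theta n m p g"
    "\<And>\<mu>. \<mu> \<in> subpartitions (rect_part m n) \<Longrightarrow> \<mu> \<noteq> lam \<Longrightarrow> g (vp m n lam \<mu>) = 0"
    "\<And>v. v \<noteq> 0 \<Longrightarrow> mset_fun n g (line n t v) = normf m n lam v"
    "mset_fun n g (ev lt (suf n True 1 lam)) \<noteq> 0"
    "normf m n lam (\<beta> True * q ^ m) \<noteq> 0"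
    "\<And>\<nu>. (\<And>k k'. 1 \<le> k \<Longrightarrow> k \<le> k' \<Longrightarrow> k' \<le> n \<Longrightarrow> \<nu> k' \<le> \<nu> k) \<Longrightarrow>
       (\<And>k. 1 \<le> k \<Longrightarrow> k \<le> n \<Longrightarrow> \<nu> k \<le> m) \<Longrightarrow> (\<exists>k. 1 \<le> k \<and> k \<le> n \<and> \<nu> k < lam k) \<Longrightarrow>
       mset_fun n g (ev lt (suf n True 1 \<nu>)) = 0"
    using star_exists_data[OF N n lam] by blast
  have gc: "star_cond m n lam (\<beta> True) (\<beta> False) q t p g" unfolding star_cond_iff[OF lam] using g
    by blast
  show ex1: "\<exists>!f. star_cond m n lam (\<beta> True) (\<beta> False) q t p f"
  proof (rule ex1I[of _ g])
    show "f = g" if "star_cond m n lam (\<beta> True) (\<beta> False) q t p f" for f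
    proof (rule star_unique[OF N n lam _ _ _ g(1-5)])
    qed (use that[unfolded star_cond_iff[OF lam]] in auto)
  qed (rule gc)
  show "star_cond m n lam (\<beta> True) (\<beta> False) q t p (P_star m n lam (\<beta> True) (\<beta> False) q t p)"
    unfolding P_star_eq by (rule theI'[OF ex1])
  have Pg: "P_star m n lam (\<beta> True) (\<beta> False) q t p = g"
    unfolding P_star_eq by (rule the1_equality[OF ex1], rule gc)
  assume \<kappa>: "is_partition \<kappa>" "\<exists>k. 1 \<le> k \<and> k \<le> n \<and> \<kappa> k < lam k" "2 * \<kappa> 1 \<le> N"
  obtain k where k: "1 \<le> k" "k \<le> n" "\<kappa> k < lam k" using \<kappa>(2) by blast
  have N2: "2 * m \<le> N" "2 * n \<le> N" using N by auto
  have gs: "sym_theta n m (mset_fun n g)" by (rule mset_fun_sym_theta[OF g(1)])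
  let ?x = "\<lambda>i\<in>{1..n}. \<beta> True * t ^ (n - i) * q ^ \<kappa> i"
  have x: "?x \<in> ctorus n" by (auto simp: ctorus_def PiE_iff)
  have pts: "mset (map ?x [1..<n + 1]) = ev lt (suf n True 1 \<kappa>)"
  proof -
    have "mset (map ?x [1..<n + 1]) = mset (map (\<lambda>i. lt (True, \<kappa> i, n - i)) [1..<n + 1])"
      by (rule arg_cong[of _ _ mset], rule map_cong) (auto simp: lat_def mult_ac)
    also have "\<dots> = ev lt (suf n True 1 \<kappa>)"
      unfolding ev_suf_cfg ev_cfg config_rows_def by (simp add: o_def del: upt_Suc)
    finally show ?thesis .
  qed
  have lk: "lam k \<le> m" using lam k by (auto simp: mem_subpartitions_rect)
  \<comment> \<open>Only the rows from the deficient row k on are prescribed, and these are at most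
    m. Earlier rows of \<kappa> may exceed m and count as free coordinates.\<close>
  have "vanishes n (mset_fun n g) lt (suf n True k \<kappa>)"
    by (rule vanishes_strong[OF sym_theta_generic[OF gs] N2 g(6)])
      (use k lk is_partition_mono[OF \<kappa>(1)] in auto)
  then have "vanishes n (mset_fun n g) lt (suf n True 1 \<kappa>)"
  proof (rule vanishes_mono)
    show "suf n True k \<kappa> \<subseteq> suf n True 1 \<kappa>"
      unfolding suf_def[of n True 1] by (rule suf_subset_cfg) (use k in auto)
  qed simp
  moreover have "good (ev lt (suf n True 1 \<kappa>))"
  proof (rule good_lat)
    fix x assume x: "x \<in> suf n True 1 \<kappa>"
    obtain c e l where xe: "x = (c, e, l)" by (cases x)
    obtain j where j: "1 \<le> j" "j \<le> n" "e = \<kappa> j" "l = n - j" using x unfolding xe in_suf by auto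
    have "e \<le> \<kappa> 1" "l \<le> n" using j is_partition_mono[OF \<kappa>(1), of 1 j] by auto
    then show "in_range x" using N2 \<kappa>(3) by (simp add: in_range_def xe)
  qed simp
  ultimately have "mset_fun n g (ev lt (suf n True 1 \<kappa>)) = 0"
    unfolding vanishes_def by (metis add.right_neutral add_0 size_empty card_suf diff_add_inverse2)
  then show "P_star m n lam (\<beta> True) (\<beta> False) q t p ?x = 0"
    unfolding Pg using mset_fun_points[OF g(1) x] pts by simp
qed

section \<open>Symmetry and vanishing of the interpolation abelian functions\<close>

lemma lattice_neg: "lattice p (\<lambda>c. - \<beta> c) q t N"
  by unfold_locales (use gen_qt gen_mult gen_div in auto)

text \<open>The value of \<open>csqrt\<close> in the binomial coefficient may differ in sign from
  the root used for the hat parameter. Changing the sign of a, b and all coordinates turns the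
  defining conditions into each other, and uniqueness applies.\<close>

lemma P_star_neg:
  assumes N: "3 * m + 3 \<le> N" "2 * n + m + 3 \<le> N" and n: "1 \<le> n"
    and lam: "lam \<in> subpartitions (rect_part m n)" and x: "x \<in> ctorus n"
  shows "P_star m n lam (- \<beta> True) (- \<beta> False) q t p (\<lambda>i\<in>{1..n}. - x i) = P_star m n lam (\<beta> True) (\<beta> False) q t p x"
proof -
  let ?s = "\<lambda>x. \<lambda>i\<in>{1..n}. (- 1) * x i"
  define f where "f = P_star m n lam (\<beta> True) (\<beta> False) q t p"
  define g where "g = (\<lambda>x\<in>ctorus n. 1 * f (?s x))"
  have f: "star_cond m n lam (\<beta> True) (\<beta> False) q t p f"
    unfolding f_def by (rule P_star_props(2)[OF N n lam])
  have sx: "?s y \<in> ctorus n" if "y \<in> ctorus n" for y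
    using that by (auto simp: ctorus_def PiE_iff)
  have g0: "g y = f (?s y)" if "y \<in> ctorus n" for y using that by (simp add: g_def)
  have "star_cond m n lam (- \<beta> True) (- \<beta> False) q t p g"
    unfolding star_cond_def
  proof (intro conjI ballI allI impI)
    show "BC_theta n m p g" unfolding g_def
      by (rule BC_theta_scale[OF _ n p_nz]) (use f in \<open>auto simp: star_cond_def\<close>)
    show "g (vanishing_point m n lam mu (- \<beta> True) (- \<beta> False) q t) = 0"
      if mu: "mu \<in> subpartitions (rect_part m n)" "mu \<noteq> lam" for mu
    proof -
      let ?v = "vanishing_point m n lam mu (- \<beta> True) (- \<beta> False) q t"
      have v: "?v \<in> ctorus n" by (auto simp: vanishing_point_def ctorus_def PiE_iff)
      have "?s ?v = vp m n lam mu" by (auto simp: vanishing_point_def fun_eq_iff)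
      then show ?thesis using f mu g0[OF v] by (simp add: star_cond_def)
    qed
    fix v :: complex assume v: "v \<noteq> 0"
    let ?v = "\<lambda>i\<in>{1..n}. v * t ^ (n - i)"
    have vc: "?v \<in> ctorus n" using v by (auto simp: ctorus_def PiE_iff)
    have s: "?s ?v = (\<lambda>i\<in>{1..n}. (- v) * t ^ (n - i))" by (auto simp: fun_eq_iff)
    have v': "- v \<noteq> 0" using v by simp
    have "f (\<lambda>i\<in>{1..n}. (- v) * t ^ (n - i)) =
       C0 lam (t ^ (n - 1) * \<beta> True * (- v)) q t p * C0 lam (\<beta> True / (- v)) q t p *
        (C0 (rect_compl m n lam) (t ^ (n - 1) * \<beta> False * (- v)) q t p * C0 (rect_compl m n lam) (\<beta> False / (- v)) q t p)"
      using f v' unfolding star_cond_def by blast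
    then show "g ?v = C0 lam (t ^ (n - 1) * (- \<beta> True) * v) q t p * C0 lam (- \<beta> True / v) q t p *
        (C0 (rect_compl m n lam) (t ^ (n - 1) * (- \<beta> False) * v) q t p * C0 (rect_compl m n lam) (- \<beta> False / v) q t p)"
      unfolding g0[OF vc] s by simp
  qed
  then have "P_star m n lam (- \<beta> True) (- \<beta> False) q t p = g"
    unfolding P_star_eq
    by (intro the1_equality lattice.P_star_props(1)[OF lattice_neg N n lam])
  moreover have "(\<lambda>i\<in>{1..n}. - x i) \<in> ctorus n" using x by (auto simp: ctorus_def PiE_iff)
  moreover have "?s (\<lambda>i\<in>{1..n}. - x i) = x" using x
    by (auto simp: ctorus_def PiE_iff extensional_def fun_eq_iff)
  ultimately show ?thesis by (simp only: g0 f_def)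
qed

end

definition base_pair :: "complex \<Rightarrow> complex \<Rightarrow> bool \<Rightarrow> complex" where
  "base_pair a b c = (if c then a else b)"

lemma base_pair_simps [simp]: "base_pair a b True = a" "base_pair a b False = b"
  by (simp_all add: base_pair_def)

lemma subpartition_rect:
  assumes "is_partition \<mu>" "\<And>k. n < k \<Longrightarrow> \<mu> k = 0"
  shows "\<mu> \<in> subpartitions (rect_part (\<mu> 1) n)" "zero_part \<in> subpartitions (rect_part m n)"
proof -
  show "\<mu> \<in> subpartitions (rect_part (\<mu> 1) n)"
    unfolding mem_subpartitions_rect using assms is_partition_mono[OF assms(1) order_refl] by blast
  show "zero_part \<in> subpartitions (rect_part m n)"
    by (simp add: mem_subpartitions_rect is_partition_def zero_part_def)
qed

context nome
begin

text \<open>\<open>R_star\<close> replaces b by q^(-m) b. A product of two such factors moves the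
  q-exponent by up to 2 m, which is taken from the bound.\<close>

lemma lattice_qshift:
  assumes L: "lattice p (base_pair a b) q t (N + 2 * m)"
  shows "lattice p (base_pair a (q powi (- int m) * b)) q t N"
proof -
  interpret lattice p "base_pair a b" q t "N + 2 * m" by fact
  have ab: "a \<noteq> 0" "b \<noteq> 0" using \<beta>_nz[of True] \<beta>_nz[of False] by auto
  show ?thesis
  proof unfold_locales
    show "q \<noteq> 0" "t \<noteq> 0" by simp_all
    show "base_pair a (q powi (- int m) * b) s \<noteq> 0" for s using ab by (cases s) auto
    fix i j :: int assume ij: "\<bar>i\<bar> \<le> int N" "\<bar>j\<bar> \<le> int N"
    show "th (q powi i * t powi j) \<noteq> 0" if "(i, j) \<noteq> (0, 0)" by (rule gen_qt) (use ij that in auto)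
    have "a / (q powi (- int m) * b) * q powi i * t powi j = base_pair a b True / base_pair a b False * q powi (i + int m) * t powi j"
      by (simp add: power_int_add power_int_minus field_simps)
    then show "th (base_pair a (q powi (- int m) * b) True / base_pair a (q powi (- int m) * b) False * q powi i * t powi j) \<noteq> 0"
      using gen_div[of "i + int m" j] ij by simp
    fix s s'
    define c :: "bool \<Rightarrow> int" where "c s = (if s then 0 else - int m)" for s
    have e: "base_pair a (q powi (- int m) * b) s = base_pair a b s * q powi c s" for s
      by (cases s) (simp_all add: c_def)
    have c: "- int m \<le> c s" "c s \<le> 0" for s by (simp_all add: c_def)
    have "base_pair a (q powi (- int m) * b) s * base_pair a (q powi (- int m) * b) s' * q powi i * t powi j =
      base_pair a b s * base_pair a b s' * q powi (i + c s + c s') * t powi j"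
      unfolding e by (simp add: power_int_add mult_ac)
    moreover have "th (base_pair a b s * base_pair a b s' * q powi (i + c s + c s') * t powi j) \<noteq> 0"
      by (rule gen_mult) (use ij c[of s] c[of s'] in auto)
    ultimately show "th (base_pair a (q powi (- int m) * b) s * base_pair a (q powi (- int m) * b) s' * q powi i * t powi j) \<noteq> 0"
      by simp
  qed
qed

lemma R_star_neg:
  assumes L: "lattice p (base_pair a b) q t N" and N: "5 * \<mu> 1 + 2 * n + 3 \<le> N" and n: "1 \<le> n"
    and \<mu>: "is_partition \<mu>" "\<And>k. n < k \<Longrightarrow> \<mu> k = 0" and x: "x \<in> ctorus n"
  shows "R_star n \<mu> (- a) (- b) q t p (\<lambda>i\<in>{1..n}. - x i) = R_star n \<mu> a b q t p x"
proof -
  let ?b = "q powi (- int (\<mu> 1)) * b"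
  interpret lattice p "base_pair a ?b" q t "N - 2 * \<mu> 1"
    by (rule lattice_qshift, rule lattice_mono[OF L]) (use N in auto)
  have "P_star (\<mu> 1) n \<nu> (- base_pair a ?b True) (- base_pair a ?b False) q t p (\<lambda>i\<in>{1..n}. - x i) =
      P_star (\<mu> 1) n \<nu> (base_pair a ?b True) (base_pair a ?b False) q t p x"
    if "\<nu> \<in> subpartitions (rect_part (\<mu> 1) n)" for \<nu>
    by (rule P_star_neg[OF _ _ n that x]) (use N in auto)
  from this[OF subpartition_rect(1)[OF \<mu>]] this[OF subpartition_rect(2)[OF \<mu>]]
  show ?thesis by (simp add: R_star_def Let_def)
qed

text \<open>The bound allows \<open>2 * \<mu> 1\<close> for \<open>lattice_qshift\<close>,
  \<open>3 * \<mu> 1 + 2 * n + 3\<close> for \<open>P_star_props\<close>, and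
  \<open>2 * \<kappa> 1\<close> to keep the point of \<kappa> in range.\<close>

lemma R_star_vanish:
  assumes L: "lattice p (base_pair a b) q t N" and N: "5 * \<mu> 1 + 2 * n + 3 + 2 * \<kappa> 1 \<le> N" and n: "1 \<le> n"
    and \<mu>: "is_partition \<mu>" "\<And>k. n < k \<Longrightarrow> \<mu> k = 0" and \<kappa>: "is_partition \<kappa>" "\<not> diagram \<mu> \<subseteq> diagram \<kappa>"
  shows "R_star n \<mu> a b q t p (\<lambda>i\<in>{1..n}. a * t ^ (n - i) * q ^ \<kappa> i) = 0"
proof -
  let ?b = "q powi (- int (\<mu> 1)) * b"
  interpret lattice p "base_pair a ?b" q t "N - 2 * \<mu> 1"
    by (rule lattice_qshift, rule lattice_mono[OF L]) (use N in auto)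
  obtain k j where k: "1 \<le> k" "1 \<le> j" "j \<le> \<mu> k" "\<not> j \<le> \<kappa> k" using \<kappa>(2)
    by (auto simp: diagram_def)
  then have "k \<le> n" using \<mu>(2)[of k] by (cases "n < k") auto
  then have ex: "\<exists>k. 1 \<le> k \<and> k \<le> n \<and> \<kappa> k < \<mu> k" using k
    by (intro exI[of _ k]) simp
  have "P_star (\<mu> 1) n \<mu> (base_pair a ?b True) (base_pair a ?b False) q t p (\<lambda>i\<in>{1..n}. base_pair a ?b True * t ^ (n - i) * q ^ \<kappa> i) = 0"
    by (rule P_star_props(3)[OF _ _ n subpartition_rect(1)[OF \<mu>] \<kappa>(1) ex]) (use N in auto)
  then show ?thesis by (simp add: R_star_def Let_def)
qed

lemma C0_nz:
  assumes \<mu>: "is_partition \<mu>" "\<And>k. n < k \<Longrightarrow> \<mu> k = 0"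
    and x: "\<And>i j. \<bar>i\<bar> \<le> int (\<mu> 1) \<Longrightarrow> \<bar>j\<bar> \<le> int n \<Longrightarrow> th (q powi i * t powi j * x) \<noteq> 0"
  shows "C0 \<mu> x q t p \<noteq> 0"
proof -
  have sub: "1 \<le> i \<and> i \<le> n \<and> 1 \<le> j \<and> j \<le> \<mu> 1" if "(i, j) \<in> diagram \<mu>"
    for i j
    using that is_partition_mono[OF \<mu>(1), of 1 i] \<mu>(2)[of i] unfolding diagram_def
    by (cases "n < i") auto
  have fin: "finite (diagram \<mu>)"
    by (rule finite_subset[of _ "{1..n} \<times> {1..\<mu> 1}"]) (use sub in auto)
  have "th (q powi (int j - 1) * t powi (1 - int i) * x) \<noteq> 0" if "(i, j) \<in> diagram \<mu>" for i j
    by (rule x) (use sub[OF that] in auto)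
  then show ?thesis unfolding C0_def prod_zero_iff[OF fin] by auto
qed

section \<open>Evaluation of the summands\<close>

text \<open>By \<open>sq\<close>, t^(n - 1) t0' is a square root of 1 / (u0 u1), so the value of
  \<open>csqrt\<close> equals it up to sign. With that root the parameters of the binomial
  coefficient become t0', u0' and its point that of \<open>lam\<close>; the sign disappears by
  \<open>R_star_neg\<close>.\<close>

lemma ell_binomial_eq:
  assumes n: "1 \<le> n" and L: "lattice p (base_pair t0' u0') q t N" and N: "5 * \<mu> 1 + 2 * n + 3 \<le> N"
    and \<mu>: "is_partition \<mu>" "\<And>k. n < k \<Longrightarrow> \<mu> k = 0"
    and nz: "t0 \<noteq> 0" "u0 \<noteq> 0" "u1 \<noteq> 0"
    and sq: "t0'\<^sup>2 = 1 / ((t ^ (n - 1))\<^sup>2 * u0 * u1)" and u0': "u0' / t0' = u0 / t0"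
  shows "ell_binomial n lam \<mu> (1 / (u0 * u1)) (1 / (t ^ (n - 1) * t0 * u1)) q t p =
    Delta \<mu> (t ^ (n - 1) * t0 / u0) [t ^ n, t ^ (n - 1) * t0 * u1] q t p *
    R_star n \<mu> t0' u0' q t p (\<lambda>i\<in>{1..n}. t0' * t ^ (n - i) * q ^ lam i)"
proof -
  interpret lattice p "base_pair t0' u0'" q t N by fact
  have t0': "t0' \<noteq> 0" using \<beta>_nz[of True] by simp
  define \<tau> where "\<tau> = t ^ (n - 1)"
  have \<tau>: "\<tau> \<noteq> 0" by (simp add: \<tau>_def)
  define r where "r = csqrt (1 / (u0 * u1))"
  note sq' = sq[folded \<tau>_def]
  have "r\<^sup>2 = (\<tau> * t0')\<^sup>2"
    unfolding power_mult_distrib sq' using \<tau> by (simp add: r_def)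
  then obtain s :: complex where s: "s = 1 \<or> s = - 1" and r: "r = s * (\<tau> * t0')"
    unfolding power2_eq_iff by (metis mult_1 mult_minus1)
  have u0'': "u0' = u0 * t0' / t0" using u0' t0' nz by (simp add: field_simps)
  have tt: "t0' * t0' * (\<tau>\<^sup>2 * u0 * u1) = 1" using sq' \<tau> nz by (simp add: power2_eq_square)
  have tp: "t powi (1 - int i) * \<tau> = t ^ (n - i)" if "i \<in> {1..n}" for i
  proof -
    have "t powi (1 - int i) * t powi int (n - 1) = t powi (int (n - i))"
      unfolding power_int_add[OF disjI1[OF t_nz], symmetric] using that
      by (intro arg_cong[of _ _ "\<lambda>k. t powi k"]) auto
    then show ?thesis by (simp only: \<tau>_def power_int_of_nat)
  qed
  have "1 \<in> {1..n} \<and> n \<in> {1..n}" using n by simp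
  then have tn: "t powi (1 - int n) * \<tau> = 1" using tp[of n] by simp
  have a: "t powi (1 - int n) * r = s * t0'" using tn by (simp add: r mult_ac)
  have "1 / (\<tau> * t0 * u1) / (s * (\<tau> * t0')) = s * u0'"
  proof -
    have "1 / s = s" using s by auto
    then have "1 / (\<tau> * t0 * u1) / (s * (\<tau> * t0')) = s * (1 / (\<tau> * t0 * u1 * (\<tau> * t0')))"
      by (metis (no_types, opaque_lifting) divide_divide_eq_left' divide_divide_eq_left mult.commute mult.right_neutral times_divide_eq_right)
    also have "1 / (\<tau> * t0 * u1 * (\<tau> * t0')) = u0'"
      using tt \<tau> nz t0' by (simp add: u0'' divide_simps power2_eq_square mult_ac)
    finally show ?thesis .
  qed
  then have b: "1 / (\<tau> * t0 * u1) / r = s * u0'" by (simp only: r)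
  have pt: "(\<lambda>i\<in>{1..n}. r * q ^ lam i * t powi (1 - int i)) = (\<lambda>i\<in>{1..n}. s * (t0' * t ^ (n - i) * q ^ lam i))"
    using tp by (auto simp: fun_eq_iff r mult_ac)
  have "R_star n \<mu> (s * t0') (s * u0') q t p (\<lambda>i\<in>{1..n}. s * (t0' * t ^ (n - i) * q ^ lam i)) =
    R_star n \<mu> t0' u0' q t p (\<lambda>i\<in>{1..n}. t0' * t ^ (n - i) * q ^ lam i)"
    using s
  proof
    assume s: "s = - 1"
    have "(\<lambda>i\<in>{1..n}. t0' * t ^ (n - i) * q ^ lam i) \<in> ctorus n" using t0'
      by (auto simp: ctorus_def PiE_iff)
    from R_star_neg[OF L N n \<mu> this]
    show ?thesis unfolding s by (simp cong: restrict_cong)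
  qed simp
  moreover have "1 / (u0 * u1) / (1 / (\<tau> * t0 * u1)) = \<tau> * t0 / u0" using nz \<tau> by simp
  moreover have "1 / (1 / (\<tau> * t0 * u1)) = \<tau> * t0 * u1" by simp
  ultimately show ?thesis
    unfolding ell_binomial_def \<tau>_def[symmetric] r_def[symmetric] a b pt by simp
qed

text \<open>B is to be t^(n - 1) t0 u1, which the change of parameters does not preserve. It occurs
  both in the binomial coefficient and in the denominator, and cancels once its C symbols are
  nonzero.\<close>

lemma R_tilde_term:
  fixes X :: complex
  assumes "ell_binomial n lam \<mu> a b q t p = Delta \<mu> A [t ^ n, B] q t p * R"
    and B: "C0 \<mu> B q t p \<noteq> 0" "C0 \<mu> (p * q * A / B) q t p \<noteq> 0"
  shows "ell_binomial n lam \<mu> a b q t p * X / Delta0 \<mu> A [c1, c2, c3, B] q t p =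
    Delta \<mu> A [t ^ n] q t p * (R * X) / Delta0 \<mu> A [c1, c2, c3] q t p"
proof -
  have "Delta \<mu> A [t ^ n, B] q t p = Delta \<mu> A [t ^ n] q t p * Delta0 \<mu> A [B] q t p"
    by (simp add: Delta_def Delta0_def mult_ac)
  moreover have "Delta0 \<mu> A [c1, c2, c3, B] q t p = Delta0 \<mu> A [c1, c2, c3] q t p * Delta0 \<mu> A [B] q t p"
    by (simp add: Delta0_def mult.assoc)
  moreover have "Delta0 \<mu> A [B] q t p \<noteq> 0" using B by (simp add: Delta0_def)
  ultimately show ?thesis using assms(1) by simp
qed

lemma subpartitions_le:
  assumes "is_partition lam" "\<mu> \<in> subpartitions lam"
  shows "is_partition \<mu>" "1 \<le> k \<Longrightarrow> \<mu> k \<le> lam k"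
proof -
  show "is_partition \<mu>" using assms by (simp add: subpartitions_def)
  show "\<mu> k \<le> lam k" if "1 \<le> k"
  proof (cases "\<mu> k = 0")
    case False
    then have "(k, \<mu> k) \<in> diagram \<mu>" using that by (simp add: diagram_def)
    then show ?thesis using assms(2) by (auto simp: subpartitions_def diagram_def)
  qed simp
qed

lemma part_length_0:
  assumes lam: "is_partition lam" and "part_length lam \<le> n" "n < k"
  shows "lam k = 0"
proof (rule ccontr)
  assume k: "lam k \<noteq> 0"
  have "lam i \<noteq> 0" if "1 \<le> i" "i \<le> k" for i using is_partition_mono[OF lam that] k by simp
  then have "{1..k} \<subseteq> {i. 1 \<le> i \<and> lam i \<noteq> 0}" by auto
  moreover have "finite {i. 1 \<le> i \<and> lam i \<noteq> 0}"
    by (rule finite_subset[of _ "{i. lam i \<noteq> 0}"]) (use lam in \<open>auto simp: is_partition_def\<close>)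
  ultimately have "card {1..k} \<le> part_length lam" unfolding part_length_def by (rule card_mono[rotated])
  then show False using assms(2,3) by simp
qed

lemma finite_subpartitions:
  assumes lam: "is_partition lam" "\<And>k. n < k \<Longrightarrow> lam k = 0"
  shows "finite (subpartitions lam)"
proof (rule finite_subset[OF _ finite_subpartitions_rect])
  show "subpartitions lam \<subseteq> subpartitions (rect_part (lam 1) n)"
    using subpartition_rect(1)[OF lam] unfolding subpartitions_def by blast
qed

text \<open>The two equations \<open>sq\<close> say that each set of parameters arises from the
  other, so \<open>ell_binomial_eq\<close> applies in both directions and yields the same summand
  \<open>T\<close>. The bound \<open>7 * (lam 1 + kap 1)\<close> covers 5 times the first part of
  \<mu> plus twice that of the partition at whose point it is evaluated.\<close>

lemma R_tilde_symmetric: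
  fixes n :: nat and lam kap :: "nat \<Rightarrow> nat" and t0 u0 u1 t0' u0' u1' q t :: complex
  defines "\<tau> \<equiv> t ^ (n - 1)"
  assumes n: "1 \<le> n"
    and lam: "is_partition lam" "\<And>k. n < k \<Longrightarrow> lam k = 0"
    and kap: "is_partition kap" "\<And>k. n < k \<Longrightarrow> kap k = 0"
    and N: "7 * (lam 1 + kap 1) + 2 * n + 3 \<le> N"
    and L: "lattice p (base_pair t0 u0) q t N" and L': "lattice p (base_pair t0' u0') q t N"
    and u1: "u1 \<noteq> 0" "u1' \<noteq> 0" and uu: "u0' / t0' = u0 / t0"
    and sq: "t0'\<^sup>2 = 1 / (\<tau>\<^sup>2 * u0 * u1)" "t0\<^sup>2 = 1 / (\<tau>\<^sup>2 * u0' * u1')"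
    and tt: "t0' * t1' = t0 * t1" "t0' * t2' = t0 * t2" "t0' * t3' = t0 * t3"
    and g: "\<And>i j. \<bar>i\<bar> \<le> int N \<Longrightarrow> \<bar>j\<bar> \<le> int N \<Longrightarrow> th (q powi i * t powi j * (\<tau> * t0 * u1)) \<noteq> 0"
      "\<And>i j. \<bar>i\<bar> \<le> int N \<Longrightarrow> \<bar>j\<bar> \<le> int N \<Longrightarrow> th (q powi i * t powi j * (1 / (u0 * u1))) \<noteq> 0"
      "\<And>i j. \<bar>i\<bar> \<le> int N \<Longrightarrow> \<bar>j\<bar> \<le> int N \<Longrightarrow> th (q powi i * t powi j * (\<tau> * t0' * u1')) \<noteq> 0"
      "\<And>i j. \<bar>i\<bar> \<le> int N \<Longrightarrow> \<bar>j\<bar> \<le> int N \<Longrightarrow> th (q powi i * t powi j * (1 / (u0' * u1'))) \<noteq> 0"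
  shows "R_tilde n lam t0 t1 t2 t3 u0 u1 q t p (\<lambda>i\<in>{1..n}. t0 * t ^ (n - i) * q ^ kap i) =
    R_tilde n kap t0' t1' t2' t3' u0' u1' q t p (\<lambda>i\<in>{1..n}. t0' * t ^ (n - i) * q ^ lam i)"
proof -
  have nz: "t0 \<noteq> 0" "u0 \<noteq> 0" "t0' \<noteq> 0" "u0' \<noteq> 0" "\<tau> \<noteq> 0"
    using lattice.\<beta>_nz[OF L, of True] lattice.\<beta>_nz[OF L, of False] lattice.\<beta>_nz[OF L', of True]
      lattice.\<beta>_nz[OF L', of False] lattice.t_nz[OF L] by (simp_all add: \<tau>_def)
  define A where "A = \<tau> * t0 / u0"
  have A': "\<tau> * t0' / u0' = A" using uu nz by (simp add: A_def field_simps)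
  have c: "\<tau> * t0' * t1' = \<tau> * t0 * t1" "\<tau> * t0' * t2' = \<tau> * t0 * t2" "\<tau> * t0' * t3' = \<tau> * t0 * t3"
    by (simp_all only: mult.assoc tt)
  define T where "T = (\<lambda>\<mu>. Delta \<mu> A [t ^ n] q t p *
    (R_star n \<mu> t0' u0' q t p (\<lambda>i\<in>{1..n}. t0' * t ^ (n - i) * q ^ lam i) *
     R_star n \<mu> t0 u0 q t p (\<lambda>i\<in>{1..n}. t0 * t ^ (n - i) * q ^ kap i)) /
    Delta0 \<mu> A [\<tau> * t0 * t1, \<tau> * t0 * t2, \<tau> * t0 * t3] q t p)"
  have C0g: "C0 \<mu> y q t p \<noteq> 0" "C0 \<mu> (p * q * y) q t p \<noteq> 0"
    if \<mu>: "is_partition \<mu>" "\<And>k. n < k \<Longrightarrow> \<mu> k = 0" "\<mu> 1 \<le> lam 1 + kap 1"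
      and y: "\<And>i j. \<bar>i\<bar> \<le> int N \<Longrightarrow> \<bar>j\<bar> \<le> int N \<Longrightarrow> th (q powi i * t powi j * y) \<noteq> 0"
        for \<mu> y
  proof -
    show "C0 \<mu> y q t p \<noteq> 0" by (rule C0_nz[OF \<mu>(1,2) y]) (use N \<mu>(3) in auto)
    show "C0 \<mu> (p * q * y) q t p \<noteq> 0"
    proof (rule C0_nz[OF \<mu>(1,2)])
      fix i j :: int assume ij: "\<bar>i\<bar> \<le> int (\<mu> 1)" "\<bar>j\<bar> \<le> int n"
      have e: "q powi i * t powi j * (p * q * y) = p * (q powi (i + 1) * t powi j * y)"
        using lattice.q_nz[OF L] by (simp add: power_int_add mult_ac)
      show "th (q powi i * t powi j * (p * q * y)) \<noteq> 0"
        unfolding e theta_p_0 by (rule y) (use ij N \<mu>(3) in auto)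
    qed
  qed
  have AB: "p * q * A / (\<tau> * t0 * u1) = p * q * (1 / (u0 * u1))" "p * q * A / (\<tau> * t0' * u1') = p * q * (1 / (u0' * u1'))"
    using nz u1 by (simp add: A_def, simp add: A'[symmetric])
  have l: "ell_binomial n lam \<mu> (1 / (u0 * u1)) (1 / (\<tau> * t0 * u1)) q t p *
        R_star n \<mu> t0 u0 q t p (\<lambda>i\<in>{1..n}. t0 * t ^ (n - i) * q ^ kap i) /
        Delta0 \<mu> A [\<tau> * t0 * t1, \<tau> * t0 * t2, \<tau> * t0 * t3, \<tau> * t0 * u1] q t p = T \<mu>"
    and r: "ell_binomial n kap \<mu> (1 / (u0' * u1')) (1 / (\<tau> * t0' * u1')) q t p *
        R_star n \<mu> t0' u0' q t p (\<lambda>i\<in>{1..n}. t0' * t ^ (n - i) * q ^ lam i) /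
        Delta0 \<mu> A [\<tau> * t0 * t1, \<tau> * t0 * t2, \<tau> * t0 * t3, \<tau> * t0' * u1'] q t p = T \<mu>"
    if \<mu>: "is_partition \<mu>" "\<And>k. n < k \<Longrightarrow> \<mu> k = 0" "\<mu> 1 \<le> lam 1 + kap 1"
      for \<mu>
  proof -
    have N': "5 * \<mu> 1 + 2 * n + 3 \<le> N" using N \<mu>(3) by simp
    have 1: "ell_binomial n lam \<mu> (1 / (u0 * u1)) (1 / (\<tau> * t0 * u1)) q t p =
      Delta \<mu> A [t ^ n, \<tau> * t0 * u1] q t p * R_star n \<mu> t0' u0' q t p (\<lambda>i\<in>{1..n}. t0' * t ^ (n - i) * q ^ lam i)"
      unfolding A_def \<tau>_def
      by (rule ell_binomial_eq[OF n L' N' \<mu>(1,2) nz(1,2) u1(1) sq(1)[unfolded \<tau>_def] uu])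
    have 2: "ell_binomial n kap \<mu> (1 / (u0' * u1')) (1 / (\<tau> * t0' * u1')) q t p =
      Delta \<mu> A [t ^ n, \<tau> * t0' * u1'] q t p * R_star n \<mu> t0 u0 q t p (\<lambda>i\<in>{1..n}. t0 * t ^ (n - i) * q ^ kap i)"
      unfolding A'[symmetric] \<tau>_def
      by (rule ell_binomial_eq[OF n L N' \<mu>(1,2) nz(3,4) u1(2) sq(2)[unfolded \<tau>_def] uu[symmetric]])
    show "ell_binomial n lam \<mu> (1 / (u0 * u1)) (1 / (\<tau> * t0 * u1)) q t p *
        R_star n \<mu> t0 u0 q t p (\<lambda>i\<in>{1..n}. t0 * t ^ (n - i) * q ^ kap i) /
        Delta0 \<mu> A [\<tau> * t0 * t1, \<tau> * t0 * t2, \<tau> * t0 * t3, \<tau> * t0 * u1] q t p = T \<mu>"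
      unfolding T_def by (rule R_tilde_term[OF 1]) (use C0g[OF \<mu> g(1)] C0g[OF \<mu> g(2)] in \<open>simp_all only: AB not_False_eq_True\<close>)
    show "ell_binomial n kap \<mu> (1 / (u0' * u1')) (1 / (\<tau> * t0' * u1')) q t p *
        R_star n \<mu> t0' u0' q t p (\<lambda>i\<in>{1..n}. t0' * t ^ (n - i) * q ^ lam i) /
        Delta0 \<mu> A [\<tau> * t0 * t1, \<tau> * t0 * t2, \<tau> * t0 * t3, \<tau> * t0' * u1'] q t p = T \<mu>"
      unfolding T_def mult.commute[of "R_star n \<mu> t0' u0' q t p _"]
      by (rule R_tilde_term[OF 2]) (use C0g[OF \<mu> g(3)] C0g[OF \<mu> g(4)] in \<open>simp_all only: AB not_False_eq_True\<close>)
  qed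
  have subl: "is_partition \<mu>" "n < k \<Longrightarrow> \<mu> k = 0" "\<mu> 1 \<le> lam 1 + kap 1"
    if "\<mu> \<in> subpartitions lam" for \<mu> k
  proof -
    note \<mu> = subpartitions_le[OF lam(1) that]
    show "is_partition \<mu>" by (rule \<mu>)
    show "\<mu> k = 0" if "n < k" using \<mu>(2)[of k] lam(2)[OF that] that by simp
    show "\<mu> 1 \<le> lam 1 + kap 1" using \<mu>(2)[of 1] by simp
  qed
  have subk: "is_partition \<mu>" "n < k \<Longrightarrow> \<mu> k = 0" "\<mu> 1 \<le> lam 1 + kap 1"
    if "\<mu> \<in> subpartitions kap" for \<mu> k
  proof -
    note \<mu> = subpartitions_le[OF kap(1) that]
    show "is_partition \<mu>" by (rule \<mu>)
    show "\<mu> k = 0" if "n < k" using \<mu>(2)[of k] kap(2)[OF that] that by simp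
    show "\<mu> 1 \<le> lam 1 + kap 1" using \<mu>(2)[of 1] by simp
  qed
  have Tl: "T \<mu> = 0" if "\<mu> \<in> subpartitions lam" "\<mu> \<notin> subpartitions kap" for \<mu>
  proof -
    have "\<not> diagram \<mu> \<subseteq> diagram kap" using that by (simp add: subpartitions_def)
    from R_star_vanish[OF L _ n subl(1,2)[OF that(1)] kap(1) this] N subl(3)[OF that(1)]
    show ?thesis by (simp add: T_def)
  qed
  have Tk: "T \<mu> = 0" if "\<mu> \<in> subpartitions kap" "\<mu> \<notin> subpartitions lam" for \<mu>
  proof -
    have "\<not> diagram \<mu> \<subseteq> diagram lam" using that by (simp add: subpartitions_def)
    from R_star_vanish[OF L' _ n subk(1,2)[OF that(1)] lam(1) this] N subk(3)[OF that(1)]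
    show ?thesis by (simp add: T_def)
  qed
  have "R_tilde n lam t0 t1 t2 t3 u0 u1 q t p (\<lambda>i\<in>{1..n}. t0 * t ^ (n - i) * q ^ kap i) = sum T (subpartitions lam)"
    unfolding R_tilde_def \<tau>_def[symmetric] A_def[symmetric]
    by (rule sum.cong[OF refl], rule l) (use subl in auto)
  also have "\<dots> = sum T (subpartitions lam \<inter> subpartitions kap)"
    by (rule sum.mono_neutral_right[OF finite_subpartitions[OF lam]]) (use Tl in auto)
  also have "\<dots> = sum T (subpartitions kap)"
    by (rule sum.mono_neutral_left[OF finite_subpartitions[OF kap]]) (use Tk in auto)
  also have "\<dots> = R_tilde n kap t0' t1' t2' t3' u0' u1' q t p (\<lambda>i\<in>{1..n}. t0' * t ^ (n - i) * q ^ lam i)"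
    unfolding R_tilde_def \<tau>_def[symmetric] A' c
    by (rule sum.cong[OF refl], rule r[symmetric]) (use subk in auto)
  finally show ?thesis .
qed

end

section \<open>Generic parameters\<close>

text \<open>The coordinates 1, 5, 6, 7, 8 are t0, u0, u1, q, t. The balancing condition turns the
  square of the hatted t0 into 1 / (t^(2n - 2) u0 u1), so every condition of the argument concerns
  theta at such a monomial.\<close>

definition param_monomial :: "(nat \<Rightarrow> complex) \<Rightarrow> int \<times> int \<times> int \<times> int \<times> int \<Rightarrow> complex" where
  "param_monomial z = (\<lambda>(a, b, c, i, j). z 1 powi a * z 5 powi b * z 6 powi c * z 7 powi i * z 8 powi j)"

definition exps :: "nat \<Rightarrow> (int \<times> int \<times> int \<times> int \<times> int) set" where
  "exps N = (let I = {- int N..int N} in I \<times> I \<times> I \<times> I \<times> I - {(0, 0, 0, 0, 0)})"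

text \<open>The lowest digit in base B, with digits of either sign: a nonzero multiple of B is too
  large to be cancelled by i.\<close>

lemma digit_0:
  fixes i r B :: int
  assumes "i + B * r = 0" "\<bar>i\<bar> < B"
  shows "i = 0" "r = 0"
proof -
  show r: "r = 0"
  proof (rule ccontr)
    assume "r \<noteq> 0"
    then have "B * 1 \<le> B * \<bar>r\<bar>" using assms(2) by (intro mult_left_mono) auto
    moreover have "\<bar>i\<bar> = B * \<bar>r\<bar>"
    proof -
      have "i = - (B * r)" using assms(1) by simp
      moreover have "\<bar>B\<bar> = B" using assms(2) by simp
      ultimately show ?thesis by (simp add: abs_mult)
    qed
    ultimately show False using assms(2) by simp
  qed
  then show "i = 0" using assms(1) by simp
qed

lemma digit_le:
  fixes i r B R :: int
  assumes "\<bar>i\<bar> \<le> N" "\<bar>r\<bar> \<le> R" "0 \<le> B"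
  shows "\<bar>i + B * r\<bar> \<le> N + B * R"
proof -
  have "\<bar>B * r\<bar> \<le> B * R" using assms by (simp add: abs_mult mult_left_mono)
  then show ?thesis using assms(1) by linarith
qed

context nome
begin

definition gen :: "nat \<Rightarrow> (nat \<Rightarrow> complex) \<Rightarrow> complex" where
  "gen N z = (\<Prod>e\<in>exps N. th (param_monomial z e))"

lemma finite_exps: "finite (exps N)"
  by (simp add: exps_def Let_def)

lemma torus_holo_powi:
  assumes "i \<in> {1..n}"
  shows "torus_holomorphic n (\<lambda>x. x i powi e)"
  by (rule torus_holo_comp[OF torus_holo_coord[OF assms], where h = "\<lambda>w. w powi e" and U = "- {0}"])
    (use assms in \<open>auto simp: ctorus_def PiE_iff intro!: holomorphic_intros\<close>)

lemma gen_holomorphic: "torus_holomorphic 8 (gen N)"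
  unfolding gen_def
proof (rule torus_holo_prod[OF finite_exps])
  fix e assume "e \<in> exps N"
  obtain a b c i j where e: "e = (a, b, c, i, j)" by (cases e)
  show "torus_holomorphic 8 (\<lambda>z. th (param_monomial z e))"
  proof (rule torus_holo_comp[OF _ theta_holomorphic])
    show "torus_holomorphic 8 (\<lambda>z. param_monomial z e)"
      unfolding param_monomial_def e prod.case by (intro torus_holo_mult torus_holo_powi) auto
    show "param_monomial z e \<in> - {0}" if "z \<in> ctorus 8" for z
      using that by (auto simp: param_monomial_def e ctorus_def PiE_iff)
  qed auto
qed

lemma genD:
  assumes "gen N z \<noteq> 0" and "\<bar>a\<bar> \<le> int N" "\<bar>b\<bar> \<le> int N" "\<bar>c\<bar> \<le> int N" "\<bar>i\<bar> \<le> int N" "\<bar>j\<bar> \<le> int N"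
    and "(a, b, c, i, j) \<noteq> (0, 0, 0, 0, 0)"
  shows "th (z 1 powi a * z 5 powi b * z 6 powi c * z 7 powi i * z 8 powi j) \<noteq> 0"
proof -
  have "(a, b, c, i, j) \<in> exps N" using assms(2-) by (auto simp: exps_def Let_def)
  then have "th (param_monomial z (a, b, c, i, j)) \<noteq> 0"
    using assms(1) unfolding gen_def prod_zero_iff[OF finite_exps] by blast
  then show ?thesis by (simp add: param_monomial_def)
qed

text \<open>Take \<open>q, t, t\<^sub>0, u\<^sub>0, u\<^sub>1\<close> to be powers of \<open>\<bar>p\<bar>\<^bsup>1/D\<^esup>\<close> with exponents \<open>1, B, B\<^sup>2, B\<^sup>3, B\<^sup>4\<close>.
  Uniqueness of base \<open>B\<close> expansions then keeps the relevant monomials away from the powers of \<open>p\<close>.\<close>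

lemma gen_nz: "\<exists>z\<in>balanced_params n p. gen N z \<noteq> 0"
proof -
  define B where "B = int N + 1"
  define K where "K = int N"
  have BK: "0 \<le> B" "K < B" by (auto simp: B_def K_def)
  \<comment> \<open>One more than a bound for |s|, where s is the number having the exponents as its
    base B digits.\<close>
  define D where "D = K + B * (K + B * (K + B * (K + B * K))) + 1"
  have D: "0 < D" using BK by (simp add: D_def K_def add_nonneg_pos)
  define P where "P = cmod p"
  have P: "0 < P" "P < 1" using p_lt1 by (auto simp: P_def)
  define y where "y = complex_of_real (P powr (1 / real_of_int D))"
  have y: "y \<noteq> 0" using P by (simp add: y_def)
  have cy: "cmod (y powi s) = P powr (real_of_int s / real_of_int D)" for s
    using P by (simp add: y_def norm_power_int powr_real_of_int' [symmetric] powr_powr)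
  \<comment> \<open>Coordinate 2 is solved from the balancing condition, coordinates 3 and 4 being
    1.\<close>
  define z :: "nat \<Rightarrow> complex" where "z = (\<lambda>k\<in>{1..8}. if k = 1 then y powi (B * B) else
    if k = 2 then p * y / ((y powi B) ^ (2 * n - 2) * y powi (B * B) * y powi (B * B * B) * y powi (B * B * B * B))
    else if k = 5 then y powi (B * B * B) else if k = 6 then y powi (B * B * B * B) else
    if k = 7 then y else if k = 8 then y powi B else 1)"
  have z: "z 1 = y powi (B * B)"
    "z 2 = p * y / ((y powi B) ^ (2 * n - 2) * y powi (B * B) * y powi (B * B * B) * y powi (B * B * B * B))"
    "z 3 = 1" "z 4 = 1" "z 5 = y powi (B * B * B)" "z 6 = y powi (B * B * B * B)" "z 7 = y" "z 8 = y powi B"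
    by (simp_all add: z_def)
  have "z \<in> ctorus 8" using y by (auto simp: z_def ctorus_def PiE_iff)
  then have "z \<in> balanced_params n p"
    unfolding balanced_params_def mem_Collect_eq z using y by simp
  moreover have "th (param_monomial z e) \<noteq> 0" if e: "e \<in> exps N" for e
  proof
    assume th0: "th (param_monomial z e) = 0"
    obtain a b c i j where abc: "e = (a, b, c, i, j)" by (cases e)
    have bd: "\<bar>a\<bar> \<le> K" "\<bar>b\<bar> \<le> K" "\<bar>c\<bar> \<le> K" "\<bar>i\<bar> \<le> K" "\<bar>j\<bar> \<le> K" and ne: "(a, b, c, i, j) \<noteq> (0, 0, 0, 0, 0)"
      using e unfolding abc exps_def Let_def K_def by auto
    define s where "s = i + B * (j + B * (a + B * (b + B * c)))"
    have "\<bar>s\<bar> \<le> K + B * (K + B * (K + B * (K + B * K)))"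
      unfolding s_def by (intro digit_le bd BK)
    then have sD: "\<bar>s\<bar> < D" by (simp add: D_def)
    have s0: "s \<noteq> 0"
    proof
      assume "s = 0"
      note 1 = this[unfolded s_def]
      have lt: "\<bar>i\<bar> < B" "\<bar>j\<bar> < B" "\<bar>a\<bar> < B" "\<bar>b\<bar> < B" using bd BK by auto
      note 2 = digit_0[OF 1 lt(1)]
      note 3 = digit_0[OF 2(2) lt(2)]
      note 4 = digit_0[OF 3(2) lt(3)]
      note 5 = digit_0[OF 4(2) lt(4)]
      show False using 2(1) 3(1) 4(1) 5 ne by simp
    qed
    have "param_monomial z e = y powi (B * B * a) * y powi (B * B * B * b) * y powi (B * B * B * B * c) * y powi i * y powi (B * j)"
      unfolding param_monomial_def abc prod.case z by (simp only: power_int_mult mult.assoc)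
    also have "\<dots> = y powi (B * B * a + B * B * B * b + B * B * B * B * c + i + B * j)"
      using y by (simp only: power_int_add simp_thms)
    also have "B * B * a + B * B * B * b + B * B * B * B * c + i + B * j = s"
      by (simp add: s_def algebra_simps)
    finally have ms: "param_monomial z e = y powi s" .
    \<comment> \<open>Taking absolute values gives s = k D, impossible for 0 < |s| < D.\<close>
    then obtain k :: int where "y powi s = p powi k" using th0 y theta_eq_0_iff[of "y powi s"] by auto
    then have "P powr (real_of_int s / real_of_int D) = P powr real_of_int k"
      using cy[of s] P by (simp add: norm_power_int P_def powr_real_of_int')
    then have "real_of_int s / real_of_int D = real_of_int k" using P by (simp add: powr_inj)
    then have "s = k * D" using D by (simp add: field_simps of_int_mult[symmetric] del: of_int_mult)
    moreover from this s0 have "1 \<le> \<bar>k\<bar>" by auto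
    then have "1 * D \<le> \<bar>k\<bar> * D" using D by (intro mult_right_mono) auto
    ultimately show False using sD D by (simp add: abs_mult)
  qed
  then have "gen N z \<noteq> 0" unfolding gen_def prod_zero_iff[OF finite_exps] by blast
  ultimately show ?thesis by blast
qed

end

theorem theorem5p4:
  fixes p :: complex and n :: nat and lam kap :: "nat \<Rightarrow> nat"
  assumes "0 < cmod p" and "cmod p < 1"
    and "n \<ge> 1"
    and "is_partition lam" and "part_length lam \<le> n"
    and "is_partition kap" and "part_length kap \<le> n"
  shows "holds_generically 8 (balanced_params n p)
    (\<lambda>z. \<forall>t0 t1 t2 t3 u0 u1 q t t0' t1' t2' t3' u0' u1'.
       t0 = z 1 \<and> t1 = z 2 \<and> t2 = z 3 \<and> t3 = z 4 \<and> u0 = z 5 \<and> u1 = z 6 \<and> q = z 7 \<and> t = z 8 \<longrightarrow>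
       t0'\<^sup>2 = t0 * t1 * t2 * t3 / (p * q) \<and>
       t0' * t1' = t0 * t1 \<and> t0' * t2' = t0 * t2 \<and> t0' * t3' = t0 * t3 \<and>
       u0' / t0' = u0 / t0 \<and> u1' / t0' = u1 / t0 \<longrightarrow>
       R_tilde n lam t0 t1 t2 t3 u0 u1 q t p (\<lambda>i\<in>{1..n}. t0 * t ^ (n - i) * q ^ kap i) =
       R_tilde n kap t0' t1' t2' t3' u0' u1' q t p (\<lambda>i\<in>{1..n}. t0' * t ^ (n - i) * q ^ lam i))"
proof -
  interpret nome p by unfold_locales (use assms(1,2) in auto)
  define N where "N = 7 * (lam 1 + kap 1) + 2 * n + 3"
  \<comment> \<open>The factor t^(n - 1) enters the monomials with an exponent between -2 and 2,
    hence the additional 2 n for the exponent of t.\<close>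
  define N' where "N' = N + 2 * n"
  show ?thesis
    unfolding holds_generically_def
  proof (intro exI[of _ "gen N'"] conjI ballI impI allI gen_holomorphic gen_nz, elim conjE)
    fix z t0 t1 t2 t3 u0 u1 q t t0' t1' t2' t3' u0' u1'
    assume z: "z \<in> balanced_params n p" and G: "gen N' z \<noteq> 0"
      and zs: "t0 = z 1" "t1 = z 2" "t2 = z 3" "t3 = z 4" "u0 = z 5" "u1 = z 6" "q = z 7" "t = z 8"
      and sq: "t0'\<^sup>2 = t0 * t1 * t2 * t3 / (p * q)"
      and tt: "t0' * t1' = t0 * t1" "t0' * t2' = t0 * t2" "t0' * t3' = t0 * t3"
      and uu: "u0' / t0' = u0 / t0" "u1' / t0' = u1 / t0"
    define \<tau> where "\<tau> = t ^ (n - 1)"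
    have nz: "t0 \<noteq> 0" "t1 \<noteq> 0" "t2 \<noteq> 0" "t3 \<noteq> 0" "u0 \<noteq> 0" "u1 \<noteq> 0" "q \<noteq> 0" "t \<noteq> 0"
      using z by (auto simp: zs balanced_params_def ctorus_def PiE_iff)
    have \<tau>: "\<tau> \<noteq> 0" using nz by (simp add: \<tau>_def)
    have "t ^ (2 * n - 2) = \<tau>\<^sup>2" unfolding \<tau>_def power_mult[symmetric]
      by (rule arg_cong[of _ _ "\<lambda>k. t ^ k"]) (simp add: diff_mult_distrib)
    then have bal: "\<tau>\<^sup>2 * t0 * t1 * t2 * t3 * u0 * u1 = p * q"
      using z unfolding balanced_params_def zs by simp
    have t0': "t0' \<noteq> 0" using sq nz p_nz by auto
    have u': "u0' = u0 * t0' / t0" "u1' = u1 * t0' / t0" using uu t0' nz by (simp_all add: field_simps)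
    have S: "t0' * t0' = 1 / (\<tau>\<^sup>2 * u0 * u1)"
      using sq nz \<tau> unfolding bal[symmetric] by (simp add: power2_eq_square)
    \<comment> \<open>As t0, u0 or u1 occurs with nonzero exponent, the exponents i and j may both
      be zero; pure monomials in q and t are treated in \<open>Q\<close>.\<close>
    have M: "th (x * q powi i * t powi j) \<noteq> 0"
      if x: "x = t0 powi a * u0 powi b * u1 powi c * \<tau> powi e" "(a, b, c) \<noteq> (0, 0, 0)"
        and abc: "\<bar>a\<bar> \<le> 2" "\<bar>b\<bar> \<le> 2" "\<bar>c\<bar> \<le> 2" "\<bar>e\<bar> \<le> 2"
        and ij: "\<bar>i\<bar> \<le> int N" "\<bar>j\<bar> \<le> int N" for x a b c e i j
    proof -
      have "\<tau> powi e = t powi (int (n - 1) * e)" by (simp add: \<tau>_def power_int_power)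
      then have e: "x * q powi i * t powi j = t0 powi a * u0 powi b * u1 powi c * q powi i * t powi (j + int (n - 1) * e)"
        using nz by (simp add: x power_int_add mult_ac)
      have "\<bar>int (n - 1) * e\<bar> \<le> int n * 2"
        unfolding abs_mult using abc(4) by (intro mult_mono) auto
      then have "\<bar>j + int (n - 1) * e\<bar> \<le> int N'" using ij(2) unfolding N'_def by linarith
      moreover have "2 \<le> int N'" "int N \<le> int N'" by (simp_all add: N'_def N_def)
      ultimately have ne: "\<bar>j + int (n - 1) * e\<bar> \<le> int N'" "2 \<le> int N'" "int N \<le> int N'" .
      show ?thesis
        unfolding e unfolding zs by (rule genD[OF G]) (use x(2) abc(1-3) ij(1) ne in auto)
    qed
    have Q: "th (q powi i * t powi j) \<noteq> 0"
      if "\<bar>i\<bar> \<le> int N" "\<bar>j\<bar> \<le> int N" "(i, j) \<noteq> (0, 0)" for i j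
      using genD[OF G, of 0 0 0 i j] that by (simp add: zs N'_def)
    have L: "lattice p (base_pair a b) q t N"
      if ab: "a \<noteq> 0" "b \<noteq> 0"
        and aa: "\<And>i j. \<bar>i\<bar> \<le> int N \<Longrightarrow> \<bar>j\<bar> \<le> int N \<Longrightarrow> th (a * a * q powi i * t powi j) \<noteq> 0"
        and abm: "\<And>i j. \<bar>i\<bar> \<le> int N \<Longrightarrow> \<bar>j\<bar> \<le> int N \<Longrightarrow> th (a * b * q powi i * t powi j) \<noteq> 0"
        and bb: "\<And>i j. \<bar>i\<bar> \<le> int N \<Longrightarrow> \<bar>j\<bar> \<le> int N \<Longrightarrow> th (b * b * q powi i * t powi j) \<noteq> 0"
        and abd: "\<And>i j. \<bar>i\<bar> \<le> int N \<Longrightarrow> \<bar>j\<bar> \<le> int N \<Longrightarrow> th (a / b * q powi i * t powi j) \<noteq> 0"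
          for a b
    proof (unfold_locales)
      show "base_pair a b s \<noteq> 0" for s using ab by (cases s) auto
      fix i j :: int assume ij: "\<bar>i\<bar> \<le> int N" "\<bar>j\<bar> \<le> int N"
      show "th (q powi i * t powi j) \<noteq> 0" if "(i, j) \<noteq> (0, 0)" by (rule Q[OF ij that])
      show "th (base_pair a b s * base_pair a b s' * q powi i * t powi j) \<noteq> 0" for s s'
        using aa[OF ij] abm[OF ij] bb[OF ij] by (cases s; cases s') (auto simp: mult.commute[of b a])
      show "th (base_pair a b True / base_pair a b False * q powi i * t powi j) \<noteq> 0" using abd[OF ij]
        by simp
    qed (use nz in auto)
    \<comment> \<open>Every expression here is even in t0' and reduces through \<open>S\<close> to a
      monomial in t0, u0, u1 and \<tau>. The last four belong to the C symbols that must not vanish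
      in the cancellation.\<close>
    have mon: "t0 * t0 = t0 powi 2 * u0 powi 0 * u1 powi 0 * \<tau> powi 0"
      "t0 * u0 = t0 powi 1 * u0 powi 1 * u1 powi 0 * \<tau> powi 0"
      "u0 * u0 = t0 powi 0 * u0 powi 2 * u1 powi 0 * \<tau> powi 0"
      "t0 / u0 = t0 powi 1 * u0 powi (- 1) * u1 powi 0 * \<tau> powi 0"
      "t0' * t0' = t0 powi 0 * u0 powi (- 1) * u1 powi (- 1) * \<tau> powi (- 2)"
      "t0' * u0' = t0 powi (- 1) * u0 powi 0 * u1 powi (- 1) * \<tau> powi (- 2)"
      "u0' * u0' = t0 powi (- 2) * u0 powi 1 * u1 powi (- 1) * \<tau> powi (- 2)"
      "t0' / u0' = t0 powi 1 * u0 powi (- 1) * u1 powi 0 * \<tau> powi 0"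
      "\<tau> * t0 * u1 = t0 powi 1 * u0 powi 0 * u1 powi 1 * \<tau> powi 1"
      "1 / (u0 * u1) = t0 powi 0 * u0 powi (- 1) * u1 powi (- 1) * \<tau> powi 0"
      "\<tau> * t0' * u1' = t0 powi (- 1) * u0 powi (- 1) * u1 powi 0 * \<tau> powi (- 1)"
      "1 / (u0' * u1') = t0 powi 2 * u0 powi 0 * u1 powi 0 * \<tau> powi 2"
    proof -
      have "t0' * u0' = (t0' * t0') * u0 / t0" "u0' * u0' = (t0' * t0') * u0\<^sup>2 / t0\<^sup>2"
        "\<tau> * t0' * u1' = \<tau> * (t0' * t0') * u1 / t0" "u0' * u1' = (t0' * t0') * u0 * u1 / t0\<^sup>2"
        by (simp_all add: u' power2_eq_square)
      note 1 = this[unfolded S]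
      show "t0' * u0' = t0 powi (- 1) * u0 powi 0 * u1 powi (- 1) * \<tau> powi (- 2)"
        "u0' * u0' = t0 powi (- 2) * u0 powi 1 * u1 powi (- 1) * \<tau> powi (- 2)"
        "\<tau> * t0' * u1' = t0 powi (- 1) * u0 powi (- 1) * u1 powi 0 * \<tau> powi (- 1)"
        "1 / (u0' * u1') = t0 powi 2 * u0 powi 0 * u1 powi 0 * \<tau> powi 2"
        unfolding 1 using nz \<tau> by (simp_all add: power_int_minus divide_simps power2_eq_square)
      show "t0' / u0' = t0 powi 1 * u0 powi (- 1) * u1 powi 0 * \<tau> powi 0"
        using nz t0' by (simp add: u' power_int_minus divide_simps)
      show "t0' * t0' = t0 powi 0 * u0 powi (- 1) * u1 powi (- 1) * \<tau> powi (- 2)"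
        unfolding S by (simp add: power_int_minus divide_simps)
    qed (simp_all add: power2_eq_square power_int_minus divide_simps)
    have M': "th (q powi i * t powi j * x) \<noteq> 0" if "th (x * q powi i * t powi j) \<noteq> 0" for x i j
      using that by (simp add: mult_ac)
    show "R_tilde n lam t0 t1 t2 t3 u0 u1 q t p (\<lambda>i\<in>{1..n}. t0 * t ^ (n - i) * q ^ kap i) =
       R_tilde n kap t0' t1' t2' t3' u0' u1' q t p (\<lambda>i\<in>{1..n}. t0' * t ^ (n - i) * q ^ lam i)"
    proof (rule R_tilde_symmetric[OF assms(3,4) part_length_0[OF assms(4,5)] assms(6) part_length_0[OF assms(6,7)]])
      show "7 * (lam 1 + kap 1) + 2 * n + 3 \<le> N" by (simp add: N_def)
      show "lattice p (base_pair t0 u0) q t N"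
        by (rule L[OF nz(1,5) M[OF mon(1)] M[OF mon(2)] M[OF mon(3)] M[OF mon(4)]]) auto
      show "lattice p (base_pair t0' u0') q t N"
        by (rule L[OF t0' _ M[OF mon(5)] M[OF mon(6)] M[OF mon(7)] M[OF mon(8)]]) (use nz t0' u' in auto)
      show "u1' \<noteq> 0" using u' nz t0' by simp
      show "t0'\<^sup>2 = 1 / ((t ^ (n - 1))\<^sup>2 * u0 * u1)" using S
        unfolding \<tau>_def power2_eq_square[of t0'] .
      have "1 / (\<tau>\<^sup>2 * u0' * u1') = 1 / (u0' * u1') / \<tau>\<^sup>2" by (simp add: mult_ac)
      then show "t0\<^sup>2 = 1 / ((t ^ (n - 1))\<^sup>2 * u0' * u1')"
        unfolding mon(12) \<tau>_def[symmetric] using \<tau> by simp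
      fix i j :: int assume ij: "\<bar>i\<bar> \<le> int N" "\<bar>j\<bar> \<le> int N"
      show "th (q powi i * t powi j * (t ^ (n - 1) * t0 * u1)) \<noteq> 0"
        unfolding \<tau>_def[symmetric] by (rule M', rule M[OF mon(9)]) (use ij in auto)
      show "th (q powi i * t powi j * (1 / (u0 * u1))) \<noteq> 0"
        by (rule M', rule M[OF mon(10)]) (use ij in auto)
      show "th (q powi i * t powi j * (t ^ (n - 1) * t0' * u1')) \<noteq> 0"
        unfolding \<tau>_def[symmetric] by (rule M', rule M[OF mon(11)]) (use ij in auto)
      show "th (q powi i * t powi j * (1 / (u0' * u1'))) \<noteq> 0"
        by (rule M', rule M[OF mon(12)]) (use ij in auto)
    qed (use nz tt uu in auto)
  qed
qed

end
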